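(* Let $[M_1,\dots,M_4]$ and $[E_1,\dots,E_4]$ be admissible data of $2\times2$ matrices, let $a_1,\dots,a_4\in\mathbb C$ be distinct points, and let $\varkappa_1\ge\varkappa_2$ be the indices of the systems of standard form with these data and singularities. Assume that $[M_1,\dots,M_4]$ is irreducible, or that $[M_1,\dots,M_4]$ possesses exactly one non-trivial invariant subspace and $n_1<n_2$ holds. Let $\varepsilon_k^{(1)},\varepsilon_k^{(2)}$ be the eigenvalues of $E_k$, $k=1,\dots,4$. (a) If $\varkappa$ is odd, then $\varkappa_1=(\varkappa+1)/2$ and $\varkappa_2=(\varkappa-1)/2$. (b) If $\varkappa$ is even, then either $\varkappa_1=\varkappa_2=\varkappa/2$, or $\varkappa_1=\varkappa/2+1$ and $\varkappa_2=\varkappa/2-1$. (b* ) For $\varkappa$ even, the indices are $\varkappa_1=\varkappa/2+1$ and $\varkappa_2=\varkappa/2-1$ if and only if $[M_1,\dots,M_4]$ is the monodromy of some second order linear differential equation with Fuchsian singularities $a_1,\dots,a_4$ (and no other singularities in $\dot{\mathbb C}$) and local exponents given by $\{\varepsilon_k^{(1)},\varepsilon_k^{(2)}\}$ for $z=a_k$, $k=1,2,3$, and $\{\varepsilon_4^{(1)}+1-\varkappa/2,\ \varepsilon_4^{(2)}+1-\varkappa/2\}$ for $z=a_4$.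
   Context: Here $m=4$, $n=2$ in the following definitions. $\dot{\mathbb C}=\mathbb C\cup\{\infty\}$; $G\mathbb C^{n\times n}$ is the group of invertible complex $n\times n$ matrices; for single matrices $M\sim M'$ means similarity. The distinct points $a_1,\dots,a_m\in\mathbb C$ lie in this order on a fixed smooth (simple) closed positively oriented curve $\Gamma\subset\mathbb C$ (indices cyclic). Let $S=\dot{\mathbb C}\setminus\{a_1,\dots,a_m\}$, $\rho:\tilde S\to S$ its universal covering, write $z=\rho(\tilde z)$ for $\tilde z\in\tilde S$, and $\tilde S^*=\tilde S\setminus\rho^{-1}(\infty)$. For small $\delta>0$, $D_a=\{0<|z-a|<\delta\}$ ($a\in\mathbb C$), $D_\infty=\{|z|>1/\delta\}$, $\tilde D_a$ is the universal covering of $D_a$, and $(\tilde z-a)^E=\exp(E\ln(\tilde z-a))$ on $\tilde D_a$. Fix $\tilde z_0\in\tilde S$ with $\rho(\tilde z_0)$ inside $\Gamma$; for each $k$ let $\tilde z_k$ be the endpoint of a simple path in $\tilde S$ starting at $\tilde z_0$ whose projection is a closed curve based at $\rho(\tilde z_0)$ meeting $\Gamma$ exactly twice, first on the subarc joining $a_{k-1}$ and $a_k$, then on the subarc joining $a_k$ and $a_{k+1}$ (so it goes once around $a_k$ in the positive direction), and let $\sigma_k$ be the deck transformation of $\tilde S$ with $\sigma_k(\tilde z_0)=\tilde z_k$. For a solution $Y:\tilde S^*\to G\mathbb C^{n\times n}$ of a linear system $Y'(\tilde z)=A(z)Y(\tilde z)$, the matrices $\chi(\sigma)$ are defined by $Y(\tilde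 z)=Y(\sigma(\tilde z))\chi(\sigma)$. Two $m$-tuples of matrices are equivalent if they are simultaneously similar; $[\cdot]_\sim$ is the equivalence class. The monodromy of the system is $[\chi(\sigma_1),\dots,\chi(\sigma_m)]_\sim$. A matrix is non-resonant if no two of its eigenvalues differ by a nonzero integer. Tuples $[M_1,\dots,M_m]$, $[E_1,\dots,E_m]$ of $n\times n$ matrices are admissible data if $M_1\cdots M_m=I$, $M_k\sim\exp(-2\pi iE_k)$ for each $k$, and all $E_k$ are non-resonant. The system $Y'(\tilde z)=A(z)Y(\tilde z)$ is of standard form with respect to these admissible data, with singularities $a_1,\dots,a_m$ and indices $\varkappa_1\ge\dots\ge\varkappa_n$ (integers) if: (i) it has singularities only at $a_1,\dots,a_m$ and at infinity (i.e. $A$ is analytic on $\mathbb C\setminus\{a_1,\dots,a_m\}$), the singularity at infinity being apparent (solutions have no branching there); (ii) its monodromy is $[M_1,\dots,M_m]_\sim$; (iii) for each $k$ the solutions on $\tilde D_{a_k}$ can be written $Y(\tilde z)=Z_k(z)(\tilde z-a_k)^{E_k}C$ with $Z_k:D_{a_k}\cup\{a_k\}\to G\mathbb C^{n\times n}$ analytic and $C\in G\mathbb C^{n\times n}$; (iv) the solutions on $D_\infty$ can be written $Y(z)=\mathrm{diag}(z^{\varkappa_1},\dots,z^{\varkappa_n})Z_\infty(z)C$ with $Z_\infty:D_\infty\cup\{\infty\}\to G\mathbb C^{n\times n}$ analytic and $C\in G\mathbb C^{n\times n}$. For given admissible data and singularities such a system exists and its indices are uniquely determined by the data and the singularities. Reducibility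 of $2\times2$ data. Put $\varkappa=\mathrm{trace}\,E_1+\dots+\mathrm{trace}\,E_m$. Invariant subspaces of $[M_1,\dots,M_m]$ are common invariant subspaces of all $M_k$; non-trivial means different from $\{0\}$ and $\mathbb C^2$; irreducible means that there is no non-trivial one. If $[M_1,\dots,M_m]$ has exactly one non-trivial invariant subspace, it is equivalent to a tuple of upper triangular matrices $\begin{pmatrix}\mu_k^{(1)}&\alpha_k\\0&\mu_k^{(2)}\end{pmatrix}$, $k=1,\dots,m$; here $\mu_k^{(1)}$ is the eigenvalue of $M_k$ on the invariant subspace and $\mu_k^{(2)}$ the other one, so these are unique. Number the eigenvalues $\varepsilon_k^{(1)},\varepsilon_k^{(2)}$ of $E_k$ such that $\mu_k^{(j)}=\exp(-2\pi i\varepsilon_k^{(j)})$ and define the integers $n_j=\varepsilon_1^{(j)}+\dots+\varepsilon_m^{(j)}$, $j=1,2$. Scalar equations. An $n$-th order linear differential equation is $y^{(n)}+q_1(z)y^{(n-1)}+\dots+q_n(z)y=0$ with $q_j$ analytic on $\mathbb C$ except for finitely many points, its singularities; $\infty$ is a singularity if $0$ is a singularity of the equation obtained by the change of variables $z\mapsto1/(z-a)$ (independent of $a\in\mathbb C$). A singularity $a\in\mathbb C$ is Fuchsian if $q_k(z)=r_k(z)/(z-a)^k$ with $r_k$ analytic at $a$, $k=1,\dots,n$; its local exponents are the roots $\rho$ of $\rho(\rho-1)\cdots(\rho-n+1)+\sum_{k=1}^nr_k(a)\rho(\rho-1)\cdots(\rho-n+1+k)=0$. For linearly independent solutions $y_1,\dots,y_n$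 on $\tilde S$, $\chi(\sigma)$ is defined by $(y_1(\tilde z),\dots,y_n(\tilde z))=(y_1(\sigma(\tilde z)),\dots,y_n(\sigma(\tilde z)))\chi(\sigma)$, and the monodromy of the equation is $[\chi(\sigma_1),\dots,\chi(\sigma_m)]_\sim$. *)

theory Defs
  imports "HOL-Complex_Analysis.Complex_Analysis"
begin

section \<open>Matrices\<close>

text \<open>\<open>mat c ** A\<close> is the multiple of \<open>A\<close> by the complex scalar \<open>c\<close>.
  A tuple of four matrices is a function on \<open>nat\<close> of which only the values at
  \<open>1, 2, 3, 4\<close> matter.\<close>

definition mexp :: "complex^'n^'n \<Rightarrow> complex^'n^'n" where
  "mexp A = (\<Sum>j. (1 / fact j) *\<^sub>R ((\<lambda>X. A ** X) ^^ j) (mat 1))"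

definition similar_matrices :: "complex^'n^'n \<Rightarrow> complex^'n^'n \<Rightarrow> bool" where
  "similar_matrices M N \<longleftrightarrow> (\<exists>P. invertible P \<and> N = matrix_inv P ** M ** P)"

definition equivalent_tuples ::
    "(nat \<Rightarrow> complex^'n^'n) \<Rightarrow> (nat \<Rightarrow> complex^'n^'n) \<Rightarrow> bool" where
  "equivalent_tuples M N \<longleftrightarrow>
     (\<exists>P. invertible P \<and> (\<forall>k\<in>{1..4}. N k = matrix_inv P ** M k ** P))"

definition mat_eigenvalue :: "complex^'n^'n \<Rightarrow> complex \<Rightarrow> bool" where
  "mat_eigenvalue A l \<longleftrightarrow> (\<exists>v. v \<noteq> 0 \<and> A *v v = l *s v)"

text \<open>\<open>e1, e2\<close> are the two eigenvalues, with multiplicity, in some order.\<close>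

definition eigenvalue_pair :: "complex^2^2 \<Rightarrow> complex \<Rightarrow> complex \<Rightarrow> bool" where
  "eigenvalue_pair A e1 e2 \<longleftrightarrow> (\<forall>x. det (mat x - A) = (x - e1) * (x - e2))"

definition nonresonant :: "complex^'n^'n \<Rightarrow> bool" where
  "nonresonant A \<longleftrightarrow>
     (\<forall>l l'. mat_eigenvalue A l \<and> mat_eigenvalue A l' \<and> l - l' \<in> \<int> \<longrightarrow> l = l')"

definition admissible_data ::
    "(nat \<Rightarrow> complex^2^2) \<Rightarrow> (nat \<Rightarrow> complex^2^2) \<Rightarrow> bool" where
  "admissible_data M E \<longleftrightarrow>
     M 1 ** M 2 ** M 3 ** M 4 = mat 1 \<and>
     (\<forall>k\<in>{1..4}. similar_matrices (M k) (mexp (mat (- 2 * of_real pi * \<i>) ** E k)) \<and>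
                 nonresonant (E k))"

definition nontrivial_invariant_subspace ::
    "(nat \<Rightarrow> complex^2^2) \<Rightarrow> (complex^2) set \<Rightarrow> bool" where
  "nontrivial_invariant_subspace M V \<longleftrightarrow>
     vec.subspace V \<and> V \<noteq> {0} \<and> V \<noteq> UNIV \<and> (\<forall>k\<in>{1..4}. \<forall>v\<in>V. M k *v v \<in> V)"

definition irreducible_tuple :: "(nat \<Rightarrow> complex^2^2) \<Rightarrow> bool" where
  "irreducible_tuple M \<longleftrightarrow> (\<nexists>V. nontrivial_invariant_subspace M V)"

text \<open>Exactly one non-trivial invariant subspace, and \<open>n1 < n2\<close>.  The \<open>mu\<close>'s are uniquely
  determined by \<open>M\<close>; by non-resonance the numbering of the eigenvalues of \<open>E k\<close> is then unique
  too, so nothing depends on the choice of the bound variables.\<close>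

definition reducible_with_n1_less_n2 ::
    "(nat \<Rightarrow> complex^2^2) \<Rightarrow> (nat \<Rightarrow> complex^2^2) \<Rightarrow> bool" where
  "reducible_with_n1_less_n2 M E \<longleftrightarrow>
     (\<exists>!V. nontrivial_invariant_subspace M V) \<and>
     (\<exists>mu1 mu2 al eps1 eps2 :: nat \<Rightarrow> complex. \<exists>n1 n2 :: int.
        equivalent_tuples M (\<lambda>k. vector [vector [mu1 k, al k], vector [0, mu2 k]]) \<and>
        (\<forall>k\<in>{1..4}. eigenvalue_pair (E k) (eps1 k) (eps2 k) \<and>
           mu1 k = exp (- 2 * of_real pi * \<i> * eps1 k) \<and>
           mu2 k = exp (- 2 * of_real pi * \<i> * eps2 k)) \<and>
        of_int n1 = (\<Sum>k=1..4. eps1 k) \<and> of_int n2 = (\<Sum>k=1..4. eps2 k) \<and> n1 < n2)"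


section \<open>The punctured Riemann sphere, its universal covering, and the loops\<close>

text \<open>The Riemann sphere is the unit sphere of \<open>complex \<times> real\<close>, identified with
  the extended plane by stereographic projection from the north pole.\<close>

definition rsphere :: "(complex \<times> real) set" where
  "rsphere = sphere 0 1"

definition rinf :: "complex \<times> real" where
  "rinf = (0, 1)"

definition of_plane :: "complex \<Rightarrow> complex \<times> real" where
  "of_plane z = (of_real (2 / (1 + (cmod z)\<^sup>2)) * z, ((cmod z)\<^sup>2 - 1) / ((cmod z)\<^sup>2 + 1))"

definition to_plane :: "complex \<times> real \<Rightarrow> complex" where
  "to_plane s = fst s / of_real (1 - snd s)"

definition punctured_sphere :: "(nat \<Rightarrow> complex) \<Rightarrow> (complex \<times> real) set" where
  "punctured_sphere a = rsphere - of_plane ` a ` {1..4}"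

text \<open>The universal covering is unique up to homeomorphism over the base, so any model of it
  may be used; by the type class, it is a subset of a normed space.  Such models exist, for
  instance the open unit disc in the complex plane.\<close>

definition universal_covering ::
    "(nat \<Rightarrow> complex) \<Rightarrow> 'b::real_normed_vector set \<Rightarrow> ('b \<Rightarrow> complex \<times> real) \<Rightarrow> bool" where
  "universal_covering a St rho \<longleftrightarrow>
     covering_space St rho (punctured_sphere a) \<and> simply_connected St"

definition finite_part :: "'b set \<Rightarrow> ('b \<Rightarrow> complex \<times> real) \<Rightarrow> 'b set" where
  "finite_part St rho = {x \<in> St. rho x \<noteq> rinf}"

definition deck_transformation ::
    "'b::real_normed_vector set \<Rightarrow> ('b \<Rightarrow> complex \<times> real) \<Rightarrow> ('b \<Rightarrow> 'b) \<Rightarrow> bool" where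
  "deck_transformation St rho s \<longleftrightarrow>
     (\<exists>s'. homeomorphism St St s s') \<and> (\<forall>x\<in>St. rho (s x) = rho x)"

text \<open>The curve is parametrized with period 1; its restriction to \<open>{0..1}\<close> is a path in the
  sense of the library.  \<open>t k\<close> is a parameter of the point \<open>a k\<close>.\<close>

definition curve_through ::
    "(nat \<Rightarrow> complex) \<Rightarrow> (real \<Rightarrow> complex) \<Rightarrow> (nat \<Rightarrow> real) \<Rightarrow> bool" where
  "curve_through a g t \<longleftrightarrow>
     (\<forall>s. g (s + 1) = g s) \<and> g C1_differentiable_on UNIV \<and>
     (\<forall>s. vector_derivative g (at s) \<noteq> 0) \<and>
     simple_path g \<and> (\<forall>z\<in>inside (path_image g). winding_number g z = 1) \<and>
     t 1 < t 2 \<and> t 2 < t 3 \<and> t 3 < t 4 \<and> t 4 < t 1 + 1 \<and>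
     (\<forall>k\<in>{1..4}. g (t k) = a k)"

text \<open>The open subarc joining \<open>a k\<close> and \<open>a (k + 1)\<close>, with indices cyclic.\<close>

definition subarc_after :: "(real \<Rightarrow> complex) \<Rightarrow> (nat \<Rightarrow> real) \<Rightarrow> nat \<Rightarrow> complex set" where
  "subarc_after g t k = g ` {t k <..< (if k = 4 then t 1 + 1 else t (k + 1))}"

definition subarc_before :: "(real \<Rightarrow> complex) \<Rightarrow> (nat \<Rightarrow> real) \<Rightarrow> nat \<Rightarrow> complex set" where
  "subarc_before g t k = subarc_after g t (if k = 1 then 4 else k - 1)"

text \<open>The last conjunct says that the projected path leaves the inside of the curve at \<open>s1\<close> and
  re-enters at \<open>s2\<close>, so that the two meeting points are crossings.  (It already follows from the
  other conditions: a loop which only touched the curve from within would lift to a closed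
  path, and a closed path is not an arc.)\<close>

definition standard_loop ::
    "'b::real_normed_vector set \<Rightarrow> ('b \<Rightarrow> complex \<times> real) \<Rightarrow> (real \<Rightarrow> complex) \<Rightarrow> (nat \<Rightarrow> real) \<Rightarrow>
     nat \<Rightarrow> 'b \<Rightarrow> 'b \<Rightarrow> bool" where
  "standard_loop St rho g t k x0 xk \<longleftrightarrow>
     (\<exists>p. arc p \<and> path_image p \<subseteq> St \<and> pathstart p = x0 \<and> pathfinish p = xk \<and>
        rho xk = rho x0 \<and>
        (\<exists>s1 s2. 0 < s1 \<and> s1 < s2 \<and> s2 < 1 \<and>
           {s\<in>{0..1}. rho (p s) \<in> of_plane ` path_image g} = {s1, s2} \<and>
           rho (p s1) \<in> of_plane ` subarc_before g t k \<and>
           rho (p s2) \<in> of_plane ` subarc_after g t k \<and>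
           (\<forall>s. s1 < s \<and> s < s2 \<longrightarrow> rho (p s) \<notin> of_plane ` inside (path_image g))))"

definition monodromy_setup ::
    "(nat \<Rightarrow> complex) \<Rightarrow> (real \<Rightarrow> complex) \<Rightarrow> (nat \<Rightarrow> real) \<Rightarrow>
     'b::real_normed_vector set \<Rightarrow> ('b \<Rightarrow> complex \<times> real) \<Rightarrow> 'b \<Rightarrow> (nat \<Rightarrow> 'b \<Rightarrow> 'b) \<Rightarrow> bool" where
  "monodromy_setup a g t St rho x0 sg \<longleftrightarrow>
     curve_through a g t \<and> universal_covering a St rho \<and>
     x0 \<in> St \<and> rho x0 \<in> of_plane ` inside (path_image g) \<and>
     (\<forall>k\<in>{1..4}. deck_transformation St rho (sg k) \<and>
                 standard_loop St rho g t k x0 (sg k x0))"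


section \<open>Systems\<close>

text \<open>Complex derivative at \<open>x\<close> of a function \<open>f\<close> on \<open>X\<close> with respect to the local coordinate
  \<open>u\<close>, a function on \<open>X\<close> that is injective near \<open>x\<close>.\<close>

definition has_coord_deriv ::
    "'b::topological_space set \<Rightarrow> ('b \<Rightarrow> complex) \<Rightarrow> ('b \<Rightarrow> complex) \<Rightarrow> complex \<Rightarrow> 'b \<Rightarrow> bool" where
  "has_coord_deriv X u f D x \<longleftrightarrow>
     ((\<lambda>y. (f y - f x) / (u y - u x)) \<longlongrightarrow> D) (at x within X)"

text \<open>\<open>Y\<close> is a fundamental solution of \<open>Y' = A(z) Y\<close> on a surface \<open>X\<close> which is spread over the
  plane by the local homeomorphism \<open>u\<close>.\<close>

definition system_solution ::
    "'b::topological_space set \<Rightarrow> ('b \<Rightarrow> complex) \<Rightarrow> (complex \<Rightarrow> complex^2^2) \<Rightarrow>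
     ('b \<Rightarrow> complex^2^2) \<Rightarrow> bool" where
  "system_solution X u A Y \<longleftrightarrow>
     (\<forall>x\<in>X. invertible (Y x) \<and>
        (\<forall>i j. has_coord_deriv X u (\<lambda>y. Y y $ i $ j) ((A (u x) ** Y x) $ i $ j) x))"

definition matrix_holomorphic_on :: "(complex \<Rightarrow> complex^2^2) \<Rightarrow> complex set \<Rightarrow> bool" where
  "matrix_holomorphic_on Z U \<longleftrightarrow> (\<forall>i j. (\<lambda>z. Z z $ i $ j) holomorphic_on U)"

definition system_monodromy ::
    "'b::real_normed_vector set \<Rightarrow> ('b \<Rightarrow> complex \<times> real) \<Rightarrow> (nat \<Rightarrow> 'b \<Rightarrow> 'b) \<Rightarrow>
     (complex \<Rightarrow> complex^2^2) \<Rightarrow> (nat \<Rightarrow> complex^2^2) \<Rightarrow> bool" where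
  "system_monodromy St rho sg A M \<longleftrightarrow>
     (\<exists>Y chi. system_solution (finite_part St rho) (\<lambda>x. to_plane (rho x)) A Y \<and>
        (\<forall>k\<in>{1..4}. \<forall>x\<in>finite_part St rho. Y x = Y (sg k x) ** chi k) \<and>
        equivalent_tuples chi M)"

definition apparent_at_infinity :: "(complex \<Rightarrow> complex^2^2) \<Rightarrow> bool" where
  "apparent_at_infinity A \<longleftrightarrow>
     (\<exists>d>0. \<exists>Y. system_solution {z. cmod z > 1 / d} (\<lambda>z. z) A Y)"

text \<open>The universal covering of the punctured disc of radius \<open>d\<close> about \<open>b\<close> is the half-plane
  \<open>Re w < ln d\<close> with projection \<open>w \<mapsto> b + exp w\<close>; thus \<open>w\<close> is the logarithm of \<open>z - b\<close>, and
  \<open>mexp (mat w ** E)\<close> is the power \<open>(z - b)^E\<close>.\<close>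

definition local_form_at ::
    "(nat \<Rightarrow> complex) \<Rightarrow> (complex \<Rightarrow> complex^2^2) \<Rightarrow> nat \<Rightarrow> complex^2^2 \<Rightarrow> bool" where
  "local_form_at a A k E \<longleftrightarrow>
     (\<exists>d>0. (\<forall>j\<in>{1..4}. j \<noteq> k \<longrightarrow> a j \<notin> ball (a k) d) \<and>
        (\<exists>Z. matrix_holomorphic_on Z (ball (a k) d) \<and> (\<forall>z\<in>ball (a k) d. invertible (Z z)) \<and>
           (\<forall>Y. system_solution {w. Re w < ln d} (\<lambda>w. a k + exp w) A Y \<longleftrightarrow>
              (\<exists>C. invertible C \<and>
                 (\<forall>w. Re w < ln d \<longrightarrow> Y w = Z (a k + exp w) ** mexp (mat w ** E) ** C)))))"

text \<open>\<open>W\<close> is the analytic factor at infinity in the coordinate \<open>1/z\<close>.\<close>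

definition local_form_at_infinity ::
    "(nat \<Rightarrow> complex) \<Rightarrow> (complex \<Rightarrow> complex^2^2) \<Rightarrow> int \<Rightarrow> int \<Rightarrow> bool" where
  "local_form_at_infinity a A kap1 kap2 \<longleftrightarrow>
     (\<exists>d>0. (\<forall>j\<in>{1..4}. cmod (a j) \<le> 1 / d) \<and>
        (\<exists>W. matrix_holomorphic_on W (ball 0 d) \<and> (\<forall>w\<in>ball 0 d. invertible (W w)) \<and>
           (\<forall>Y. system_solution {z. cmod z > 1 / d} (\<lambda>z. z) A Y \<longleftrightarrow>
              (\<exists>C. invertible C \<and>
                 (\<forall>z. cmod z > 1 / d \<longrightarrow>
                    Y z = vector [vector [z powi kap1, 0], vector [0, z powi kap2]]
                          ** W (1 / z) ** C)))))"

definition standard_form ::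
    "(nat \<Rightarrow> complex) \<Rightarrow> 'b::real_normed_vector set \<Rightarrow> ('b \<Rightarrow> complex \<times> real) \<Rightarrow> (nat \<Rightarrow> 'b \<Rightarrow> 'b) \<Rightarrow>
     (nat \<Rightarrow> complex^2^2) \<Rightarrow> (nat \<Rightarrow> complex^2^2) \<Rightarrow> int \<Rightarrow> int \<Rightarrow> (complex \<Rightarrow> complex^2^2) \<Rightarrow> bool" where
  "standard_form a St rho sg M E kap1 kap2 A \<longleftrightarrow>
     kap1 \<ge> kap2 \<and>
     matrix_holomorphic_on A (- (a ` {1..4})) \<and> apparent_at_infinity A \<and>
     system_monodromy St rho sg A M \<and>
     (\<forall>k\<in>{1..4}. local_form_at a A k (E k)) \<and>
     local_form_at_infinity a A kap1 kap2"


section \<open>Second order scalar equations \<open>y'' + q1 y' + q2 y = 0\<close>\<close>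

text \<open>The values of the coefficients at the point itself are immaterial.\<close>

definition ode_singular_at :: "(complex \<Rightarrow> complex) \<Rightarrow> (complex \<Rightarrow> complex) \<Rightarrow> complex \<Rightarrow> bool" where
  "ode_singular_at q1 q2 b \<longleftrightarrow>
     \<not> (\<exists>h1 h2. h1 analytic_on {b} \<and> h2 analytic_on {b} \<and>
           (\<forall>\<^sub>F z in at b. q1 z = h1 z \<and> q2 z = h2 z))"

text \<open>With \<open>w = 1/z\<close> and \<open>u(w) = y(1/w)\<close> one has \<open>y' = - w^2 u'\<close> and
  \<open>y'' = w^4 u'' + 2 w^3 u'\<close>, so the equation becomes
  \<open>u'' + (2/w - q1(1/w)/w^2) u' + (q2(1/w)/w^4) u = 0\<close>.\<close>

definition ode_singular_at_infinity :: "(complex \<Rightarrow> complex) \<Rightarrow> (complex \<Rightarrow> complex) \<Rightarrow> bool" where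
  "ode_singular_at_infinity q1 q2 \<longleftrightarrow>
     ode_singular_at (\<lambda>w. 2 / w - q1 (1 / w) / w\<^sup>2) (\<lambda>w. q2 (1 / w) / w ^ 4) 0"

text \<open>A Fuchsian singularity whose local exponents, with multiplicity, are \<open>e1\<close> and \<open>e2\<close>.\<close>

definition fuchsian_with_exponents ::
    "(complex \<Rightarrow> complex) \<Rightarrow> (complex \<Rightarrow> complex) \<Rightarrow> complex \<Rightarrow> complex \<Rightarrow> complex \<Rightarrow> bool" where
  "fuchsian_with_exponents q1 q2 b e1 e2 \<longleftrightarrow>
     ode_singular_at q1 q2 b \<and>
     (\<exists>r1 r2. r1 analytic_on {b} \<and> r2 analytic_on {b} \<and>
        (\<forall>\<^sub>F z in at b. q1 z = r1 z / (z - b) \<and> q2 z = r2 z / (z - b)\<^sup>2) \<and>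
        (\<forall>x. x * (x - 1) + r1 b * x + r2 b = (x - e1) * (x - e2)))"

text \<open>A solution on the whole covering surface: it satisfies the equation off the fibre over
  infinity, and is analytic at the points of that fibre, where \<open>1/z\<close> is a coordinate.\<close>

definition ode_solution ::
    "'b::real_normed_vector set \<Rightarrow> ('b \<Rightarrow> complex \<times> real) \<Rightarrow>
     (complex \<Rightarrow> complex) \<Rightarrow> (complex \<Rightarrow> complex) \<Rightarrow> ('b \<Rightarrow> complex) \<Rightarrow> bool" where
  "ode_solution St rho q1 q2 y \<longleftrightarrow>
     (\<exists>y'. \<forall>x\<in>finite_part St rho.
        has_coord_deriv (finite_part St rho) (\<lambda>x. to_plane (rho x)) y (y' x) x \<and>
        has_coord_deriv (finite_part St rho) (\<lambda>x. to_plane (rho x)) y'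
          (- q1 (to_plane (rho x)) * y' x - q2 (to_plane (rho x)) * y x) x) \<and>
     (\<forall>x\<in>St. rho x = rinf \<longrightarrow>
        (\<exists>D. has_coord_deriv St (\<lambda>x. if rho x = rinf then 0 else 1 / to_plane (rho x)) y D x))"

definition ode_monodromy ::
    "'b::real_normed_vector set \<Rightarrow> ('b \<Rightarrow> complex \<times> real) \<Rightarrow> (nat \<Rightarrow> 'b \<Rightarrow> 'b) \<Rightarrow>
     (complex \<Rightarrow> complex) \<Rightarrow> (complex \<Rightarrow> complex) \<Rightarrow> (nat \<Rightarrow> complex^2^2) \<Rightarrow> bool" where
  "ode_monodromy St rho sg q1 q2 M \<longleftrightarrow>
     (\<exists>y1 y2 chi. ode_solution St rho q1 q2 y1 \<and> ode_solution St rho q1 q2 y2 \<and>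
        (\<forall>c1 c2. (\<forall>x\<in>St. c1 * y1 x + c2 * y2 x = 0) \<longrightarrow> c1 = 0 \<and> c2 = 0) \<and>
        (\<forall>k\<in>{1..4}. \<forall>x\<in>St.
           (vector [y1 x, y2 x] :: complex^2) = vector [y1 (sg k x), y2 (sg k x)] v* chi k) \<and>
        equivalent_tuples chi M)"

end

(* Since Z_k' + Z_k E_k / (z - a_k) = A Z_k near a_k, the matrix A has at most simple poles at the a_k, with
   residues similar to E_k, while at infinity z A_11 -> kap1, z A_22 -> kap2 and A_21 = O(z^(kap2 - kap1 - 2)).
   Hence kap1 + kap2 = kap by the residue theorem for the trace, and A_21 prod (z - a_k) is a polynomial of
   degree at most 2 - (kap1 - kap2). If A_21 vanished, the system would be triangular: this contradicts
   irreducibility, and in the reducible case it gives n_1 = kap1 >= kap2 = n_2. So kap1 - kap2 <= 2.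

   If kap1 - kap2 = 2, then A_21 = c / prod (z - a_k) has no zeros, and the second row of Y, multiplied by
   (z - a_4)^(- kap2), solves a second order equation without apparent singularities, which is the required one.

   Conversely let kap1 = kap2 = kap / 2 and let y be the row of fundamental solutions of such an equation, with
   the monodromy of Y. Then F = y Y^(-1) is single valued. With F_1 = y' Y^(-1) it satisfies a linear system with
   singularities of the first kind, and by non-resonance F (z - a_4)^(kap / 2 - 1) is entire; it tends to 0 at
   infinity, so y = 0, which is absurd. *)

theory Submission
  imports Defs
begin

text \<open>The data live on an abstract covering surface, whereas the arguments concern rational
  functions in the plane. The passage rests on the simple connectivity of the sphere minus an arc:
  off the arc \<open>co_arc g t k\<close>, which contains all four points and leaves out only the
  subarc after \<open>a k\<close>, the covering has a section through the base point. The four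
  sections agree inside the curve; outside it, consecutive sections differ by the deck
  transformation of a loop. Thus monodromy becomes a jump between branches on slit planes.

  The shift at \<open>a 4\<close> is forced by the Fuchs relation: for a second order equation with
  four singular points all exponents add up to 2, and kap + 2 (1 - kap / 2) = 2. When the indices
  differ by 2, this shift is \<open>- kap2\<close>.

  Non-resonance enters three times: it identifies the diagonal residues of a triangular system from
  their exponentials; it excludes exponents 0 and 1, for which a point could be regular; and it
  bounds the pole orders of the row \<open>y Y^(-1)\<close>.\<close>

no_notation fps_nth (infixl "$" 75)

section \<open>Derivatives in a local coordinate\<close>

text \<open>Chain rule on the level of difference quotients. As \<open>u' \<noteq> 0\<close>, the
  value \<open>u y\<close> differs from \<open>u x\<close> near \<open>x\<close>, so that no
  quotient takes the default value of a division by 0.\<close>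

lemma has_coord_deriv_imp_field_derivative:
  assumes "open X" "x \<in> X" and u: "(u has_field_derivative u') (at x)" "u' \<noteq> 0"
    and f: "has_coord_deriv X u f D x"
  shows "(f has_field_derivative D * u') (at x)"
proof -
  have ux: "\<forall>\<^sub>F y in at x. u y \<noteq> u x"
  proof -
    have "((\<lambda>y. (u y - u x) / (y - x)) \<longlongrightarrow> u') (at x)"
      using u(1) by (simp add: has_field_derivative_iff)
    then have "\<forall>\<^sub>F y in at x. (u y - u x) / (y - x) \<noteq> 0"
      using u(2) by (rule tendsto_imp_eventually_ne)
    then show ?thesis by eventually_elim auto
  qed
  have "((\<lambda>y. (f y - f x) / (u y - u x)) \<longlongrightarrow> D) (at x)"
    using f at_within_open[OF assms(2,1)] unfolding has_coord_deriv_def by metis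
  moreover have "((\<lambda>y. (u y - u x) / (y - x)) \<longlongrightarrow> u') (at x)"
    using u(1) by (simp add: has_field_derivative_iff)
  ultimately have "((\<lambda>y. (f y - f x) / (u y - u x) * ((u y - u x) / (y - x))) \<longlongrightarrow> D * u') (at x)"
    by (rule tendsto_mult)
  then have "((\<lambda>y. (f y - f x) / (y - x)) \<longlongrightarrow> D * u') (at x)"
    by (rule Lim_transform_eventually) (use ux in eventually_elim, auto)
  then show ?thesis by (simp add: has_field_derivative_iff)
qed

section \<open>Entries of the matrix exponential\<close>

lemma mat_mult_left: "mat c ** (M :: complex^2^2) = (\<chi> i j. c * M $ i $ j)"
  by (simp add: matrix_matrix_mult_def mat_def vec_eq_iff forall_2 sum_2)

lemma mat2_eq_iff: "(M :: 'a^2^2) = N \<longleftrightarrow> M$1$1 = N$1$1 \<and> M$1$2 = N$1$2 \<and> M$2$1 = N$2$1 \<and> M$2$2 = N$2$2"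
  by (auto simp: vec_eq_iff forall_2)

lemma mult2_nth: "((M :: 'a::semiring_1^2^2) ** N) $ i $ j = M$i$1 * N$1$j + M$i$2 * N$2$j"
  by (simp add: matrix_matrix_mult_def sum_2)

definition mpow :: "complex^2^2 \<Rightarrow> nat \<Rightarrow> complex^2^2" where
  "mpow E j = ((\<lambda>X. E ** X) ^^ j) (mat 1)"

lemma mpow_Suc: "mpow E (Suc j) = E ** mpow E j"
  by (simp add: mpow_def)

lemma mpow_scale: "((\<lambda>X. (mat w ** E) ** X) ^^ j) (mat 1) = mat (w ^ j) ** mpow E j"
proof (induction j)
  case 0 show ?case by (simp add: mpow_def)
next
  case (Suc j)
  then show ?case
    by (simp add: mpow_Suc mat_mult_left mat2_eq_iff mult2_nth algebra_simps)
qed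

text \<open>An entry of a product is a sum of two terms, so each multiplication by \<open>E\<close>
  costs a factor \<open>2 * b\<close> if \<open>b\<close> bounds the entries of \<open>E\<close>.
  The entries of the exponential series are thereby dominated by a scalar exponential
  series.\<close>

lemma mpow_bound: "\<exists>B. \<forall>j i k. cmod (mpow E j $ i $ k) \<le> B ^ j"
proof -
  define b where "b = Max {cmod (E$1$1), cmod (E$1$2), cmod (E$2$1), cmod (E$2$2)}"
  have b: "cmod (E$i$k) \<le> b" for i k
    using exhaust_2[of i] exhaust_2[of k] by (auto simp: b_def)
  have b0: "0 \<le> b" using b[of 1 1] norm_ge_zero order_trans by blast
  have "cmod (mpow E j $ i $ k) \<le> (2*b) ^ j" for j i k
  proof (induction j arbitrary: i k)
    case 0 show ?case by (simp add: mpow_def mat_def)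
  next
    case (Suc j)
    have "cmod (mpow E (Suc j) $ i $ k) \<le> cmod (E$i$1 * mpow E j $ 1 $ k) + cmod (E$i$2 * mpow E j $ 2 $ k)"
      unfolding mpow_Suc mult2_nth by (rule norm_triangle_ineq)
    also have "\<dots> \<le> b * (2*b)^j + b * (2*b)^j"
      unfolding norm_mult by (intro add_mono mult_mono b Suc b0) auto
    finally show ?case by (simp add: algebra_simps)
  qed
  then show ?thesis by blast
qed

lemma mpow_summable: "summable (\<lambda>j. (mpow E j $ i $ k / fact j) * w ^ j)"
proof -
  obtain B where B: "\<And>j i k. cmod (mpow E j $ i $ k) \<le> B ^ j"
    using mpow_bound by blast
  have "summable (\<lambda>j. inverse (fact j) * (B * cmod w) ^ j)"
    by (rule summable_exp)
  then show ?thesis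
  proof (rule summable_comparison_test'[where N=0])
    fix n :: nat
    have "cmod (mpow E n $ i $ k / fact n * w ^ n) \<le> B ^ n / fact n * cmod w ^ n"
      unfolding norm_mult norm_divide norm_power
      by (intro mult_right_mono) (auto intro!: divide_right_mono B)
    then show "cmod (mpow E n $ i $ k / fact n * w ^ n) \<le> inverse (fact n) * (B * cmod w) ^ n"
      by (simp add: field_simps)
  qed
qed

text \<open>Termwise differentiation is available for scalar power series, hence the splitting into
  entries. The partial sums converge in every entry, therefore as matrices, and \<open>mexp\<close>
  is a genuine limit.\<close>

lemma mexp_nth:
  fixes E :: "complex^2^2"
  shows "mexp (mat w ** E) $ i $ k = (\<Sum>j. (mpow E j $ i $ k / fact j) * w ^ j)"
proof -
  let ?T = "\<lambda>j. (1 / fact j) *\<^sub>R ((\<lambda>X. (mat w ** E) ** X) ^^ j) (mat 1)"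
  have T: "?T j $ i $ k = (mpow E j $ i $ k / fact j) * w ^ j" for i k j
    unfolding mpow_scale by (simp add: mat_mult_left) (simp add: scaleR_conv_of_real)
  define L :: "complex^2^2" where "L = (\<chi> i k. \<Sum>j. (mpow E j $ i $ k / fact j) * w ^ j)"
  have "(\<lambda>n. (\<Sum>j<n. ?T j)) \<longlonglongrightarrow> L"
  proof (intro vec_tendstoI)
    fix i k
    have "(\<lambda>n. (\<Sum>j<n. (mpow E j $ i $ k / fact j) * w ^ j)) \<longlonglongrightarrow> L $ i $ k"
      unfolding L_def using summable_LIMSEQ[OF mpow_summable] by simp
    then show "(\<lambda>n. (\<Sum>j<n. ?T j) $ i $ k) \<longlonglongrightarrow> L $ i $ k"
      by (simp only: sum_component T)
  qed
  then have "mexp (mat w ** E) = L"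
    unfolding mexp_def sums_def[symmetric] by (rule sums_unique[symmetric])
  then show ?thesis by (simp add: L_def)
qed

lemma mexp_has_field_derivative:
  fixes E :: "complex^2^2"
  shows "((\<lambda>w. mexp (mat w ** E) $ i $ k) has_field_derivative (E ** mexp (mat w ** E)) $ i $ k) (at w)"
proof -
  let ?c = "\<lambda>i j. mpow E j $ i $ k / fact j"
  \<comment> \<open>Differentiation turns \<open>1 / fact (j + 1)\<close> into
    \<open>1 / fact j\<close>, and the power \<open>E^(j + 1)\<close> splits off one factor
    \<open>E\<close> on the left.\<close>
  have d: "diffs (?c i) j * w ^ j = E$i$1 * (?c 1 j * w^j) + E$i$2 * (?c 2 j * w^j)" for j
  proof -
    have "(of_nat (Suc j) :: complex) / fact (Suc j) = 1 / fact j"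
      by (simp add: field_simps del: of_nat_Suc)
    then have d0: "diffs (?c i) j = mpow E (Suc j) $ i $ k / fact j"
      by (simp add: diffs_def del: fact_Suc of_nat_Suc)
        (metis (no_types, lifting) times_divide_eq_left times_divide_eq_right mult.commute mult_1)
    show ?thesis unfolding d0 mpow_Suc mult2_nth by (simp add: field_simps)
  qed
  have "((\<lambda>w. \<Sum>j. ?c i j * w ^ j) has_field_derivative (\<Sum>j. diffs (?c i) j * w ^ j)) (at w)"
    by (rule termdiffs_strong_converges_everywhere) (rule mpow_summable)
  moreover have "(\<Sum>j. diffs (?c i) j * w ^ j) = (E ** mexp (mat w ** E)) $ i $ k"
    unfolding d mult2_nth mexp_nth
    by (subst suminf_add [symmetric]) (intro summable_mult mpow_summable suminf_mult arg_cong2[where f="(+)"] refl | simp add: suminf_mult mpow_summable)+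
  ultimately show ?thesis by (simp add: mexp_nth)
qed

section \<open>Determinants and eigenvalue pairs in size 2\<close>

text \<open>The adjugate: \<open>adj2 Z\<close> divided by \<open>det Z\<close> is the inverse of
  \<open>Z\<close>, in a form whose entries are visibly holomorphic together with those of
  \<open>Z\<close>.\<close>

definition adj2 :: "complex^2^2 \<Rightarrow> complex^2^2" where
  "adj2 M = vector [vector [M$2$2, - M$1$2], vector [- M$2$1, M$1$1]]"

lemma adj2_nth [simp]: "adj2 M $1$1 = M$2$2" "adj2 M $1$2 = - M$1$2"
  "adj2 M $2$1 = - M$2$1" "adj2 M $2$2 = M$1$1"
  by (simp_all add: adj2_def)

lemma det_nz_iff: "invertible (M :: complex^2^2) \<longleftrightarrow> M$1$1 * M$2$2 - M$1$2 * M$2$1 \<noteq> 0"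
  by (simp add: invertible_det_nz det_2)

text \<open>Two monic quadratics which agree at 0 and 1 are equal. In terms of trace and determinant
  the invariance of the pair under conjugation is a polynomial identity.\<close>

lemma eigenvalue_pair_2:
  "eigenvalue_pair M x y \<longleftrightarrow> x + y = M$1$1 + M$2$2 \<and> x * y = M$1$1 * M$2$2 - M$1$2 * M$2$1"
proof
  assume "eigenvalue_pair M x y"
  then have *: "(z - M$1$1) * (z - M$2$2) - M$1$2 * M$2$1 = (z - x) * (z - y)" for z
    by (simp add: eigenvalue_pair_def det_2 mat_def)
  from *[of 0] *[of 1] show "x + y = M$1$1 + M$2$2 \<and> x * y = M$1$1 * M$2$2 - M$1$2 * M$2$1"
    by (auto simp: algebra_simps)
next
  assume *: "x + y = M$1$1 + M$2$2 \<and> x * y = M$1$1 * M$2$2 - M$1$2 * M$2$1"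
  have "(z - M$1$1) * (z - M$2$2) - M$1$2 * M$2$1 = (z - x) * (z - y)" for z
    using * by algebra
  then show "eigenvalue_pair M x y"
    by (simp add: eigenvalue_pair_def det_2 mat_def)
qed

lemma eigenvalue_pair_imp_eigenvalue:
  assumes "eigenvalue_pair M x y" shows "mat_eigenvalue M x" "mat_eigenvalue M y"
proof -
  have *: "mat_eigenvalue M x" if "eigenvalue_pair M x y" for x y
  proof -
    have "det (mat x - M) = 0" using that by (simp add: eigenvalue_pair_def)
    then have "\<not> invertible (mat x - M)" by (simp add: invertible_det_nz)
    then obtain v where v: "v \<noteq> 0" "(mat x - M) *v v = 0"
      using matrix_left_invertible_ker[of "mat x - M"] invertible_left_inverse[of "mat x - M"] by auto
    have "M *v v = x *s v"
      using v(2) by (simp add: matrix_vector_mult_diff_rdistrib)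
        (simp add: matrix_vector_mult_def mat_def vec_eq_iff forall_2 sum_2 )
    with v(1) show ?thesis unfolding mat_eigenvalue_def by blast
  qed
  have "eigenvalue_pair M y x" using assms by (simp add: eigenvalue_pair_2 ac_simps)
  with assms show "mat_eigenvalue M x" "mat_eigenvalue M y"
    by (auto intro: *)
qed

lemma nonresonant_pair:
  assumes "nonresonant M" "eigenvalue_pair M x y" "x - y \<in> \<int>" shows "x = y"
  using assms eigenvalue_pair_imp_eigenvalue[OF assms(2)] unfolding nonresonant_def by blast

section \<open>The coefficient matrix near a singularity and near infinity\<close>

text \<open>\<open>X\<close> stands for the power \<open>(z - a)^E\<close> and \<open>c\<close> for
  \<open>z - a\<close>, the derivative of the projection in the logarithmic coordinate; the
  assumption on \<open>A\<close> is the product rule for \<open>Z X\<close>. The multivalued factor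
  \<open>X\<close> cancels on the right, and division by \<open>Z\<close> leaves an expression for
  \<open>(z - a) A\<close> which remains holomorphic at \<open>c = 0\<close>.\<close>

lemma mexp_solution_algebra:
  fixes Z Z' E X A :: "complex^2^2"
  assumes "invertible Z" "invertible X" and "mat c ** (Z' ** X) + Z ** (E ** X) = mat c ** (A ** (Z ** X))"
  shows "mat c ** A = mat (1 / det Z) ** ((mat c ** Z' + Z ** E) ** adj2 Z)"
proof -
  obtain X' where X': "X ** X' = mat 1" using assms(2) unfolding invertible_def by blast
  have "(mat c ** Z' + Z ** E) ** X = (mat c ** (A ** Z)) ** X"
    using assms(3) by (simp add: mat_mult_left mat2_eq_iff mult2_nth algebra_simps)
  then have "((mat c ** Z' + Z ** E) ** X) ** X' = ((mat c ** (A ** Z)) ** X) ** X'" by simp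
  then have "mat c ** Z' + Z ** E = mat c ** (A ** Z)"
    by (simp add: X' matrix_mul_assoc[symmetric])
  then have "mat (1 / det Z) ** ((mat c ** Z' + Z ** E) ** adj2 Z) = mat (1 / det Z) ** ((mat c ** (A ** Z)) ** adj2 Z)"
    by simp
  also have "\<dots> = mat c ** A"
  proof -
    have "det Z \<noteq> 0" using assms(1) by (simp add: invertible_det_nz)
    then show ?thesis
      by (simp add: mat_mult_left mat2_eq_iff mult2_nth det_2 divide_simps) (simp add: algebra_simps)
  qed
  finally show ?thesis by simp
qed

lemma matrix_holomorphic_onD:
  "matrix_holomorphic_on Z U \<Longrightarrow> (\<lambda>z. Z z $ i $ j) holomorphic_on U"
  by (simp add: matrix_holomorphic_on_def)

lemma holomorphic_det2:
  "matrix_holomorphic_on Z U \<Longrightarrow> (\<lambda>z. det (Z z)) holomorphic_on U"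
  unfolding det_2 by (intro holomorphic_intros matrix_holomorphic_onD)

text \<open>The residue is \<open>Z(a\<^sub>k) E Z(a\<^sub>k)\<^sup>-\<^sup>1\<close>.\<close>

lemma local_form_residue:
  assumes "local_form_at a A k E"
  obtains d H where "d > 0" "\<And>j. j \<in> {1..4} \<Longrightarrow> j \<noteq> k \<Longrightarrow> a j \<notin> ball (a k) d"
    "matrix_holomorphic_on H (ball (a k) d)"
    "\<And>z. z \<in> ball (a k) d - {a k} \<Longrightarrow> H z = mat (z - a k) ** A z"
    "\<And>x y. eigenvalue_pair E x y \<Longrightarrow> eigenvalue_pair (H (a k)) x y"
proof -
  from assms obtain d Z where d: "d > 0" and away: "\<forall>j\<in>{1..4}. j \<noteq> k \<longrightarrow> a j \<notin> ball (a k) d"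
    and Z: "matrix_holomorphic_on Z (ball (a k) d)" "\<forall>z\<in>ball (a k) d. invertible (Z z)"
    and all: "\<And>Y. (\<exists>C. invertible C \<and>
         (\<forall>w. Re w < ln d \<longrightarrow> Y w = Z (a k + exp w) ** mexp (mat w ** E) ** C)) \<Longrightarrow>
        system_solution {w. Re w < ln d} (\<lambda>w. a k + exp w) A Y"
    unfolding local_form_at_def by blast
  define Y where "Y = (\<lambda>w. Z (a k + exp w) ** mexp (mat w ** E))"
  have Y: "system_solution {w. Re w < ln d} (\<lambda>w. a k + exp w) A Y"
    by (rule all) (auto intro!: exI[of _ "mat 1"] simp: Y_def invertible_def)
  define Z' :: "complex \<Rightarrow> complex^2^2" where "Z' = (\<lambda>z. \<chi> i j. deriv (\<lambda>z. Z z $ i $ j) z)"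
  define H where "H = (\<lambda>z. mat (1 / det (Z z)) ** ((mat (z - a k) ** Z' z + Z z ** E) ** adj2 (Z z)))"
  have Zd: "((\<lambda>z. Z z $ i $ j) has_field_derivative Z' z $ i $ j) (at z)" if "z \<in> ball (a k) d" for i j z
    using holomorphic_derivI[OF matrix_holomorphic_onD[OF Z(1)] open_ball that, of i j] by (simp add: Z'_def)
  have H: "H z = mat (z - a k) ** A z" if z: "z \<in> ball (a k) d - {a k}" for z
  proof -
    \<comment> \<open>Any logarithm of \<open>z - a k\<close> would do: the formula obtained for
      \<open>A z\<close> does not involve \<open>w\<close>, since the power factor cancels.\<close>
    define w where "w = Ln (z - a k)"
    have ew: "exp w = z - a k" "a k + exp w = z" using z by (auto simp: w_def)
    have "exp (Re w) < d" using z ew(1) norm_exp_eq_Re[of w] by (auto simp: dist_norm norm_minus_commute)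
    then have w: "Re w < ln d" using d by (metis exp_less_cancel_iff exp_ln)
    have inv: "invertible (Y w)" using Y w by (auto simp: system_solution_def)
    let ?X = "mexp (mat w ** E)"
    have "det (Y w) = det (Z z) * det ?X" by (simp add: Y_def ew det_mul)
    then have X: "invertible ?X" using inv by (auto simp: invertible_det_nz)
    have op: "open {w. Re w < ln d}" by (simp add: open_halfspace_Re_lt)
    have ed: "((\<lambda>w. a k + exp w) has_field_derivative exp w) (at w)"
      by (auto intro!: derivative_eq_intros)
    have "(mat (z - a k) ** (Z' z ** ?X) + Z z ** (E ** ?X)) $ i $ j = (mat (z - a k) ** (A z ** (Z z ** ?X))) $ i $ j" for i j
    proof -
      have "has_coord_deriv {w. Re w < ln d} (\<lambda>w. a k + exp w) (\<lambda>y. Y y $ i $ j) ((A z ** Y w) $ i $ j) w"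
        using Y w ew by (auto simp: system_solution_def)
      then have 1: "((\<lambda>y. Y y $ i $ j) has_field_derivative (A z ** Y w) $ i $ j * exp w) (at w)"
        by (intro has_coord_deriv_imp_field_derivative[OF op _ ed]) (use w in auto)
      have ZE: "((\<lambda>w. Z (a k + exp w) $ i $ j) has_field_derivative Z' z $ i $ j * exp w) (at w)" for i j
        by (rule DERIV_chain2[where f="\<lambda>z. Z z $ i $ j", OF _ ed]) (use Zd[of z] z ew in auto)
      have 2: "((\<lambda>y. Y y $ i $ j) has_field_derivative
          (Z' z $ i $ 1 * exp w * ?X $ 1 $ j + (E ** ?X) $ 1 $ j * Z z $ i $ 1) +
          (Z' z $ i $ 2 * exp w * ?X $ 2 $ j + (E ** ?X) $ 2 $ j * Z z $ i $ 2)) (at w)"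
        unfolding Y_def mult2_nth[of "Z _"]
        using DERIV_add[OF DERIV_mult[OF ZE[of i 1] mexp_has_field_derivative[of E 1 j w]]
            DERIV_mult[OF ZE[of i 2] mexp_has_field_derivative[of E 2 j w]]]
        by (simp add: ew)
      from DERIV_unique[OF 1 2] show ?thesis
        by (simp add: mat_mult_left mult2_nth[of "A z"] mult2_nth[of "Z z"] mult2_nth[of "Z' z"] Y_def ew algebra_simps)
    qed
    then have "mat (z - a k) ** (Z' z ** ?X) + Z z ** (E ** ?X) = mat (z - a k) ** (A z ** (Z z ** ?X))"
      by (simp add: vec_eq_iff)
    from mexp_solution_algebra[OF _ X this] show ?thesis
      using Z(2) z by (simp add: H_def)
  qed
  have nz: "det (Z z) \<noteq> 0" if "z \<in> ball (a k) d" for z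
    using Z(2) that by (simp add: invertible_det_nz)
  have Z'h: "(\<lambda>z. Z' z $ i $ j) holomorphic_on ball (a k) d" for i j
    unfolding Z'_def by (simp add: holomorphic_deriv matrix_holomorphic_onD[OF Z(1)])
  have Hh: "matrix_holomorphic_on H (ball (a k) d)"
    unfolding matrix_holomorphic_on_def forall_2 H_def mat_mult_left vec_lambda_beta mult2_nth adj2_nth vector_add_component
    by (intro conjI holomorphic_intros Z'h matrix_holomorphic_onD[OF Z(1)] holomorphic_det2[OF Z(1)] nz)
  have "eigenvalue_pair (H (a k)) x y" if "eigenvalue_pair E x y" for x y
  proof -
    have nz: "det (Z (a k)) \<noteq> 0" using nz d by simp
    have "H (a k) = mat (1 / det (Z (a k))) ** ((Z (a k) ** E) ** adj2 (Z (a k)))"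
      by (simp add: H_def mat_mult_left mat2_eq_iff mult2_nth)
    moreover have "x + y = E$1$1 + E$2$2" "x * y = E$1$1 * E$2$2 - E$1$2 * E$2$1"
      using that by (auto simp: eigenvalue_pair_2)
    ultimately show ?thesis using nz
      unfolding eigenvalue_pair_2
      by (simp add: mat_mult_left mult2_nth det_2 divide_simps) (intro conjI; simp add: algebra_simps)
  qed
  with that[OF d _ Hh H] away show ?thesis by blast
qed

lemma powi_has_field_derivative:
  "z \<noteq> 0 \<Longrightarrow> ((\<lambda>z::complex. z powi n) has_field_derivative (of_int n * z powi n / z)) (at z)"
  by (auto intro!: derivative_eq_intros simp: power_int_diff)

text \<open>With \<open>B = W' W^(-1)\<close> and \<open>D\<close> the diagonal factor,
  differentiation of \<open>D W(1 / z)\<close> gives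
  \<open>A = D' D^(-1) - z^(-2) D B(1 / z) D^(-1)\<close>. Conjugation by \<open>D\<close>
  multiplies the off-diagonal entries by \<open>z powi (k1 - k2)\<close> and its inverse; this is
  the source of the growth estimates for the entries of \<open>A\<close>.\<close>

lemma local_form_infinity:
  assumes "local_form_at_infinity a A k1 k2"
  obtains d W B where "d > 0" "\<And>j. j \<in> {1..4} \<Longrightarrow> cmod (a j) \<le> 1 / d"
    "\<And>w. w \<in> ball 0 d \<Longrightarrow> invertible (W w)"
    "matrix_holomorphic_on B (ball 0 d)"
    "\<And>w i j. w \<in> ball 0 d \<Longrightarrow> ((\<lambda>w. W w $ i $ j) has_field_derivative (B w ** W w) $ i $ j) (at w)"
    "system_solution {z. cmod z > 1 / d} (\<lambda>z. z) A
       (\<lambda>z. vector [vector [z powi k1, 0], vector [0, z powi k2]] ** W (1 / z))"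
    "\<And>z. cmod z > 1 / d \<Longrightarrow> A z $ 1 $ 1 = of_int k1 / z - B (1 / z) $ 1 $ 1 / z\<^sup>2"
    "\<And>z. cmod z > 1 / d \<Longrightarrow> A z $ 1 $ 2 = - (z powi (k1 - k2) * B (1 / z) $ 1 $ 2 / z\<^sup>2)"
    "\<And>z. cmod z > 1 / d \<Longrightarrow> A z $ 2 $ 1 = - (z powi (k2 - k1) * B (1 / z) $ 2 $ 1 / z\<^sup>2)"
    "\<And>z. cmod z > 1 / d \<Longrightarrow> A z $ 2 $ 2 = of_int k2 / z - B (1 / z) $ 2 $ 2 / z\<^sup>2"
proof -
  let ?D = "\<lambda>z::complex. vector [vector [z powi k1, 0], vector [0, z powi k2]] :: complex^2^2"
  from assms obtain d W where d: "d > 0" and aj: "\<forall>j\<in>{1..4}. cmod (a j) \<le> 1 / d"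
    and W: "matrix_holomorphic_on W (ball 0 d)" "\<forall>w\<in>ball 0 d. invertible (W w)"
    and all: "\<And>Y. (\<exists>C. invertible C \<and>
         (\<forall>z. cmod z > 1 / d \<longrightarrow> Y z = ?D z ** W (1 / z) ** C)) \<Longrightarrow>
        system_solution {z. cmod z > 1 / d} (\<lambda>z. z) A Y"
    unfolding local_form_at_infinity_def by blast
  define Y where "Y = (\<lambda>z. ?D z ** W (1 / z))"
  have Y: "system_solution {z. cmod z > 1 / d} (\<lambda>z. z) A Y"
    by (rule all) (auto intro!: exI[of _ "mat 1"] simp: Y_def invertible_def)
  define W' :: "complex \<Rightarrow> complex^2^2" where "W' = (\<lambda>z. \<chi> i j. deriv (\<lambda>z. W z $ i $ j) z)"
  define B where "B = (\<lambda>z. mat (1 / det (W z)) ** (W' z ** adj2 (W z)))"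
  have nz: "det (W z) \<noteq> 0" if "z \<in> ball 0 d" for z
    using W(2) that by (simp add: invertible_det_nz)
  have W'h: "(\<lambda>z. W' z $ i $ j) holomorphic_on ball 0 d" for i j
    unfolding W'_def by (simp add: holomorphic_deriv matrix_holomorphic_onD[OF W(1)])
  have Bh: "matrix_holomorphic_on B (ball 0 d)"
    unfolding matrix_holomorphic_on_def forall_2 B_def mat_mult_left vec_lambda_beta mult2_nth adj2_nth
    by (intro conjI holomorphic_intros W'h matrix_holomorphic_onD[OF W(1)] holomorphic_det2[OF W(1)] nz)
  have BW: "B z ** W z = W' z" if "z \<in> ball 0 d" for z
    using nz[OF that] unfolding B_def
    by (simp add: mat_mult_left mat2_eq_iff mult2_nth det_2 divide_simps) (simp add: algebra_simps)
  have Wd: "((\<lambda>z. W z $ i $ j) has_field_derivative (B z ** W z) $ i $ j) (at z)" if "z \<in> ball 0 d" for i j z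
    unfolding BW[OF that]
    using holomorphic_derivI[OF matrix_holomorphic_onD[OF W(1)] open_ball that, of i j] by (simp add: W'_def)
  have D: "?D z $ 1 $ 1 = z powi k1" "?D z $ 1 $ 2 = 0" "?D z $ 2 $ 1 = 0" "?D z $ 2 $ 2 = z powi k2" for z
    by simp_all
  have key: "A z ** ?D z = vector [vector [of_int k1 / z, 0], vector [0, of_int k2 / z]] ** ?D z
          + mat (- 1 / z\<^sup>2) ** (?D z ** B (1/z))" if z: "cmod z > 1 / d" for z
  proof -
    have z0: "z \<noteq> 0" using z d by auto
    have wz: "1/z \<in> ball 0 d" using z d z0 by (simp add: norm_divide field_simps)
    have op: "open {z. cmod z > 1 / d}"
      by (intro open_Collect_less continuous_intros)
    have invd: "((\<lambda>z. 1/z) has_field_derivative (- 1 / z\<^sup>2)) (at z)"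
      using z0 by (auto intro!: derivative_eq_intros simp: power2_eq_square divide_simps)
    have dW: "((\<lambda>z. W (1/z) $ i $ j) has_field_derivative (B (1/z) ** W (1/z)) $ i $ j * (- 1 / z\<^sup>2)) (at z)" for i j
      by (rule DERIV_chain2[OF Wd[OF wz] invd])
    have 1: "((\<lambda>z. Y z $ i $ j) has_field_derivative (A z ** Y z) $ i $ j) (at z)" for i j
      using has_coord_deriv_imp_field_derivative[OF op, of z "\<lambda>z. z" 1] Y z
      by (fastforce simp: system_solution_def)
    have Yn: "Y z $ 1 $ j = z powi k1 * W (1/z) $ 1 $ j" "Y z $ 2 $ j = z powi k2 * W (1/z) $ 2 $ j" for z j
      by (simp_all add: Y_def mult2_nth)
    have 2: "((\<lambda>z. Y z $ 1 $ j) has_field_derivative of_int k1 * z powi k1 / z * W (1/z) $ 1 $ j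
        + (B (1/z) ** W (1/z)) $ 1 $ j * (- 1 / z\<^sup>2) * z powi k1) (at z)" for j
      unfolding Yn by (rule DERIV_mult[OF powi_has_field_derivative[OF z0] dW])
    have 3: "((\<lambda>z. Y z $ 2 $ j) has_field_derivative of_int k2 * z powi k2 / z * W (1/z) $ 2 $ j
        + (B (1/z) ** W (1/z)) $ 2 $ j * (- 1 / z\<^sup>2) * z powi k2) (at z)" for j
      unfolding Yn by (rule DERIV_mult[OF powi_has_field_derivative[OF z0] dW])
    have "A z ** Y z = (vector [vector [of_int k1 / z, 0], vector [0, of_int k2 / z]] ** ?D z
          + mat (- 1 / z\<^sup>2) ** (?D z ** B (1/z))) ** W (1/z)"
      unfolding mat2_eq_iff DERIV_unique[OF 1 2] DERIV_unique[OF 1 3]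
      by (simp add: mult2_nth mat_mult_left algebra_simps)
    then have e: "(A z ** ?D z) ** W (1/z) = (vector [vector [of_int k1 / z, 0], vector [0, of_int k2 / z]] ** ?D z
          + mat (- 1 / z\<^sup>2) ** (?D z ** B (1/z))) ** W (1/z)"
      by (simp add: Y_def matrix_mul_assoc)
    obtain X where X: "W (1/z) ** X = mat 1"
      using W(2) wz unfolding invertible_def by blast
    from arg_cong[OF e, of "\<lambda>M. M ** X"] show ?thesis
      by (simp add: X matrix_mul_assoc[symmetric])
  qed
  have A: "A z $ 1 $ 1 = of_int k1 / z - B (1 / z) $ 1 $ 1 / z\<^sup>2"
    "A z $ 1 $ 2 = - (z powi (k1 - k2) * B (1 / z) $ 1 $ 2 / z\<^sup>2)"
    "A z $ 2 $ 1 = - (z powi (k2 - k1) * B (1 / z) $ 2 $ 1 / z\<^sup>2)"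
    "A z $ 2 $ 2 = of_int k2 / z - B (1 / z) $ 2 $ 2 / z\<^sup>2" if z: "cmod z > 1 / d" for z
  proof -
    have z0: "z \<noteq> 0" using z d by auto
    have p: "z powi k1 \<noteq> 0" "z powi k2 \<noteq> 0" using z0 by auto
    note k = key[OF z, unfolded mat2_eq_iff]
    have "(A z $ 1 $ 1 - (of_int k1 / z - B (1 / z) $ 1 $ 1 / z\<^sup>2)) * z powi k1 = 0"
      using k p z0 by (simp add: mult2_nth mat_mult_left algebra_simps)
    with p z0 show "A z $ 1 $ 1 = of_int k1 / z - B (1 / z) $ 1 $ 1 / z\<^sup>2"
      by simp
    have "(A z $ 1 $ 2 - (- (z powi (k1 - k2) * B (1 / z) $ 1 $ 2 / z\<^sup>2))) * z powi k2 = 0"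
      using k p z0 by (simp add: power_int_diff z0 mult2_nth mat_mult_left algebra_simps)
    with p z0 show "A z $ 1 $ 2 = - (z powi (k1 - k2) * B (1 / z) $ 1 $ 2 / z\<^sup>2)"
      by (simp add: eq_neg_iff_add_eq_0)
    have "(A z $ 2 $ 1 - (- (z powi (k2 - k1) * B (1 / z) $ 2 $ 1 / z\<^sup>2))) * z powi k1 = 0"
      using k p z0 by (simp add: power_int_diff z0 mult2_nth mat_mult_left algebra_simps)
    with p z0 show "A z $ 2 $ 1 = - (z powi (k2 - k1) * B (1 / z) $ 2 $ 1 / z\<^sup>2)"
      by (simp add: eq_neg_iff_add_eq_0)
    have "(A z $ 2 $ 2 - (of_int k2 / z - B (1 / z) $ 2 $ 2 / z\<^sup>2)) * z powi k2 = 0"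
      using k p z0 by (simp add: mult2_nth mat_mult_left algebra_simps)
    with p z0 show "A z $ 2 $ 2 = of_int k2 / z - B (1 / z) $ 2 $ 2 / z\<^sup>2"
      by simp
  qed
  show ?thesis
    by (rule that[OF d _ _ Bh Wd Y[unfolded Y_def] A]) (use aj W(2) in auto)
qed

section \<open>Rational functions by Liouville's theorem\<close>

text \<open>Riemann's theorem on removable singularities, one point at a time. Near each remaining
  point the extended function still coincides with \<open>f\<close>, so its limit condition
  survives.\<close>

lemma entire_extension:
  assumes "finite S" "f holomorphic_on (- S)" "\<And>a. a \<in> S \<Longrightarrow> ((\<lambda>z. (z - a) * f z) \<longlongrightarrow> 0) (at a)"
  shows "\<exists>g. g holomorphic_on UNIV \<and> (\<forall>z. z \<notin> S \<longrightarrow> g z = f z)"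
  using assms
proof (induction S arbitrary: f rule: finite_induct)
  case empty
  then show ?case by auto
next
  case (insert b T)
  have op: "open (- T)" using insert(1) by (simp add: finite_imp_closed open_Compl)
  then have bi: "b \<in> interior (- T)" using insert(2) by (simp add: interior_open)
  have "- insert b T = - T - {b}" by auto
  then have h: "f holomorphic_on (- T - {b})" using insert(4) by simp
  obtain g where g: "g holomorphic_on (- T)" "\<And>z. z \<in> - T - {b} \<Longrightarrow> g z = f z"
    using insert(5)[of b] holomorphic_on_extend_lim[OF h bi] by auto
  have "((\<lambda>z. (z - a) * g z) \<longlongrightarrow> 0) (at a)" if a: "a \<in> T" for a
  proof (rule Lim_transform_eventually)
    show "((\<lambda>z. (z - a) * f z) \<longlongrightarrow> 0) (at a)" using insert(5) a by auto
    have "open (- (T - {a} \<union> {b}))" using insert(1) by (simp add: finite_imp_closed open_Compl)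
    moreover have "a \<in> - (T - {a} \<union> {b})" using insert(2) a by auto
    ultimately have "\<forall>\<^sub>F z in at a. z \<in> - (T - {a} \<union> {b}) \<and> z \<noteq> a"
      by (intro eventually_conj eventually_at_in_open' eventually_neq_at_within)
    then show "\<forall>\<^sub>F z in at a. (z - a) * f z = (z - a) * g z"
      by eventually_elim (auto simp: g(2))
  qed
  from insert(3)[OF g(1) this] obtain g' where "g' holomorphic_on UNIV" "\<And>z. z \<notin> T \<Longrightarrow> g' z = g z"
    by blast
  then show ?case using g(2) by (intro exI[of _ g']) auto
qed

lemma eventually_notin_at_infinity:
  assumes "finite S" shows "\<forall>\<^sub>F z in at_infinity. (z :: 'a :: real_normed_vector) \<notin> S"
proof -
  obtain B where "\<And>x. x \<in> S \<Longrightarrow> norm x \<le> B"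
    using finite_imp_bounded[OF assms] bounded_iff by blast
  then show ?thesis unfolding eventually_at_infinity
    by (intro exI[of _ "B + 1"]) force
qed

lemma punctured_plane_Liouville:
  assumes S: "finite S" and f: "f holomorphic_on (- S)"
    and lim: "\<And>a. a \<in> S \<Longrightarrow> ((\<lambda>z. (z - a) * f z) \<longlongrightarrow> 0) (at a)"
    and inf: "(f \<longlongrightarrow> l) at_infinity" and z: "z \<notin> S"
  shows "f z = l"
proof -
  from entire_extension[OF S f lim] obtain g where
    g: "g holomorphic_on UNIV" "\<And>z. z \<notin> S \<Longrightarrow> g z = f z" by blast
  have "(g \<longlongrightarrow> l) at_infinity"
    by (rule Lim_transform_eventually[OF inf])
      (use eventually_notin_at_infinity[OF S] in eventually_elim, simp add: g(2))
  from Liouville_weak[OF g(1) this] g(2)[OF z] show ?thesis by metis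
qed

lemma tendsto_div_shift_at_infinity: "((\<lambda>z::complex. z / (z - c)) \<longlongrightarrow> 1) at_infinity"
proof -
  have "((\<lambda>z. 1 / (1 - c / z)) \<longlongrightarrow> 1 / (1 - 0)) at_infinity"
    by (intro tendsto_intros tendsto_divide_0[OF tendsto_const] filterlim_ident) auto
  then have "((\<lambda>z. 1 / (1 - c / z)) \<longlongrightarrow> 1) at_infinity" by simp
  then show ?thesis
  proof (rule Lim_transform_eventually)
    show "\<forall>\<^sub>F z in at_infinity. 1 / (1 - c / z) = z / (z - c)"
      using eventually_notin_at_infinity[of "{0, c}"]
      by (simp, elim eventually_mono) (auto simp: field_simps)
  qed
qed

text \<open>After subtraction of the principal parts all singularities are removable. Since
  \<open>z\<close> times the difference converges at infinity, the difference itself tends to 0 and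
  vanishes by Liouville. Multiplying by \<open>z\<close> once more turns
  \<open>z / (z - a k) \<longlongrightarrow> 1\<close> into the residue theorem.\<close>

lemma simple_poles_partial_fractions:
  fixes a :: "'i \<Rightarrow> complex"
  assumes I: "finite I" "inj_on a I" and f: "f holomorphic_on (- a ` I)"
    and r: "\<And>k. k \<in> I \<Longrightarrow> ((\<lambda>z. (z - a k) * f z) \<longlongrightarrow> r k) (at (a k))"
    and L: "((\<lambda>z. z * f z) \<longlongrightarrow> L) at_infinity"
  shows "\<And>z. z \<notin> a ` I \<Longrightarrow> f z = (\<Sum>k\<in>I. r k / (z - a k))" and "L = (\<Sum>k\<in>I. r k)"
proof -
  let ?g = "\<lambda>z. \<Sum>k\<in>I. r k / (z - a k)"
  have lim: "((\<lambda>z. (z - b) * (f z - ?g z)) \<longlongrightarrow> 0) (at b)" if b: "b \<in> a ` I" for b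
  proof -
    obtain k where k: "k \<in> I" "b = a k" using b by auto
    have "((\<lambda>z. (z - b) * f z - (r k + (\<Sum>j\<in>I - {k}. (z - b) * (r j / (z - a j))))) \<longlongrightarrow>
        r k - (r k + (\<Sum>j\<in>I - {k}. (b - b) * (r j / (b - a j))))) (at b)"
    proof (intro tendsto_intros)
      show "((\<lambda>z. (z - b) * f z) \<longlongrightarrow> r k) (at b)" using r[OF k(1)] k(2) by simp
      show "b - a j \<noteq> 0" if "j \<in> I - {k}" for j using I(2) k that by (auto simp: inj_on_def)
    qed
    then have "((\<lambda>z. (z - b) * f z - (r k + (\<Sum>j\<in>I - {k}. (z - b) * (r j / (z - a j))))) \<longlongrightarrow> 0) (at b)"
      by simp
    then show ?thesis
    proof (rule Lim_transform_eventually)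
      have "\<forall>\<^sub>F z in at b. z \<noteq> b" by (rule eventually_neq_at_within)
      then show "\<forall>\<^sub>F z in at b. (z - b) * f z - (r k + (\<Sum>j\<in>I - {k}. (z - b) * (r j / (z - a j)))) = (z - b) * (f z - ?g z)"
        by eventually_elim
          (simp add: sum.remove[OF I(1) k(1)] k(2) sum_distrib_left right_diff_distrib distrib_left)
    qed
  qed
  have hol: "(\<lambda>z. f z - ?g z) holomorphic_on (- a ` I)"
    by (intro holomorphic_intros f) auto
  have zg: "((\<lambda>z. z * ?g z) \<longlongrightarrow> (\<Sum>k\<in>I. r k * 1)) at_infinity"
    unfolding sum_distrib_left times_divide_eq_right mult.commute[of _ "r _"]
    unfolding times_divide_eq_right[symmetric]
    by (intro tendsto_sum tendsto_mult tendsto_const tendsto_div_shift_at_infinity)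
  have "((\<lambda>z. (z * f z - z * ?g z) / z) \<longlongrightarrow> 0) at_infinity"
    by (rule tendsto_divide_0[OF tendsto_diff[OF L zg] filterlim_ident])
  then have "((\<lambda>z. f z - ?g z) \<longlongrightarrow> 0) at_infinity"
  proof (rule Lim_transform_eventually)
    show "\<forall>\<^sub>F z in at_infinity. (z * f z - z * ?g z) / z = f z - ?g z"
      by (rule eventually_mono[OF eventually_notin_at_infinity[of "{0}"]])
        (auto simp: diff_divide_distrib)
  qed
  from punctured_plane_Liouville[OF finite_imageI[OF I(1)] hol lim this]
  show *: "\<And>z. z \<notin> a ` I \<Longrightarrow> f z = ?g z" by simp
  have "((\<lambda>z. z * f z) \<longlongrightarrow> (\<Sum>k\<in>I. r k * 1)) at_infinity"
    by (rule Lim_transform_eventually[OF zg])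
      (use eventually_notin_at_infinity[OF finite_imageI[OF I(1), of a]] in eventually_elim, simp add: *)
  from tendsto_unique[OF trivial_limit_at_infinity L this] show "L = (\<Sum>k\<in>I. r k)" by simp
qed

text \<open>The product of the \<open>z - a k\<close> cancels the simple poles, and the growth
  condition makes the resulting entire function converge at infinity, so it is constant. For the
  lower left entry of \<open>A\<close>, the constant is 0 if the indices differ by more than 2, and
  the leading coefficient at infinity if they differ by exactly 2.\<close>

lemma simple_poles_product_form:
  fixes a :: "'i \<Rightarrow> complex"
  assumes I: "finite I" "inj_on a I" and f: "f holomorphic_on (- a ` I)"
    and r: "\<And>k. k \<in> I \<Longrightarrow> ((\<lambda>z. (z - a k) * f z) \<longlongrightarrow> r k) (at (a k))"
    and L: "((\<lambda>z. z ^ card I * f z) \<longlongrightarrow> c) at_infinity" and z: "z \<notin> a ` I"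
  shows "f z = c / (\<Prod>k\<in>I. z - a k)"
proof -
  let ?p = "\<lambda>z. \<Prod>k\<in>I. z - a k"
  have lim: "((\<lambda>z. (z - b) * (f z * ?p z)) \<longlongrightarrow> 0) (at b)" if b: "b \<in> a ` I" for b
  proof -
    obtain k where k: "k \<in> I" "b = a k" using b by auto
    have "((\<lambda>z. ((z - a k) * f z) * ?p z) \<longlongrightarrow> r k * ?p (a k)) (at (a k))"
      by (intro tendsto_mult[OF r[OF k(1)]] tendsto_intros)
    moreover have "?p (a k) = 0" using k I(1) by (auto simp: prod_zero_iff)
    ultimately show ?thesis by (simp add: k(2) mult.assoc)
  qed
  have "((\<lambda>z. (z ^ card I * f z) / (\<Prod>k\<in>I. z / (z - a k))) \<longlongrightarrow> c / (\<Prod>k\<in>I. 1)) at_infinity"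
    by (intro tendsto_divide[OF L] tendsto_prod tendsto_div_shift_at_infinity) auto
  then have "((\<lambda>z. (z ^ card I * f z) / (\<Prod>k\<in>I. z / (z - a k))) \<longlongrightarrow> c) at_infinity" by simp
  then have inf: "((\<lambda>z. f z * ?p z) \<longlongrightarrow> c) at_infinity"
  proof (rule Lim_transform_eventually)
    show "\<forall>\<^sub>F z in at_infinity. (z ^ card I * f z) / (\<Prod>k\<in>I. z / (z - a k)) = f z * ?p z"
      by (rule eventually_mono[OF eventually_notin_at_infinity[of "{0}"]])
        (auto simp: prod_dividef)
  qed
  have "f z * ?p z = c"
    by (rule punctured_plane_Liouville[OF finite_imageI[OF I(1)] _ lim inf z])
      (intro holomorphic_intros f)
  moreover have "?p z \<noteq> 0" using I(1) z by (auto simp: prod_zero_iff)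
  ultimately show ?thesis by (simp add: eq_divide_eq)
qed

section \<open>Simple connectivity of the complement of an arc\<close>

text \<open>Inversion at the end point of the arc turns the sphere minus the arc into a plane set,
  whose complement is a half-open arc running to infinity. The point 0 represents infinity and has
  to be inserted: by \<open>1 / 0 = 0\<close> the comprehension would test the end point itself at
  \<open>w = 0\<close> and reject it.\<close>

lemma arc_complement_inverted:
  fixes \<gamma> :: "real \<Rightarrow> complex"
  assumes arc: "arc \<gamma>"
  defines "b \<equiv> pathfinish \<gamma>" and "U \<equiv> insert 0 {w. pathfinish \<gamma> + 1 / w \<notin> path_image \<gamma>}"
  shows "open U" "simply_connected U"
proof -
  let ?K = "path_image \<gamma>"
  have bK: "b \<in> ?K" by (simp add: b_def pathfinish_in_path_image)
  have U: "U = insert 0 {w. b + 1 / w \<notin> ?K}" by (simp add: U_def b_def)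
  have cK: "closed ?K" "bounded ?K"
    using arc by (simp_all add: closed_arc_image bounded_arc_image)
  then obtain R where R: "R > 0" "\<And>z. z \<in> ?K \<Longrightarrow> cmod z \<le> R"
    by (meson bounded_pos)
  define r where "r = 1 / (R + cmod b + 1)"
  have r0: "r > 0" using R(1) by (simp add: r_def add_pos_nonneg)
  have near: "b + 1 / w \<notin> ?K" if "w \<noteq> 0" "cmod w < r" for w
  proof
    assume "b + 1 / w \<in> ?K"
    then have "cmod (b + 1 / w) \<le> R" by (rule R)
    then have "cmod (1 / w) \<le> R + cmod b"
      by (smt (verit) add_diff_cancel_left' norm_triangle_ineq4)
    moreover have "1 / r < cmod (1 / w)"
      using that r0 by (simp add: norm_divide frac_less2)
    ultimately show False by (simp add: r_def)
  qed
  have ballU: "ball 0 r \<subseteq> U" using near by (auto simp: U)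
  have "open ((- {0}) \<inter> (\<lambda>w. b + 1 / w) -` (- ?K))"
    by (intro continuous_open_preimage continuous_intros) (use cK in \<open>auto simp: open_Compl\<close>)
  also have "(- {0}) \<inter> (\<lambda>w. b + 1 / w) -` (- ?K) = U - {0}"
    by (auto simp: U)
  finally have op0: "open (U - {0})" .
  have "U = (U - {0}) \<union> ball 0 r" using ballU r0 by (auto simp: U)
  then show opU: "open U" using op0 by (metis open_Un open_ball)
  have im: "U - {0} = (\<lambda>z. 1 / (z - b)) ` (- ?K)"
  proof (intro set_eqI iffI)
    fix w assume "w \<in> U - {0}"
    then show "w \<in> (\<lambda>z. 1 / (z - b)) ` (- ?K)"
      by (intro image_eqI[of _ _ "b + 1 / w"]) (auto simp: U)
  next
    fix w assume "w \<in> (\<lambda>z. 1 / (z - b)) ` (- ?K)"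
    then obtain z where z: "z \<notin> ?K" "w = 1 / (z - b)" by auto
    then have "z \<noteq> b" using bK by auto
    then show "w \<in> U - {0}" using z by (auto simp: U)
  qed
  have conn: "connected (U - {0})" unfolding im
    by (intro connected_continuous_image continuous_intros connected_arc_complement arc)
      (use bK in auto)
  have "0 \<in> closure (U - {0})"
  proof -
    have "0 islimpt U" using opU ballU r0 by (simp add: interior_limit_point interior_open U)
    then show ?thesis unfolding closure_def islimpt_def by blast
  qed
  then have cU: "connected U"
    by (intro connected_intermediate_closure[OF conn]) (auto intro: subsetD[OF closure_subset])
  have cim: "- U = (\<lambda>z. 1 / (z - b)) ` (?K - {b})"
  proof (intro set_eqI iffI)
    fix w assume w: "w \<in> - U"
    then show "w \<in> (\<lambda>z. 1 / (z - b)) ` (?K - {b})"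
      by (intro image_eqI[of _ _ "b + 1 / w"]) (auto simp: U)
  qed (auto simp: U)
  have K': "?K - {b} = \<gamma> ` {0..<1}"
  proof (intro set_eqI iffI)
    fix z assume "z \<in> ?K - {b}"
    then obtain s where s: "s \<in> {0..1}" "z = \<gamma> s" "z \<noteq> \<gamma> 1"
      by (auto simp: path_image_def b_def pathfinish_def)
    then have "s \<noteq> 1" by auto
    then show "z \<in> \<gamma> ` {0..<1}" using s by auto
  next
    fix z assume "z \<in> \<gamma> ` {0..<1}"
    then obtain s where "s \<in> {0..<1}" "z = \<gamma> s" by auto
    then show "z \<in> ?K - {b}"
      using arcD[OF arc, of s 1] by (auto simp: path_image_def b_def pathfinish_def)
  qed
  have cg: "continuous_on {0..1} \<gamma>" using arc by (simp add: arc_def path_def)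
  have "connected (?K - {b})" unfolding K'
    by (intro connected_continuous_image continuous_on_subset[OF cg]) auto
  then have connC: "connected (- U)" unfolding cim
    by (intro connected_continuous_image continuous_intros) auto
  \<comment> \<open>Near its end the arc comes arbitrarily close to \<open>b\<close>, so its
    inverted image is unbounded. A connected unbounded complement has no bounded component, which is
    the criterion for simple connectivity of a connected open plane set.\<close>
  have unb: "\<not> bounded (- U)"
  proof
    assume "bounded (- U)"
    then obtain B where B: "B > 0" "\<And>w. w \<in> - U \<Longrightarrow> cmod w \<le> B"
      by (meson bounded_pos)
    have "(\<gamma> \<longlongrightarrow> \<gamma> 1) (at 1 within {0..1})"
      using cg by (simp add: continuous_on_def)
    then have "\<forall>\<^sub>F s in at 1 within {0..1}. dist (\<gamma> s) (\<gamma> 1) < 1 / B"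
      by (rule tendstoD) (use B in simp)
    then obtain e where e: "e > 0" "\<And>s. s \<in> {0..1} \<Longrightarrow> s \<noteq> 1 \<Longrightarrow> dist s 1 < e \<Longrightarrow> dist (\<gamma> s) (\<gamma> 1) < 1 / B"
      unfolding eventually_at by blast
    define s where "s = max 0 (1 - e / 2)"
    have s: "s \<in> {0..<1}" "dist (\<gamma> s) (\<gamma> 1) < 1 / B"
      using e by (auto simp: s_def dist_real_def max_def)
    then have g: "\<gamma> s \<in> ?K - {b}" using K' by auto
    then have "1 / (\<gamma> s - b) \<in> - U" using cim by auto
    then have "cmod (1 / (\<gamma> s - b)) \<le> B" by (rule B)
    moreover have "cmod (\<gamma> s - b) < 1 / B" using s by (simp add: b_def pathfinish_def dist_norm)
    moreover have "0 < cmod (\<gamma> s - b)" using g by auto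
    ultimately show False using B(1) by (auto simp: norm_divide field_simps)
  qed
  have "components (- U) \<subseteq> {- U}" using connC by (simp add: connected_eq_components_subset_sing)
  then show "simply_connected U"
    unfolding simply_connected_eq_unbounded_complement_components[OF opU] using cU unb by auto
qed

section \<open>The curve and its arcs\<close>

definition next_par :: "(nat \<Rightarrow> real) \<Rightarrow> nat \<Rightarrow> real" where
  "next_par t k = (if k = 4 then t 1 + 1 else t (k + 1))"

definition prev_index :: "nat \<Rightarrow> nat" where
  "prev_index k = (if k = 1 then 4 else k - 1)"

text \<open>The closed arc complementary to the open subarc after \<open>a k\<close>. It runs from
  \<open>a (k + 1)\<close> through the remaining points to \<open>a k\<close>, where the period 1 is
  used. As a slit it passes through every singular point and leaves the curve open in one gap
  only.\<close>

definition co_arc :: "(real \<Rightarrow> complex) \<Rightarrow> (nat \<Rightarrow> real) \<Rightarrow> nat \<Rightarrow> complex set" where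
  "co_arc g t k = g ` {next_par t k .. t k + 1}"

lemma next_par_simps: "next_par t 1 = t 2" "next_par t 2 = t 3" "next_par t 3 = t 4"
  "next_par t 4 = t 1 + 1"
  by (auto simp: next_par_def numeral_eq_Suc)

lemma atLeastAtMost_1_4: "{1..4} = {1, 2, 3, 4 :: nat}"
  by auto

lemma prev_index_mem: "k \<in> {1..4} \<Longrightarrow> prev_index k \<in> {1..4}"
  by (auto simp: prev_index_def)

lemma subarc_before_alt: "subarc_before g t k = subarc_after g t (prev_index k)"
  by (simp add: subarc_before_def prev_index_def)

lemma subarc_after_alt: "subarc_after g t k = g ` {t k <..< next_par t k}"
  by (simp add: subarc_after_def next_par_def)

context
  fixes a g t
  assumes curve: "curve_through a g t"
begin

lemma curve_order: "t 1 < t 2" "t 2 < t 3" "t 3 < t 4" "t 4 < t 1 + 1"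
  using curve by (auto simp: curve_through_def)

lemma curve_points: "k \<in> {1..4} \<Longrightarrow> g (t k) = a k"
  using curve by (auto simp: curve_through_def)

lemma curve_simple: "simple_path g"
  using curve by (auto simp: curve_through_def)

lemma curve_plus_1: "g (s + 1) = g s"
  using curve by (auto simp: curve_through_def)

lemma curve_plus_int: "g (s + of_int n) = g s"
proof -
  have nat: "g (s + of_nat n) = g s" for s n
  proof (induction n)
    case (Suc n)
    have "g (s + of_nat (Suc n)) = g ((s + of_nat n) + 1)" by (simp add: algebra_simps)
    then show ?case using Suc by (simp only: curve_plus_1)
  qed simp
  show ?thesis
  proof (cases "n \<ge> 0")
    case True
    then show ?thesis using nat[of s "nat n"] by simp
  next
    case False
    then show ?thesis using nat[of "s + of_int n" "nat (- n)"] by simp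
  qed
qed

lemma curve_frac: "g (frac s) = g s"
  using curve_plus_int[of s "- \<lfloor>s\<rfloor>"] by (simp add: frac_def)

lemma curve_eq_iff: "g s = g s' \<longleftrightarrow> s - s' \<in> \<int>"
proof
  assume "g s = g s'"
  then have "g (frac s) = g (frac s')" by (simp add: curve_frac)
  moreover have "frac s \<in> {0..1}" "frac s' \<in> {0..1}" "frac s < 1" "frac s' < 1"
    by (auto simp: less_imp_le[OF frac_lt_1] frac_lt_1)
  ultimately have "frac s = frac s'"
    using curve_simple unfolding simple_path_def loop_free_def by fastforce
  then show "s - s' \<in> \<int>" by (metis frac_def Ints_of_int add.commute add_diff_eq diff_add_cancel diff_diff_eq2 eq_diff_eq of_int_diff)
next
  assume "s - s' \<in> \<int>"
  then obtain n where "s = s' + of_int n" by (metis Ints_cases add.commute diff_add_cancel)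
  then show "g s = g s'" by (simp add: curve_plus_int)
qed

lemma curve_eq_close:
  assumes "g s = g s'" "\<bar>s - s'\<bar> < 1" shows "s = s'"
proof -
  obtain n where n: "s - s' = of_int n" using assms(1) by (auto simp: curve_eq_iff elim: Ints_cases)
  then have "\<bar>n\<bar> < 1" using assms(2) by linarith
  then show ?thesis using n by simp
qed

lemma curve_in_period: "\<exists>s'. c \<le> s' \<and> s' < c + 1 \<and> g s' = g s"
proof (intro exI conjI)
  show "g (c + frac (s - c)) = g s" unfolding curve_eq_iff by (simp add: frac_def)
qed (use frac_lt_1 in auto)

lemma curve_image: "path_image g = range g"
proof
  show "path_image g \<subseteq> range g" by (auto simp: path_image_def)
  show "range g \<subseteq> path_image g"
  proof
    fix z assume "z \<in> range g"
    then obtain s where "z = g (frac s)" by (auto simp: curve_frac)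
    then show "z \<in> path_image g" using frac_lt_1[of s] by (auto simp: path_image_def less_imp_le)
  qed
qed

lemma curve_closed: "pathfinish g = pathstart g"
  using curve_plus_1[of 0] by (simp add: pathfinish_def pathstart_def)

lemma curve_continuous: "continuous_on A g"
proof -
  have "g C1_differentiable_on UNIV" using curve by (simp add: curve_through_def)
  then show ?thesis
    using C1_differentiable_imp_continuous_on continuous_on_subset by blast
qed

lemmas curve_Jordan = Jordan_inside_outside[OF curve_simple curve_closed]

lemma param_order: "k \<in> {1..4} \<Longrightarrow> t k < next_par t k" "k \<in> {1..4} \<Longrightarrow> next_par t k < t k + 1"
  using curve_order unfolding atLeastAtMost_1_4 by (auto simp: next_par_simps simp del: One_nat_def)

lemma image_split: "k \<in> {1..4} \<Longrightarrow> path_image g = co_arc g t k \<union> subarc_after g t k"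
proof
  assume k: "k \<in> {1..4}"
  show "path_image g \<subseteq> co_arc g t k \<union> subarc_after g t k"
  proof
    fix z assume "z \<in> path_image g"
    then obtain s where "z = g s" by (auto simp: curve_image)
    then obtain s' where s: "t k \<le> s'" "s' < t k + 1" "z = g s'"
      using curve_in_period[of "t k" s] by auto
    consider "s' = t k" | "t k < s'" "s' < next_par t k" | "next_par t k \<le> s'" using s by linarith
    then show "z \<in> co_arc g t k \<union> subarc_after g t k"
    proof cases
      case 1
      \<comment> \<open>The point with parameter \<open>t k\<close> belongs to the closed arc as its
        other end, with parameter \<open>t k + 1\<close>.\<close>
      then have "z = g (t k + 1)" using s by (simp add: curve_plus_1)
      then show ?thesis using param_order(2)[OF k] by (auto simp: co_arc_def)
    qed (use s in \<open>auto simp: co_arc_def subarc_after_alt\<close>)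
  qed
qed (auto simp: curve_image co_arc_def subarc_after_alt)

lemma arcs_disjoint: "k \<in> {1..4} \<Longrightarrow> co_arc g t k \<inter> subarc_after g t k = {}"
proof -
  assume k: "k \<in> {1..4}"
  have "s = s'" if "g s = g s'" "next_par t k \<le> s" "s \<le> t k + 1" "t k < s'" "s' < next_par t k" for s s'
    using that by (intro curve_eq_close) (auto simp: abs_if)
  then show ?thesis by (force simp: co_arc_def subarc_after_alt)
qed

text \<open>For \<open>i > k\<close> the parameters already lie in the interval of the complementary
  arc; for \<open>i < k\<close> they do so after a shift by one period.\<close>

lemma subarc_after_subset_co_arc:
  "i \<in> {1..4} \<Longrightarrow> k \<in> {1..4} \<Longrightarrow> i \<noteq> k \<Longrightarrow> g ` {t i .. next_par t i} \<subseteq> co_arc g t k"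
proof -
  assume i: "i \<in> {1..4}" and k: "k \<in> {1..4}" and ik: "i \<noteq> k"
  have "g s \<in> co_arc g t k" if s: "t i \<le> s" "s \<le> next_par t i" for s
  proof (cases "i > k")
    case True
    then have "next_par t k \<le> s" "s \<le> t k + 1"
      using s i k curve_order unfolding atLeastAtMost_1_4 by (auto simp: next_par_simps simp del: One_nat_def)
    then show ?thesis by (auto simp: co_arc_def)
  next
    case False
    then have "next_par t k \<le> s + 1" "s + 1 \<le> t k + 1"
      using s i k ik curve_order unfolding atLeastAtMost_1_4 by (auto simp: next_par_simps simp del: One_nat_def)
    then have "g (s + 1) \<in> co_arc g t k" by (auto simp: co_arc_def)
    then show ?thesis by (simp add: curve_plus_1)
  qed
  then show ?thesis by auto
qed

lemma points_in_co_arc: "a ` {1..4} \<subseteq> co_arc g t k" if k: "k \<in> {1..4}"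
proof -
  have "a i \<in> co_arc g t k" if i: "i \<in> {1..4}" for i
  proof (cases "i = k")
    case True
    have "g (t k + 1) = a k" by (simp add: curve_plus_1 curve_points[OF k])
    then have "a i = g (t k + 1)" using True by simp
    then show ?thesis using param_order(2)[OF k] by (simp add: co_arc_def)
  next
    case False
    have "g (t i) \<in> g ` {t i .. next_par t i}" using param_order(1)[OF i] by simp
    then show ?thesis
      using subarc_after_subset_co_arc[OF i k False] curve_points[OF i] by auto
  qed
  then show ?thesis by auto
qed

text \<open>A point off the curve is off every slit; any other point lies on one of the four open
  subarcs, that is, in the gap of the corresponding slit. Hence functions on the plane minus the
  singular points can be glued from the four sheets.\<close>

lemma co_arcs_cover:
  assumes "z \<notin> a ` {1..4}" shows "\<exists>k\<in>{1..4}. z \<notin> co_arc g t k"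
proof (cases "z \<in> path_image g")
  case False
  then show ?thesis using image_split[of 1] by auto
next
  case True
  then obtain s where "z = g s" by (auto simp: curve_image)
  then obtain s where s: "t 1 \<le> s" "s < t 1 + 1" "z = g s"
    using curve_in_period[of "t 1" s] by auto
  have ne: "s \<noteq> t k" if "k \<in> {1..4}" for k using assms s curve_points[OF that] that by auto
  consider "t 1 < s" "s < t 2" | "t 2 < s" "s < t 3" | "t 3 < s" "s < t 4" | "t 4 < s" "s < t 1 + 1"
    using s ne[of 1] ne[of 2] ne[of 3] ne[of 4] by (auto simp: not_less) linarith
  then obtain k where k: "k \<in> {1..4}" "z \<in> subarc_after g t k"
  proof cases
    case 1 then show ?thesis using s by (intro that[of 1]) (auto simp: subarc_after_alt next_par_def numeral_2_eq_2)
  next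
    case 2 then show ?thesis using s by (intro that[of 2]) (auto simp: subarc_after_alt next_par_def)
  next
    case 3 then show ?thesis using s by (intro that[of 3]) (auto simp: subarc_after_alt next_par_def)
  next
    case 4 then show ?thesis using s by (intro that[of 4]) (auto simp: subarc_after_alt next_par_def)
  qed
  then show ?thesis using arcs_disjoint by blast
qed

text \<open>Injectivity holds because the parameter interval is shorter than the period. The end
  point is recorded since it serves as the centre of the inversion.\<close>

lemma co_arc_is_arc:
  assumes k: "k \<in> {1..4}"
  obtains \<gamma> where "arc \<gamma>" "path_image \<gamma> = co_arc g t k" "pathfinish \<gamma> = a k"
proof
  let ?l = "\<lambda>s. next_par t k + s * (t k + 1 - next_par t k)"
  let ?\<gamma> = "\<lambda>s. g (?l s)"
  have d: "0 < t k + 1 - next_par t k" "t k + 1 - next_par t k < 1" using param_order[OF k] by auto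
  have "inj_on ?\<gamma> {0..1}"
  proof
    fix x y assume xy: "x \<in> {0..1}" "y \<in> {0..1}" and e: "?\<gamma> x = ?\<gamma> y"
    have "\<bar>(x - y) * (t k + 1 - next_par t k)\<bar> \<le> 1 * (t k + 1 - next_par t k)"
      unfolding abs_mult using xy d by (intro mult_mono) auto
    then have "\<bar>?l x - ?l y\<bar> < 1" using d(2) by (simp add: algebra_simps)
    then have "?l x = ?l y" using curve_eq_close e by blast
    then show "x = y" using d by auto
  qed
  then show "arc ?\<gamma>" unfolding arc_def path_def
    by (auto intro!: continuous_on_compose2[OF curve_continuous[of UNIV]] continuous_intros)
  have "?l ` {0..1} = {next_par t k..t k + 1}"
  proof (intro set_eqI iffI)
    fix u assume "u \<in> ?l ` {0..1}"
    then obtain s where s: "0 \<le> s" "s \<le> 1" "u = ?l s" by auto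
    have "s * (t k + 1 - next_par t k) \<le> 1 * (t k + 1 - next_par t k)"
      using s d by (intro mult_right_mono) auto
    moreover have "0 \<le> s * (t k + 1 - next_par t k)" using s d by simp
    ultimately show "u \<in> {next_par t k..t k + 1}"
      unfolding atLeastAtMost_iff s(3) by auto
  next
    fix u assume "u \<in> {next_par t k..t k + 1}"
    then show "u \<in> ?l ` {0..1}" using d
      by (intro image_eqI[of _ _ "(u - next_par t k) / (t k + 1 - next_par t k)"]) (auto simp: field_simps)
  qed
  then show "path_image ?\<gamma> = co_arc g t k"
    unfolding path_image_def co_arc_def by (metis image_image)
  show "pathfinish ?\<gamma> = a k"
    using curve_plus_1[of "t k"] curve_points[OF k] by (simp add: pathfinish_def)
qed

end

section \<open>Stereographic projection\<close>

lemma rsphere_iff: "s \<in> rsphere \<longleftrightarrow> (cmod (fst s))\<^sup>2 + (snd s)\<^sup>2 = 1"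
  by (simp add: rsphere_def norm_prod_def)

lemma rsphere_complex: "s \<in> rsphere \<Longrightarrow> fst s * cnj (fst s) = (1 - of_real (snd s)) * (1 + of_real (snd s))"
proof -
  assume "s \<in> rsphere"
  then have "(cmod (fst s))\<^sup>2 = (1 - snd s) * (1 + snd s)"
    by (simp add: rsphere_iff algebra_simps power2_eq_square)
  then have "of_real ((cmod (fst s))\<^sup>2) = (of_real ((1 - snd s) * (1 + snd s)) :: complex)" by simp
  then show ?thesis by (simp only: complex_norm_square) simp
qed

lemma rsphere_snd_1: "s \<in> rsphere \<Longrightarrow> snd s = 1 \<longleftrightarrow> s = rinf"
  by (cases s) (auto simp: rsphere_iff rinf_def)

lemma rinf_rsphere: "rinf \<in> rsphere"
  by (simp add: rsphere_iff rinf_def)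

lemma one_plus_norm_sq_nz: "1 + (cmod z)\<^sup>2 \<noteq> 0" "(cmod z)\<^sup>2 + 1 \<noteq> 0"
  by (smt (verit) zero_le_power2)+

lemma of_plane_rsphere: "of_plane z \<in> rsphere"
proof -
  have "(cmod (of_real (2 / (1 + (cmod z)\<^sup>2)) * z))\<^sup>2 = 4 * (cmod z)\<^sup>2 / (1 + (cmod z)\<^sup>2)\<^sup>2"
    unfolding norm_mult norm_of_real by (simp add: power_mult_distrib power_divide)
  then show ?thesis
    using one_plus_norm_sq_nz[of z]
    by (simp add: rsphere_iff of_plane_def power_divide add.commute divide_simps) (simp add: power2_eq_square algebra_simps)
qed

lemma of_plane_neq_rinf: "of_plane z \<noteq> rinf"
proof -
  have "((cmod z)\<^sup>2 - 1) / ((cmod z)\<^sup>2 + 1) \<noteq> 1" using one_plus_norm_sq_nz[of z] by (simp add: divide_simps)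
  then show ?thesis by (simp add: of_plane_def rinf_def)
qed

lemma to_plane_of_plane [simp]: "to_plane (of_plane z) = z"
proof -
  have "1 - ((cmod z)\<^sup>2 - 1) / ((cmod z)\<^sup>2 + 1) = 2 / (1 + (cmod z)\<^sup>2)"
    using one_plus_norm_sq_nz[of z] by (simp add: field_simps)
  moreover have "of_real (2 / (1 + (cmod z)\<^sup>2)) \<noteq> (0 :: complex)"
    using one_plus_norm_sq_nz[of z] by (simp only: of_real_eq_0_iff) simp
  ultimately show ?thesis by (simp only: of_plane_def to_plane_def fst_conv snd_conv) simp
qed

lemma of_plane_to_plane:
  assumes s: "s \<in> rsphere" "s \<noteq> rinf" shows "of_plane (to_plane s) = s"
proof -
  obtain x h where sx: "s = (x, h)" by (cases s)
  have h: "h \<noteq> 1" using rsphere_snd_1[OF s(1)] s(2) by (auto simp: sx)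
  have xh: "(cmod x)\<^sup>2 = (1 - h) * (1 + h)" using s(1) by (simp add: rsphere_iff sx power2_eq_square algebra_simps)
  have n: "(cmod (to_plane s))\<^sup>2 = (1 + h) / (1 - h)"
  proof -
    have "(cmod (to_plane s))\<^sup>2 = (cmod x)\<^sup>2 / (1 - h)\<^sup>2"
      unfolding to_plane_def sx fst_conv snd_conv norm_divide norm_of_real power_divide power2_abs ..
    then show ?thesis using h unfolding xh by (simp add: power2_eq_square)
  qed
  have 1: "1 + (1 + h) / (1 - h) = 2 / (1 - h)" "(1 + h) / (1 - h) + 1 = 2 / (1 - h)"
    using h by (simp_all add: field_simps)
  have 2: "(1 + h) / (1 - h) - 1 = 2 * h / (1 - h)" using h by (simp add: field_simps)
  have nz: "of_real (1 - h) \<noteq> (0 :: complex)" using h by (metis of_real_eq_0_iff right_minus_eq)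
  have "2 / (2 / (1 - h)) = 1 - h" "2 * h / (1 - h) / (2 / (1 - h)) = h" using h by simp_all
  moreover have "of_real (1 - h) * (x / of_real (1 - h)) = x"
    by (metis nz nonzero_mult_div_cancel_left times_divide_eq_right)
  ultimately show ?thesis unfolding of_plane_def n 1 2 by (simp only: sx to_plane_def fst_conv snd_conv)
qed

lemma of_plane_inj: "of_plane z = of_plane w \<longleftrightarrow> z = w"
  by (metis to_plane_of_plane)

lemma continuous_on_of_plane: "continuous_on A of_plane"
  unfolding of_plane_def
  by (intro continuous_intros) (use one_plus_norm_sq_nz in auto)

lemma continuous_on_to_plane: "continuous_on {s. snd s \<noteq> 1} to_plane"
  unfolding to_plane_def by (intro continuous_intros) auto

definition inv_chart :: "complex \<Rightarrow> complex \<times> real" where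
  "inv_chart w = (if w = 0 then rinf else of_plane (1 / w))"

text \<open>On the sphere the map \<open>z \<mapsto> 1 / z\<close> is the half turn
  \<open>(x, h) \<mapsto> (cnj x, - h)\<close>. The closed formula includes \<open>w = 0\<close> and
  shows continuity there.\<close>

lemma inv_chart_alt: "inv_chart w = (of_real (2 / (1 + (cmod w)\<^sup>2)) * cnj w, (1 - (cmod w)\<^sup>2) / (1 + (cmod w)\<^sup>2))"
proof (cases "w = 0")
  case False
  have n: "(cmod (1 / w))\<^sup>2 = 1 / (cmod w)\<^sup>2" by (simp add: norm_divide power_divide)
  have nz: "(cmod w)\<^sup>2 \<noteq> 0" using False by simp
  have "1 / w = cnj w / of_real ((cmod w)\<^sup>2)"
    unfolding complex_norm_square using False by simp
  moreover have "2 / (1 + 1 / (cmod w)\<^sup>2) = 2 / (1 + (cmod w)\<^sup>2) * (cmod w)\<^sup>2"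
    using nz one_plus_norm_sq_nz[of w] by (simp add: field_simps)
  moreover have "(1 / (cmod w)\<^sup>2 - 1) / (1 / (cmod w)\<^sup>2 + 1) = (1 - (cmod w)\<^sup>2) / (1 + (cmod w)\<^sup>2)"
    using nz one_plus_norm_sq_nz[of w] by (simp add: divide_simps)
  ultimately show ?thesis using False nz unfolding inv_chart_def of_plane_def n
    by (simp del: of_real_power)
qed (simp add: inv_chart_def rinf_def)

lemma continuous_on_inv_chart: "continuous_on A inv_chart"
  unfolding inv_chart_alt by (intro continuous_intros) (use one_plus_norm_sq_nz in auto)

text \<open>The coordinate \<open>1 / (z - b)\<close> on the sphere; \<open>b\<close> itself gets the value 0 by \<open>1 / 0 = 0\<close>.\<close>

definition pole_chart :: "complex \<Rightarrow> complex \<times> real \<Rightarrow> complex" where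
  "pole_chart b s = (if s = rinf then 0 else 1 / (to_plane s - b))"

text \<open>Expand \<open>1 / (x / (1 - h) - b)\<close> by \<open>cnj x\<close> and use
  \<open>x * cnj x = (1 - h) * (1 + h)\<close> to cancel \<open>1 - h\<close>. The new denominator
  equals 2 at \<open>rinf\<close>, which makes the formula suitable for continuity at
  infinity.\<close>

lemma pole_chart_alt:
  assumes s: "s \<in> rsphere" and nz: "1 + of_real (snd s) - b * cnj (fst s) \<noteq> 0" "snd s \<noteq> -1"
  shows "pole_chart b s = cnj (fst s) / (1 + of_real (snd s) - b * cnj (fst s))"
proof (cases "s = rinf")
  case False
  obtain x h where sx: "s = (x, h)" by (cases s)
  have h: "1 - of_real h \<noteq> (0::complex)" using rsphere_snd_1[OF s] False by (auto simp: sx)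
  have "snd s * snd s \<noteq> 1" using h nz by (auto simp: sx square_eq_1_iff)
  then have h2: "1 - complex_of_real (snd s) * of_real (snd s) \<noteq> 0"
    by (metis eq_iff_diff_eq_0 of_real_1 of_real_eq_iff of_real_mult)
  have e: "x * cnj x = (1 - of_real h) * (1 + of_real h)" using rsphere_complex[OF s] by (simp add: sx)
  then have x: "cnj x \<noteq> 0" using h2 by (auto simp: sx algebra_simps)
  have "x / (1 - of_real h) - b = (1 + of_real h - b * cnj x) / cnj x"
    using h x e by (simp add: field_simps)
  then show ?thesis using False by (simp add: pole_chart_def to_plane_def sx)
qed (auto simp: pole_chart_def rinf_def)

lemma continuous_on_pole_chart: "continuous_on (rsphere - {of_plane b}) (pole_chart b)"
  unfolding continuous_on_def
proof
  fix s assume s: "s \<in> rsphere - {of_plane b}"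
  let ?F = "at s within rsphere - {of_plane b}"
  show "(pole_chart b \<longlongrightarrow> pole_chart b s) ?F"
  proof (cases "s = rinf")
    case True
    let ?d = "\<lambda>s. 1 + of_real (snd s) - b * cnj (fst s)"
    have "((\<lambda>s. cnj (fst s) / ?d s) \<longlongrightarrow> cnj (fst s) / ?d s) ?F"
      by (intro tendsto_intros) (use True in \<open>auto simp: rinf_def\<close>)
    then have lim: "((\<lambda>s. cnj (fst s) / ?d s) \<longlongrightarrow> pole_chart b s) ?F"
      using True by (simp add: pole_chart_def rinf_def)
    have "(?d \<longlongrightarrow> ?d s) ?F" by (intro tendsto_intros)
    then have 1: "\<forall>\<^sub>F s in ?F. ?d s \<noteq> 0"
      by (rule tendsto_imp_eventually_ne) (use True in \<open>simp add: rinf_def\<close>)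
    have "(snd \<longlongrightarrow> snd s) ?F" by (intro tendsto_intros)
    then have 2: "\<forall>\<^sub>F s in ?F. snd s \<noteq> -1"
      by (rule tendsto_imp_eventually_ne) (use True in \<open>simp add: rinf_def\<close>)
    have 3: "\<forall>\<^sub>F s in ?F. s \<in> rsphere" by (simp add: eventually_at_filter)
    show ?thesis
      by (rule Lim_transform_eventually[OF lim])
        (use 1 2 3 in eventually_elim, simp add: pole_chart_alt)
  next
    case False
    have s1: "snd s \<noteq> 1" using s False rsphere_snd_1 by auto
    have "to_plane s \<noteq> b" using of_plane_to_plane[of s] s False by auto
    moreover have "isCont to_plane s"
      using s1 unfolding to_plane_def by (auto intro!: continuous_intros)
    ultimately have lim: "((\<lambda>s. 1 / (to_plane s - b)) \<longlongrightarrow> 1 / (to_plane s - b)) ?F"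
      by (intro tendsto_intros) (auto simp: isCont_def intro: tendsto_within_subset)
    have "\<forall>\<^sub>F s in ?F. s \<noteq> rinf"
      by (rule tendsto_imp_eventually_ne[OF tendsto_ident_at False])
    then show ?thesis using False
      by (auto simp: pole_chart_def intro!: Lim_transform_eventually[OF lim] elim: eventually_mono)
  qed
qed

definition inv_pole_chart :: "complex \<Rightarrow> complex \<Rightarrow> complex \<times> real" where
  "inv_pole_chart b w = (if w = 0 then rinf else of_plane (b + 1 / w))"

lemma continuous_on_inv_pole_chart: "continuous_on A (inv_pole_chart b)"
proof -
  have "isCont (inv_pole_chart b) w" for w
  proof (cases "w = 0")
    case True
    have c: "isCont inv_chart z" for z
      using continuous_on_inv_chart[of UNIV] by (simp add: continuous_on_eq_continuous_at)
    \<comment> \<open>Since \<open>b + 1 / w = 1 / (w / (1 + b * w))\<close>, the map near 0 is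
      \<open>inv_chart\<close> after a continuous function.\<close>
    have "isCont (\<lambda>w. w / (1 + b * w)) 0" by (intro continuous_intros) auto
    then have "isCont (\<lambda>w. inv_chart (w / (1 + b * w))) 0"
      by (rule isCont_o2) (rule c)
    moreover have "\<forall>\<^sub>F w in nhds 0. 1 + b * w \<noteq> 0"
      by (rule tendsto_imp_eventually_ne[of _ "1 + b * 0"]) (intro tendsto_intros filterlim_ident, simp)
    then have ev: "\<forall>\<^sub>F w in nhds 0. inv_pole_chart b w = inv_chart (w / (1 + b * w))"
    proof eventually_elim
      case (elim w)
      have "(1 + b * w) / w = b + 1 / w" if "w \<noteq> 0" using that by (simp add: field_simps)
      then show ?case using elim by (simp add: inv_pole_chart_def inv_chart_def)
    qed
    ultimately show ?thesis unfolding True isCont_cong[OF ev] by blast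
  next
    case False
    have "isCont (\<lambda>w. of_plane (b + 1 / w)) w"
      by (rule isCont_o2[of _ _ of_plane])
        (use False continuous_on_of_plane[of UNIV] in \<open>auto intro!: continuous_intros simp: continuous_on_eq_continuous_at\<close>)
    moreover have "\<forall>\<^sub>F v in nhds w. v \<noteq> 0" using False by (rule t1_space_nhds)
    then have ev: "\<forall>\<^sub>F v in nhds w. inv_pole_chart b v = of_plane (b + 1 / v)"
      by eventually_elim (simp add: inv_pole_chart_def)
    ultimately show ?thesis unfolding isCont_cong[OF ev] by blast
  qed
  then show ?thesis by (simp add: continuous_at_imp_continuous_on)
qed

lemma inv_pole_chart_pole_chart:
  "s \<in> rsphere \<Longrightarrow> s \<noteq> of_plane b \<Longrightarrow> inv_pole_chart b (pole_chart b s) = s"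
  using of_plane_to_plane[of s] by (auto simp: inv_pole_chart_def pole_chart_def)

lemma of_plane_tendsto_rinf: "(of_plane \<longlongrightarrow> rinf) at_infinity"
proof -
  have "(inv_chart \<longlongrightarrow> inv_chart 0) (at 0)"
    using continuous_on_inv_chart[of UNIV] by (simp add: continuous_on_def)
  then have "((\<lambda>z. inv_chart (inverse z)) \<longlongrightarrow> inv_chart 0) at_infinity"
    using continuous_on_inv_chart[of UNIV]
    by (intro isCont_tendsto_compose[of 0 inv_chart] tendsto_inverse_0) (simp add: continuous_on_eq_continuous_at)
  then have "((\<lambda>z. inv_chart (inverse z)) \<longlongrightarrow> rinf) at_infinity" by (simp add: inv_chart_def[of 0])
  then show ?thesis
    by (rule Lim_transform_eventually)
      (rule eventually_mono[OF eventually_notin_at_infinity[of "{0}"]],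
        auto simp: inv_chart_def divide_inverse)
qed

section \<open>Sheets of the universal covering\<close>

context
  fixes a :: "nat \<Rightarrow> complex" and g t and St :: "'b::real_normed_vector set" and rho x0 sg
  assumes mono: "monodromy_setup a g t St rho x0 sg"
begin

lemma setup_curve: "curve_through a g t"
  using mono by (simp add: monodromy_setup_def)

lemma setup_covering: "covering_space St rho (punctured_sphere a)"
  using mono by (simp add: monodromy_setup_def universal_covering_def)

lemma setup_connected: "connected St"
  using mono by (simp add: monodromy_setup_def universal_covering_def simply_connected_imp_connected)

lemma rho_continuous: "continuous_on St rho"
  using setup_covering by (rule covering_space_imp_continuous)

lemma rho_mem: "x \<in> St \<Longrightarrow> rho x \<in> punctured_sphere a"
  using covering_space_imp_surjective[OF setup_covering] by auto

lemma rho_mem_rsphere: "x \<in> St \<Longrightarrow> rho x \<in> rsphere"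
  using rho_mem by (auto simp: punctured_sphere_def)

lemma deck_continuous: "k \<in> {1..4} \<Longrightarrow> continuous_on St (sg k)"
  and deck_image: "k \<in> {1..4} \<Longrightarrow> sg k ` St = St"
  and deck_rho: "k \<in> {1..4} \<Longrightarrow> x \<in> St \<Longrightarrow> rho (sg k x) = rho x"
  using mono unfolding monodromy_setup_def deck_transformation_def homeomorphism_def by blast+

lemma deck_mem: "k \<in> {1..4} \<Longrightarrow> x \<in> St \<Longrightarrow> sg k x \<in> St"
  using deck_image by blast

lemma base_mem: "x0 \<in> St"
  using mono by (simp add: monodromy_setup_def)

text \<open>The chart \<open>pole_chart (a k)\<close> sends the end point of the slit to infinity
  and thus maps the slit sphere onto a simply connected open plane set, to which the lifting theorem
  applies. Working on the sphere keeps infinity in the domain of the section.\<close>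

lemma sphere_sheet:
  assumes k: "k \<in> {1..4}"
  shows "\<exists>S. continuous_on (rsphere - of_plane ` co_arc g t k) S \<and> S (rho x0) = x0 \<and>
    (\<forall>s\<in>rsphere - of_plane ` co_arc g t k. S s \<in> St \<and> rho (S s) = s)"
proof -
  note [simp] = of_plane_inj
  let ?R = "rsphere - of_plane ` co_arc g t k"
  obtain z0 where z0: "rho x0 = of_plane z0" "z0 \<in> inside (path_image g)"
    using mono by (auto simp: monodromy_setup_def)
  have z0k: "z0 \<notin> co_arc g t k"
    using z0(2) image_split[OF setup_curve k] inside_no_overlap by blast
  obtain \<gamma> where \<gamma>: "arc \<gamma>" "path_image \<gamma> = co_arc g t k" "pathfinish \<gamma> = a k"
    using co_arc_is_arc[OF setup_curve k] by blast
  define U where "U = insert 0 {w. a k + 1 / w \<notin> co_arc g t k}"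
  have U: "open U" "simply_connected U"
    using arc_complement_inverted[OF \<gamma>(1)] by (simp_all add: U_def \<gamma>)
  have ak: "a k \<in> co_arc g t k" using points_in_co_arc[OF setup_curve k] k by auto
  have chart: "pole_chart (a k) s \<in> U" "inv_pole_chart (a k) (pole_chart (a k) s) = s" if s: "s \<in> ?R" for s
  proof -
    show *: "inv_pole_chart (a k) (pole_chart (a k) s) = s"
      using s ak by (intro inv_pole_chart_pole_chart) auto
    show "pole_chart (a k) s \<in> U"
      using * s by (auto simp: U_def inv_pole_chart_def split: if_splits) (metis imageI)
  qed
  have fim: "inv_pole_chart (a k) \<in> U \<rightarrow> punctured_sphere a"
  proof
    fix w assume w: "w \<in> U"
    have "of_plane z \<in> punctured_sphere a" if "z \<notin> co_arc g t k" for z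
      using that points_in_co_arc[OF setup_curve k] by (auto simp: punctured_sphere_def of_plane_rsphere)
    moreover have "rinf \<in> punctured_sphere a"
      using of_plane_neq_rinf by (auto simp: punctured_sphere_def rinf_rsphere) (metis of_plane_neq_rinf)
    ultimately show "inv_pole_chart (a k) w \<in> punctured_sphere a"
      using w by (auto simp: inv_pole_chart_def U_def)
  qed
  have x0R: "rho x0 \<in> ?R" using z0k by (auto simp: z0 of_plane_rsphere)
  obtain G where G: "continuous_on U G" "G \<in> U \<rightarrow> St" "G (pole_chart (a k) (rho x0)) = x0"
    "\<And>w. w \<in> U \<Longrightarrow> rho (G w) = inv_pole_chart (a k) w"
    using covering_space_lift_strong[OF setup_covering base_mem chart(1)[OF x0R] U(2) open_imp_locally_path_connected[OF U(1)]
        continuous_on_inv_pole_chart fim chart(2)[OF x0R]] by blast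
  let ?S = "\<lambda>s. G (pole_chart (a k) s)"
  have "continuous_on ?R ?S"
    by (rule continuous_on_compose2[OF G(1) continuous_on_subset[OF continuous_on_pole_chart]])
      (use ak chart in auto)
  then show ?thesis using G chart by (intro exI[of _ ?S]) auto
qed

lemma lifts_agree:
  assumes "connected X" "u \<in> X" "v \<in> X" "continuous_on X f" "continuous_on X h"
    "\<And>x. x \<in> X \<Longrightarrow> f x \<in> St \<and> h x \<in> St \<and> rho (f x) = rho (h x)" "f u = h u"
  shows "f v = h v"
proof (rule covering_space_lift_unique[OF setup_covering, of f u h X "\<lambda>x. rho (f x)"])
  show "continuous_on X (\<lambda>x. rho (f x))"
    by (rule continuous_on_compose2[OF rho_continuous assms(4)]) (use assms in auto)
qed (use assms rho_mem in auto)

text \<open>The section over the slit \<open>prev_index k\<close> follows the k-th loop until its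
  second crossing, because the first crossing lies in the gap of that slit. The section over the
  slit \<open>k\<close>, moved by \<open>sg k\<close>, follows it backwards from the end point down
  to the first crossing. Between the crossings both are available, which gives their equality at one
  outside point; uniqueness of lifts extends it to the connected outside.\<close>

lemma monodromy_sheets:
  obtains T xi where
    "\<And>k. k \<in> {1..4} \<Longrightarrow> continuous_on (- co_arc g t k) (T k)"
    "\<And>k z. k \<in> {1..4} \<Longrightarrow> z \<notin> co_arc g t k \<Longrightarrow> T k z \<in> St \<and> rho (T k z) = of_plane z"
    "\<And>j k z. j \<in> {1..4} \<Longrightarrow> k \<in> {1..4} \<Longrightarrow> z \<in> inside (path_image g) \<Longrightarrow> T j z = T k z"
    "\<And>k z. k \<in> {1..4} \<Longrightarrow> z \<in> outside (path_image g) \<Longrightarrow> T (prev_index k) z = sg k (T k z)"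
    "\<And>k. k \<in> {1..4} \<Longrightarrow> xi k \<in> St \<and> rho (xi k) = rinf \<and> (T k \<longlongrightarrow> xi k) at_infinity"
proof -
  note [simp] = of_plane_inj
  let ?R = "\<lambda>k. rsphere - of_plane ` co_arc g t k"
  have "\<forall>k\<in>{1..4}. \<exists>S. continuous_on (?R k) S \<and> S (rho x0) = x0 \<and> (\<forall>s\<in>?R k. S s \<in> St \<and> rho (S s) = s)"
    using sphere_sheet by blast
  from bchoice[OF this] obtain S where S0: "\<forall>k\<in>{1..4}. continuous_on (?R k) (S k) \<and> S k (rho x0) = x0 \<and>
      (\<forall>s\<in>?R k. S k s \<in> St \<and> rho (S k s) = s)"
    by blast
  have S: "\<And>k. k \<in> {1..4} \<Longrightarrow> continuous_on (?R k) (S k)"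
      "\<And>k. k \<in> {1..4} \<Longrightarrow> S k (rho x0) = x0"
      "\<And>k s. k \<in> {1..4} \<Longrightarrow> s \<in> ?R k \<Longrightarrow> S k s \<in> St \<and> rho (S k s) = s"
    using S0 by blast+
  obtain z0 where z0: "rho x0 = of_plane z0" "z0 \<in> inside (path_image g)"
    using mono by (auto simp: monodromy_setup_def)
  let ?T = "\<lambda>k z. S k (of_plane z)"
  have ofR: "of_plane z \<in> ?R k" if "z \<notin> co_arc g t k" for z k
    using that by (auto simp: of_plane_rsphere)
  have Tc: "continuous_on (- co_arc g t k) (?T k)" if k: "k \<in> {1..4}" for k
    by (rule continuous_on_compose2[OF S(1)[OF k] continuous_on_of_plane]) (use ofR in auto)
  have Tm: "?T k z \<in> St \<and> rho (?T k z) = of_plane z" if k: "k \<in> {1..4}" and z: "z \<notin> co_arc g t k" for k z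
    using S(3)[OF k ofR[OF z]] .
  have sub: "co_arc g t k \<subseteq> path_image g" if "k \<in> {1..4}" for k
    using image_split[OF setup_curve that] by blast
  have ins: "z \<notin> co_arc g t k" if "k \<in> {1..4}" "z \<in> inside (path_image g)" for k z
    using sub[OF that(1)] that(2) inside_no_overlap by blast
  have outs: "z \<notin> co_arc g t k" if "k \<in> {1..4}" "z \<in> outside (path_image g)" for k z
    using sub[OF that(1)] that(2) outside_no_overlap by blast
  note Jordan = curve_Jordan[OF setup_curve]
  have Tin: "?T j z = ?T k z" if j: "j \<in> {1..4}" and k: "k \<in> {1..4}" and z: "z \<in> inside (path_image g)" for j k z
  proof (rule lifts_agree[of "inside (path_image g)" z0 z])
    show "connected (inside (path_image g))" using Jordan by blast
    show "continuous_on (inside (path_image g)) (?T j)" "continuous_on (inside (path_image g)) (?T k)"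
      using ins j k by (auto intro: continuous_on_subset[OF Tc])
    show "?T j z0 = ?T k z0" unfolding z0(1)[symmetric] using S(2)[OF j] S(2)[OF k] by simp
  qed (use z z0 Tm ins j k in auto)
  have Tout: "?T (prev_index k) z = sg k (?T k z)" if k: "k \<in> {1..4}" and z: "z \<in> outside (path_image g)" for k z
  proof -
    let ?i = "prev_index k"
    have i: "?i \<in> {1..4}" using prev_index_mem[OF k] .
    have "standard_loop St rho g t k x0 (sg k x0)" using mono k by (simp add: monodromy_setup_def)
    then obtain p s1 s2 where p: "arc p" "path_image p \<subseteq> St" "pathstart p = x0" "pathfinish p = sg k x0"
      and s12: "0 < s1" "s1 < s2" "s2 < 1"
      and cross: "{s\<in>{0..1}. rho (p s) \<in> of_plane ` path_image g} = {s1, s2}"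
      and c1: "rho (p s1) \<in> of_plane ` subarc_after g t ?i" and c2: "rho (p s2) \<in> of_plane ` subarc_after g t k"
      and mid: "\<And>s. s1 < s \<Longrightarrow> s < s2 \<Longrightarrow> rho (p s) \<notin> of_plane ` inside (path_image g)"
      unfolding standard_loop_def subarc_before_alt by blast
    have pc: "continuous_on {0..1} p" using p(1) by (simp add: arc_def path_def)
    have pSt: "p s \<in> St" if "s \<in> {0..1}" for s using p(2) that by (auto simp: path_image_def)
    have rpc: "continuous_on {0..1} (\<lambda>s. rho (p s))"
      by (rule continuous_on_compose2[OF rho_continuous pc]) (use pSt in auto)
    have sub01: "{0..<s2} \<subseteq> {0..1}" "{s1<..1} \<subseteq> {0..1}" using s12 by auto
    have R1: "rho (p s) \<in> ?R ?i" if s: "s \<in> {0..<s2}" for s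
    proof -
      have "rho (p s) \<notin> of_plane ` co_arc g t ?i"
      proof
        assume c: "rho (p s) \<in> of_plane ` co_arc g t ?i"
        then have "rho (p s) \<in> of_plane ` path_image g" using sub[OF i] by auto
        then have "s \<in> {s1, s2}" unfolding cross[symmetric] using s s12 by simp
        then have "s = s1" using s by auto
        then show False using c c1 arcs_disjoint[OF setup_curve i] by auto
      qed
      then show ?thesis using rho_mem_rsphere[OF pSt] s s12 by auto
    qed
    have R2: "rho (p s) \<in> ?R k" if s: "s \<in> {s1<..1}" for s
    proof -
      have "rho (p s) \<notin> of_plane ` co_arc g t k"
      proof
        assume c: "rho (p s) \<in> of_plane ` co_arc g t k"
        then have "rho (p s) \<in> of_plane ` path_image g" using sub[OF k] by auto
        then have "s \<in> {s1, s2}" unfolding cross[symmetric] using s s12 by simp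
        then have "s = s2" using s by auto
        then show False using c c2 arcs_disjoint[OF setup_curve k] by auto
      qed
      then show ?thesis using rho_mem_rsphere[OF pSt] s s12 by auto
    qed
    have im1: "(\<lambda>s. rho (p s)) ` {0..<s2} \<subseteq> ?R ?i" by (rule image_subsetI) (rule R1)
    have im2: "(\<lambda>s. rho (p s)) ` {s1<..1} \<subseteq> ?R k" by (rule image_subsetI) (rule R2)
    have e1: "S ?i (rho (p s)) = p s" if s: "s \<in> {0..<s2}" for s
    proof (rule lifts_agree[of "{0..<s2}" 0 s])
      show "continuous_on {0..<s2} (\<lambda>s. S ?i (rho (p s)))"
        by (rule continuous_on_compose2[OF S(1)[OF i] continuous_on_subset[OF rpc]]) (rule sub01 im1)+
      show "continuous_on {0..<s2} p" by (rule continuous_on_subset[OF pc]) (use s12 in auto)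
      show "S ?i (rho (p 0)) = p 0" using p(3) S(2)[OF i] by (simp add: pathstart_def)
    qed (use s s12 S(3)[OF i R1] pSt in auto)
    have e2: "sg k (S k (rho (p s))) = p s" if s: "s \<in> {s1<..1}" for s
    proof (rule lifts_agree[of "{s1<..1}" 1 s])
      show "continuous_on {s1<..1} (\<lambda>s. sg k (S k (rho (p s))))"
        by (rule continuous_on_compose2[OF deck_continuous[OF k]
              continuous_on_compose2[OF S(1)[OF k] continuous_on_subset[OF rpc]]])
           (rule sub01 im2 | use S(3)[OF k R2] in blast)+
      show "continuous_on {s1<..1} p" by (rule continuous_on_subset[OF pc]) (use s12 in auto)
      have "p 1 = sg k x0" using p(4) by (simp add: pathfinish_def)
      then show "sg k (S k (rho (p 1))) = p 1" using S(2)[OF k] deck_rho[OF k base_mem] by simp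
      show "sg k (S k (rho (p x))) \<in> St \<and> p x \<in> St \<and> rho (sg k (S k (rho (p x)))) = rho (p x)"
        if "x \<in> {s1<..1}" for x
        using that S(3)[OF k R2[OF that]] pSt s12 deck_mem[OF k] deck_rho[OF k] by auto
    qed (use s s12 in auto)
    \<comment> \<open>The loop may pass through infinity between the crossings, whereas the outside
      is a plane domain. Shortly after \<open>s1\<close> the projection is finite, since the
      crossing point is.\<close>
    have "\<exists>s. s1 < s \<and> s < s2 \<and> rho (p s) \<noteq> rinf"
    proof -
      have "((\<lambda>s. rho (p s)) \<longlongrightarrow> rho (p s1)) (at s1 within {s1<..<s2})"
        by (rule tendsto_within_subset[of _ _ _ "{0..1}"])
          (use rpc s12 in \<open>auto simp: continuous_on_def\<close>)
      moreover have "rho (p s1) \<noteq> rinf" using c1 of_plane_neq_rinf by (metis imageE)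
      ultimately have "\<forall>\<^sub>F s in at s1 within {s1<..<s2}. rho (p s) \<noteq> rinf"
        by (rule tendsto_imp_eventually_ne)
      then have "\<forall>\<^sub>F s in at s1 within {s1<..<s2}. s \<in> {s1<..<s2} \<and> rho (p s) \<noteq> rinf"
        by (intro eventually_conj) (simp_all add: eventually_at_filter)
      moreover have "at s1 within {s1<..<s2} \<noteq> bot"
        using s12 by (simp add: at_within_eq_bot_iff)
      ultimately have "\<exists>s. s \<in> {s1<..<s2} \<and> rho (p s) \<noteq> rinf"
        using eventually_happens' by blast
      then show ?thesis by auto
    qed
    then obtain s where s: "s1 < s" "s < s2" "rho (p s) \<noteq> rinf" by blast
    define z1 where "z1 = to_plane (rho (p s))"
    have z1: "of_plane z1 = rho (p s)"
      unfolding z1_def by (rule of_plane_to_plane) (use s s12 pSt rho_mem_rsphere in auto)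
    have "rho (p s) \<notin> of_plane ` path_image g" using cross s s12 by auto
    then have "z1 \<notin> path_image g" "z1 \<notin> inside (path_image g)"
      using mid[OF s(1,2)] by (auto simp flip: z1)
    then have z1o: "z1 \<in> outside (path_image g)" using Jordan by blast
    have e: "?T ?i z1 = sg k (?T k z1)" using e1[of s] e2[of s] s s12 by (simp add: z1)
    show ?thesis
    proof (rule lifts_agree[of "outside (path_image g)" z1 z])
      show "connected (outside (path_image g))" using Jordan by blast
      show "continuous_on (outside (path_image g)) (?T ?i)"
        using outs[OF i] by (auto intro: continuous_on_subset[OF Tc[OF i]])
      show "continuous_on (outside (path_image g)) (\<lambda>z. sg k (?T k z))"
        by (rule continuous_on_compose2[OF deck_continuous[OF k] continuous_on_subset[OF Tc[OF k]]])
          (use outs[OF k] Tm[OF k] in auto)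
    qed (use z z1o e Tm outs i k deck_mem deck_rho in auto)
  qed
  \<comment> \<open>The slit is bounded and the section is continuous at \<open>rinf\<close>, so the
    plane sheet has a limit on the covering surface.\<close>
  have Ti: "S k rinf \<in> St \<and> rho (S k rinf) = rinf \<and> (?T k \<longlongrightarrow> S k rinf) at_infinity" if k: "k \<in> {1..4}" for k
  proof -
    have R: "rinf \<in> ?R k" using of_plane_neq_rinf by (auto simp: rinf_rsphere) (metis of_plane_neq_rinf)
    have "(S k \<longlongrightarrow> S k rinf) (at rinf within ?R k)"
      using S(1)[OF k] R by (simp add: continuous_on_def)
    moreover have "filterlim of_plane (at rinf within ?R k) at_infinity"
    proof (rule filterlim_at_withinI)
      obtain \<gamma> where "arc \<gamma>" "path_image \<gamma> = co_arc g t k"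
        using co_arc_is_arc[OF setup_curve k] by blast
      then have "bounded (co_arc g t k)" by (metis bounded_arc_image)
      then obtain B where B: "\<And>z. z \<in> co_arc g t k \<Longrightarrow> cmod z \<le> B" unfolding bounded_iff by blast
      have "\<forall>\<^sub>F z in at_infinity. z \<notin> co_arc g t k"
        unfolding eventually_at_infinity by (intro exI[of _ "B + 1"]) (force dest: B)
      then show "\<forall>\<^sub>F z in at_infinity. of_plane z \<in> ?R k - {rinf}"
        by eventually_elim (use ofR of_plane_neq_rinf in auto)
    qed (rule of_plane_tendsto_rinf)
    ultimately have "(?T k \<longlongrightarrow> S k rinf) at_infinity"
      by (rule filterlim_compose)
    then show ?thesis using S(3)[OF k R] by simp
  qed
  show ?thesis by (rule that[of ?T, OF Tc Tm Tin Tout Ti])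
qed

end

text \<open>Along a section of the projection the local coordinate is \<open>z\<close> itself, so
  the coordinate derivative becomes an ordinary one. In this way functions on the covering surface
  become holomorphic functions in plane domains.\<close>

lemma has_coord_deriv_section:
  assumes U: "open U" "z \<in> U" and T: "continuous_on U T" "\<And>z. z \<in> U \<Longrightarrow> T z \<in> X \<and> u (T z) = z"
    and f: "has_coord_deriv X u f D (T z)"
  shows "((\<lambda>z. f (T z)) has_field_derivative D) (at z)"
proof -
  have ev: "\<forall>\<^sub>F y in at z. y \<in> U \<and> y \<noteq> z"
    using U by (intro eventually_conj eventually_at_in_open' eventually_neq_at_within) auto
  have "(T \<longlongrightarrow> T z) (at z)"
    using T(1) U by (metis continuous_on_eq_continuous_at isCont_def)
  then have "filterlim T (at (T z) within X) (at z)"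
    by (rule filterlim_at_withinI) (rule eventually_mono[OF ev], metis T(2) U(2) Diff_iff singletonD)
  from filterlim_compose[OF f[unfolded has_coord_deriv_def] this]
  have "((\<lambda>y. (f (T y) - f (T z)) / (u (T y) - u (T z))) \<longlongrightarrow> D) (at z)" .
  then have "((\<lambda>y. (f (T y) - f (T z)) / (y - z)) \<longlongrightarrow> D) (at z)"
    by (rule Lim_transform_eventually) (use ev in eventually_elim, use T(2) U in auto)
  then show ?thesis by (simp add: has_field_derivative_iff)
qed

section \<open>Scalar first order equations\<close>

text \<open>A primitive of \<open>c\<close> is only available on a ball, where the integrating
  factor shows that \<open>f\<close> vanishes; the identity theorem carries this through the
  connected set.\<close>

lemma linear_ode_zero:
  fixes f :: "complex \<Rightarrow> complex"
  assumes S: "open S" "connected S" and c: "c holomorphic_on S"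
    and f: "\<And>z. z \<in> S \<Longrightarrow> (f has_field_derivative c z * f z) (at z)"
    and z0: "z0 \<in> S" "f z0 = 0" and z: "z \<in> S"
  shows "f z = 0"
proof -
  obtain r where r: "r > 0" "ball z0 r \<subseteq> S" using S(1) z0(1) open_contains_ball by blast
  obtain C where C: "\<And>x. x \<in> ball z0 r \<Longrightarrow> (C has_field_derivative c x) (at x)"
    using holomorphic_convex_primitive'[of "ball z0 r" c] c r holomorphic_on_subset
    by (metis at_within_open convex_ball open_ball)
  have fh: "f holomorphic_on S" using f S(1) by (auto simp: holomorphic_on_open)
  have "((\<lambda>x. f x * exp (- C x)) has_field_derivative 0) (at x)" if "x \<in> ball z0 r" for x
    by (rule derivative_eq_intros f C refl | use that r in force)+
  then have "\<exists>k. \<forall>x\<in>ball z0 r. f x * exp (- C x) = k"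
    by (intro has_field_derivative_zero_constant) (auto intro: has_field_derivative_at_within)
  then have b: "f x = 0" if "x \<in> ball z0 r" for x
    using that z0(2) r(1) by (metis centre_in_ball exp_not_eq_zero mult_eq_0_iff)
  show ?thesis
    by (rule analytic_continuation[OF fh S r(2) z0(1) _ b z])
      (use r(1) in \<open>auto simp: islimpt_ball\<close>)
qed

lemma linear_ode_ratio:
  fixes f e :: "complex \<Rightarrow> complex"
  assumes S: "open S" "connected S"
    and f: "\<And>z. z \<in> S \<Longrightarrow> (f has_field_derivative c z * f z) (at z)"
    and e: "\<And>z. z \<in> S \<Longrightarrow> (e has_field_derivative c z * e z) (at z)" "\<And>z. z \<in> S \<Longrightarrow> e z \<noteq> 0"
  shows "\<exists>k. \<forall>z\<in>S. f z = k * e z"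
proof -
  have "((\<lambda>z. f z / e z) has_field_derivative 0) (at z)" if "z \<in> S" for z
    by (rule derivative_eq_intros f e refl that | simp)+
  then obtain k where "\<And>z. z \<in> S \<Longrightarrow> f z / e z = k"
    using DERIV_zero_connected_constant[of S "{}" "\<lambda>z. f z / e z"] S
    by (metis DERIV_isCont Diff_empty continuous_at_imp_continuous_on finite.emptyI)
  then show ?thesis using e(2) by (intro exI[of _ k]) (auto simp: field_simps)
qed

section \<open>The system on the sheets\<close>

text \<open>The fundamental solution on the covering surface as seen through the four sheets. In
  this form monodromy is the jump between consecutive branches outside the curve, and the analysis
  takes place on slit planes.\<close>

definition sheet_solution ::
    "(real \<Rightarrow> complex) \<Rightarrow> (nat \<Rightarrow> real) \<Rightarrow> (complex \<Rightarrow> complex^2^2) \<Rightarrow> (nat \<Rightarrow> complex^2^2) \<Rightarrow>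
     (nat \<Rightarrow> complex \<Rightarrow> complex^2^2) \<Rightarrow> bool" where
  "sheet_solution g t A chi Y \<longleftrightarrow>
     (\<forall>k\<in>{1..4}. \<forall>z. z \<notin> co_arc g t k \<longrightarrow> invertible (Y k z) \<and>
        (\<forall>i j. ((\<lambda>z. Y k z $ i $ j) has_field_derivative (A z ** Y k z) $ i $ j) (at z))) \<and>
     (\<forall>j\<in>{1..4}. \<forall>k\<in>{1..4}. \<forall>z\<in>inside (path_image g). Y j z = Y k z) \<and>
     (\<forall>k\<in>{1..4}. \<forall>z\<in>outside (path_image g). Y k z = Y (prev_index k) z ** chi k)"

lemma sheet_solutionD:
  assumes "sheet_solution g t A chi Y" "k \<in> {1..4}"
  shows "z \<notin> co_arc g t k \<Longrightarrow> invertible (Y k z)"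
    and "z \<notin> co_arc g t k \<Longrightarrow> ((\<lambda>z. Y k z $ i $ j) has_field_derivative (A z ** Y k z) $ i $ j) (at z)"
    and "j' \<in> {1..4} \<Longrightarrow> z \<in> inside (path_image g) \<Longrightarrow> Y k z = Y j' z"
    and "z \<in> outside (path_image g) \<Longrightarrow> Y k z = Y (prev_index k) z ** chi k"
  using assms unfolding sheet_solution_def by blast+

context
  fixes a g t assumes curve: "curve_through a g t"
begin

lemma co_arc_open_connected:
  assumes "k \<in> {1..4}" shows "open (- co_arc g t k)" "connected (- co_arc g t k)" "bounded (co_arc g t k)"
proof -
  obtain \<gamma> where \<gamma>: "arc \<gamma>" "path_image \<gamma> = co_arc g t k"
    using co_arc_is_arc[OF curve assms] by blast
  show "open (- co_arc g t k)" "connected (- co_arc g t k)" "bounded (co_arc g t k)"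
    using connected_arc_complement[OF \<gamma>(1)] closed_arc_image[OF \<gamma>(1)] bounded_arc_image[OF \<gamma>(1)]
    by (simp_all add: \<gamma>(2) open_Compl)
qed

lemma inside_not_co_arc: "k \<in> {1..4} \<Longrightarrow> z \<in> inside (path_image g) \<Longrightarrow> z \<notin> co_arc g t k"
  and outside_not_co_arc: "k \<in> {1..4} \<Longrightarrow> z \<in> outside (path_image g) \<Longrightarrow> z \<notin> co_arc g t k"
  using image_split[OF curve] inside_no_overlap outside_no_overlap by blast+

text \<open>The gap of one slit is part of the other slit, so two different slits together cover the
  curve.\<close>

lemma inside_or_outside:
  assumes "j \<in> {1..4}" "k \<in> {1..4}" "j \<noteq> k" "z \<notin> co_arc g t j" "z \<notin> co_arc g t k"
  shows "z \<in> inside (path_image g) \<or> z \<in> outside (path_image g)"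
proof -
  have "subarc_after g t j \<subseteq> co_arc g t k"
    using subarc_after_subset_co_arc[OF curve assms(1,2,3)] by (auto simp: subarc_after_alt)
  then have "z \<notin> path_image g" using image_split[OF curve assms(1)] assms(4,5) by auto
  then show ?thesis using curve_Jordan[OF curve] by blast
qed

lemma outside_point: obtains z where "z \<in> outside (path_image g)"
  using curve_Jordan[OF curve] by blast

lemma inside_point: obtains z where "z \<in> inside (path_image g)"
  using curve_Jordan[OF curve] by blast

text \<open>A column of solutions whose second entry vanishes at one point stays that way, and so do its
  continuations; hence it spans a line which is invariant under the monodromy.\<close>

lemma triangular_invariant_line:
  assumes Y: "sheet_solution g t A chi Y"
    and A: "matrix_holomorphic_on A (- a ` {1..4})" "\<And>z. z \<notin> a ` {1..4} \<Longrightarrow> A z $ 2 $ 1 = 0"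
  obtains c mu where "c \<noteq> 0" "\<And>k. k \<in> {1..4} \<Longrightarrow> chi k *v c = mu k *s c"
    "\<And>k z. k \<in> {1..4} \<Longrightarrow> z \<notin> co_arc g t k \<Longrightarrow> (Y k z *v c) $ 2 = 0"
proof -
  obtain z0 where z0: "z0 \<in> inside (path_image g)" by (rule inside_point)
  \<comment> \<open>A vector annihilated by the second row of the solution at \<open>z0\<close>; it
    is non-zero because that row of an invertible matrix is.\<close>
  define c :: "complex^2" where "c = vector [Y 1 z0 $ 2 $ 2, - Y 1 z0 $ 2 $ 1]"
  have notin: "z \<notin> a ` {1..4}" if "k \<in> {1..4}" "z \<notin> co_arc g t k" for k z
    using points_in_co_arc[OF curve that(1)] that(2) by blast
  have row: "Y k z $ 2 $ 1 \<noteq> 0 \<or> Y k z $ 2 $ 2 \<noteq> 0" if "k \<in> {1..4}" "z \<notin> co_arc g t k" for k z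
    using sheet_solutionD(1)[OF Y that] unfolding det_nz_iff by force
  have c0: "c \<noteq> 0"
    using row[of 1 z0] inside_not_co_arc[OF _ z0, of 1] by (auto simp: c_def vec_eq_iff forall_2)
  \<comment> \<open>As the lower left entry of \<open>A\<close> vanishes, the second entry of
    \<open>Y k z *v c\<close> satisfies a scalar equation of its own. All sheets take the same value
    at the inside point \<open>z0\<close>, so each of them has a zero there.\<close>
  have van: "(Y k z *v c) $ 2 = 0" if k: "k \<in> {1..4}" and z: "z \<notin> co_arc g t k" for k z
  proof -
    have hol: "(\<lambda>z. A z $ 2 $ 2) holomorphic_on (- co_arc g t k)"
      by (rule holomorphic_on_subset[OF matrix_holomorphic_onD[OF A(1)]]) (use notin[OF k] in auto)
    have "Y k z $ 2 $ 1 * c $ 1 + Y k z $ 2 $ 2 * c $ 2 = 0"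
    proof (rule linear_ode_zero[OF co_arc_open_connected(1,2)[OF k] hol, of "\<lambda>z. Y k z $ 2 $ 1 * c $ 1 + Y k z $ 2 $ 2 * c $ 2" z0])
      fix z assume z: "z \<in> - co_arc g t k"
      then have 1: "((\<lambda>z. Y k z $ i $ j) has_field_derivative (A z ** Y k z) $ i $ j) (at z)" for i j
        by (intro sheet_solutionD(2)[OF Y k]) simp
      have A0: "A z $ 2 $ 1 = 0" using A(2) notin[OF k, of z] z by blast
      show "((\<lambda>z. Y k z $ 2 $ 1 * c $ 1 + Y k z $ 2 $ 2 * c $ 2) has_field_derivative
          A z $ 2 $ 2 * (Y k z $ 2 $ 1 * c $ 1 + Y k z $ 2 $ 2 * c $ 2)) (at z)"
        by (rule DERIV_cong[OF DERIV_add[OF DERIV_cmult_right[OF 1[of 2 1], of "c $ 1"] DERIV_cmult_right[OF 1[of 2 2], of "c $ 2"]]])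
          (simp only: mult2_nth A0, simp add: algebra_simps)
    next
      have "Y k z0 = Y 1 z0" by (rule sheet_solutionD(3)[OF Y k _ z0]) simp
      then show "Y k z0 $ 2 $ 1 * c $ 1 + Y k z0 $ 2 $ 2 * c $ 2 = 0"
        by (simp add: c_def algebra_simps)
    qed (use z inside_not_co_arc[OF k z0] in auto)
    then show ?thesis by (simp add: matrix_vector_mult_def sum_2)
  qed
  have "\<exists>mu. chi k *v c = mu *s c" if k: "k \<in> {1..4}" for k
  proof -
    obtain z where z: "z \<in> outside (path_image g)" by (rule outside_point)
    let ?j = "prev_index k"
    have j: "?j \<in> {1..4}" by (rule prev_index_mem[OF k])
    have "Y k z = Y ?j z ** chi k" by (rule sheet_solutionD(4)[OF Y k z])
    then have "(Y ?j z *v (chi k *v c)) $ 2 = 0"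
      using van[OF k outside_not_co_arc[OF k z]] by (simp add: matrix_vector_mul_assoc)
    moreover have "(Y ?j z *v c) $ 2 = 0" by (rule van[OF j outside_not_co_arc[OF j z]])
    moreover note row[OF j outside_not_co_arc[OF j z]]
    \<comment> \<open>A non-zero row annihilates both \<open>c\<close> and
      \<open>chi k *v c\<close>, and in dimension 2 its kernel is a line.\<close>
    moreover have par: "\<exists>mu. d = mu *s c" if pq: "p \<noteq> 0 \<or> q \<noteq> 0" "p * c $ 1 + q * c $ 2 = 0" "p * d $ 1 + q * d $ 2 = 0"
      for p q and d :: "complex^2"
    proof -
      have e: "d $ 1 * c $ 2 = d $ 2 * c $ 1" using pq by algebra
      show ?thesis
      proof (cases "c $ 1 = 0")
        case True
        then have "c $ 2 \<noteq> 0" using c0 by (auto simp: vec_eq_iff forall_2)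
        then show ?thesis using e True by (intro exI[of _ "d $ 2 / c $ 2"]) (auto simp: vec_eq_iff forall_2)
      next
        case False
        then show ?thesis using e by (intro exI[of _ "d $ 1 / c $ 1"]) (auto simp: vec_eq_iff forall_2 field_simps)
      qed
    qed
    ultimately show ?thesis
      by (intro par[of "Y ?j z $ 2 $ 1" "Y ?j z $ 2 $ 2"]) (auto simp: matrix_vector_mult_def[of "Y ?j z"] sum_2)
  qed
  then obtain mu where "\<And>k. k \<in> {1..4} \<Longrightarrow> chi k *v c = mu k *s c" by metis
  with c0 van that show ?thesis by blast
qed

end

lemma sheet_solution_exists:
  fixes rho :: "'b::real_normed_vector \<Rightarrow> complex \<times> real"
  assumes mono: "monodromy_setup a g t St rho x0 sg"
    and Y: "system_solution (finite_part St rho) (\<lambda>x. to_plane (rho x)) A Y"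
      "\<And>k x. k \<in> {1..4} \<Longrightarrow> x \<in> finite_part St rho \<Longrightarrow> Y x = Y (sg k x) ** chi k"
    and T: "\<And>k. k \<in> {1..4} \<Longrightarrow> continuous_on (- co_arc g t k) (T k)"
      "\<And>k z. k \<in> {1..4} \<Longrightarrow> z \<notin> co_arc g t k \<Longrightarrow> T k z \<in> St \<and> rho (T k z) = of_plane z"
      "\<And>j k z. j \<in> {1..4} \<Longrightarrow> k \<in> {1..4} \<Longrightarrow> z \<in> inside (path_image g) \<Longrightarrow> T j z = T k z"
      "\<And>k z. k \<in> {1..4} \<Longrightarrow> z \<in> outside (path_image g) \<Longrightarrow> T (prev_index k) z = sg k (T k z)"
  shows "sheet_solution g t A chi (\<lambda>k z. Y (T k z))"
proof -
  note curve = setup_curve[OF mono]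
  have Tf: "T k z \<in> finite_part St rho" "to_plane (rho (T k z)) = z" if "k \<in> {1..4}" "z \<notin> co_arc g t k" for k z
    using T(2)[OF that] of_plane_neq_rinf by (auto simp: finite_part_def)
  have "((\<lambda>z. Y (T k z) $ i $ j) has_field_derivative (A z ** Y (T k z)) $ i $ j) (at z)"
    if k: "k \<in> {1..4}" and z: "z \<notin> co_arc g t k" for k z i j
  proof (rule has_coord_deriv_section[OF co_arc_open_connected(1)[OF curve k] _ T(1)[OF k], of z "finite_part St rho" "\<lambda>x. to_plane (rho x)" "\<lambda>x. Y x $ i $ j"])
    show "has_coord_deriv (finite_part St rho) (\<lambda>x. to_plane (rho x)) (\<lambda>x. Y x $ i $ j) ((A z ** Y (T k z)) $ i $ j) (T k z)"
      using Y(1) Tf[OF k z] by (metis system_solution_def)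
  qed (use Tf[OF k] z in auto)
  moreover have "invertible (Y (T k z))" if k: "k \<in> {1..4}" and z: "z \<notin> co_arc g t k" for k z
    using Y(1) Tf[OF k z] by (auto simp: system_solution_def)
  moreover have "Y (T k z) = Y (T (prev_index k) z) ** chi k" if k: "k \<in> {1..4}" and z: "z \<in> outside (path_image g)" for k z
    using Y(2)[OF k Tf(1)[OF k outside_not_co_arc[OF curve k z]]] T(4)[OF k z] by simp
  moreover have "Y (T j z) = Y (T k z)" if "j \<in> {1..4}" "k \<in> {1..4}" "z \<in> inside (path_image g)" for j k z
    using T(3)[OF that] by simp
  ultimately show ?thesis unfolding sheet_solution_def by blast
qed

definition next_index :: "nat \<Rightarrow> nat" where
  "next_index k = (if k = 4 then 1 else k + 1)"

context
  fixes a g t assumes curve: "curve_through a g t"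
begin

lemma curve_next_par: "i \<in> {1..4} \<Longrightarrow> g (next_par t i) = a (next_index i)"
  using curve_points[OF curve, of "next_index i"] curve_plus_1[OF curve]
  by (auto simp: next_par_def next_index_def)

text \<open>\<open>h i\<close> is a branch of \<open>ln ((z - a\<^sub>i\<^sub>+\<^sub>1) / (z - a\<^sub>i))\<close> off the arc from \<open>a\<^sub>i\<close> to \<open>a\<^sub>i\<^sub>+\<^sub>1\<close>, namely
  the integral of \<open>1 / (u - z)\<close> along this arc; the four integrals add up to the
  winding number of the whole curve.\<close>

lemma arc_logarithms:
  obtains h where
    "\<And>i z. i \<in> {1..4} \<Longrightarrow> z \<notin> g ` {t i..next_par t i} \<Longrightarrow>
       (h i has_field_derivative (1 / (z - a (next_index i)) - 1 / (z - a i))) (at z)"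
    "\<And>z. z \<in> inside (path_image g) \<Longrightarrow> h 1 z + h 2 z + h 3 z + h 4 z = 2 * of_real pi * \<i>"
    "\<And>z. z \<in> outside (path_image g) \<Longrightarrow> h 1 z + h 2 z + h 3 z + h 4 z = 0"
proof -
  \<comment> \<open>The curve is started at \<open>a 1\<close>, so that the four subarcs are
    consecutive subpaths over a partition of \<open>{0..1}\<close>, although the parameters
    \<open>t k\<close> themselves need not lie in that interval.\<close>
  define G where "G = (\<lambda>s. g (t 1 + s))"
  have "g C1_differentiable_on UNIV" using curve by (simp add: curve_through_def)
  then obtain D where D: "\<And>s. (g has_vector_derivative D s) (at s)" "continuous_on UNIV D"
    unfolding C1_differentiable_on_def by auto
  define arcpath where "arcpath = (\<lambda>i. subpath (t i - t 1) (next_par t i - t 1) G)"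
  have arcpath: "arcpath i = (\<lambda>x. g ((next_par t i - t i) * x + t i))" for i
    by (auto simp: arcpath_def subpath_def G_def algebra_simps)
  have lin: "((\<lambda>x. g (m * x + b)) has_vector_derivative m *\<^sub>R D (m * x + b)) (at x)" for m b x
  proof -
    have "((\<lambda>x. m * x + b) has_real_derivative m) (at x)"
      by (auto intro!: derivative_eq_intros)
    then show ?thesis
      using vector_diff_chain_at[of "\<lambda>x. m * x + b" m x g "D (m * x + b)"] D(1)
      by (simp add: o_def has_real_derivative_iff_has_vector_derivative)
  qed
  have linC1: "(\<lambda>x. g (m * x + b)) C1_differentiable_on S" for m b S
    unfolding C1_differentiable_on_def
    by (intro exI[of _ "\<lambda>x. m *\<^sub>R D (m * x + b)"] conjI ballI lin continuous_intros
        continuous_on_compose2[OF D(2)]) auto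
  have vG: "valid_path G"
    using linC1[of 1 "t 1"] unfolding G_def valid_path_def
    by (simp add: add.commute C1_differentiable_imp_piecewise)
  have va: "valid_path (arcpath i)" for i
    using linC1 unfolding arcpath valid_path_def
    by (simp add: C1_differentiable_imp_piecewise)
  have Gs: "G s = shiftpath (frac (t 1)) g s" for s
  proof -
    have "g (t 1 + s) = g (frac (t 1) + s)" "g (frac (t 1) + s - 1) = g (frac (t 1) + s)"
      unfolding curve_eq_iff[OF curve] by (auto simp: frac_def)
    then show ?thesis by (simp add: G_def shiftpath_def)
  qed
  have Gim: "path_image G \<subseteq> path_image g" unfolding curve_image[OF curve] by (auto simp: path_image_def G_def)
  have wG: "winding_number G z = winding_number g z" if "z \<notin> path_image g" for z
    unfolding ext[OF Gs]
    by (rule winding_number_shiftpath)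
      (use that curve_simple[OF curve] curve_closed[OF curve] frac_lt_1[of "t 1"] in \<open>auto simp: simple_path_imp_path\<close>)
  define h where "h = (\<lambda>i z. contour_integral (arcpath i) (\<lambda>u. 1 / (u - z)))"
  have pim: "path_image (arcpath i) = g ` {t i..next_par t i}" if "i \<in> {1..4}" for i
  proof -
    have "path_image (arcpath i) = g ` ((\<lambda>x. (next_par t i - t i) * x + t i) ` {0..1})"
      unfolding path_image_def arcpath by (simp add: image_image)
    also have "(\<lambda>x. (next_par t i - t i) * x + t i) ` {0..1} = {t i..next_par t i}"
      using param_order(1)[OF curve that] by (simp add: image_affinity_atLeastAtMost)
    finally show ?thesis .
  qed
  have dh: "(h i has_field_derivative (1 / (z - a (next_index i)) - 1 / (z - a i))) (at z)"
    if i: "i \<in> {1..4}" and z: "z \<notin> g ` {t i..next_par t i}" for i z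
  proof -
    let ?m = "next_par t i - t i"
    have zi: "z \<in> UNIV - path_image (arcpath i)" using z pim[OF i] by simp
    have "compact ((\<lambda>x. ?m *\<^sub>R D (?m * x + t i)) ` {0..1})"
      by (intro compact_continuous_image continuous_intros continuous_on_compose2[OF D(2)]) auto
    then obtain B where B: "\<And>x. x \<in> {0..1} \<Longrightarrow> norm (?m *\<^sub>R D (?m * x + t i)) \<le> B"
      using compact_imp_bounded bounded_iff by (metis (no_types, lifting) imageI)
    have vd: "vector_derivative (arcpath i) (at x) = ?m *\<^sub>R D (?m * x + t i)" for x
      unfolding arcpath by (rule vector_derivative_at[OF lin])
    have int: "((\<lambda>u. 1 / (u - w) ^ 1) has_contour_integral h i w) (arcpath i)" if "w \<in> UNIV - path_image (arcpath i)" for w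
    proof -
      have "(\<lambda>u. 1 / (u - w)) contour_integrable_on arcpath i"
        by (rule contour_integrable_inversediff[OF va]) (use that in auto)
      then show ?thesis by (simp add: h_def has_contour_integral_integral)
    qed
    \<comment> \<open>Differentiation under the integral sign gives the integral of
      \<open>1 / (u - z)^2\<close>. This has the single valued primitive
      \<open>- 1 / (u - z)\<close>, so only the end points contribute.\<close>
    have der: "(h i has_field_derivative (of_nat 1 * contour_integral (arcpath i) (\<lambda>u. 1 / (u - z) ^ Suc 1))) (at z)"
      using Cauchy_next_derivative(2)[of "arcpath i" "\<lambda>u. 1" B UNIV 1 "h i" z] B int zi va
      by (auto simp: vd)
    have "((\<lambda>u. 1 / (u - z)\<^sup>2) has_contour_integral (- 1 / (pathfinish (arcpath i) - z) - (- 1 / (pathstart (arcpath i) - z)))) (arcpath i)"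
    proof (rule contour_integral_primitive[of "- {z}"])
      show "((\<lambda>u. - 1 / (u - z)) has_field_derivative 1 / (u - z)\<^sup>2) (at u within - {z})" if "u \<in> - {z}" for u
        using that by (auto intro!: derivative_eq_intros simp: power2_eq_square divide_simps)
      show "path_image (arcpath i) \<subseteq> - {z}" using zi by auto
    qed (rule va)
    moreover have "pathfinish (arcpath i) = a (next_index i)" "pathstart (arcpath i) = a i"
      using curve_next_par[OF i] curve_points[OF curve i] by (auto simp: arcpath pathfinish_def pathstart_def)
    ultimately have "contour_integral (arcpath i) (\<lambda>u. 1 / (u - z)\<^sup>2) = - 1 / (a (next_index i) - z) - (- 1 / (a i - z))"
      by (metis contour_integral_unique)
    also have "\<dots> = 1 / (z - a (next_index i)) - 1 / (z - a i)"
      by (metis (no_types, lifting) diff_minus_eq_add minus_diff_eq minus_divide_left minus_divide_right uminus_add_conv_diff)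
    finally have e: "contour_integral (arcpath i) (\<lambda>u. 1 / (u - z)\<^sup>2) = 1 / (z - a (next_index i)) - 1 / (z - a i)" .
    show ?thesis using der e by (simp add: numeral_2_eq_2)
  qed
  have sum: "h 1 z + h 2 z + h 3 z + h 4 z = 2 * of_real pi * \<i> * winding_number g z" if z: "z \<notin> path_image g" for z
  proof -
    note ord = curve_order[OF curve]
    have zG: "z \<notin> path_image G" using z Gim by auto
    have int: "(\<lambda>u. 1 / (u - z)) contour_integrable_on G"
      by (rule contour_integrable_inversediff[OF vG zG])
    note comb = contour_integral_subpath_combine[OF int vG]
    have "h 1 z + h 2 z + h 3 z + h 4 z = contour_integral (subpath 0 1 G) (\<lambda>u. 1 / (u - z))"
      unfolding h_def arcpath_def next_par_simps using ord by (simp add: comb)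
    also have "\<dots> = 2 * of_real pi * \<i> * winding_number G z"
      using winding_number_valid_path[OF vG zG] by simp
    finally show ?thesis using wG[OF z] by simp
  qed
  show ?thesis
  proof (rule that[of h, OF dh])
    show "h 1 z + h 2 z + h 3 z + h 4 z = 2 * of_real pi * \<i>" if "z \<in> inside (path_image g)" for z
    proof -
      have "winding_number g z = 1" using curve that by (simp add: curve_through_def)
      moreover have "z \<notin> path_image g" using that inside_no_overlap by blast
      ultimately show ?thesis using sum[of z] by simp
    qed
    show "h 1 z + h 2 z + h 3 z + h 4 z = 0" if "z \<in> outside (path_image g)" for z
    proof -
      have "winding_number g z = 0"
        by (rule winding_number_zero_in_outside)
          (use that curve_simple[OF curve] curve_closed[OF curve] in \<open>auto simp: simple_path_imp_path\<close>)
      moreover have "z \<notin> path_image g" using that outside_no_overlap by blast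
      ultimately show ?thesis using sum[of z] by simp
    qed
  qed
qed

text \<open>On the invariant line the first entry \<open>f k\<close> satisfies
  \<open>f' = (A z $ 1 $ 1) f\<close>, and \<open>e k\<close> is an explicit branch of the product
  of the powers \<open>(z - a k)\<close> to \<open>eps k\<close> on the same sheet. The constant
  ratio is the same on consecutive sheets, by comparison inside the curve; outside, the multiplier
  \<open>mu\<close> is therefore the jump of the explicit branch.\<close>

lemma triangular_characters:
  assumes Y: "sheet_solution g t A chi Y"
    and c: "c \<noteq> 0" "chi k *v c = mu *s c"
      "\<And>k z. k \<in> {1..4} \<Longrightarrow> z \<notin> co_arc g t k \<Longrightarrow> (Y k z *v c) $ 2 = 0"
    and A: "\<And>z. z \<notin> a ` {1..4} \<Longrightarrow> A z $ 1 $ 1 = (\<Sum>k=1..4. eps k / (z - a k))"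
    and N: "of_int N = (\<Sum>k=1..4. eps k)" and k: "k \<in> {1..4}"
  shows "mu = exp (- 2 * of_real pi * \<i> * eps k)"
proof -
  obtain h where h: "\<And>i z. i \<in> {1..4} \<Longrightarrow> z \<notin> g ` {t i..next_par t i} \<Longrightarrow>
       (h i has_field_derivative (1 / (z - a (next_index i)) - 1 / (z - a i))) (at z)"
    and hin: "\<And>z. z \<in> inside (path_image g) \<Longrightarrow> h 1 z + h 2 z + h 3 z + h 4 z = 2 * of_real pi * \<i>"
    and hout: "\<And>z. z \<in> outside (path_image g) \<Longrightarrow> h 1 z + h 2 z + h 3 z + h 4 z = 0"
    using arc_logarithms by blast
  let ?pi = "2 * of_real pi * \<i>"
  \<comment> \<open>The cut of \<open>h k\<close> fills the gap of the slit \<open>k\<close>, so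
    \<open>h k\<close> is replaced by \<open>2 pi i\<close> minus the sum of the other logarithms,
    whose cuts lie in the slit. Inside the curve the replacement equals \<open>h k\<close>; outside
    it exceeds \<open>h k\<close> by \<open>2 pi i\<close>.\<close>
  define l where "l = (\<lambda>k i z. if i = k then ?pi - (h 1 z + h 2 z + h 3 z + h 4 z - h i z) else h i z)"
  \<comment> \<open>Summation by parts: \<open>C i\<close> is the tail
    \<open>eps (i + 1) + ... + eps 4\<close>, so that \<open>N ln (z - a 1)\<close> plus the sum of
    the \<open>C i\<close> times the logarithms of the quotients is formally the sum of the
    \<open>eps k ln (z - a k)\<close>. Only integer powers of \<open>z - a 1\<close> occur outside
    the exponential.\<close>
  define C where "C = (\<lambda>i::nat. if i = 1 then eps 2 + eps 3 + eps 4 else if i = 2 then eps 3 + eps 4 else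
      if i = 3 then eps 4 else 0)"
  define L where "L = (\<lambda>k z. C 1 * l k 1 z + C 2 * l k 2 z + C 3 * l k 3 z)"
  define e where "e = (\<lambda>k z. (z - a 1) powi N * exp (L k z))"
  define f where "f = (\<lambda>k z. (Y k z *v c) $ 1)"
  have fdef: "f k z = Y k z $ 1 $ 1 * c $ 1 + Y k z $ 1 $ 2 * c $ 2" for k z
    by (simp add: f_def matrix_vector_mult_def sum_2)
  have notin: "z \<notin> a ` {1..4}" if "k \<in> {1..4}" "z \<notin> co_arc g t k" for k z
    using points_in_co_arc[OF curve that(1)] that(2) by blast
  have dl: "((\<lambda>z. l k i z) has_field_derivative (1 / (z - a (next_index i)) - 1 / (z - a i))) (at z)"
    if k: "k \<in> {1..4}" and z: "z \<notin> co_arc g t k" and i: "i \<in> {1..4}" for k i z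
  proof (cases "i = k")
    case False
    have "z \<notin> g ` {t i..next_par t i}" using subarc_after_subset_co_arc[OF curve i k False] z by blast
    from h[OF i this] False show ?thesis by (simp add: l_def)
  next
    case True
    have hj: "(h j has_field_derivative (1 / (z - a (next_index j)) - 1 / (z - a j))) (at z)" if "j \<in> {1..4}" "j \<noteq> k" for j
      using h[OF that(1), of z] subarc_after_subset_co_arc[OF curve that(1) k that(2)] z by auto
    have n: "next_index 1 = 2" "next_index 2 = 3" "next_index 3 = 4" "next_index 4 = 1"
      by (simp_all add: next_index_def)
    let ?d = "\<lambda>j. 1 / (z - a (next_index j)) - 1 / (z - a j)"
    consider "k = 1" | "k = 2" | "k = 3" | "k = 4" using k unfolding atLeastAtMost_1_4 by auto
    then show ?thesis unfolding True
    proof cases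
      case 1
      have "((\<lambda>z. ?pi - (h 2 z + h 3 z + h 4 z)) has_field_derivative
          0 - (?d 2 + ?d 3 + ?d 4)) (at z)"
        by (intro DERIV_diff DERIV_add DERIV_const hj) (use 1 in auto)
      moreover have "l k k = (\<lambda>z. ?pi - (h 2 z + h 3 z + h 4 z))"
        by (rule ext) (simp add: l_def 1)
      moreover have "0 - (?d 2 + ?d 3 + ?d 4) = ?d k" unfolding 1 n by simp
      ultimately show "((\<lambda>z. l k k z) has_field_derivative ?d k) (at z)" by simp
    next
      case 2
      have "((\<lambda>z. ?pi - (h 1 z + h 3 z + h 4 z)) has_field_derivative
          0 - (?d 1 + ?d 3 + ?d 4)) (at z)"
        by (intro DERIV_diff DERIV_add DERIV_const hj) (use 2 in auto)
      moreover have "l k k = (\<lambda>z. ?pi - (h 1 z + h 3 z + h 4 z))"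
        by (rule ext) (simp add: l_def 2)
      moreover have "0 - (?d 1 + ?d 3 + ?d 4) = ?d k" unfolding 2 n by simp
      ultimately show "((\<lambda>z. l k k z) has_field_derivative ?d k) (at z)" by simp
    next
      case 3
      have "((\<lambda>z. ?pi - (h 1 z + h 2 z + h 4 z)) has_field_derivative
          0 - (?d 1 + ?d 2 + ?d 4)) (at z)"
        by (intro DERIV_diff DERIV_add DERIV_const hj) (use 3 in auto)
      moreover have "l k k = (\<lambda>z. ?pi - (h 1 z + h 2 z + h 4 z))"
        by (rule ext) (simp add: l_def 3)
      moreover have "0 - (?d 1 + ?d 2 + ?d 4) = ?d k" unfolding 3 n by simp
      ultimately show "((\<lambda>z. l k k z) has_field_derivative ?d k) (at z)" by simp
    next
      case 4
      have "((\<lambda>z. ?pi - (h 1 z + h 2 z + h 3 z)) has_field_derivative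
          0 - (?d 1 + ?d 2 + ?d 3)) (at z)"
        by (intro DERIV_diff DERIV_add DERIV_const hj) (use 4 in auto)
      moreover have "l k k = (\<lambda>z. ?pi - (h 1 z + h 2 z + h 3 z))"
        by (rule ext) (simp add: l_def 4)
      moreover have "0 - (?d 1 + ?d 2 + ?d 3) = ?d k" unfolding 4 n by simp
      ultimately show "((\<lambda>z. l k k z) has_field_derivative ?d k) (at z)" by simp
    qed
  qed
  have S4: "(\<Sum>k=1..4. F k) = F 1 + F 2 + F 3 + F (4::nat)" for F :: "nat \<Rightarrow> complex"
    unfolding atLeastAtMost_1_4 by simp
  have ratio: "\<exists>K. \<forall>z\<in>- co_arc g t k. f k z = K * e k z" if k: "k \<in> {1..4}" for k
  proof (rule linear_ode_ratio[OF co_arc_open_connected(1,2)[OF curve k], of _ "\<lambda>z. A z $ 1 $ 1"])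
    fix z assume z': "z \<in> - co_arc g t k"
    then have z: "z \<notin> co_arc g t k" by simp
    have za: "z \<noteq> a j" if "j \<in> {1..4}" for j using notin[OF k z] that by auto
    have Y2: "Y k z $ 2 $ 1 * c $ 1 + Y k z $ 2 $ 2 * c $ 2 = 0"
      using c(3)[OF k z] by (simp add: matrix_vector_mult_def sum_2)
    have "((\<lambda>z. f k z) has_field_derivative ((A z ** Y k z) $ 1 $ 1 * c $ 1 + (A z ** Y k z) $ 1 $ 2 * c $ 2)) (at z)"
      unfolding fdef
      by (rule DERIV_add[OF DERIV_cmult_right[OF sheet_solutionD(2)[OF Y k z]] DERIV_cmult_right[OF sheet_solutionD(2)[OF Y k z]]])
    moreover have "(A z ** Y k z) $ 1 $ 1 * c $ 1 + (A z ** Y k z) $ 1 $ 2 * c $ 2 = A z $ 1 $ 1 * f k z"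
      unfolding fdef mult2_nth using Y2 by algebra
    ultimately show "(f k has_field_derivative A z $ 1 $ 1 * f k z) (at z)" by simp
    have nz: "z - a 1 \<noteq> 0" using za[of 1] by simp
    have n: "next_index 1 = 2" "next_index 2 = 3" "next_index 3 = 4"
      by (simp_all add: next_index_def)
    define d where "d = (\<lambda>i. 1 / (z - a (next_index i)) - 1 / (z - a i))"
    have dL: "(L k has_field_derivative (C 1 * d 1 + C 2 * d 2 + C 3 * d 3)) (at z)"
      unfolding L_def d_def
      by (intro DERIV_add DERIV_cmult dl k z) auto
    have dp: "((\<lambda>z. (z - a 1) powi N) has_field_derivative of_int N * (z - a 1) powi N / (z - a 1)) (at z)"
    proof -
      have "((\<lambda>z. z - a 1) has_field_derivative 1) (at z)"
        by (auto intro!: derivative_eq_intros)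
      from DERIV_chain2[where f = "\<lambda>z. z powi N" and g = "\<lambda>z. z - a 1" and x = z and s = UNIV,
          OF powi_has_field_derivative[OF nz, of N] this]
      show ?thesis by simp
    qed
    have de: "(e k has_field_derivative (of_int N * (z - a 1) powi N / (z - a 1) * exp (L k z)
        + exp (L k z) * (C 1 * d 1 + C 2 * d 2 + C 3 * d 3) * (z - a 1) powi N)) (at z)"
      unfolding e_def by (rule DERIV_mult[OF dp DERIV_chain2[OF DERIV_exp dL]])
    have "of_int N / (z - a 1) + (C 1 * d 1 + C 2 * d 2 + C 3 * d 3) = A z $ 1 $ 1"
      unfolding A[OF notin[OF k z]] N S4 d_def n C_def
      by (simp add: add_divide_distrib algebra_simps)
    then have "A z $ 1 $ 1 * e k z = (of_int N * (z - a 1) powi N / (z - a 1) * exp (L k z)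
        + exp (L k z) * (C 1 * d 1 + C 2 * d 2 + C 3 * d 3) * (z - a 1) powi N)"
      unfolding e_def by (simp add: algebra_simps flip: \<open>_ = A z $ 1 $ 1\<close>)
    with de show "(e k has_field_derivative A z $ 1 $ 1 * e k z) (at z)" by simp
    show "e k z \<noteq> 0" using nz by (simp add: e_def)
  qed
  then obtain K where K: "\<And>k z. k \<in> {1..4} \<Longrightarrow> z \<notin> co_arc g t k \<Longrightarrow> f k z = K k * e k z"
    by (metis ComplI)
  have enz: "e k z \<noteq> 0" if "k \<in> {1..4}" "z \<notin> co_arc g t k" for k z
    using notin[OF that] by (auto simp: e_def)
  let ?j = "prev_index k"
  have j: "?j \<in> {1..4}" by (rule prev_index_mem[OF k])
  have Kj: "K ?j = K k"
  proof -
    obtain z where z: "z \<in> inside (path_image g)" by (rule inside_point[OF curve])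
    note zk = inside_not_co_arc[OF curve k z] and zj = inside_not_co_arc[OF curve j z]
    have "Y ?j z = Y k z" by (rule sheet_solutionD(3)[OF Y j k z])
    then have "f ?j z = f k z" by (simp add: f_def)
    moreover have "l k i z = h i z" for k i
      using hin[OF z] by (simp add: l_def)
    then have "e ?j z = e k z" by (simp add: e_def L_def)
    ultimately show ?thesis using K[OF k zk] K[OF j zj] enz[OF k zk] by simp
  qed
  obtain z where z: "z \<in> outside (path_image g)" by (rule outside_point[OF curve])
  note zk = outside_not_co_arc[OF curve k z] and zj = outside_not_co_arc[OF curve j z]
  have "Y k z *v c = mu *s (Y ?j z *v c)"
    using sheet_solutionD(4)[OF Y k z] c(2)
    by (simp add: matrix_vector_mul_assoc[symmetric] vector_scalar_commute)
  then have fk: "f k z = mu * f ?j z" by (simp add: f_def)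
  have "f k z \<noteq> 0"
  proof
    assume "f k z = 0"
    then have "Y k z *v c = 0" using c(3)[OF k zk] by (simp add: f_def vec_eq_iff forall_2)
    moreover obtain X where "X ** Y k z = mat 1"
      using sheet_solutionD(1)[OF Y k zk] unfolding invertible_def by blast
    ultimately have "c = 0" by (metis matrix_vector_mul_assoc matrix_vector_mul_lid matrix_vector_mult_0_right)
    then show False using c(1) by simp
  qed
  then have ek: "e k z = mu * e ?j z" using fk K[OF k zk] K[OF j zj] Kj by auto
  have lk: "l k i z = h i z + (if i = k then ?pi else 0)" for k i
    using hout[OF z] by (simp add: l_def algebra_simps)
  define Lh where "Lh = C 1 * h 1 z + C 2 * h 2 z + C 3 * h 3 z"
  have Lz: "L k z = Lh + C k * ?pi" if "k \<in> {1..4}" for k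
    using that unfolding atLeastAtMost_1_4 by (auto simp: L_def lk Lh_def C_def algebra_simps)
  have "e k z = (z - a 1) powi N * exp (Lh + C k * ?pi)" by (simp add: e_def Lz[OF k])
  also have "\<dots> = (z - a 1) powi N * exp (Lh + C ?j * ?pi) * exp (C k * ?pi - C ?j * ?pi)"
    by (simp add: mult.assoc flip: exp_add)
  also have "\<dots> = e ?j z * exp (C k * ?pi - C ?j * ?pi)" by (simp add: e_def Lz[OF j])
  finally have "mu = exp (C k * ?pi - C ?j * ?pi)" using ek enz[OF j zj] by simp
  also have "\<dots> = exp (- 2 * of_real pi * \<i> * eps k)"
  proof (cases "k = 1")
    case True
    \<comment> \<open>The cyclic predecessor of 1 is 4. There \<open>C 4 = 0\<close> and
      \<open>C 1 = N - eps 1\<close>, and the integer \<open>N\<close> disappears in the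
      exponential.\<close>
    have "C k * ?pi - C ?j * ?pi = - 2 * of_real pi * \<i> * eps k + ?pi * of_int N"
      using True N[unfolded S4] by (simp add: C_def prev_index_def algebra_simps)
    moreover have "exp (?pi * of_int N) = 1" by (auto simp: exp_eq_1)
    ultimately show ?thesis by (simp only: exp_add mult_1_right)
  next
    case False
    then have "C k * ?pi - C ?j * ?pi = - 2 * of_real pi * \<i> * eps k"
      using k unfolding atLeastAtMost_1_4 by (auto simp: C_def prev_index_def algebra_simps)
    then show ?thesis by simp
  qed
  finally show ?thesis .
qed

end

section \<open>Residues and growth of the coefficient matrix\<close>

lemma residue_limits:
  assumes "local_form_at a A k E"
  obtains R where "\<And>i j. ((\<lambda>z. (z - a k) * A z $ i $ j) \<longlongrightarrow> R $ i $ j) (at (a k))"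
    "\<And>x y. eigenvalue_pair E x y \<Longrightarrow> eigenvalue_pair R x y"
proof -
  obtain d H where d: "d > 0" and H: "matrix_holomorphic_on H (ball (a k) d)"
    "\<And>z. z \<in> ball (a k) d - {a k} \<Longrightarrow> H z = mat (z - a k) ** A z"
    "\<And>x y. eigenvalue_pair E x y \<Longrightarrow> eigenvalue_pair (H (a k)) x y"
    using local_form_residue[OF assms] by metis
  have "((\<lambda>z. (z - a k) * A z $ i $ j) \<longlongrightarrow> H (a k) $ i $ j) (at (a k))" for i j
  proof -
    have "isCont (\<lambda>z. H z $ i $ j) (a k)"
      using holomorphic_on_imp_continuous_on[OF matrix_holomorphic_onD[OF H(1), of i j]] d
      by (simp add: continuous_on_eq_continuous_at)
    then have "((\<lambda>z. H z $ i $ j) \<longlongrightarrow> H (a k) $ i $ j) (at (a k))" by (simp add: isCont_def)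
    then show ?thesis
    proof (rule Lim_transform_eventually)
      have "\<forall>\<^sub>F z in at (a k). z \<in> ball (a k) d \<and> z \<noteq> a k"
        using d by (intro eventually_conj eventually_at_in_open' eventually_neq_at_within) auto
      then show "\<forall>\<^sub>F z in at (a k). H z $ i $ j = (z - a k) * A z $ i $ j"
        by eventually_elim (simp add: H(2) mat_mult_left)
    qed
  qed
  with H(3) that show ?thesis by blast
qed

text \<open>The exponent 4 is the number of singular points, to match the product form of functions
  with simple poles. Up to sign, \<open>z ^ 4 * A z $ 2 $ 1\<close> is
  \<open>z powi (2 - (k1 - k2))\<close> times the bounded factor
  \<open>B (1 / z) $ 2 $ 1\<close>.\<close>

lemma infinity_limits:
  assumes "local_form_at_infinity a A k1 k2"
  shows "((\<lambda>z. z * A z $ 1 $ 1) \<longlongrightarrow> of_int k1) at_infinity"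
    and "((\<lambda>z. z * A z $ 2 $ 2) \<longlongrightarrow> of_int k2) at_infinity"
    and "k1 - k2 > 2 \<Longrightarrow> ((\<lambda>z. z ^ 4 * A z $ 2 $ 1) \<longlongrightarrow> 0) at_infinity"
proof -
  obtain d B where d: "d > 0" and B: "matrix_holomorphic_on B (ball 0 d)"
    and A: "\<And>z. cmod z > 1 / d \<Longrightarrow> A z $ 1 $ 1 = of_int k1 / z - B (1 / z) $ 1 $ 1 / z\<^sup>2"
    "\<And>z. cmod z > 1 / d \<Longrightarrow> A z $ 2 $ 1 = - (z powi (k2 - k1) * B (1 / z) $ 2 $ 1 / z\<^sup>2)"
    "\<And>z. cmod z > 1 / d \<Longrightarrow> A z $ 2 $ 2 = of_int k2 / z - B (1 / z) $ 2 $ 2 / z\<^sup>2"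
    by (rule local_form_infinity[OF assms]) (rule that)
  have ev: "\<forall>\<^sub>F z in at_infinity. cmod z > 1 / d \<and> z \<noteq> 0"
    unfolding eventually_at_infinity
  proof (intro exI[of _ "1 / d + 1"] allI impI)
    fix z :: complex assume "1 / d + 1 \<le> cmod z"
    moreover have "0 < 1 / d" using d by simp
    ultimately have "cmod z > 1 / d" "cmod z > 0" by linarith+
    then show "cmod z > 1 / d \<and> z \<noteq> 0" by simp
  qed
  have inv: "((\<lambda>z::complex. 1 / z) \<longlongrightarrow> 0) at_infinity"
    using tendsto_inverse_0 by (simp add: divide_inverse)
  have Blim: "((\<lambda>z. B (1 / z) $ i $ j) \<longlongrightarrow> B 0 $ i $ j) at_infinity" for i j
  proof -
    have "isCont (\<lambda>z. B z $ i $ j) 0"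
      using holomorphic_on_imp_continuous_on[OF matrix_holomorphic_onD[OF B, of i j]] d
      by (simp add: continuous_on_eq_continuous_at)
    then show ?thesis by (rule isCont_tendsto_compose[OF _ inv])
  qed
  have diag: "((\<lambda>z. of_int k - B (1 / z) $ i $ i * (1 / z)) \<longlongrightarrow> of_int k) at_infinity" for k i
    using tendsto_diff[OF tendsto_const tendsto_mult[OF Blim inv]] by simp
  show "((\<lambda>z. z * A z $ 1 $ 1) \<longlongrightarrow> of_int k1) at_infinity"
    by (rule Lim_transform_eventually[OF diag[of k1 1]])
      (use ev in eventually_elim, simp add: A right_diff_distrib power2_eq_square)
  show "((\<lambda>z. z * A z $ 2 $ 2) \<longlongrightarrow> of_int k2) at_infinity"
    by (rule Lim_transform_eventually[OF diag[of k2 2]])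
      (use ev in eventually_elim, simp add: A right_diff_distrib power2_eq_square)
  have A21: "\<forall>\<^sub>F z in at_infinity. - ((1 / z) ^ nat (k1 - k2 - 2)) * B (1 / z) $ 2 $ 1 = z ^ 4 * A z $ 2 $ 1"
    if k: "k1 - k2 \<ge> 2"
    using ev
  proof eventually_elim
    case (elim z)
    have "z powi (k2 - k1) = z powi (- 2) * z powi (- (k1 - k2 - 2))"
      using elim by (simp flip: power_int_add)
    also have "z powi (- (k1 - k2 - 2)) = (1 / z) ^ nat (k1 - k2 - 2)"
      using k by (cases "k1 - k2 - 2 = 0") (simp_all add: power_int_def divide_inverse)
    finally have p: "z powi (k2 - k1) = z powi (- 2) * (1 / z) ^ nat (k1 - k2 - 2)" .
    have "z ^ 4 * (z powi (- 2) / z\<^sup>2) = 1"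
      using elim by (simp add: power_int_minus power_int_def field_simps flip: power_add)
    then have "z ^ 4 * A z $ 2 $ 1 = - ((1 / z) ^ nat (k1 - k2 - 2)) * B (1 / z) $ 2 $ 1 * 1"
      using A(2)[of z] elim unfolding p by (simp only: ) (simp add: field_simps)
    then show ?case by simp
  qed
  show "((\<lambda>z. z ^ 4 * A z $ 2 $ 1) \<longlongrightarrow> 0) at_infinity" if k: "k1 - k2 > 2"
  proof (rule Lim_transform_eventually[OF _ A21])
    have "((\<lambda>z. - ((1 / z) ^ nat (k1 - k2 - 2)) * B (1 / z) $ 2 $ 1) \<longlongrightarrow> - (0 ^ nat (k1 - k2 - 2)) * B 0 $ 2 $ 1) at_infinity"
      by (intro tendsto_intros inv Blim)
    then show "((\<lambda>z. - ((1 / z) ^ nat (k1 - k2 - 2)) * B (1 / z) $ 2 $ 1) \<longlongrightarrow> 0) at_infinity"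
      using k by (simp add: zero_power)
  qed (use k in simp)
qed

section \<open>Tuples of matrices\<close>

lemma vec2_eq_iff: "(v :: 'a^2) = w \<longleftrightarrow> v $ 1 = w $ 1 \<and> v $ 2 = w $ 2"
  by (auto simp: vec_eq_iff forall_2)

lemma eigenvector_subspace:
  assumes v: "v \<noteq> 0" and M: "\<And>k. k \<in> {1..4} \<Longrightarrow> M k *v v = mu k *s v"
  shows "nontrivial_invariant_subspace M (vec.span {v})"
  unfolding nontrivial_invariant_subspace_def
proof (intro conjI ballI)
  have sp: "vec.span {v} = range (\<lambda>k. k *s v)" by (rule vec.span_singleton)
  show "vec.subspace (vec.span {v})" by (rule vec.subspace_span)
  show "vec.span {v} \<noteq> {0}" using v vec.span_base[of v "{v}"] by auto
  show "vec.span {v} \<noteq> UNIV"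
  proof
    assume U: "vec.span {v} = UNIV"
    have "axis 1 1 \<in> vec.span {v}" "axis 2 1 \<in> vec.span {v}" using U by auto
    then obtain k l where "(axis 1 1 :: complex^2) = k *s v" "(axis 2 1 :: complex^2) = l *s v"
      unfolding sp by blast
    then have "1 = k * v $ 1" "0 = k * v $ 2" "1 = l * v $ 2"
      by (auto simp: vec2_eq_iff axis_def)
    then show False by auto
  qed
  show "M k *v w \<in> vec.span {v}" if k: "k \<in> {1..4}" and w: "w \<in> vec.span {v}" for k w
  proof -
    obtain s where "w = s *s v" using w unfolding sp by auto
    then have "M k *v w = (s * mu k) *s v" using M[OF k] by (simp add: vector_scalar_commute)
    then show ?thesis using sp by auto
  qed
qed

lemma matrix_inv:
  fixes P :: "complex^'n^'n"
  assumes "invertible P" shows "P ** matrix_inv P = mat 1" "matrix_inv P ** P = mat 1"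
  using someI_ex[OF assms[unfolded invertible_def]] by (auto simp: matrix_inv_def)

lemma matrix_inv_eq:
  fixes P Q :: "complex^'n^'n"
  assumes "P ** Q = mat 1" "Q ** P = mat 1" shows "matrix_inv P = Q"
proof -
  have "invertible P" using assms unfolding invertible_def by blast
  then have "matrix_inv P ** P ** Q = Q" by (simp add: matrix_inv)
  then show ?thesis using assms by (simp add: matrix_mul_assoc[symmetric])
qed

lemma equivalent_tuples_eigenvector:
  assumes "equivalent_tuples M N" and v: "v \<noteq> 0" "\<And>k. k \<in> {1..4} \<Longrightarrow> M k *v v = mu k *s v"
  obtains w where "w \<noteq> 0" "\<And>k. k \<in> {1..4} \<Longrightarrow> N k *v w = mu k *s w"
proof -
  obtain P where P: "invertible P" "\<And>k. k \<in> {1..4} \<Longrightarrow> N k = matrix_inv P ** M k ** P"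
    using assms(1) by (auto simp: equivalent_tuples_def)
  have inv: "P ** matrix_inv P = mat 1" "matrix_inv P ** P = mat 1"
    using P(1) by (simp_all add: matrix_inv)
  show thesis
  proof (rule that[of "matrix_inv P *v v"])
    have "P *v (matrix_inv P *v v) = v" by (simp add: matrix_vector_mul_assoc inv)
    then show "matrix_inv P *v v \<noteq> 0" using v by auto
    show "N k *v (matrix_inv P *v v) = mu k *s (matrix_inv P *v v)" if k: "k \<in> {1..4}" for k
    proof -
      have "N k *v (matrix_inv P *v v) = matrix_inv P *v (M k *v ((P ** matrix_inv P) *v v))"
        unfolding P(2)[OF k] by (simp only: matrix_vector_mul_assoc matrix_mul_assoc)
      then show ?thesis using v(2)[OF k] by (simp add: inv vector_scalar_commute)
    qed
  qed
qed

lemma equivalent_tuples_sym: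
  assumes "equivalent_tuples M N" shows "equivalent_tuples N M"
proof -
  obtain P where P: "invertible P" "\<And>k. k \<in> {1..4} \<Longrightarrow> N k = matrix_inv P ** M k ** P"
    using assms(1) by (auto simp: equivalent_tuples_def)
  have inv: "P ** matrix_inv P = mat 1" "matrix_inv P ** P = mat 1"
    using P(1) by (simp_all add: matrix_inv)
  have ii: "invertible (matrix_inv P)" using inv unfolding invertible_def by blast
  have "matrix_inv (matrix_inv P) = P"
    by (rule matrix_inv_eq[OF inv(2,1)])
  moreover have "M k = P ** N k ** matrix_inv P" if "k \<in> {1..4}" for k
  proof -
    have "P ** N k ** matrix_inv P = (P ** matrix_inv P) ** M k ** (P ** matrix_inv P)"
      unfolding P(2)[OF that] by (simp only: matrix_mul_assoc)
    then show ?thesis by (simp add: inv)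
  qed
  ultimately show ?thesis unfolding equivalent_tuples_def using ii by auto
qed

lemma equivalent_tuples_trans:
  assumes "equivalent_tuples M N" "equivalent_tuples N L" shows "equivalent_tuples M L"
proof -
  obtain P where P: "invertible P" "\<And>k. k \<in> {1..4} \<Longrightarrow> N k = matrix_inv P ** M k ** P"
    using assms(1) by (auto simp: equivalent_tuples_def)
  obtain Q where Q: "invertible Q" "\<And>k. k \<in> {1..4} \<Longrightarrow> L k = matrix_inv Q ** N k ** Q"
    using assms(2) by (auto simp: equivalent_tuples_def)
  have "matrix_inv (P ** Q) = matrix_inv Q ** matrix_inv P"
  proof (rule matrix_inv_eq)
    have "P ** Q ** (matrix_inv Q ** matrix_inv P) = P ** (Q ** matrix_inv Q) ** matrix_inv P"
      by (simp only: matrix_mul_assoc)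
    then show "P ** Q ** (matrix_inv Q ** matrix_inv P) = mat 1"
      by (simp add: matrix_inv P(1) Q(1))
    have "matrix_inv Q ** matrix_inv P ** (P ** Q) = matrix_inv Q ** (matrix_inv P ** P) ** Q"
      by (simp only: matrix_mul_assoc)
    then show "matrix_inv Q ** matrix_inv P ** (P ** Q) = mat 1"
      by (simp add: matrix_inv P(1) Q(1))
  qed
  then show ?thesis unfolding equivalent_tuples_def using P Q
    by (intro exI[of _ "P ** Q"]) (simp add: invertible_mult matrix_mul_assoc)
qed

section \<open>Exclusion of triangular systems\<close>

text \<open>If \<open>A\<close> is upper triangular, the first entries of the solutions in the invariant line
  have exponents \<open>R k $ 1 $ 1\<close> which add up to \<open>kap1\<close>; irreducibility or \<open>n1 < n2\<close> excludes this.\<close>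

lemma lower_left_nonzero:
  fixes M E :: "nat \<Rightarrow> complex^2^2" and St :: "'b::real_normed_vector set"
  assumes inj: "inj_on a {1..4}" and mono: "monodromy_setup a g t St rho x0 sg"
    and adm: "admissible_data M E" and std: "standard_form a St rho sg M E kap1 kap2 A"
    and irr: "irreducible_tuple M \<or> reducible_with_n1_less_n2 M E"
  shows "\<exists>z. z \<notin> a ` {1..4} \<and> A z $ 2 $ 1 \<noteq> 0"
proof (rule ccontr)
  assume "\<nexists>z. z \<notin> a ` {1..4} \<and> A z $ 2 $ 1 \<noteq> 0"
  then have A21: "A z $ 2 $ 1 = 0" if "z \<notin> a ` {1..4}" for z using that by blast
  note curve = setup_curve[OF mono]
  have hol: "matrix_holomorphic_on A (- a ` {1..4})" and kk: "kap1 \<ge> kap2"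
    and lf: "\<And>k. k \<in> {1..4} \<Longrightarrow> local_form_at a A k (E k)" and li: "local_form_at_infinity a A kap1 kap2"
    using std by (auto simp: standard_form_def)
  obtain Y0 chi where Y0: "system_solution (finite_part St rho) (\<lambda>x. to_plane (rho x)) A Y0"
    "\<And>k x. k \<in> {1..4} \<Longrightarrow> x \<in> finite_part St rho \<Longrightarrow> Y0 x = Y0 (sg k x) ** chi k"
    and eq: "equivalent_tuples chi M"
    using std by (auto simp: standard_form_def system_monodromy_def)
  obtain T xi where T:
    "\<And>k. k \<in> {1..4} \<Longrightarrow> continuous_on (- co_arc g t k) (T k)"
    "\<And>k z. k \<in> {1..4} \<Longrightarrow> z \<notin> co_arc g t k \<Longrightarrow> T k z \<in> St \<and> rho (T k z) = of_plane z"
    "\<And>j k z. j \<in> {1..4} \<Longrightarrow> k \<in> {1..4} \<Longrightarrow> z \<in> inside (path_image g) \<Longrightarrow> T j z = T k z"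
    "\<And>k z. k \<in> {1..4} \<Longrightarrow> z \<in> outside (path_image g) \<Longrightarrow> T (prev_index k) z = sg k (T k z)"
    "\<And>k. k \<in> {1..4} \<Longrightarrow> xi k \<in> St \<and> rho (xi k) = rinf \<and> (T k \<longlongrightarrow> xi k) at_infinity"
    using monodromy_sheets[OF mono] by blast
  note Y = sheet_solution_exists[OF mono Y0 T(1-4)]
  obtain c mu where c: "c \<noteq> 0" "\<And>k. k \<in> {1..4} \<Longrightarrow> chi k *v c = mu k *s c"
    "\<And>k z. k \<in> {1..4} \<Longrightarrow> z \<notin> co_arc g t k \<Longrightarrow> (Y0 (T k z) *v c) $ 2 = 0"
    using triangular_invariant_line[OF curve Y hol A21] by blast
  obtain v where v: "v \<noteq> 0" "\<And>k. k \<in> {1..4} \<Longrightarrow> M k *v v = mu k *s v"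
    using equivalent_tuples_eigenvector[OF eq c(1,2)] by blast
  have nts: "nontrivial_invariant_subspace M (vec.span {v})"
    by (rule eigenvector_subspace[OF v])
  then have "reducible_with_n1_less_n2 M E" using irr by (auto simp: irreducible_tuple_def)
  then have red: "(\<exists>!V. nontrivial_invariant_subspace M V) \<and>
     (\<exists>mu1 mu2 al eps1 eps2 :: nat \<Rightarrow> complex. \<exists>n1 n2 :: int.
        equivalent_tuples M (\<lambda>k. vector [vector [mu1 k, al k], vector [0, mu2 k]]) \<and>
        (\<forall>k\<in>{1..4}. eigenvalue_pair (E k) (eps1 k) (eps2 k) \<and>
           mu1 k = exp (- 2 * of_real pi * \<i> * eps1 k) \<and>
           mu2 k = exp (- 2 * of_real pi * \<i> * eps2 k)) \<and>
        of_int n1 = (\<Sum>k=1..4. eps1 k) \<and> of_int n2 = (\<Sum>k=1..4. eps2 k) \<and> n1 < n2)"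
    by (simp only: reducible_with_n1_less_n2_def)
  obtain mu1 mu2 al eps1 eps2 :: "nat \<Rightarrow> complex" and n1 n2 :: int
    where uniq: "\<exists>!V. nontrivial_invariant_subspace M V"
      and up: "equivalent_tuples M (\<lambda>k. vector [vector [mu1 k, al k], vector [0, mu2 k]])"
      and eps0: "\<forall>k\<in>{1..4}. eigenvalue_pair (E k) (eps1 k) (eps2 k) \<and>
           mu1 k = exp (- 2 * of_real pi * \<i> * eps1 k) \<and>
           mu2 k = exp (- 2 * of_real pi * \<i> * eps2 k)"
      and n: "of_int n1 = (\<Sum>k=1..4. eps1 k)" "of_int n2 = (\<Sum>k=1..4. eps2 k)" "n1 < n2"
    using red by (elim conjE exE) (rule that)
  have eps: "\<And>k. k \<in> {1..4} \<Longrightarrow> eigenvalue_pair (E k) (eps1 k) (eps2 k)"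
    "\<And>k. k \<in> {1..4} \<Longrightarrow> mu1 k = exp (- 2 * of_real pi * \<i> * eps1 k)"
    using eps0 by blast+
  have "(axis 1 1 :: complex^2) \<noteq> 0" by (simp add: vec2_eq_iff axis_def)
  moreover have "(vector [vector [mu1 k, al k], vector [0, mu2 k]] :: complex^2^2) *v axis 1 1 = mu1 k *s axis 1 1" for k
    unfolding vec2_eq_iff by (simp add: axis_def matrix_vector_mult_def sum_2)
  ultimately obtain u where u: "u \<noteq> 0" "\<And>k. k \<in> {1..4} \<Longrightarrow> M k *v u = mu1 k *s u"
    by (rule equivalent_tuples_eigenvector[OF equivalent_tuples_sym[OF up]]) (rule that)
  \<comment> \<open>Both lines are invariant, hence equal to the unique invariant subspace. So the
    multipliers of the solutions on it are the diagonal entries \<open>mu1\<close> of the triangular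
    form.\<close>
  have "vec.span {v} = vec.span {u}"
  proof -
    obtain V where "\<And>W. nontrivial_invariant_subspace M W \<Longrightarrow> W = V"
      using uniq by (elim ex1E) (rule that, drule spec, erule mp)
    from this[OF nts] this[OF eigenvector_subspace[OF u]] show ?thesis by simp
  qed
  then have "v \<in> vec.span {u}" using vec.span_base[of v "{v}"] by auto
  then obtain s where s: "v = s *s u" by (auto simp: vec.span_singleton)
  have mu: "mu k = mu1 k" if k: "k \<in> {1..4}" for k
  proof -
    have "mu k *s v = M k *v (s *s u)" using v(2)[OF k] s by simp
    also have "\<dots> = mu1 k *s v" using u(2)[OF k] by (simp add: s vector_scalar_commute ac_simps)
    finally show ?thesis using v(1) by simp
  qed
  have "\<forall>k\<in>{1..4}. \<exists>R. (\<forall>i j. ((\<lambda>z. (z - a k) * A z $ i $ j) \<longlongrightarrow> R $ i $ j) (at (a k))) \<and>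
      (\<forall>x y. eigenvalue_pair (E k) x y \<longrightarrow> eigenvalue_pair R x y)"
  proof
    fix k :: nat assume k: "k \<in> {1..4}"
    show "\<exists>R. (\<forall>i j. ((\<lambda>z. (z - a k) * A z $ i $ j) \<longlongrightarrow> R $ i $ j) (at (a k))) \<and>
      (\<forall>x y. eigenvalue_pair (E k) x y \<longrightarrow> eigenvalue_pair R x y)"
      by (rule residue_limits[OF lf[OF k]]) blast
  qed
  from bchoice[OF this] obtain R where
    R: "\<And>k i j. k \<in> {1..4} \<Longrightarrow> ((\<lambda>z. (z - a k) * A z $ i $ j) \<longlongrightarrow> R k $ i $ j) (at (a k))"
    "\<And>k x y. k \<in> {1..4} \<Longrightarrow> eigenvalue_pair (E k) x y \<Longrightarrow> eigenvalue_pair (R k) x y"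
    by blast
  have R21: "R k $ 2 $ 1 = 0" if k: "k \<in> {1..4}" for k
  proof -
    have fin: "finite (a ` {1..4} - {a k})" by simp
    have "\<forall>\<^sub>F z in at (a k). z \<in> - (a ` {1..4} - {a k}) \<and> z \<noteq> a k"
      by (intro eventually_conj eventually_at_in_open' eventually_neq_at_within open_Compl
          finite_imp_closed fin) auto
    then have "\<forall>\<^sub>F z in at (a k). (z - a k) * A z $ 2 $ 1 = 0"
      by eventually_elim (use A21 in auto)
    then have "((\<lambda>z. (z - a k) * A z $ 2 $ 1) \<longlongrightarrow> 0) (at (a k))"
      by (simp add: tendsto_eventually)
    from tendsto_unique[OF _ R(1)[OF k] this] show ?thesis by simp
  qed
  have fin: "finite {1..4::nat}" by simp
  note A11 = simple_poles_partial_fractions[OF fin inj matrix_holomorphic_onD[OF hol] R(1) infinity_limits(1)[OF li]]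
  note A22 = simple_poles_partial_fractions[OF fin inj matrix_holomorphic_onD[OF hol] R(1) infinity_limits(2)[OF li]]
  \<comment> \<open>The residue is triangular with eigenvalues \<open>eps1 k\<close> and
    \<open>eps2 k\<close>, but their order on the diagonal is open. In the reversed order the
    multipliers show that \<open>eps1 k - eps2 k\<close> is an integer, and non-resonance makes the
    two equal.\<close>
  have R11: "R k $ 1 $ 1 = eps1 k" "R k $ 2 $ 2 = eps2 k" if k: "k \<in> {1..4}" for k
  proof -
    have p: "eps1 k + eps2 k = R k $ 1 $ 1 + R k $ 2 $ 2" "eps1 k * eps2 k = R k $ 1 $ 1 * R k $ 2 $ 2"
      using R(2)[OF k eps(1)[OF k]] R21[OF k] by (simp_all add: eigenvalue_pair_2)
    then have "(R k $ 1 $ 1 - eps1 k) * (R k $ 1 $ 1 - eps2 k) = 0" by algebra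
    then consider "R k $ 1 $ 1 = eps1 k" | "R k $ 1 $ 1 = eps2 k" by auto
    then show 1: "R k $ 1 $ 1 = eps1 k"
    proof cases
      case 2
      have "mu k = exp (- 2 * of_real pi * \<i> * R k $ 1 $ 1)"
        by (rule triangular_characters[OF curve Y c(1) c(2)[OF k] c(3) A11 k])
      then have "exp (- 2 * of_real pi * \<i> * eps1 k) = exp (- 2 * of_real pi * \<i> * eps2 k)"
        using mu[OF k] eps(2)[OF k] 2 by simp
      then obtain m :: int where "- 2 * of_real pi * \<i> * eps1 k = - 2 * of_real pi * \<i> * eps2 k + of_int (2 * m) * pi * \<i>"
        unfolding exp_eq by auto
      then have "eps1 k - eps2 k = - of_int m"
      proof -
        assume "- 2 * of_real pi * \<i> * eps1 k = - 2 * of_real pi * \<i> * eps2 k + of_int (2 * m) * pi * \<i>"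
        then have "(2 * of_real pi * \<i>) * (eps1 k - eps2 k + of_int m) = 0"
          by (simp add: algebra_simps)
        then show ?thesis by (simp add: eq_neg_iff_add_eq_0)
      qed
      then have "eps1 k - eps2 k \<in> \<int>" by simp
      moreover have "nonresonant (E k)" using adm k by (simp add: admissible_data_def)
      ultimately show ?thesis using nonresonant_pair[OF _ eps(1)[OF k]] 2 by simp
    qed
    show "R k $ 2 $ 2 = eps2 k" using p(1) 1 by simp
  qed
  have "of_int kap1 = (\<Sum>k=1..4. R k $ 1 $ 1)" by (rule A11(2))
  also have "\<dots> = of_int n1" unfolding n(1) using R11 by (intro sum.cong) auto
  finally have "kap1 = n1" by simp
  have "of_int kap2 = (\<Sum>k=1..4. R k $ 2 $ 2)" by (rule A22(2))
  also have "\<dots> = of_int n2" unfolding n(2) using R11 by (intro sum.cong) auto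
  finally have "kap2 = n2" by simp
  with \<open>kap1 = n1\<close> show False using n(3) kk by simp
qed

section \<open>Charts of the covering surface\<close>

text \<open>A local inverse of the covering projection is composed with a parametrization
  \<open>i\<close> of the base, whose inverse on \<open>V\<close> is \<open>j\<close>. The ball is
  shrunk until \<open>i\<close> maps it into the image of one homeomorphic piece. Both the charts at
  finite points and those at infinity arise in this way.\<close>

lemma covering_chart:
  fixes St :: "'b::real_normed_vector set" and rho :: "'b \<Rightarrow> complex \<times> real"
  assumes cov: "covering_space St rho P" and x: "x \<in> St"
    and i: "continuous_on UNIV i" "i c = rho x" "r0 > 0" "\<And>w. w \<in> ball c r0 \<Longrightarrow> i w \<in> V"
    and V: "openin (top_of_set P) V" "continuous_on V j" "\<And>s. s \<in> V \<Longrightarrow> i (j s) = s"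
      "\<And>w. w \<in> ball c r0 \<Longrightarrow> j (i w) = w"
  obtains r N S where "r > 0" "r \<le> r0" "openin (top_of_set St) N" "x \<in> N" "continuous_on (ball c r) S"
    "\<And>w. w \<in> ball c r \<Longrightarrow> S w \<in> N \<and> rho (S w) = i w"
    "\<And>x. x \<in> N \<Longrightarrow> rho x \<in> V \<and> j (rho x) \<in> ball c r \<and> S (j (rho x)) = x"
proof -
  obtain T u q where T: "x \<in> T" "openin (top_of_set St) T" and u: "rho x \<in> u" "openin (top_of_set P) u"
    and q: "homeomorphism T u rho q"
    using covering_space_local_homeomorphism[OF cov x] by blast
  obtain Q where Q: "open Q" "u = P \<inter> Q" using u(2) by (auto simp: openin_open)
  have VP: "V \<subseteq> P" using V(1) by (rule openin_imp_subset)
  have "open (i -` Q)" using i(1) Q(1) by (rule open_vimage[rotated])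
  moreover have "c \<in> i -` Q" using i(2) u(1) Q(2) by auto
  ultimately obtain r1 where r1: "r1 > 0" "ball c r1 \<subseteq> i -` Q" using open_contains_ball by blast
  define r where "r = min r0 r1"
  have r: "r > 0" "r \<le> r0" using r1 i(3) by (auto simp: r_def)
  have iu: "i w \<in> u" "i w \<in> V" "j (i w) = w" if "w \<in> ball c r" for w
    using that r1(2) i(4)[of w] V(4)[of w] VP by (auto simp: r_def Q(2))
  define B where "B = {s \<in> V. j s \<in> ball c r}"
  have "openin (top_of_set V) (V \<inter> j -` ball c r)"
    by (rule continuous_openin_preimage_gen[OF V(2)]) simp
  moreover have "V \<inter> j -` ball c r = B" by (auto simp: B_def)
  ultimately have oB: "openin (top_of_set P) B"
    using V(1) openin_trans by metis
  have rc: "continuous_on St rho" "rho ` St = P"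
    using cov by (auto simp: covering_space_imp_continuous covering_space_imp_surjective)
  have "openin (top_of_set St) (St \<inter> rho -` B)"
    by (rule continuous_openin_preimage[OF rc(1) _ oB]) (use rc in auto)
  then have oN: "openin (top_of_set St) (T \<inter> (St \<inter> rho -` B))"
    using T(2) by (rule openin_Int[rotated])
  have TSt: "T \<subseteq> St" using T(2) by (rule openin_imp_subset)
  have qT: "q s \<in> T" "rho (q s) = s" if "s \<in> u" for s
    using q that by (auto simp: homeomorphism_def)
  show thesis
  proof (rule that[of r "T \<inter> (St \<inter> rho -` B)" "\<lambda>w. q (i w)", OF r oN])
    have c: "c \<in> ball c r" using r by simp
    then show "x \<in> T \<inter> (St \<inter> rho -` B)"
      using T(1) x iu[OF c] i(2) by (auto simp: B_def dest: arg_cong[of _ _ j])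
    have "continuous_on u q" using q by (simp add: homeomorphism_def)
    then show "continuous_on (ball c r) (\<lambda>w. q (i w))"
      by (rule continuous_on_compose2[OF _ continuous_on_subset[OF i(1)]]) (use iu in auto)
    show "q (i w) \<in> T \<inter> (St \<inter> rho -` B) \<and> rho (q (i w)) = i w" if w: "w \<in> ball c r" for w
      using iu[OF w] qT[OF iu(1)[OF w]] TSt w by (auto simp: B_def)
    show "rho x \<in> V \<and> j (rho x) \<in> ball c r \<and> q (i (j (rho x))) = x" if xN: "x \<in> T \<inter> (St \<inter> rho -` B)" for x
    proof -
      have "q (rho x) = x" using q xN by (auto simp: homeomorphism_def)
      then show ?thesis using xN V(3)[of "rho x"] by (auto simp: B_def)
    qed
  qed
qed

lemma has_coord_deriv_add:
  assumes "has_coord_deriv X u f D x" "has_coord_deriv X u h D' x"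
  shows "has_coord_deriv X u (\<lambda>y. f y + h y) (D + D') x"
proof -
  have "((\<lambda>y. (f y - f x) / (u y - u x) + (h y - h x) / (u y - u x)) \<longlongrightarrow> D + D') (at x within X)"
    using assms unfolding has_coord_deriv_def by (rule tendsto_add)
  then show ?thesis unfolding has_coord_deriv_def
    by (simp add: add_divide_distrib diff_divide_distrib algebra_simps)
qed

lemma has_coord_deriv_mult_coord:
  assumes f: "has_coord_deriv X u f D x" and p: "(p has_field_derivative p') (at (u x))"
    and u: "(u \<longlongrightarrow> u x) (at x within X)" "\<forall>\<^sub>F y in at x within X. u y \<noteq> u x"
  shows "has_coord_deriv X u (\<lambda>y. p (u y) * f y) (p' * f x + p (u x) * D) x"
proof -
  have fl: "filterlim u (at (u x)) (at x within X)" using u by (rule filterlim_atI)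
  have "((\<lambda>z. (p z - p (u x)) / (z - u x)) \<longlongrightarrow> p') (at (u x))"
    using p by (simp add: has_field_derivative_iff)
  from filterlim_compose[OF this fl]
  have 1: "((\<lambda>y. (p (u y) - p (u x)) / (u y - u x)) \<longlongrightarrow> p') (at x within X)" .
  have 2: "((\<lambda>y. p (u y)) \<longlongrightarrow> p (u x)) (at x within X)"
    using DERIV_isCont[OF p] u(1) by (rule isCont_tendsto_compose)
  have "((\<lambda>y. (p (u y) - p (u x)) / (u y - u x) * f x + p (u y) * ((f y - f x) / (u y - u x)))
      \<longlongrightarrow> p' * f x + p (u x) * D) (at x within X)"
    by (intro tendsto_intros 1 2 f[unfolded has_coord_deriv_def])
  moreover have "(p (u y) - p (u x)) / (u y - u x) * f x + p (u y) * ((f y - f x) / (u y - u x)) =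
     (p (u y) * f y - p (u x) * f x) / (u y - u x)" for y
    by (simp add: algebra_simps diff_divide_distrib)
  ultimately show ?thesis unfolding has_coord_deriv_def by simp
qed

context
  fixes a :: "nat \<Rightarrow> complex" and g t and St :: "'b::real_normed_vector set" and rho x0 sg
  assumes mono: "monodromy_setup a g t St rho x0 sg"
begin

lemma finite_chart:
  assumes x: "x \<in> St" "rho x \<noteq> rinf" and e: "e > 0"
  obtains r N S where "r > 0" "r \<le> e" "openin (top_of_set St) N" "x \<in> N" "continuous_on (ball (to_plane (rho x)) r) S"
    "\<And>w. w \<in> ball (to_plane (rho x)) r \<Longrightarrow> S w \<in> N \<and> rho (S w) = of_plane w \<and> w \<notin> a ` {1..4}"
    "\<And>x'. x' \<in> N \<Longrightarrow> rho x' \<noteq> rinf \<and> to_plane (rho x') \<in> ball (to_plane (rho x)) r \<and> S (to_plane (rho x')) = x'"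
proof -
  let ?P = "punctured_sphere a" and ?c = "to_plane (rho x)"
  let ?V = "?P - {rinf}"
  have rs: "rho x \<in> rsphere" by (rule rho_mem_rsphere[OF mono x(1)])
  have op: "of_plane ?c = rho x" by (rule of_plane_to_plane[OF rs x(2)])
  have oV: "openin (top_of_set ?P) ?V"
    unfolding openin_open by (intro exI[of _ "- {rinf}"]) auto
  have opl: "open (- (a ` {1..4}))" by (simp add: open_Compl finite_imp_closed)
  have ca: "?c \<in> - (a ` {1..4})"
  proof -
    have "of_plane ?c \<notin> of_plane ` a ` {1..4}"
      using rho_mem[OF mono x(1)] op by (simp add: punctured_sphere_def)
    then show ?thesis by blast
  qed
  obtain r1 where r1: "r1 > 0" "ball ?c r1 \<subseteq> - (a ` {1..4})"
    using opl ca open_contains_ball by blast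
  define r0 where "r0 = min e r1"
  have r0: "r0 > 0" "ball ?c r0 \<subseteq> - (a ` {1..4})" using r1 e by (auto simp: r0_def)
  have iV: "of_plane w \<in> ?V" if "w \<in> ball ?c r0" for w
    using that r0(2) of_plane_neq_rinf by (auto simp: punctured_sphere_def of_plane_rsphere of_plane_inj)
  have "?V \<subseteq> {s. snd s \<noteq> 1}"
    using rsphere_snd_1 unfolding punctured_sphere_def by blast
  then have cV: "continuous_on ?V to_plane"
    by (rule continuous_on_subset[OF continuous_on_to_plane])
  have inv: "of_plane (to_plane s) = s" if "s \<in> ?V" for s
    using that by (intro of_plane_to_plane) (auto simp: punctured_sphere_def)
  show thesis
  proof (rule covering_chart[OF setup_covering[OF mono] x(1) continuous_on_of_plane op r0(1) iV oV cV inv to_plane_of_plane])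
    fix r N S
    assume "r > 0" and r: "r \<le> r0" and N: "openin (top_of_set St) N" "x \<in> N" "continuous_on (ball ?c r) S"
      and S: "\<And>w. w \<in> ball ?c r \<Longrightarrow> S w \<in> N \<and> rho (S w) = of_plane w"
      and j: "\<And>x'. x' \<in> N \<Longrightarrow> rho x' \<in> ?V \<and> to_plane (rho x') \<in> ball ?c r \<and> S (to_plane (rho x')) = x'"
    have re: "r \<le> e" using r by (simp add: r0_def)
    show thesis
    proof (rule that[OF \<open>r > 0\<close> re N])
      show "S w \<in> N \<and> rho (S w) = of_plane w \<and> w \<notin> a ` {1..4}" if "w \<in> ball ?c r" for w
      proof -
        have "w \<in> ball ?c r0" using that r by auto
        then show ?thesis using S[OF that] r0(2) by blast
      qed
      show "rho x' \<noteq> rinf \<and> to_plane (rho x') \<in> ball ?c r \<and> S (to_plane (rho x')) = x'" if "x' \<in> N" for x'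
        using j[OF that] by blast
    qed
  qed
qed

lemma infinite_chart:
  assumes x: "x \<in> St" "rho x = rinf" and e: "e > 0"
  obtains r N S where "r > 0" "r \<le> e" "\<And>w. w \<in> ball 0 r \<Longrightarrow> w \<noteq> 0 \<Longrightarrow> 1 / w \<notin> a ` {1..4}"
    "openin (top_of_set St) N" "x \<in> N" "continuous_on (ball 0 r) S"
    "\<And>w. w \<in> ball 0 r \<Longrightarrow> S w \<in> N \<and> rho (S w) = inv_chart w"
    "\<And>x'. x' \<in> N \<Longrightarrow> pole_chart 0 (rho x') \<in> ball 0 r \<and> S (pole_chart 0 (rho x')) = x'"
proof -
  let ?P = "punctured_sphere a"
  \<comment> \<open>By \<open>1 / 0 = 0\<close> the coordinate \<open>pole_chart 0\<close> takes the
    value 0 at the origin as well as at infinity, so the origin has to be removed.\<close>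
  let ?V = "?P - {of_plane 0}"
  obtain R where R: "R > 0" "\<And>z. z \<in> a ` {1..4} \<Longrightarrow> cmod z \<le> R"
    using finite_imp_bounded[of "a ` {1..4}"] by (auto simp: bounded_pos)
  have oV: "openin (top_of_set ?P) ?V"
    unfolding openin_open by (intro exI[of _ "- {of_plane 0}"]) auto
  have i0: "inv_chart 0 = rho x" by (simp add: inv_chart_def x)
  define r0 where "r0 = min e (1 / R)"
  have nin: "1 / w \<notin> a ` {1..4}" if "w \<in> ball 0 r0" "w \<noteq> 0" for w
  proof
    assume "1 / w \<in> a ` {1..4}"
    then have "cmod (1 / w) \<le> R" by (rule R(2))
    then show False using that R(1) by (simp add: r0_def norm_divide field_simps)
  qed
  have iV: "inv_chart w \<in> ?V" if w: "w \<in> ball 0 r0" for w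
  proof (cases "w = 0")
    case True
    then show ?thesis using rho_mem[OF mono x(1)] of_plane_neq_rinf[of 0] x by (auto simp: inv_chart_def)
  next
    case False
    then have "of_plane (1 / w) \<notin> of_plane ` a ` {1..4}" "of_plane (1 / w) \<noteq> of_plane 0"
      using nin[OF w] by (auto simp: of_plane_inj image_iff)
    then show ?thesis using False by (simp add: inv_chart_def punctured_sphere_def of_plane_rsphere)
  qed
  have cV: "continuous_on ?V (pole_chart 0)"
    by (rule continuous_on_subset[OF continuous_on_pole_chart]) (auto simp: punctured_sphere_def)
  have inv: "inv_chart (pole_chart 0 s) = s" if "s \<in> ?V" for s
  proof -
    have "inv_chart = inv_pole_chart 0" by (auto simp: inv_chart_def inv_pole_chart_def)
    moreover have "s \<in> rsphere" "s \<noteq> of_plane 0" using that unfolding punctured_sphere_def by blast+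
    ultimately show ?thesis by (metis inv_pole_chart_pole_chart)
  qed
  have inv2: "pole_chart 0 (inv_chart w) = w" for w
    using of_plane_neq_rinf by (auto simp: inv_chart_def pole_chart_def)
  have r0: "r0 > 0" using R(1) e by (simp add: r0_def)
  show thesis
  proof (rule covering_chart[OF setup_covering[OF mono] x(1) continuous_on_inv_chart i0 r0 iV oV cV inv inv2])
    fix r N S
    assume "r > 0" and r: "r \<le> r0" and N: "openin (top_of_set St) N" "x \<in> N" "continuous_on (ball 0 r) S"
      and S: "\<And>w. w \<in> ball 0 r \<Longrightarrow> S w \<in> N \<and> rho (S w) = inv_chart w"
      and j: "\<And>x'. x' \<in> N \<Longrightarrow> rho x' \<in> ?V \<and> pole_chart 0 (rho x') \<in> ball 0 r \<and> S (pole_chart 0 (rho x')) = x'"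
    have re: "r \<le> e" using r by (simp add: r0_def)
    show thesis
    proof (rule that[OF \<open>r > 0\<close> re _ N S j[THEN conjunct2]])
      show "1 / w \<notin> a ` {1..4}" if "w \<in> ball 0 r" "w \<noteq> 0" for w
        using nin[of w] that r by auto
    qed
  qed
qed

lemma pole_chart_tendsto:
  assumes "x \<in> St" "rho x = rinf" shows "((\<lambda>x. pole_chart 0 (rho x)) \<longlongrightarrow> 0) (at x within St)"
proof -
  let ?V = "{y \<in> St. rho y \<noteq> of_plane 0}"
  have xV: "x \<in> ?V" using assms of_plane_neq_rinf[of 0] by auto
  have "continuous_on ?V (\<lambda>x. pole_chart 0 (rho x))"
    by (rule continuous_on_compose2[OF continuous_on_pole_chart continuous_on_subset[OF rho_continuous[OF mono]]])
      (use rho_mem_rsphere[OF mono] in auto)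
  then have "((\<lambda>x. pole_chart 0 (rho x)) \<longlongrightarrow> pole_chart 0 (rho x)) (at x within ?V)" using xV by (simp add: continuous_on_def)
  moreover have "pole_chart 0 (rho x) = 0" using assms by (simp add: pole_chart_def)
  moreover have "at x within ?V = at x within St"
  proof -
    have "openin (top_of_set St) (St \<inter> rho -` (- {of_plane 0}))"
      by (rule continuous_openin_preimage_gen[OF rho_continuous[OF mono]]) auto
    then obtain O' where O: "open O'" "St \<inter> rho -` (- {of_plane 0}) = St \<inter> O'" by (auto simp: openin_open)
    have "x \<in> O'" using O(2) xV by blast
    moreover have "?V \<inter> O' - {x} = St \<inter> O' - {x}" using O(2) by blast
    ultimately show ?thesis using O(1) by (intro at_within_nhd[of x O'])
  qed
  ultimately show ?thesis by simp
qed

lemma pole_chart_nonzero: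
  assumes x: "x \<in> St" "rho x = rinf"
  shows "\<forall>\<^sub>F y in at x within St. pole_chart 0 (rho y) \<noteq> 0"
proof -
  obtain r N S where N: "openin (top_of_set St) N" "x \<in> N"
    "\<And>x'. x' \<in> N \<Longrightarrow> pole_chart 0 (rho x') \<in> ball 0 r \<and> S (pole_chart 0 (rho x')) = x'"
    by (rule infinite_chart[OF x zero_less_one]) blast
  obtain O' where O: "open O'" "N = St \<inter> O'" using N(1) by (auto simp: openin_open)
  have "\<forall>\<^sub>F y in at x within St. y \<in> O' \<and> y \<noteq> x \<and> y \<in> St"
    using O N(2) by (auto simp: eventually_at_filter eventually_nhds)
  then show ?thesis
  proof eventually_elim
    case (elim y)
    then have "y \<in> N" using O(2) by auto
    moreover have "pole_chart 0 (rho x) = 0" using x by (simp add: pole_chart_def)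
    ultimately show ?case using elim N(2,3) by metis
  qed
qed

lemma finite_coord:
  assumes x: "x \<in> finite_part St rho"
  shows "((\<lambda>y. to_plane (rho y)) \<longlongrightarrow> to_plane (rho x)) (at x within finite_part St rho)"
    and "\<forall>\<^sub>F y in at x within finite_part St rho. to_plane (rho y) \<noteq> to_plane (rho x)"
proof -
  have xS: "x \<in> St" "rho x \<noteq> rinf" using x by (auto simp: finite_part_def)
  have "continuous_on (finite_part St rho) (\<lambda>y. to_plane (rho y))"
    by (rule continuous_on_compose2[OF continuous_on_to_plane continuous_on_subset[OF rho_continuous[OF mono]]])
      (auto simp: finite_part_def rsphere_snd_1 rho_mem_rsphere[OF mono])
  then show "((\<lambda>y. to_plane (rho y)) \<longlongrightarrow> to_plane (rho x)) (at x within finite_part St rho)"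
    using x by (simp add: continuous_on_def)
  obtain r N S where N: "openin (top_of_set St) N" "x \<in> N"
    "\<And>x'. x' \<in> N \<Longrightarrow> rho x' \<noteq> rinf \<and> to_plane (rho x') \<in> ball (to_plane (rho x)) r \<and> S (to_plane (rho x')) = x'"
    by (rule finite_chart[OF xS zero_less_one]) blast
  obtain O' where O: "open O'" "N = St \<inter> O'" using N(1) by (auto simp: openin_open)
  have "\<forall>\<^sub>F y in at x within finite_part St rho. y \<in> O' \<and> y \<noteq> x \<and> y \<in> finite_part St rho"
    using O N(2) by (auto simp: eventually_at_filter eventually_nhds)
  then show "\<forall>\<^sub>F y in at x within finite_part St rho. to_plane (rho y) \<noteq> to_plane (rho x)"
  proof eventually_elim
    case (elim y)
    then have "y \<in> N" using O(2) by (auto simp: finite_part_def)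
    then show ?case using elim N(2,3) by metis
  qed
qed

end

section \<open>Singular points of second order equations\<close>

text \<open>If the coefficients extended analytically, \<open>r1 b\<close> and \<open>r2 b\<close>
  would vanish. The exponents would then be 0 and 1, against the assumption that they do not differ
  by 1; hence the point is a true singularity.\<close>

lemma fuchsian_with_exponentsI:
  assumes r: "r1 analytic_on {b}" "r2 analytic_on {b}"
    and q: "\<forall>\<^sub>F z in at b. q1 z = r1 z / (z - b) \<and> q2 z = r2 z / (z - b)\<^sup>2"
    and val: "r1 b = 1 - (x + y)" "r2 b = x * y" and res: "x - y \<noteq> 1" "y - x \<noteq> 1"
  shows "fuchsian_with_exponents q1 q2 b x y"
proof -
  have "ode_singular_at q1 q2 b"
    unfolding ode_singular_at_def
  proof
    assume "\<exists>h1 h2. h1 analytic_on {b} \<and> h2 analytic_on {b} \<and> (\<forall>\<^sub>F z in at b. q1 z = h1 z \<and> q2 z = h2 z)"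
    then obtain h1 h2 where h: "h1 analytic_on {b}" "h2 analytic_on {b}"
      and ev: "\<forall>\<^sub>F z in at b. q1 z = h1 z \<and> q2 z = h2 z" by blast
    have lim: "(f \<longlongrightarrow> f b) (at b)" if "f analytic_on {b}" for f :: "complex \<Rightarrow> complex"
      using analytic_at_imp_isCont[OF that] by (simp add: isCont_def)
    have ne: "\<forall>\<^sub>F z in at b. z \<noteq> b" by (rule eventually_neq_at_within)
    have "((\<lambda>z. (z - b) * h1 z) \<longlongrightarrow> (b - b) * h1 b) (at b)" by (intro tendsto_intros lim h)
    then have "(r1 \<longlongrightarrow> 0) (at b)"
    proof (simp, elim Lim_transform_eventually)
      show "\<forall>\<^sub>F z in at b. (z - b) * h1 z = r1 z"
        using ev q ne
      proof eventually_elim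
        case (elim z)
        then have "h1 z = r1 z / (z - b)" "z - b \<noteq> 0" by auto
        then show ?case by simp
      qed
    qed
    then have 1: "r1 b = 0" using lim[OF r(1)] by (metis tendsto_unique trivial_limit_at)
    have "((\<lambda>z. (z - b)\<^sup>2 * h2 z) \<longlongrightarrow> (b - b)\<^sup>2 * h2 b) (at b)" by (intro tendsto_intros lim h)
    then have "(r2 \<longlongrightarrow> 0) (at b)"
    proof (simp, elim Lim_transform_eventually)
      show "\<forall>\<^sub>F z in at b. (z - b)\<^sup>2 * h2 z = r2 z"
        using ev q ne
      proof eventually_elim
        case (elim z)
        then have "h2 z = r2 z / (z - b)\<^sup>2" "z - b \<noteq> 0" by auto
        then show ?case by simp
      qed
    qed
    then have 2: "r2 b = 0" using lim[OF r(2)] by (metis tendsto_unique trivial_limit_at)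
    have "x = 0 \<or> y = 0" "x + y = 1" using 1 2 val by (auto simp: algebra_simps)
    then show False using res by auto
  qed
  moreover have "\<forall>X. X * (X - 1) + r1 b * X + r2 b = (X - x) * (X - y)"
    unfolding val by (simp add: algebra_simps)
  ultimately show ?thesis unfolding fuchsian_with_exponents_def using r q by blast
qed

text \<open>Two solutions determine the coefficients by Cramer's rule: \<open>Q1\<close> and
  \<open>Q2\<close> are quotients with the Wronskian as denominator, which are analytic where it
  does not vanish.\<close>

lemma not_ode_singular_at_solutions:
  assumes r: "r > 0" and u: "u1 holomorphic_on ball b r" "u2 holomorphic_on ball b r"
    and wr: "u1 b * deriv u2 b - u2 b * deriv u1 b \<noteq> 0"
    and eq: "\<And>w. w \<in> ball b r - {b} \<Longrightarrow> deriv (deriv u1) w + Q1 w * deriv u1 w + Q2 w * u1 w = 0"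
      "\<And>w. w \<in> ball b r - {b} \<Longrightarrow> deriv (deriv u2) w + Q1 w * deriv u2 w + Q2 w * u2 w = 0"
  shows "\<not> ode_singular_at Q1 Q2 b"
proof -
  have bb: "b \<in> ball b r" using r by simp
  have an: "f analytic_on {b}" if "f holomorphic_on ball b r" for f
    using that bb analytic_at open_ball by blast
  note d = holomorphic_deriv[OF u(1) open_ball] holomorphic_deriv[OF u(2) open_ball]
  note dd = holomorphic_deriv[OF d(1) open_ball] holomorphic_deriv[OF d(2) open_ball]
  define wro where "wro = (\<lambda>w. u1 w * deriv u2 w - u2 w * deriv u1 w)"
  have wroh: "wro holomorphic_on ball b r" unfolding wro_def by (intro holomorphic_intros u d)
  have a1: "(\<lambda>w. - (u1 w * deriv (deriv u2) w - u2 w * deriv (deriv u1) w) / wro w) analytic_on {b}"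
    using wr by (intro analytic_intros an u d dd wroh) (auto simp: wro_def)
  have a2: "(\<lambda>w. (deriv u1 w * deriv (deriv u2) w - deriv u2 w * deriv (deriv u1) w) / wro w) analytic_on {b}"
    using wr by (intro analytic_intros an u d dd wroh) (auto simp: wro_def)
  have "(wro \<longlongrightarrow> wro b) (at b)"
    using analytic_at_imp_isCont[OF an[OF wroh]] by (simp add: isCont_def)
  then have "\<forall>\<^sub>F w in at b. wro w \<noteq> 0"
    by (rule tendsto_imp_eventually_ne) (use wr in \<open>simp add: wro_def\<close>)
  moreover have "\<forall>\<^sub>F w in at b. w \<in> ball b r \<and> w \<noteq> b"
    using bb by (intro eventually_conj eventually_at_in_open' eventually_neq_at_within) auto
  ultimately have "\<forall>\<^sub>F w in at b. Q1 w = - (u1 w * deriv (deriv u2) w - u2 w * deriv (deriv u1) w) / wro w \<and>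
      Q2 w = (deriv u1 w * deriv (deriv u2) w - deriv u2 w * deriv (deriv u1) w) / wro w"
  proof eventually_elim
    case (elim w)
    then have w: "w \<in> ball b r - {b}" by auto
    have e1: "deriv (deriv u1) w = - Q1 w * deriv u1 w - Q2 w * u1 w"
      and e2: "deriv (deriv u2) w = - Q1 w * deriv u2 w - Q2 w * u2 w"
      using eq(1)[OF w] eq(2)[OF w] by (simp_all add: eq_neg_iff_add_eq_0 algebra_simps)
    have "Q1 w * wro w = - (u1 w * deriv (deriv u2) w - u2 w * deriv (deriv u1) w)"
      "Q2 w * wro w = (deriv u1 w * deriv (deriv u2) w - deriv u2 w * deriv (deriv u1) w)"
      unfolding wro_def e1 e2 by (simp_all add: algebra_simps)
    then show ?case using elim by (simp add: field_simps)
  qed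
  then show ?thesis unfolding ode_singular_at_def using a1 a2 by blast
qed

section \<open>Fundamental solutions in plane domains\<close>

lemma system_solution_plane:
  assumes U: "open U" and Y: "system_solution U (\<lambda>z. z) A Y" and z: "z \<in> U"
  shows "((\<lambda>z. Y z $ i $ j) has_field_derivative (A z ** Y z) $ i $ j) (at z)" "invertible (Y z)"
  using has_coord_deriv_imp_field_derivative[OF U z, of "\<lambda>z. z" 1] Y z
  by (fastforce simp: system_solution_def)+

text \<open>The entries of \<open>Y^(-1) X\<close> have the Cramer numerators \<open>n j\<close>,
  \<open>m j\<close> and the denominator \<open>D\<close>. By Liouville's formula all of them
  satisfy the same scalar equation, with the trace of \<open>A\<close> as coefficient, so the ratios
  are constant.\<close>

lemma fundamental_solution_unique:
  fixes A X Y :: "complex \<Rightarrow> complex^2^2"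
  assumes U: "open U" "connected U"
    and Y: "\<And>z i j. z \<in> U \<Longrightarrow> ((\<lambda>z. Y z $ i $ j) has_field_derivative (A z ** Y z) $ i $ j) (at z)"
      "\<And>z. z \<in> U \<Longrightarrow> invertible (Y z)"
    and X: "\<And>z i j. z \<in> U \<Longrightarrow> ((\<lambda>z. X z $ i $ j) has_field_derivative (A z ** X z) $ i $ j) (at z)"
  obtains C where "\<And>z. z \<in> U \<Longrightarrow> X z = Y z ** (C :: complex^2^2)"
proof -
  define D where "D = (\<lambda>z. Y z $ 1 $ 1 * Y z $ 2 $ 2 - Y z $ 1 $ 2 * Y z $ 2 $ 1)"
  let ?tr = "\<lambda>z. A z $ 1 $ 1 + A z $ 2 $ 2"
  have D0: "D z \<noteq> 0" if "z \<in> U" for z using Y(2)[OF that] by (simp add: D_def det_nz_iff)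
  have dD: "(D has_field_derivative ?tr z * D z) (at z)" if z: "z \<in> U" for z
    unfolding D_def
    by (rule DERIV_cong[OF DERIV_diff[OF DERIV_mult[OF Y(1)[OF z] Y(1)[OF z]] DERIV_mult[OF Y(1)[OF z] Y(1)[OF z]]]])
      (simp add: mult2_nth algebra_simps)
  define n where "n = (\<lambda>j z. Y z $ 2 $ 2 * X z $ 1 $ j - Y z $ 1 $ 2 * X z $ 2 $ j)"
  define m where "m = (\<lambda>j z. Y z $ 1 $ 1 * X z $ 2 $ j - Y z $ 2 $ 1 * X z $ 1 $ j)"
  have dn: "(n j has_field_derivative ?tr z * n j z) (at z)" if z: "z \<in> U" for z j
    unfolding n_def
    by (rule DERIV_cong[OF DERIV_diff[OF DERIV_mult[OF Y(1)[OF z] X[OF z]] DERIV_mult[OF Y(1)[OF z] X[OF z]]]])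
      (simp add: mult2_nth algebra_simps)
  have dm: "(m j has_field_derivative ?tr z * m j z) (at z)" if z: "z \<in> U" for z j
    unfolding m_def
    by (rule DERIV_cong[OF DERIV_diff[OF DERIV_mult[OF Y(1)[OF z] X[OF z]] DERIV_mult[OF Y(1)[OF z] X[OF z]]]])
      (simp add: mult2_nth algebra_simps)
  have "\<exists>k. \<forall>z\<in>U. n j z = k * D z" for j by (rule linear_ode_ratio[OF U dn dD D0])
  then obtain kn where kn: "\<And>j z. z \<in> U \<Longrightarrow> n j z = kn j * D z" by metis
  have "\<exists>k. \<forall>z\<in>U. m j z = k * D z" for j by (rule linear_ode_ratio[OF U dm dD D0])
  then obtain km where km: "\<And>j z. z \<in> U \<Longrightarrow> m j z = km j * D z" by metis
  let ?C = "\<chi> i j. if i = 1 then kn j else km j :: complex^2^2"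
  have "X z = Y z ** ?C" if z: "z \<in> U" for z
  proof -
    have "X z $ 1 $ j * D z = (Y z $ 1 $ 1 * kn j + Y z $ 1 $ 2 * km j) * D z"
      "X z $ 2 $ j * D z = (Y z $ 2 $ 1 * kn j + Y z $ 2 $ 2 * km j) * D z" for j
      using kn[OF z, of j] km[OF z, of j] by (simp_all add: D_def n_def m_def) algebra+
    then show ?thesis using D0[OF z] by (simp add: mat2_eq_iff mult2_nth)
  qed
  then show ?thesis by (rule that)
qed

lemma connected_outside_disc: "connected {z. cmod z > r}"
proof -
  have "{z. cmod z > r} = - cball 0 r" by auto
  then show ?thesis by (simp add: connected_complement_bounded_convex)
qed

lemma open_outside_disc: "open {z. cmod z > r}"
  by (intro open_Collect_less continuous_intros)

section \<open>From the system to a scalar equation\<close>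

text \<open>\<open>(z - b)^s\<close> times the second entry of a solution of \<open>Y' = A Y\<close> satisfies
  \<open>y'' + scalar_q1 y' + scalar_q2 y = 0\<close>; its derivative is
  \<open>scalar_alpha\<close> times the first plus \<open>scalar_beta\<close> times the second entry.\<close>

definition logder :: "(complex \<Rightarrow> complex^2^2) \<Rightarrow> complex \<Rightarrow> complex" where
  "logder A z = deriv (\<lambda>z. A z $ 2 $ 1) z / A z $ 2 $ 1"

definition scalar_q1 :: "(complex \<Rightarrow> complex^2^2) \<Rightarrow> int \<Rightarrow> complex \<Rightarrow> complex \<Rightarrow> complex" where
  "scalar_q1 A s b z = - (logder A z + A z $ 1 $ 1 + A z $ 2 $ 2) - 2 * (of_int s / (z - b))"

definition scalar_q2 :: "(complex \<Rightarrow> complex^2^2) \<Rightarrow> int \<Rightarrow> complex \<Rightarrow> complex \<Rightarrow> complex" where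
  "scalar_q2 A s b z = A z $ 1 $ 1 * A z $ 2 $ 2 + logder A z * A z $ 2 $ 2 - A z $ 1 $ 2 * A z $ 2 $ 1
     - deriv (\<lambda>z. A z $ 2 $ 2) z + of_int s / (z - b) * (logder A z + A z $ 1 $ 1 + A z $ 2 $ 2)
     + of_int s * (of_int s + 1) / (z - b)\<^sup>2"

definition scalar_alpha :: "(complex \<Rightarrow> complex^2^2) \<Rightarrow> int \<Rightarrow> complex \<Rightarrow> complex \<Rightarrow> complex" where
  "scalar_alpha A s b z = (z - b) powi s * A z $ 2 $ 1"

definition scalar_beta :: "(complex \<Rightarrow> complex^2^2) \<Rightarrow> int \<Rightarrow> complex \<Rightarrow> complex \<Rightarrow> complex" where
  "scalar_beta A s b z = (z - b) powi s * (A z $ 2 $ 2 + of_int s / (z - b))"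

lemma powi_shift_derivative:
  "z \<noteq> b \<Longrightarrow> ((\<lambda>z::complex. (z - b) powi s) has_field_derivative (z - b) powi s * (of_int s / (z - b))) (at z)"
proof -
  assume z: "z \<noteq> b"
  have "((\<lambda>z. z - b) has_field_derivative 1) (at z)" by (auto intro!: derivative_eq_intros)
  from DERIV_chain2[where f = "\<lambda>z. z powi s" and g = "\<lambda>z. z - b" and x = z and s = UNIV,
      OF powi_has_field_derivative this] z
  show ?thesis by (simp add: mult.commute)
qed

context
  fixes A :: "complex \<Rightarrow> complex^2^2" and S :: "complex set" and s :: int and b :: complex
  assumes S: "open S" and A: "matrix_holomorphic_on A S" and nz: "\<forall>z\<in>S. A z $ 2 $ 1 \<noteq> 0"
    and b: "b \<notin> S"
begin

lemma A21: "z \<in> S \<Longrightarrow> A z $ 2 $ 1 \<noteq> 0"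
  using nz by blast

lemma A_derivative:
  assumes "z \<in> S"
  shows "((\<lambda>z. A z $ i $ j) has_field_derivative deriv (\<lambda>z. A z $ i $ j) z) (at z)"
  using holomorphic_derivI[OF matrix_holomorphic_onD[OF A] S assms] .

lemma scalar_q_holomorphic: "scalar_q1 A s b holomorphic_on S" "scalar_q2 A s b holomorphic_on S"
proof -
  have l: "logder A holomorphic_on S"
    unfolding logder_def
    by (intro holomorphic_intros holomorphic_deriv[OF _ S] matrix_holomorphic_onD[OF A] A21)
  show "scalar_q1 A s b holomorphic_on S" "scalar_q2 A s b holomorphic_on S"
    unfolding scalar_q1_def scalar_q2_def using b
    by (intro holomorphic_intros holomorphic_deriv[OF _ S] matrix_holomorphic_onD[OF A] l; auto)+
qed

text \<open>Comparison of the coefficients of the first entry of the solution in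
  \<open>y'' = - q1 y' - q2 y\<close>. As \<open>y\<close> itself contains only the second entry,
  \<open>q2\<close> is absent here; the second entry gives the companion identity for
  \<open>scalar_beta\<close>.\<close>

lemma scalar_alpha_derivative:
  assumes z: "z \<in> S"
  shows "(scalar_alpha A s b has_field_derivative
    - scalar_q1 A s b z * scalar_alpha A s b z - scalar_alpha A s b z * A z $ 1 $ 1 - scalar_beta A s b z * A z $ 2 $ 1) (at z)"
proof -
  have zb: "z \<noteq> b" using z b by auto
  have "deriv (\<lambda>z. A z $ 2 $ 1) z = logder A z * A z $ 2 $ 1"
    using A21[OF z] by (simp add: logder_def)
  note d = DERIV_mult[OF powi_shift_derivative[OF zb, of s] A_derivative[OF z, of 2 1], unfolded this]
  show ?thesis
    unfolding scalar_alpha_def by (rule DERIV_cong[OF d])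
      (simp add: scalar_q1_def scalar_beta_def algebra_simps)
qed

lemma scalar_beta_derivative:
  assumes z: "z \<in> S"
  shows "(scalar_beta A s b has_field_derivative
    - scalar_q1 A s b z * scalar_beta A s b z - scalar_q2 A s b z * (z - b) powi s
      - scalar_alpha A s b z * A z $ 1 $ 2 - scalar_beta A s b z * A z $ 2 $ 2) (at z)"
proof -
  have zb: "z \<noteq> b" using z b by auto
  have di: "((\<lambda>z. of_int s / (z - b)) has_field_derivative - (of_int s / (z - b)\<^sup>2)) (at z)"
    using zb by (auto intro!: derivative_eq_intros simp: power2_eq_square)
  note d = DERIV_mult[OF powi_shift_derivative[OF zb, of s] DERIV_add[OF A_derivative[OF z, of 2 2] di]]
  have e: "of_int s * (of_int s + 1) / (z - b)\<^sup>2 = (of_int s / (z - b))\<^sup>2 + of_int s / (z - b)\<^sup>2"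
    by (simp add: power2_eq_square add_divide_distrib algebra_simps)
  show ?thesis
    unfolding scalar_beta_def
    by (rule DERIV_cong[OF d], unfold scalar_q1_def scalar_q2_def scalar_alpha_def e)
      (simp only: power2_eq_square, algebra)
qed

text \<open>The surface \<open>X\<close> is left general because two cases occur: the finite part of
  the covering surface, and a plane neighbourhood of infinity.\<close>

lemma scalar_equation_solution:
  fixes j :: 2
  assumes Y: "system_solution X u A Y" and x: "x \<in> X" "u x \<in> S"
    and u: "(u \<longlongrightarrow> u x) (at x within X)" "\<forall>\<^sub>F y in at x within X. u y \<noteq> u x"
  defines "y \<equiv> \<lambda>y. (u y - b) powi s * Y y $ 2 $ j"
    and "yd \<equiv> \<lambda>y. scalar_alpha A s b (u y) * Y y $ 1 $ j + scalar_beta A s b (u y) * Y y $ 2 $ j"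
  shows "has_coord_deriv X u y (yd x) x"
    and "has_coord_deriv X u yd (- scalar_q1 A s b (u x) * yd x - scalar_q2 A s b (u x) * y x) x"
proof -
  have ub: "u x \<noteq> b" using x b by auto
  have Yd: "has_coord_deriv X u (\<lambda>y. Y y $ i $ j) ((A (u x) ** Y x) $ i $ j) x" for i
    using Y x by (auto simp: system_solution_def)
  show "has_coord_deriv X u y (yd x) x"
    using has_coord_deriv_mult_coord[OF Yd[of 2] powi_shift_derivative[OF ub, of s] u]
    by (simp add: y_def yd_def scalar_alpha_def scalar_beta_def mult2_nth algebra_simps)
  have "has_coord_deriv X u yd
     ((- scalar_q1 A s b (u x) * scalar_alpha A s b (u x) - scalar_alpha A s b (u x) * A (u x) $ 1 $ 1 - scalar_beta A s b (u x) * A (u x) $ 2 $ 1) * Y x $ 1 $ j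
       + scalar_alpha A s b (u x) * (A (u x) ** Y x) $ 1 $ j +
      ((- scalar_q1 A s b (u x) * scalar_beta A s b (u x) - scalar_q2 A s b (u x) * (u x - b) powi s
      - scalar_alpha A s b (u x) * A (u x) $ 1 $ 2 - scalar_beta A s b (u x) * A (u x) $ 2 $ 2) * Y x $ 2 $ j
       + scalar_beta A s b (u x) * (A (u x) ** Y x) $ 2 $ j)) x"
    unfolding yd_def
    by (intro has_coord_deriv_add has_coord_deriv_mult_coord Yd scalar_alpha_derivative scalar_beta_derivative x u)
  moreover have "((- scalar_q1 A s b (u x) * scalar_alpha A s b (u x) - scalar_alpha A s b (u x) * A (u x) $ 1 $ 1 - scalar_beta A s b (u x) * A (u x) $ 2 $ 1) * Y x $ 1 $ j
       + scalar_alpha A s b (u x) * (A (u x) ** Y x) $ 1 $ j +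
      ((- scalar_q1 A s b (u x) * scalar_beta A s b (u x) - scalar_q2 A s b (u x) * (u x - b) powi s
      - scalar_alpha A s b (u x) * A (u x) $ 1 $ 2 - scalar_beta A s b (u x) * A (u x) $ 2 $ 2) * Y x $ 2 $ j
       + scalar_beta A s b (u x) * (A (u x) ** Y x) $ 2 $ j))
     = - scalar_q1 A s b (u x) * yd x - scalar_q2 A s b (u x) * y x"
    unfolding mult2_nth yd_def y_def by (simp add: algebra_simps)
  ultimately show "has_coord_deriv X u yd (- scalar_q1 A s b (u x) * yd x - scalar_q2 A s b (u x) * y x) x"
    by simp
qed

text \<open>\<open>nu\<close>, \<open>si\<close> and \<open>ta\<close> are the terms of the
  coefficients after multiplication by the appropriate power of \<open>z - c\<close>. The value
  \<open>nu c = -1\<close> reflects a simple pole of the lower left entry. The indicial polynomial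
  then is the characteristic polynomial of the residue shifted by \<open>si c\<close>, which covers
  both \<open>c = b\<close> and \<open>c \<noteq> b\<close>.\<close>

lemma scalar_fuchsian:
  assumes d: "d > 0" "ball c d - {c} \<subseteq> S" and H: "matrix_holomorphic_on H (ball c d)"
      "\<And>z. z \<in> ball c d - {c} \<Longrightarrow> H z = mat (z - c) ** A z"
    and nu: "nu holomorphic_on ball c d" "nu c = -1" "\<And>z. z \<in> ball c d - {c} \<Longrightarrow> logder A z = nu z / (z - c)"
    and si: "si holomorphic_on ball c d" "\<And>z. z \<in> ball c d - {c} \<Longrightarrow> of_int s / (z - b) = si z / (z - c)"
    and ta: "ta holomorphic_on ball c d" "ta c = si c * (si c + 1)"
      "\<And>z. z \<in> ball c d - {c} \<Longrightarrow> of_int s * (of_int s + 1) / (z - b)\<^sup>2 = ta z / (z - c)\<^sup>2"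
    and e: "eigenvalue_pair (H c) x y" "x - y \<noteq> 1" "y - x \<noteq> 1"
  shows "fuchsian_with_exponents (scalar_q1 A s b) (scalar_q2 A s b) c (x + si c) (y + si c)"
proof (rule fuchsian_with_exponentsI)
  define r1 where "r1 = (\<lambda>z. - (nu z + H z $ 1 $ 1 + H z $ 2 $ 2) - 2 * si z)"
  define r2 where "r2 = (\<lambda>z. H z $ 1 $ 1 * H z $ 2 $ 2 + nu z * H z $ 2 $ 2 - H z $ 1 $ 2 * H z $ 2 $ 1
    - ((z - c) * deriv (\<lambda>z. H z $ 2 $ 2) z - H z $ 2 $ 2) + si z * (nu z + H z $ 1 $ 1 + H z $ 2 $ 2) + ta z)"
  have cb: "c \<in> ball c d" using d by simp
  have an: "f analytic_on {c}" if "f holomorphic_on ball c d" for f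
    using that cb analytic_at open_ball by blast
  note Hh = matrix_holomorphic_onD[OF H(1)]
  have "r1 holomorphic_on ball c d" "r2 holomorphic_on ball c d"
    unfolding r1_def r2_def
    by (intro holomorphic_intros nu si ta Hh holomorphic_deriv[OF Hh open_ball])+
  then show "r1 analytic_on {c}" "r2 analytic_on {c}" by (auto intro: an)
  have p: "x + y = H c $ 1 $ 1 + H c $ 2 $ 2" "x * y = H c $ 1 $ 1 * H c $ 2 $ 2 - H c $ 1 $ 2 * H c $ 2 $ 1"
    using e(1) by (auto simp: eigenvalue_pair_2)
  show "r1 c = 1 - (x + si c + (y + si c))" unfolding r1_def nu(2) using p(1) by (simp add: algebra_simps)
  show "r2 c = (x + si c) * (y + si c)" unfolding r2_def nu(2) ta(2) using p by (simp add: algebra_simps) algebra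
  show "x + si c - (y + si c) \<noteq> 1" "y + si c - (x + si c) \<noteq> 1" using e by auto
  have ev: "\<forall>\<^sub>F z in at c. z \<in> ball c d \<and> z \<noteq> c"
    using cb by (intro eventually_conj eventually_at_in_open' eventually_neq_at_within) auto
  show "\<forall>\<^sub>F z in at c. scalar_q1 A s b z = r1 z / (z - c) \<and> scalar_q2 A s b z = r2 z / (z - c)\<^sup>2"
    using ev
  proof eventually_elim
    case (elim z)
    then have z: "z \<in> ball c d - {c}" and zc: "z - c \<noteq> 0" by auto
    have Az: "A w $ i $ j = H w $ i $ j / (w - c)" if "w \<in> ball c d - {c}" for w i j
      using H(2)[OF that] that by (simp add: mat_mult_left)
    have op: "open (ball c d - {c})" by (simp add: open_Diff)
    have Hd: "((\<lambda>z. H z $ 2 $ 2) has_field_derivative deriv (\<lambda>z. H z $ 2 $ 2) z) (at z)"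
      using holomorphic_derivI[OF Hh open_ball] z by auto
    have "((\<lambda>z. H z $ 2 $ 2 / (z - c)) has_field_derivative
        (deriv (\<lambda>z. H z $ 2 $ 2) z / (z - c) - H z $ 2 $ 2 / (z - c)\<^sup>2)) (at z)"
      by (rule DERIV_cong[OF DERIV_divide[OF Hd DERIV_diff[OF DERIV_ident DERIV_const]]])
        (use zc in \<open>simp_all add: power2_eq_square diff_divide_distrib\<close>)
    then have "((\<lambda>z. A z $ 2 $ 2) has_field_derivative
        (deriv (\<lambda>z. H z $ 2 $ 2) z / (z - c) - H z $ 2 $ 2 / (z - c)\<^sup>2)) (at z)"
      by (rule has_field_derivative_transform_within_open[OF _ op z]) (simp add: Az)
    then have dA: "deriv (\<lambda>z. A z $ 2 $ 2) z = deriv (\<lambda>z. H z $ 2 $ 2) z / (z - c) - H z $ 2 $ 2 / (z - c)\<^sup>2"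
      by (rule DERIV_imp_deriv)
    have "scalar_q1 A s b z = r1 z / (z - c)"
      unfolding scalar_q1_def r1_def nu(3)[OF z] si(2)[OF z] Az[OF z]
      by (simp add: add_divide_distrib diff_divide_distrib)
    moreover have "scalar_q2 A s b z = r2 z / (z - c)\<^sup>2"
      unfolding scalar_q2_def r2_def nu(3)[OF z] si(2)[OF z] ta(3)[OF z] Az[OF z] dA
      using zc by (simp add: divide_simps) (simp add: power2_eq_square algebra_simps)
    ultimately show ?case by simp
  qed
qed

end

lemma power_int_shift: "z \<noteq> 0 \<Longrightarrow> (z - b) powi s * z powi (- s) = (1 - b * (1 / z)) powi s" for z b :: complex
proof -
  assume z: "z \<noteq> 0"
  have "(z - b) powi s = (z * (1 - b * (1 / z))) powi s" using z by (simp add: right_diff_distrib)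
  also have "\<dots> = z powi s * (1 - b * (1 / z)) powi s" by (rule power_int_mult_distrib)
  finally have "(z - b) powi s * z powi (- s) = (z powi s * z powi (- s)) * (1 - b * (1 / z)) powi s" by simp
  also have "z powi s * z powi (- s) = 1" using z by (simp flip: power_int_add)
  finally show ?thesis by simp
qed

lemma holomorphic_shifted_power:
  assumes "d > 0" "cmod b \<le> 1 / d" shows "(\<lambda>w. (1 - b * w) powi s) holomorphic_on ball 0 d"
proof -
  have nz: "1 - b * w \<noteq> 0" if w: "w \<in> ball 0 d" for w
  proof -
  have "cmod (b * w) < 1 / d * d"
  proof (cases "b = 0")
    case True
    then show ?thesis using assms(1) by simp
  next
    case False
    then show ?thesis unfolding norm_mult
      using w assms by (intro mult_le_less_imp_less) auto
  qed
  then have "cmod (b * w) < 1" using assms(1) by simp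
  then show ?thesis by auto
  qed
  show ?thesis by (intro holomorphic_intros) (use nz in auto)
qed

abbreviation diag_power :: "int \<Rightarrow> int \<Rightarrow> complex \<Rightarrow> complex^2^2" where
  "diag_power k1 k2 z \<equiv> vector [vector [z powi k1, 0], vector [0, z powi k2]]"

abbreviation shifted_row ::
    "('b \<Rightarrow> complex \<times> real) \<Rightarrow> complex \<Rightarrow> int \<Rightarrow> ('b \<Rightarrow> complex^2^2) \<Rightarrow> 2 \<Rightarrow> 'b \<Rightarrow> complex" where
  "shifted_row rho b s Y j x \<equiv> (to_plane (rho x) - b) powi s * Y x $ 2 $ j"

context
  fixes A :: "complex \<Rightarrow> complex^2^2" and a :: "nat \<Rightarrow> complex" and s :: int and b :: complex
    and d :: real and W B :: "complex \<Rightarrow> complex^2^2" and k1 :: int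
  assumes A: "matrix_holomorphic_on A (- a ` {1..4})" and A21: "\<And>z. z \<notin> a ` {1..4} \<Longrightarrow> A z $ 2 $ 1 \<noteq> 0"
    and b: "b \<in> a ` {1..4}" and d: "d > 0" "\<And>k. k \<in> {1..4} \<Longrightarrow> cmod (a k) \<le> 1 / d"
    and Winv: "\<And>w. w \<in> ball 0 d \<Longrightarrow> invertible (W w)"
    and Wd: "\<And>w i j. w \<in> ball 0 d \<Longrightarrow> ((\<lambda>w. W w $ i $ j) has_field_derivative (B w ** W w) $ i $ j) (at w)"
    and Yinf: "system_solution {z. cmod z > 1 / d} (\<lambda>z. z) A
       (\<lambda>z. diag_power k1 (- s) z ** W (1 / z))"
    and B21: "B 0 $ 2 $ 1 \<noteq> 0"
begin

lemma regular_set: "open (- a ` {1..4})" "b \<notin> - a ` {1..4}" "\<forall>z\<in>- a ` {1..4}. A z $ 2 $ 1 \<noteq> 0"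
  using b A21 by (auto simp: open_Compl finite_imp_closed)

lemma outer: "cmod z > 1 / d \<Longrightarrow> z \<in> - a ` {1..4}" "cmod z > 1 / d \<Longrightarrow> z \<noteq> 0"
  using d by force+

lemma b_bound: "cmod b \<le> 1 / d"
  using b d by auto

lemma W_holomorphic: "(\<lambda>w. W w $ i $ j) holomorphic_on ball 0 d"
  unfolding holomorphic_on_open[OF open_ball] using Wd by blast

lemma row_at_infinity:
  "z \<noteq> 0 \<Longrightarrow> (z - b) powi s * (diag_power k1 (- s) z ** W (1 / z)) $ 2 $ j = (1 - b * (1 / z)) powi s * W (1 / z) $ 2 $ j"
  using power_int_shift[of z b s] by (simp add: mult2_nth flip: mult.assoc)

text \<open>The lower index is \<open>- s\<close>, so its power of \<open>z\<close> cancels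
  \<open>(z - b) powi s\<close> up to the holomorphic factor \<open>(1 - b w) powi s\<close> with
  \<open>w = 1 / z\<close>. Hence both solutions are holomorphic at infinity. In their Wronskian at
  \<open>w = 0\<close> the derivative of that factor cancels, and \<open>- B 0 $ 2 $ 1\<close> times
  the determinant of \<open>W 0\<close> remains.\<close>

lemma scalar_not_singular_at_infinity: "\<not> ode_singular_at_infinity (scalar_q1 A s b) (scalar_q2 A s b)"
proof -
  let ?Yi = "\<lambda>z. diag_power k1 (- s) z ** W (1 / z)"
  define u where "u = (\<lambda>j w. (1 - b * w) powi s * W w $ 2 $ j)"
  have uh: "u j holomorphic_on ball 0 d" for j
    unfolding u_def by (intro holomorphic_intros holomorphic_shifted_power[OF d(1) b_bound] W_holomorphic)
  define y where "y = (\<lambda>j z. (z - b) powi s * ?Yi z $ 2 $ j)"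
  define yd where "yd = (\<lambda>j z. scalar_alpha A s b z * ?Yi z $ 1 $ j + scalar_beta A s b z * ?Yi z $ 2 $ j)"
  have uy: "u j w = y j (1 / w)" if "w \<noteq> 0" for j w
    using that row_at_infinity[of "1 / w" j] by (simp add: u_def y_def)
  have opX: "open {z. cmod z > 1 / d}" by (rule open_outside_disc)
  have dy: "(y j has_field_derivative yd j z) (at z)"
    "(yd j has_field_derivative (- scalar_q1 A s b z * yd j z - scalar_q2 A s b z * y j z)) (at z)"
    if z: "cmod z > 1 / d" for j z
  proof -
    let ?X = "{z. cmod z > 1 / d}"
    have zX: "z \<in> ?X" using z by simp
    have u: "((\<lambda>z. z) \<longlongrightarrow> z) (at z within ?X)" "\<forall>\<^sub>F y in at z within ?X. y \<noteq> z"
      by (auto simp: eventually_neq_at_within)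
    note e = scalar_equation_solution[OF regular_set(1) A regular_set(3) regular_set(2) Yinf zX outer(1)[OF z] u, where j = j and s = s]
    from e has_coord_deriv_imp_field_derivative[OF opX zX, of "\<lambda>z. z" 1]
    show "(y j has_field_derivative yd j z) (at z)"
      "(yd j has_field_derivative (- scalar_q1 A s b z * yd j z - scalar_q2 A s b z * y j z)) (at z)"
      unfolding y_def yd_def by (fastforce)+
  qed
  have op0: "open (ball 0 d - {0::complex})" by (simp add: open_Diff)
  have outw: "cmod (1 / w) > 1 / d" if "w \<in> ball 0 d - {0}" for w :: complex
    using that d by (auto simp: norm_divide field_simps)
  have invd: "((\<lambda>w. 1 / w) has_field_derivative - (1 / w\<^sup>2)) (at w)" if "w \<noteq> 0" for w :: complex
    using that by (auto intro!: derivative_eq_intros simp: power2_eq_square)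
  have du: "deriv (u j) w = yd j (1 / w) * - (1 / w\<^sup>2)" if w: "w \<in> ball 0 d - {0}" for j w
  proof -
    have "((\<lambda>w. y j (1 / w)) has_field_derivative yd j (1 / w) * - (1 / w\<^sup>2)) (at w)"
      by (rule DERIV_chain2[OF dy(1)[OF outw[OF w]] invd]) (use w in simp)
    then have "(u j has_field_derivative yd j (1 / w) * - (1 / w\<^sup>2)) (at w)"
      by (rule has_field_derivative_transform_within_open[OF _ op0 w]) (simp add: uy)
    then show ?thesis by (rule DERIV_imp_deriv)
  qed
  have ddu: "deriv (deriv (u j)) w = (- scalar_q1 A s b (1 / w) * yd j (1 / w) - scalar_q2 A s b (1 / w) * y j (1 / w)) / w ^ 4
      + 2 * yd j (1 / w) / w ^ 3" if w: "w \<in> ball 0 d - {0}" for j w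
  proof -
    have w0: "w \<noteq> 0" using w by simp
    have inv2: "((\<lambda>w. - (1 / w\<^sup>2)) has_field_derivative 2 / w ^ 3) (at w)"
      using w0 by (auto intro!: derivative_eq_intros simp: divide_simps power2_eq_square power3_eq_cube)
    have "((\<lambda>w. yd j (1 / w) * - (1 / w\<^sup>2)) has_field_derivative
        (- scalar_q1 A s b (1 / w) * yd j (1 / w) - scalar_q2 A s b (1 / w) * y j (1 / w)) / w ^ 4
      + 2 * yd j (1 / w) / w ^ 3) (at w)"
      by (rule DERIV_cong[OF DERIV_mult[OF DERIV_chain2[OF dy(2)[OF outw[OF w]] invd[OF w0]] inv2]])
        (simp add: power4_eq_xxxx power2_eq_square)
    then have "(deriv (u j) has_field_derivative
        (- scalar_q1 A s b (1 / w) * yd j (1 / w) - scalar_q2 A s b (1 / w) * y j (1 / w)) / w ^ 4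
      + 2 * yd j (1 / w) / w ^ 3) (at w)"
      by (rule has_field_derivative_transform_within_open[OF _ op0 w]) (simp add: du)
    then show ?thesis by (rule DERIV_imp_deriv)
  qed
  show ?thesis
    unfolding ode_singular_at_infinity_def
  proof (rule not_ode_singular_at_solutions[OF d(1) uh[of 1] uh[of 2]])
    fix w assume w: "w \<in> ball 0 d - {0::complex}"
    then have w0: "w \<noteq> 0" by simp
    have "deriv (deriv (u j)) w + (2 / w - scalar_q1 A s b (1 / w) / w\<^sup>2) * deriv (u j) w +
          scalar_q2 A s b (1 / w) / w ^ 4 * u j w = 0" for j
      unfolding ddu[OF w] du[OF w] uy[OF w0] 
      unfolding divide_inverse power_inverse[symmetric] mult_1_left by algebra
    then show "deriv (deriv (u 1)) w + (2 / w - scalar_q1 A s b (1 / w) / w\<^sup>2) * deriv (u 1) w +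
          scalar_q2 A s b (1 / w) / w ^ 4 * u 1 w = 0"
        "deriv (deriv (u 2)) w + (2 / w - scalar_q1 A s b (1 / w) / w\<^sup>2) * deriv (u 2) w +
          scalar_q2 A s b (1 / w) / w ^ 4 * u 2 w = 0" by blast+
  next
    have z0: "0 \<in> ball 0 d" using d by simp
    have "((\<lambda>w. 1 - b * w) has_field_derivative - b) (at 0)" by (auto intro!: derivative_eq_intros)
    moreover have "((\<lambda>z. z powi s) has_field_derivative of_int s) (at (1 - b * 0))"
      using powi_has_field_derivative[of 1 s] by simp
    ultimately have pd: "((\<lambda>w. (1 - b * w) powi s) has_field_derivative of_int s * - b) (at 0)"
      by (rule DERIV_chain2[rotated])
    have "(u j has_field_derivative (of_int s * - b * W 0 $ 2 $ j + (B 0 ** W 0) $ 2 $ j)) (at 0)" for j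
      unfolding u_def
      by (rule DERIV_cong[OF DERIV_mult[OF pd Wd[OF z0]]]) simp
    then have du0: "deriv (u j) 0 = of_int s * - b * W 0 $ 2 $ j + (B 0 ** W 0) $ 2 $ j" for j
      by (rule DERIV_imp_deriv)
    have "u 1 0 * deriv (u 2) 0 - u 2 0 * deriv (u 1) 0 =
        - B 0 $ 2 $ 1 * (W 0 $ 1 $ 1 * W 0 $ 2 $ 2 - W 0 $ 1 $ 2 * W 0 $ 2 $ 1)"
      unfolding du0 by (simp add: u_def mult2_nth algebra_simps)
    then show "u 1 0 * deriv (u 2) 0 - u 2 0 * deriv (u 1) 0 \<noteq> 0"
      using Winv[OF z0] B21 by (simp add: det_nz_iff)
  qed
qed

context
  fixes g t and St :: "'b::real_normed_vector set" and rho x0 sg and Y0 :: "'b \<Rightarrow> complex^2^2" and chi :: "nat \<Rightarrow> complex^2^2"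
  assumes mono: "monodromy_setup a g t St rho x0 sg"
    and Y0: "system_solution (finite_part St rho) (\<lambda>x. to_plane (rho x)) A Y0"
      "\<And>k x. k \<in> {1..4} \<Longrightarrow> x \<in> finite_part St rho \<Longrightarrow> Y0 x = Y0 (sg k x) ** chi k"
begin

text \<open>Around a point over infinity the solution \<open>Y0\<close> differs from the normal form
  by a constant right factor, so the shifted row is a holomorphic function \<open>h j\<close> of
  \<open>1 / z\<close>. The non-trivial filter makes its limit unique, as required for the values
  over infinity.\<close>

lemma behaviour_at_infinity:
  assumes x: "x \<in> St" "rho x = rinf"
  obtains N h where "openin (top_of_set St) N" "x \<in> N"
    "\<And>x'. x' \<in> N \<Longrightarrow> x' \<noteq> x \<Longrightarrow> x' \<in> finite_part St rho \<and> pole_chart 0 (rho x') \<noteq> 0 \<and> (\<forall>j. shifted_row rho b s Y0 j x' = h j (pole_chart 0 (rho x')))"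
    "\<And>j::2. \<exists>D. (h j has_field_derivative D) (at 0)"
    "at x within finite_part St rho \<noteq> bot" "\<And>j. (shifted_row rho b s Y0 j \<longlongrightarrow> h j 0) (at x within finite_part St rho)"
proof -
  let ?Yi = "\<lambda>z. diag_power k1 (- s) z ** W (1 / z)"
  obtain r N S where r: "r > 0" "r \<le> d" "\<And>w. w \<in> ball 0 r \<Longrightarrow> w \<noteq> 0 \<Longrightarrow> 1 / w \<notin> a ` {1..4}"
    and N: "openin (top_of_set St) N" "x \<in> N" and Sc: "continuous_on (ball 0 r) S"
    and S1: "\<And>w. w \<in> ball 0 r \<Longrightarrow> S w \<in> N \<and> rho (S w) = inv_chart w"
    and N1: "\<And>x'. x' \<in> N \<Longrightarrow> pole_chart 0 (rho x') \<in> ball 0 r \<and> S (pole_chart 0 (rho x')) = x'"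
    by (rule infinite_chart[OF mono x d(1)]) blast
  have NSt: "N \<subseteq> St" using N(1) by (rule openin_imp_subset)
  have kx: "pole_chart 0 (rho x) = 0" using x by (simp add: pole_chart_def)
  have S0: "S 0 = x" using N1[OF N(2)] kx by simp
  let ?U = "{z. cmod z > 1 / r}"
  define Z where "Z = (\<lambda>z. S (1 / z))"
  have zU: "cmod z > 1 / d" "z \<noteq> 0" "1 / z \<in> ball 0 r" if "z \<in> ?U" for z
  proof -
    have "1 / d \<le> 1 / r" using r by (simp add: frac_le)
    then show 1: "cmod z > 1 / d" using that by auto
    then show "z \<noteq> 0" using outer(2) by blast
    then show "1 / z \<in> ball 0 r" using that r by (simp add: norm_divide field_simps)
  qed
  have Zm: "Z z \<in> N" "Z z \<in> finite_part St rho" "to_plane (rho (Z z)) = z" if z: "z \<in> ?U" for z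
  proof -
    have "rho (Z z) = of_plane z" "Z z \<in> N"
      using S1[OF zU(3)[OF z]] zU(2)[OF z] by (auto simp: Z_def inv_chart_def)
    then show "Z z \<in> N" "Z z \<in> finite_part St rho" "to_plane (rho (Z z)) = z"
      using NSt of_plane_neq_rinf by (auto simp: finite_part_def)
  qed
  have Zc: "continuous_on ?U Z" unfolding Z_def
    by (rule continuous_on_compose2[OF Sc]) (use zU in \<open>auto intro!: continuous_intros\<close>)
  have dX: "((\<lambda>z. Y0 (Z z) $ i $ j) has_field_derivative (A z ** Y0 (Z z)) $ i $ j) (at z)" if z: "z \<in> ?U" for z i j
  proof (rule has_coord_deriv_section[OF open_outside_disc z Zc, of "finite_part St rho" "\<lambda>x. to_plane (rho x)" "\<lambda>x. Y0 x $ i $ j"])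
    show "has_coord_deriv (finite_part St rho) (\<lambda>x. to_plane (rho x)) (\<lambda>x. Y0 x $ i $ j) ((A z ** Y0 (Z z)) $ i $ j) (Z z)"
      using Y0(1) Zm(2,3)[OF z] unfolding system_solution_def by metis
  qed (use Zm in auto)
  have dY: "((\<lambda>z. ?Yi z $ i $ j) has_field_derivative (A z ** ?Yi z) $ i $ j) (at z)" "invertible (?Yi z)"
    if z: "z \<in> ?U" for z i j
    by (rule system_solution_plane[OF open_outside_disc Yinf]; use zU(1)[OF z] in simp)+
  obtain C where C: "\<And>z. z \<in> ?U \<Longrightarrow> Y0 (Z z) = ?Yi z ** C"
    by (rule fundamental_solution_unique[OF open_outside_disc[of "1 / r"] connected_outside_disc[of "1 / r"] dY dX],
        assumption+, rule that)
  define h where "h = (\<lambda>j w. (1 - b * w) powi s * (W w ** C) $ 2 $ j)"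
  have fh: "x' \<in> finite_part St rho \<and> pole_chart 0 (rho x') \<noteq> 0 \<and> (\<forall>j. shifted_row rho b s Y0 j x' = h j (pole_chart 0 (rho x')))" if x': "x' \<in> N" "x' \<noteq> x" for x'
  proof -
    have k: "pole_chart 0 (rho x') \<in> ball 0 r" "S (pole_chart 0 (rho x')) = x'" using N1[OF x'(1)] by auto
    have k0: "pole_chart 0 (rho x') \<noteq> 0" using k(2) S0 x'(2) by auto
    then have fin: "rho x' \<noteq> rinf" "pole_chart 0 (rho x') = 1 / to_plane (rho x')" by (auto simp: pole_chart_def)
    let ?z = "to_plane (rho x')"
    have z0: "?z \<noteq> 0" using k0 fin(2) by auto
    have zU': "?z \<in> ?U" using k(1) z0 r(1) by (simp add: fin(2) norm_divide field_simps)
    have Zz: "Z ?z = x'" using k(2) fin(2) by (simp add: Z_def)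
    have "shifted_row rho b s Y0 j x' = h j (pole_chart 0 (rho x'))" for j
    proof -
      have "shifted_row rho b s Y0 j x' = (?z - b) powi s * (?Yi ?z ** C) $ 2 $ j" using C[OF zU'] Zz by simp
      also have "\<dots> = ((?z - b) powi s * ?Yi ?z $ 2 $ 1) * C $ 1 $ j + ((?z - b) powi s * ?Yi ?z $ 2 $ 2) * C $ 2 $ j"
        by (simp add: mult2_nth[of "?Yi ?z"] algebra_simps)
      also have "\<dots> = h j (pole_chart 0 (rho x'))"
        unfolding row_at_infinity[OF z0] fin(2) h_def by (simp add: mult2_nth[of "W _"] algebra_simps)
      finally show ?thesis .
    qed
    then show ?thesis using fin(1) k0 x' NSt by (auto simp: finite_part_def)
  qed
  have hh: "h j holomorphic_on ball 0 d" for j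
    unfolding h_def mult2_nth
    by (intro holomorphic_intros holomorphic_shifted_power[OF d(1) b_bound] W_holomorphic)
  have hd: "\<exists>D. (h j has_field_derivative D) (at 0)" for j
    using hh[of j] d(1) by (auto simp: holomorphic_on_open)
  obtain O' where O: "open O'" "N = St \<inter> O'" using N(1) by (auto simp: openin_open)
  have lim: "(shifted_row rho b s Y0 j \<longlongrightarrow> h j 0) (at x within finite_part St rho)" for j
  proof -
    have "isCont (h j) 0" using hd[of j] DERIV_isCont by blast
    moreover have "((\<lambda>x. pole_chart 0 (rho x)) \<longlongrightarrow> 0) (at x within finite_part St rho)"
      by (rule tendsto_within_subset[OF pole_chart_tendsto[OF mono x]]) (auto simp: finite_part_def)
    ultimately have "((\<lambda>x. h j (pole_chart 0 (rho x))) \<longlongrightarrow> h j 0) (at x within finite_part St rho)" by (rule isCont_tendsto_compose)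
    moreover have "\<forall>\<^sub>F y in at x within finite_part St rho. y \<in> O' \<and> y \<noteq> x \<and> y \<in> finite_part St rho"
      using O N(2) by (auto simp: eventually_at_filter eventually_nhds)
    then have "\<forall>\<^sub>F y in at x within finite_part St rho. h j (pole_chart 0 (rho y)) = shifted_row rho b s Y0 j y"
      by eventually_elim (use fh O(2) in \<open>auto simp: finite_part_def\<close>)
    ultimately show ?thesis by (rule Lim_transform_eventually)
  qed
  have "at x within finite_part St rho \<noteq> bot"
  proof
    assume bot: "at x within finite_part St rho = bot"
    have "isCont S 0" using Sc r(1) by (simp add: continuous_on_eq_continuous_at)
    moreover have "((\<lambda>z::complex. 1 / z) \<longlongrightarrow> 0) at_infinity"
      using tendsto_inverse_0 by (simp add: divide_inverse)
    ultimately have "(Z \<longlongrightarrow> x) at_infinity" unfolding Z_def S0[symmetric] by (rule isCont_tendsto_compose)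
    moreover have evU: "\<forall>\<^sub>F z in at_infinity. z \<in> ?U"
      unfolding eventually_at_infinity by (intro exI[of _ "1 / r + 1"]) auto
    then have "\<forall>\<^sub>F z in at_infinity. Z z \<in> finite_part St rho - {x}"
      by eventually_elim (use Zm x in \<open>auto simp: finite_part_def\<close>)
    ultimately have "filterlim Z (at x within finite_part St rho) at_infinity" by (rule filterlim_at_withinI)
    then have "\<forall>P. \<forall>\<^sub>F z in at_infinity. P (Z z)" by (simp add: bot filterlim_iff)
    from spec[OF this, of "\<lambda>_. False"] show False
      using trivial_limit_at_infinity[where 'a = complex] by (simp add: trivial_limit_def)
  qed
  with N fh hd lim that show ?thesis by blast
qed

text \<open>Multiplication by \<open>(z - b) powi s\<close> with integer \<open>s\<close> is single
  valued, and passing to a row of \<open>Y0\<close> commutes with right multiplication; so the two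
  scalar solutions inherit the matrices \<open>chi k\<close>.\<close>

lemma scalar_ode_monodromy:
  assumes eq: "equivalent_tuples chi M"
  shows "ode_monodromy St rho sg (scalar_q1 A s b) (scalar_q2 A s b) M"
proof -
  \<comment> \<open>\<open>Y0\<close> is a solution on the finite part only, whereas a scalar
    solution must also be defined and differentiable over infinity; the limit supplies these
    values.\<close>
  define y where "y = (\<lambda>j x. if rho x = rinf then Lim (at x within finite_part St rho) (shifted_row rho b s Y0 j) else shifted_row rho b s Y0 j x)"
  define yd where "yd = (\<lambda>j x. scalar_alpha A s b (to_plane (rho x)) * Y0 x $ 1 $ j
      + scalar_beta A s b (to_plane (rho x)) * Y0 x $ 2 $ j)"
  have yF: "y j x = shifted_row rho b s Y0 j x" if "x \<in> finite_part St rho" for j x using that by (simp add: y_def finite_part_def)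
  have uS: "to_plane (rho x) \<in> - a ` {1..4}" if x: "x \<in> finite_part St rho" for x
  proof -
    have "rho x \<in> punctured_sphere a" "rho x \<noteq> rinf" using x rho_mem[OF mono] by (auto simp: finite_part_def)
    then have "of_plane (to_plane (rho x)) \<notin> of_plane ` a ` {1..4}"
      using of_plane_to_plane[of "rho x"] by (simp add: punctured_sphere_def)
    then show ?thesis by blast
  qed
  have dfin: "has_coord_deriv (finite_part St rho) (\<lambda>x. to_plane (rho x)) (y j) (yd j x) x"
    "has_coord_deriv (finite_part St rho) (\<lambda>x. to_plane (rho x)) (yd j)
       (- scalar_q1 A s b (to_plane (rho x)) * yd j x - scalar_q2 A s b (to_plane (rho x)) * y j x) x"
    if x: "x \<in> finite_part St rho" for j x
  proof -
    note e = scalar_equation_solution[OF regular_set(1) A regular_set(3) regular_set(2) Y0(1) x uS[OF x] finite_coord[OF mono x], where j = j and s = s, folded yd_def]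
    have "\<forall>\<^sub>F y' in at x within finite_part St rho. y j y' = shifted_row rho b s Y0 j y'" by (simp add: eventually_at_filter yF)
    then show "has_coord_deriv (finite_part St rho) (\<lambda>x. to_plane (rho x)) (y j) (yd j x) x"
      using e(1) yF[OF x, of j] unfolding has_coord_deriv_def yd_def
      by (elim Lim_transform_eventually) (elim eventually_mono, simp)
    show "has_coord_deriv (finite_part St rho) (\<lambda>x. to_plane (rho x)) (yd j)
       (- scalar_q1 A s b (to_plane (rho x)) * yd j x - scalar_q2 A s b (to_plane (rho x)) * y j x) x"
      using e(2) unfolding yF[OF x] yd_def .
  qed
  have yinf: "y j x = l" if "rho x = rinf" "at x within finite_part St rho \<noteq> bot"
      "(shifted_row rho b s Y0 j \<longlongrightarrow> l) (at x within finite_part St rho)" for j x l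
    using that tendsto_Lim[OF that(2,3)] by (simp add: y_def)
  have dinf: "\<exists>D. has_coord_deriv St (\<lambda>x. if rho x = rinf then 0 else 1 / to_plane (rho x)) (y j) D x"
    if x: "x \<in> St" "rho x = rinf" for j x
  proof -
    obtain N h where N: "openin (top_of_set St) N" "x \<in> N"
      "\<And>x'. x' \<in> N \<Longrightarrow> x' \<noteq> x \<Longrightarrow> x' \<in> finite_part St rho \<and> pole_chart 0 (rho x') \<noteq> 0 \<and> (\<forall>j. shifted_row rho b s Y0 j x' = h j (pole_chart 0 (rho x')))"
      and hd: "\<And>j::2. \<exists>D. (h j has_field_derivative D) (at 0)"
      and lim: "at x within finite_part St rho \<noteq> bot" "\<And>j. (shifted_row rho b s Y0 j \<longlongrightarrow> h j 0) (at x within finite_part St rho)"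
      by (rule behaviour_at_infinity[OF x]) blast
    obtain D where D: "(h j has_field_derivative D) (at 0)" using hd by blast
    have kx: "pole_chart 0 (rho x) = 0" using x by (simp add: pole_chart_def)
    obtain O' where O: "open O'" "N = St \<inter> O'" using N(1) by (auto simp: openin_open)
    have ev: "\<forall>\<^sub>F y in at x within St. y \<in> N \<and> y \<noteq> x"
      using O N(2) by (auto simp: eventually_at_filter eventually_nhds)
    have "filterlim (\<lambda>x. pole_chart 0 (rho x)) (at 0) (at x within St)"
      by (rule filterlim_atI[OF pole_chart_tendsto[OF mono x]]) (use ev in eventually_elim, use N(3) in blast)
    from filterlim_compose[OF D[unfolded has_field_derivative_iff] this]
    have "((\<lambda>x. (h j (pole_chart 0 (rho x)) - h j 0) / (pole_chart 0 (rho x) - 0)) \<longlongrightarrow> D) (at x within St)" .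
    then have "((\<lambda>x'. (y j x' - y j x) / (pole_chart 0 (rho x') - pole_chart 0 (rho x))) \<longlongrightarrow> D) (at x within St)"
    proof (rule Lim_transform_eventually)
      show "\<forall>\<^sub>F x' in at x within St. (h j (pole_chart 0 (rho x')) - h j 0) / (pole_chart 0 (rho x') - 0) = (y j x' - y j x) / (pole_chart 0 (rho x') - pole_chart 0 (rho x))"
        using ev
      proof eventually_elim
        case (elim x')
        then have "y j x' = h j (pole_chart 0 (rho x'))" using N(3)[of x'] yF by auto
        then show ?case using yinf[OF x(2) lim(1) lim(2)[of j]] kx by simp
      qed
    qed
    then have "has_coord_deriv St (\<lambda>x. pole_chart 0 (rho x)) (y j) D x"
      unfolding has_coord_deriv_def .
    then show ?thesis unfolding pole_chart_def diff_zero by blast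
  qed
  have sol: "ode_solution St rho (scalar_q1 A s b) (scalar_q2 A s b) (y j)" for j
    unfolding ode_solution_def using dfin dinf by blast
  \<comment> \<open>A linear relation can be differentiated at \<open>x0\<close>. Since
    \<open>scalar_alpha\<close> does not vanish, the relations for \<open>y\<close> and for its
    derivative say that both rows of the invertible matrix \<open>Y0 x0\<close> annihilate
    \<open>(c1, c2)\<close>.\<close>
  have indep: "c1 = 0 \<and> c2 = 0" if c: "\<forall>x\<in>St. c1 * y 1 x + c2 * y 2 x = 0" for c1 c2
  proof -
    have xF: "x0 \<in> St" "rho x0 \<noteq> rinf"
      using mono of_plane_neq_rinf by (auto simp: monodromy_setup_def) (metis of_plane_neq_rinf)
    obtain r N T where r: "r > 0" and N: "openin (top_of_set St) N" "x0 \<in> N" and T: "continuous_on (ball (to_plane (rho x0)) r) T"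
      "\<And>w. w \<in> ball (to_plane (rho x0)) r \<Longrightarrow> T w \<in> N \<and> rho (T w) = of_plane w \<and> w \<notin> a ` {1..4}"
      and N1: "\<And>x'. x' \<in> N \<Longrightarrow> rho x' \<noteq> rinf \<and> to_plane (rho x') \<in> ball (to_plane (rho x0)) r \<and> T (to_plane (rho x')) = x'"
      by (rule finite_chart[OF mono xF zero_less_one]) blast
    let ?z = "to_plane (rho x0)"
    have zb: "?z \<in> ball ?z r" using r by simp
    have Tz: "T ?z = x0" using N1[OF N(2)] by simp
    have x0F: "x0 \<in> finite_part St rho" using xF by (simp add: finite_part_def)
    have TF: "T w \<in> finite_part St rho \<and> to_plane (rho (T w)) = w" if "w \<in> ball ?z r" for w
      using T(2)[OF that] openin_imp_subset[OF N(1)] of_plane_neq_rinf by (auto simp: finite_part_def)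
    have dT: "((\<lambda>w. y j (T w)) has_field_derivative yd j x0) (at ?z)" for j
      by (rule has_coord_deriv_section[OF open_ball zb T(1) TF]) (use dfin(1)[OF x0F] Tz in auto)
    have "((\<lambda>w. c1 * y 1 (T w) + c2 * y 2 (T w)) has_field_derivative (c1 * yd 1 x0 + c2 * yd 2 x0)) (at ?z)"
      by (intro DERIV_add DERIV_cmult dT)
    moreover have "((\<lambda>w. c1 * y 1 (T w) + c2 * y 2 (T w)) has_field_derivative 0) (at ?z)"
      by (rule has_field_derivative_transform_within_open[OF DERIV_const open_ball zb, of 0])
        (use c TF in \<open>auto simp: finite_part_def\<close>)
    ultimately have e2: "c1 * yd 1 x0 + c2 * yd 2 x0 = 0" by (rule DERIV_unique)
    have zS: "?z \<in> - a ` {1..4}" by (rule uS[OF x0F])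
    have zb': "(?z - b) powi s \<noteq> 0" using zS regular_set(2) by auto
    have "(?z - b) powi s * (Y0 x0 $ 2 $ 1 * c1 + Y0 x0 $ 2 $ 2 * c2) = 0"
    proof -
      have "c1 * y 1 x0 + c2 * y 2 x0 = 0" using c xF by blast
      then show ?thesis unfolding yF[OF x0F] by (simp add: algebra_simps)
    qed
    then have row2: "Y0 x0 $ 2 $ 1 * c1 + Y0 x0 $ 2 $ 2 * c2 = 0" using zb' by (metis mult_eq_0_iff)
    have "scalar_alpha A s b ?z * (Y0 x0 $ 1 $ 1 * c1 + Y0 x0 $ 1 $ 2 * c2)
        + scalar_beta A s b ?z * (Y0 x0 $ 2 $ 1 * c1 + Y0 x0 $ 2 $ 2 * c2) = 0"
      using e2 by (simp add: yd_def algebra_simps)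
    moreover have "scalar_alpha A s b ?z \<noteq> 0"
      unfolding scalar_alpha_def by (rule no_zero_divisors[OF zb' bspec[OF regular_set(3) zS]])
    ultimately have row1: "Y0 x0 $ 1 $ 1 * c1 + Y0 x0 $ 1 $ 2 * c2 = 0"
      using row2 by simp
    have "Y0 x0 $ 1 $ 1 * Y0 x0 $ 2 $ 2 - Y0 x0 $ 1 $ 2 * Y0 x0 $ 2 $ 1 \<noteq> 0"
      using Y0(1) x0F by (auto simp: system_solution_def det_nz_iff)
    moreover have "(Y0 x0 $ 1 $ 1 * Y0 x0 $ 2 $ 2 - Y0 x0 $ 1 $ 2 * Y0 x0 $ 2 $ 1) * c1 = 0"
      "(Y0 x0 $ 1 $ 1 * Y0 x0 $ 2 $ 2 - Y0 x0 $ 1 $ 2 * Y0 x0 $ 2 $ 1) * c2 = 0"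
      using row1 row2 by algebra+
    ultimately show ?thesis by auto
  qed
  have sgF: "sg k x \<in> finite_part St rho" if "k \<in> {1..4}" "x \<in> finite_part St rho" for k x
    using that deck_mem[OF mono] deck_rho[OF mono] by (auto simp: finite_part_def)
  have relF: "shifted_row rho b s Y0 j x = shifted_row rho b s Y0 1 (sg k x) * chi k $ 1 $ j + shifted_row rho b s Y0 2 (sg k x) * chi k $ 2 $ j" if k: "k \<in> {1..4}" and x: "x \<in> finite_part St rho" for k x j
  proof -
    have "rho (sg k x) = rho x" using deck_rho[OF mono k] x by (simp add: finite_part_def)
    then show ?thesis using Y0(2)[OF k x] by (simp add: mult2_nth algebra_simps)
  qed
  have rel: "y j x = y 1 (sg k x) * chi k $ 1 $ j + y 2 (sg k x) * chi k $ 2 $ j" if k: "k \<in> {1..4}" and x: "x \<in> St" for k x j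
  proof (cases "rho x = rinf")
    case False
    then have xF: "x \<in> finite_part St rho" using x by (simp add: finite_part_def)
    show ?thesis unfolding yF[OF xF] yF[OF sgF[OF k xF]] by (rule relF[OF k xF])
  next
    case True
    \<comment> \<open>Over infinity the relation is a limit of the relation at finite points, as
      \<open>sg k\<close> carries finite points near \<open>x\<close> to finite points near
      \<open>sg k x\<close>.\<close>
    have sx: "sg k x \<in> St" "rho (sg k x) = rinf" using deck_mem[OF mono k x] deck_rho[OF mono k x] True by auto
    obtain h where h: "at x within finite_part St rho \<noteq> bot" "\<And>j::2. (shifted_row rho b s Y0 j \<longlongrightarrow> h j 0) (at x within finite_part St rho)"
      by (rule behaviour_at_infinity[OF x True]) (rule that)
    obtain h' where h': "at (sg k x) within finite_part St rho \<noteq> bot" "\<And>j::2. (shifted_row rho b s Y0 j \<longlongrightarrow> h' j 0) (at (sg k x) within finite_part St rho)"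
      by (rule behaviour_at_infinity[OF sx]) (rule that)
    have "(sg k \<longlongrightarrow> sg k x) (at x within finite_part St rho)"
      by (rule tendsto_within_subset[of _ _ _ St])
        (use deck_continuous[OF mono k] x in \<open>auto simp: continuous_on_def finite_part_def\<close>)
    moreover have "\<forall>\<^sub>F x' in at x within finite_part St rho. sg k x' \<in> finite_part St rho - {sg k x}"
      unfolding eventually_at_filter using sgF[OF k] sx by (auto simp: finite_part_def intro!: always_eventually)
    ultimately have fl: "filterlim (sg k) (at (sg k x) within finite_part St rho) (at x within finite_part St rho)" by (rule filterlim_at_withinI)
    have "((\<lambda>x. shifted_row rho b s Y0 1 (sg k x) * chi k $ 1 $ j + shifted_row rho b s Y0 2 (sg k x) * chi k $ 2 $ j) \<longlongrightarrow> h' 1 0 * chi k $ 1 $ j + h' 2 0 * chi k $ 2 $ j) (at x within finite_part St rho)"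
      by (intro tendsto_intros filterlim_compose[OF h'(2) fl])
    moreover have "\<forall>\<^sub>F x in at x within finite_part St rho. shifted_row rho b s Y0 1 (sg k x) * chi k $ 1 $ j + shifted_row rho b s Y0 2 (sg k x) * chi k $ 2 $ j = shifted_row rho b s Y0 j x"
      unfolding eventually_at_filter using relF[OF k, symmetric] by (intro always_eventually) blast
    ultimately have "(shifted_row rho b s Y0 j \<longlongrightarrow> h' 1 0 * chi k $ 1 $ j + h' 2 0 * chi k $ 2 $ j) (at x within finite_part St rho)"
      by (rule Lim_transform_eventually)
    from tendsto_unique[OF h(1) h(2)[of j] this] show ?thesis
      using yinf[OF True h(1) h(2)[of j]] yinf[OF sx(2) h'(1) h'(2)[of 1]] yinf[OF sx(2) h'(1) h'(2)[of 2]] by simp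
  qed
  have "(vector [y 1 x, y 2 x] :: complex^2) = vector [y 1 (sg k x), y 2 (sg k x)] v* chi k"
    if "k \<in> {1..4}" "x \<in> St" for k x
    using rel[OF that, of 1] rel[OF that, of 2]
    by (simp add: vec2_eq_iff vector_matrix_mult_def sum_2 mult.commute)
  then show ?thesis unfolding ode_monodromy_def
    using sol[of 1] sol[of 2] indep eq by (intro exI[of _ "y 1"] exI[of _ "y 2"] exI[of _ chi]) blast
qed

end

end

section \<open>Singular points of the first kind\<close>

lemma double_sum_bound:
  fixes x :: "'i \<Rightarrow> real"
  assumes "finite I"
  shows "(\<Sum>i\<in>I. \<Sum>j\<in>I. x i * x j) \<le> card I * (\<Sum>i\<in>I. (x i)\<^sup>2)"
proof -
  have "x i * x j \<le> ((x i)\<^sup>2 + (x j)\<^sup>2) / 2" for i j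
    using sum_squares_bound[of "x i" "x j"] by (simp add: mult.assoc)
  then have "(\<Sum>i\<in>I. \<Sum>j\<in>I. x i * x j) \<le> (\<Sum>i\<in>I. \<Sum>j\<in>I. ((x i)\<^sup>2 + (x j)\<^sup>2) / 2)"
    by (intro sum_mono)
  also have "\<dots> = card I * (\<Sum>i\<in>I. (x i)\<^sup>2)"
    by (simp add: sum.distrib sum_divide_distrib[symmetric] add_divide_distrib sum_distrib_left[symmetric])
  finally show ?thesis .
qed

text \<open>Along a ray \<open>z = c + t v\<close> the function \<open>t^(2 m) (\<Sum>i. |u i|\<^sup>2)\<close> is nondecreasing once \<open>m\<close> is large,
  so that the solutions grow at most like a power of \<open>1 / |z - c|\<close>.\<close>

lemma moderate_growth:
  fixes u :: "'i \<Rightarrow> complex \<Rightarrow> complex"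
  assumes I: "finite I" and d: "d > 0"
    and B: "\<And>i j. i \<in> I \<Longrightarrow> j \<in> I \<Longrightarrow> B i j holomorphic_on ball c d"
    and u: "\<And>i z. i \<in> I \<Longrightarrow> z \<in> ball c d - {c} \<Longrightarrow>
      (u i has_field_derivative (\<Sum>j\<in>I. B i j z * u j z) / (z - c)) (at z)"
  obtains m :: nat where "\<And>i. i \<in> I \<Longrightarrow>
      \<exists>v. v holomorphic_on ball c d \<and> (\<forall>z\<in>ball c d - {c}. v z = (z - c) ^ m * u i z)"
proof -
  define r where "r = d / 2"
  have r: "r > 0" "cball c r \<subseteq> ball c d" "r < d" using d by (auto simp: r_def)
  have "\<exists>K. \<forall>i\<in>I. \<forall>j\<in>I. \<forall>z\<in>cball c r. cmod (B i j z) \<le> K"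
  proof -
    have "\<exists>K. \<forall>z\<in>cball c r. cmod (B i j z) \<le> K" if "i \<in> I" "j \<in> I" for i j
    proof -
      have "continuous_on (cball c r) (B i j)"
        using holomorphic_on_imp_continuous_on[OF B[OF that]] r(2) continuous_on_subset by blast
      then have "bounded (B i j ` cball c r)"
        by (intro compact_imp_bounded compact_continuous_image) auto
      then show ?thesis by (auto simp: bounded_iff)
    qed
    then obtain K where K: "\<And>i j z. i \<in> I \<Longrightarrow> j \<in> I \<Longrightarrow> z \<in> cball c r \<Longrightarrow> cmod (B i j z) \<le> K i j" by metis
    show ?thesis
    proof (intro exI ballI)
      fix i j z assume ij: "i \<in> I" "j \<in> I" and z: "z \<in> cball c r"
      have cc: "c \<in> cball c r" using r by simp
      have K0: "0 \<le> K i j" if "i \<in> I" "j \<in> I" for i j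
        using K[OF that cc] norm_ge_zero order_trans by blast
      have "K i j \<le> (\<Sum>j\<in>I. K i j)" by (rule member_le_sum) (use ij K0 I in auto)
      also have "\<dots> \<le> (\<Sum>i\<in>I. \<Sum>j\<in>I. K i j)"
        by (rule member_le_sum[of i I "\<lambda>i. \<Sum>j\<in>I. K i j"]) (use ij K0 I in \<open>auto intro!: sum_nonneg\<close>)
      finally show "cmod (B i j z) \<le> (\<Sum>i\<in>I. \<Sum>j\<in>I. K i j)" using K[OF ij z] by linarith
    qed
  qed
  then obtain K0 where K0: "\<And>i j z. i \<in> I \<Longrightarrow> j \<in> I \<Longrightarrow> z \<in> cball c r \<Longrightarrow> cmod (B i j z) \<le> K0" by blast
  define K where "K = max K0 0"
  have K: "cmod (B i j z) \<le> K" if "i \<in> I" "j \<in> I" "z \<in> cball c r" for i j z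
    using K0[OF that] by (simp add: K_def)
  have Knn: "K \<ge> 0" by (simp add: K_def)
  \<comment> \<open>At parameter \<open>x\<close> on the ray, the derivative of the sum of squares
    is at least \<open>- 2 * K * card I / x\<close> times that sum, a loss which the factor
    \<open>x ^ (2 * m)\<close> compensates.\<close>
  obtain m :: nat where m: "K * card I \<le> m" using real_arch_simple by blast
  have uh: "u i holomorphic_on ball c d - {c}" if "i \<in> I" for i
    unfolding holomorphic_on_open[OF open_Diff[OF open_ball finite_imp_closed[OF finite.insertI[OF finite.emptyI]]]]
    using u[OF that] by blast
  have "\<exists>M. \<forall>i\<in>I. \<forall>z\<in>sphere c r. (cmod (u i z))\<^sup>2 \<le> M"
  proof -
    have "\<exists>M. \<forall>z\<in>sphere c r. cmod (u i z) \<le> M" if "i \<in> I" for i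
    proof -
      have "sphere c r \<subseteq> ball c d - {c}" using r by auto
      then have "continuous_on (sphere c r) (u i)"
        using holomorphic_on_imp_continuous_on[OF uh[OF that]] continuous_on_subset by blast
      then have "bounded (u i ` sphere c r)"
        by (intro compact_imp_bounded compact_continuous_image) auto
      then show ?thesis by (auto simp: bounded_iff)
    qed
    then obtain M where M: "\<And>i z. i \<in> I \<Longrightarrow> z \<in> sphere c r \<Longrightarrow> cmod (u i z) \<le> M i" by metis
    have "(cmod (u i z))\<^sup>2 \<le> (\<Sum>i\<in>I. (M i)\<^sup>2)" if "i \<in> I" "z \<in> sphere c r" for i z
    proof -
      have "(cmod (u i z))\<^sup>2 \<le> (M i)\<^sup>2" using M[OF that] by (intro power_mono) auto
      also have "\<dots> \<le> (\<Sum>i\<in>I. (M i)\<^sup>2)" by (rule member_le_sum) (use that I in auto)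
      finally show ?thesis .
    qed
    then show ?thesis by blast
  qed
  then obtain M where M: "\<And>i z. i \<in> I \<Longrightarrow> z \<in> sphere c r \<Longrightarrow> (cmod (u i z))\<^sup>2 \<le> M" by blast
  define Q where "Q = (\<lambda>z. \<Sum>i\<in>I. (cmod (u i z))\<^sup>2)"
  have QM: "Q z \<le> card I * M" if "z \<in> sphere c r" for z
    unfolding Q_def using sum_bounded_above[of I "\<lambda>i. (cmod (u i z))\<^sup>2" M] M that by auto
  have mono: "t ^ (2 * m) * Q (c + of_real t * v) \<le> card I * M"
    if v: "cmod v = r" and t: "0 < t" "t \<le> 1" for v t
  proof -
    have pt: "c + of_real x * v \<in> cball c r" "c + of_real x * v \<in> ball c d - {c}" "of_real x * v \<noteq> 0" if "t \<le> x" "x \<le> 1" for x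
    proof -
      have "cmod (of_real x * v) \<le> 1 * r" unfolding norm_mult v using that t r by (intro mult_right_mono) auto
      moreover show "of_real x * v \<noteq> 0" using that t v r by auto
      ultimately show "c + of_real x * v \<in> cball c r" "c + of_real x * v \<in> ball c d - {c}"
        using r(3) by (auto simp: dist_norm)
    qed
    let ?psi = "\<lambda>x. x ^ (2 * m) * Q (c + of_real x * v)"
    have "?psi t \<le> ?psi 1"
    proof (rule DERIV_nonneg_imp_nondecreasing[OF t(2)])
      fix x assume x: "t \<le> x" "x \<le> 1"
      note px = pt[OF x]
      have x0: "x > 0" using x t by simp
      let ?z = "c + of_real x * v"
      define w where "w = (\<lambda>i. (\<Sum>j\<in>I. B i j ?z * u j ?z))"
      have du: "((\<lambda>x. u i (c + of_real x * v)) has_vector_derivative w i / of_real x) (at x)" if i: "i \<in> I" for i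
      proof -
        have "((\<lambda>x. c + of_real x * v) has_vector_derivative v) (at x)"
          by (auto intro!: derivative_eq_intros)
        from field_vector_diff_chain_at[OF this u[OF i px(2)]]
        have "((\<lambda>x. u i (c + of_real x * v)) has_vector_derivative v * (w i / (of_real x * v))) (at x)"
          by (simp add: o_def w_def)
        moreover have "v \<noteq> 0" using px(3) by auto
        ultimately show ?thesis by (simp add: mult.commute)
      qed
      have dsq: "((\<lambda>x. (cmod (u i (c + of_real x * v)))\<^sup>2) has_real_derivative 2 * Re (cnj (u i ?z) * w i) / x) (at x)" if i: "i \<in> I" for i
      proof -
        have re: "((\<lambda>x. Re (u i (c + of_real x * v))) has_real_derivative Re (w i) / x) (at x)"
          using bounded_linear.has_vector_derivative[OF bounded_linear_Re du[OF i]]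
          by (simp add: has_real_derivative_iff_has_vector_derivative Re_divide_of_real)
        have im: "((\<lambda>x. Im (u i (c + of_real x * v))) has_real_derivative Im (w i) / x) (at x)"
          using bounded_linear.has_vector_derivative[OF bounded_linear_Im du[OF i]]
          by (simp add: has_real_derivative_iff_has_vector_derivative Im_divide_of_real)
        show ?thesis unfolding cmod_power2
          by (rule DERIV_cong[OF DERIV_add[OF DERIV_power[OF re, of 2] DERIV_power[OF im, of 2]]])
            (simp add: add_divide_distrib algebra_simps)
      qed
      let ?D = "of_nat (2 * m) * x ^ (2 * m - 1) * Q ?z + (\<Sum>i\<in>I. 2 * Re (cnj (u i ?z) * w i) / x) * x ^ (2 * m)"
      have dpsi: "(?psi has_real_derivative ?D) (at x)"
      proof -
        have 1: "((\<lambda>x. x ^ (2 * m)) has_real_derivative of_nat (2 * m) * x ^ (2 * m - 1)) (at x)"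
          using DERIV_pow[of "2 * m" x] by simp
        have 2: "((\<lambda>x. Q (c + of_real x * v)) has_real_derivative (\<Sum>i\<in>I. 2 * Re (cnj (u i ?z) * w i) / x)) (at x)"
          unfolding Q_def by (intro DERIV_sum dsq)
        show ?thesis by (rule DERIV_cong[OF DERIV_mult[OF 1 2]]) simp
      qed
      have bnd: "- (\<Sum>i\<in>I. 2 * Re (cnj (u i ?z) * w i)) \<le> 2 * m * Q ?z"
      proof -
        have "- Re (cnj (u i ?z) * w i) \<le> (\<Sum>j\<in>I. K * (cmod (u i ?z) * cmod (u j ?z)))" if i: "i \<in> I" for i
        proof -
          have "- Re (cnj (u i ?z) * w i) \<le> cmod (cnj (u i ?z) * w i)"
            using abs_Re_le_cmod[of "cnj (u i ?z) * w i"] by linarith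
          also have "\<dots> = cmod (u i ?z) * cmod (w i)" by (simp add: norm_mult)
          also have "\<dots> \<le> cmod (u i ?z) * (\<Sum>j\<in>I. K * cmod (u j ?z))"
          proof (rule mult_left_mono)
            show "cmod (w i) \<le> (\<Sum>j\<in>I. K * cmod (u j ?z))" unfolding w_def
              by (rule sum_norm_le) (auto simp: norm_mult intro!: mult_right_mono K i px(1))
          qed simp
          also have "\<dots> = (\<Sum>j\<in>I. K * (cmod (u i ?z) * cmod (u j ?z)))"
            by (simp add: sum_distrib_left ac_simps)
          finally show ?thesis .
        qed
        then have "(\<Sum>i\<in>I. - Re (cnj (u i ?z) * w i)) \<le> (\<Sum>i\<in>I. \<Sum>j\<in>I. K * (cmod (u i ?z) * cmod (u j ?z)))"
          by (rule sum_mono)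
        also have "\<dots> = K * (\<Sum>i\<in>I. \<Sum>j\<in>I. cmod (u i ?z) * cmod (u j ?z))" by (simp add: sum_distrib_left)
        also have "\<dots> \<le> K * (card I * Q ?z)"
          unfolding Q_def by (intro mult_left_mono double_sum_bound I Knn)
        also have "\<dots> \<le> m * Q ?z"
          using mult_right_mono[OF m, of "Q ?z"] by (simp add: Q_def sum_nonneg mult.assoc)
        finally show ?thesis unfolding sum_negf sum_distrib_left[symmetric] by linarith
      qed
      have "?D \<ge> 0"
      proof (cases "m = 0")
        case True
        have "0 \<le> (\<Sum>i\<in>I. 2 * Re (cnj (u i ?z) * w i))" using bnd True by simp
        then show ?thesis using True x0 by (simp add: sum_divide_distrib[symmetric])
      next
        case False
        have "?D = (2 * m * Q ?z + (\<Sum>i\<in>I. 2 * Re (cnj (u i ?z) * w i))) * x ^ (2 * m - 1)"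
        proof -
          have "x ^ (2 * m) = x * x ^ (2 * m - 1)" using False by (simp flip: power_Suc)
          then show ?thesis using x0 by (simp add: sum_divide_distrib[symmetric] algebra_simps)
        qed
        also have "\<dots> \<ge> 0" using bnd x0 by (intro mult_nonneg_nonneg) auto
        finally show ?thesis .
      qed
      then show "\<exists>y. (?psi has_real_derivative y) (at x) \<and> 0 \<le> y" using dpsi by blast
    qed
    also have "?psi 1 \<le> card I * M" using QM[of "c + v"] v by (simp add: dist_norm)
    finally show ?thesis .
  qed
  have bounded: "cmod ((z - c) ^ m * u i z) \<le> sqrt (card I * M) * r ^ m" if i: "i \<in> I" and z: "z \<in> cball c r - {c}" for i z
  proof -
    \<comment> \<open>The ray through \<open>z\<close> meets the circle of radius \<open>r\<close>
      in \<open>c + v\<close>. The monotone quantity at \<open>z\<close> is at most its value there,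
      which is bounded by compactness.\<close>
    define t where "t = cmod (z - c) / r"
    define v where "v = (z - c) / of_real t"
    have t: "0 < t" "t \<le> 1" using z r by (auto simp: t_def dist_norm norm_minus_commute)
    have v: "cmod v = r"
    proof -
      have "cmod v = cmod (z - c) / t" using t(1) by (simp add: v_def norm_divide)
      moreover have "cmod (z - c) \<noteq> 0" using z by auto
      ultimately show ?thesis using r(1) by (simp add: t_def)
    qed
    have zz: "z = c + of_real t * v" using t by (simp add: v_def)
    have "(cmod (u i z))\<^sup>2 \<le> Q z" unfolding Q_def
      by (rule member_le_sum[OF i, of "\<lambda>i. (cmod (u i z))\<^sup>2"]) (use I in auto)
    then have "t ^ (2 * m) * (cmod (u i z))\<^sup>2 \<le> t ^ (2 * m) * Q z" using t by (intro mult_left_mono) auto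
    also have "\<dots> \<le> card I * M" using mono[OF v t] zz by simp
    finally have "(t ^ m * cmod (u i z))\<^sup>2 \<le> card I * M" by (simp add: power_mult_distrib power_even_eq mult.commute[of 2] power_mult)
    then have "t ^ m * cmod (u i z) \<le> sqrt (card I * M)" by (rule real_le_rsqrt)
    moreover have "cmod ((z - c) ^ m * u i z) = (t ^ m * cmod (u i z)) * r ^ m"
      using r(1) by (simp add: t_def norm_mult norm_power power_divide)
    ultimately show ?thesis using r(1) by (simp add: mult_right_mono)
  qed
  have "\<exists>v. v holomorphic_on ball c d \<and> (\<forall>z\<in>ball c d - {c}. v z = (z - c) ^ m * u i z)" if i: "i \<in> I" for i
  proof (subst holomorphic_on_extend_bounded)
    show "(\<lambda>z. (z - c) ^ m * u i z) holomorphic_on ball c d - {c}"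
      by (intro holomorphic_intros uh[OF i])
    show "c \<in> interior (ball c d)" using d by simp
    show "\<exists>B. \<forall>\<^sub>F z in at c. cmod ((z - c) ^ m * u i z) \<le> B"
    proof
      have "\<forall>\<^sub>F z in at c. z \<in> ball c r \<and> z \<noteq> c"
        using r by (intro eventually_conj eventually_at_in_open' eventually_neq_at_within) auto
      then show "\<forall>\<^sub>F z in at c. cmod ((z - c) ^ m * u i z) \<le> sqrt (card I * M) * r ^ m"
        by eventually_elim (rule bounded[OF i], auto)
    qed
  qed
  then show ?thesis by (rule that)
qed

text \<open>A pole is lowered as long as its order is not an eigenvalue of \<open>B c\<close>: by the equation, the vector of
  leading coefficients is an eigenvector, hence zero.\<close>

lemma regular_singular_extension:
  fixes u :: "'i \<Rightarrow> complex \<Rightarrow> complex" and N :: int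
  assumes I: "finite I" and d: "d > 0"
    and B: "\<And>i j. i \<in> I \<Longrightarrow> j \<in> I \<Longrightarrow> B i j holomorphic_on ball c d"
    and u: "\<And>i z. i \<in> I \<Longrightarrow> z \<in> ball c d - {c} \<Longrightarrow>
      (u i has_field_derivative (\<Sum>j\<in>I. B i j z * u j z) / (z - c)) (at z)"
    and eig: "\<And>n x. n > N \<Longrightarrow> (\<And>i. i \<in> I \<Longrightarrow> - of_int n * x i = (\<Sum>j\<in>I. B i j c * x j)) \<Longrightarrow> \<forall>i\<in>I. x i = 0"
    and i: "i \<in> I"
  shows "\<exists>v. v holomorphic_on ball c d \<and> (\<forall>z\<in>ball c d - {c}. v z = (z - c) powi N * u i z)"
proof -
  define P where "P = (\<lambda>n::int. \<forall>i\<in>I. \<exists>v. v holomorphic_on ball c d \<and> (\<forall>z\<in>ball c d - {c}. v z = (z - c) powi n * u i z))"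
  obtain m :: nat where m: "\<And>i. i \<in> I \<Longrightarrow>
      \<exists>v. v holomorphic_on ball c d \<and> (\<forall>z\<in>ball c d - {c}. v z = (z - c) ^ m * u i z)"
    using moderate_growth[OF I d B u] by blast
  have up: "P (n + int k)" if Pn: "P n" for n k
    unfolding P_def
  proof
    fix i assume "i \<in> I"
    then obtain v where v: "v holomorphic_on ball c d" "\<forall>z\<in>ball c d - {c}. v z = (z - c) powi n * u i z"
      using Pn unfolding P_def by blast
    have "(\<lambda>z. (z - c) ^ k * v z) holomorphic_on ball c d" by (intro holomorphic_intros v)
    moreover have "\<forall>z\<in>ball c d - {c}. (z - c) ^ k * v z = (z - c) powi (n + int k) * u i z"
      using v(2) by (auto simp: power_int_add)
    ultimately show "\<exists>v. v holomorphic_on ball c d \<and> (\<forall>z\<in>ball c d - {c}. v z = (z - c) powi (n + int k) * u i z)"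
      by (intro exI[of _ "\<lambda>z. (z - c) ^ k * v z"] conjI)
  qed
  have cb: "c \<in> ball c d" using d by simp
  have ne: "\<forall>\<^sub>F z in at c. z \<in> ball c d - {c}"
  proof -
    have "\<forall>\<^sub>F z in at c. z \<in> ball c d \<and> z \<noteq> c"
      using cb by (intro eventually_conj eventually_at_in_open' eventually_neq_at_within) auto
    then show ?thesis by eventually_elim auto
  qed
  have down: "P (n - 1)" if P: "P n" and n: "n > N" for n
  proof -
    from P obtain v where v: "\<And>i. i \<in> I \<Longrightarrow> v i holomorphic_on ball c d"
      "\<And>i z. i \<in> I \<Longrightarrow> z \<in> ball c d - {c} \<Longrightarrow> v i z = (z - c) powi n * u i z"
      unfolding P_def by metis
    have op: "open (ball c d - {c})" by (simp add: open_Diff)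
    have lim: "(f \<longlongrightarrow> f c) (at c)" if "f holomorphic_on ball c d" for f :: "complex \<Rightarrow> complex"
      using holomorphic_on_imp_continuous_on[OF that] cb by (simp add: continuous_on_eq_continuous_at isCont_def)
    have "- of_int n * v i c = (\<Sum>j\<in>I. B i j c * v j c)" if i: "i \<in> I" for i
    proof -
      have dv: "(z - c) * deriv (v i) z = of_int n * v i z + (\<Sum>j\<in>I. B i j z * v j z)" if z: "z \<in> ball c d - {c}" for z
      proof -
        have zc: "z \<noteq> c" "z - c \<noteq> 0" using z by auto
        have "((\<lambda>z. (z - c) powi n * u i z) has_field_derivative
          (of_int n * (z - c) powi n / (z - c) * u i z + (\<Sum>j\<in>I. B i j z * u j z) / (z - c) * (z - c) powi n)) (at z)"
        proof (rule DERIV_mult[OF _ u[OF i z]])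
          have "((\<lambda>z. z - c) has_field_derivative 1) (at z)" by (auto intro!: derivative_eq_intros)
          from DERIV_chain2[where f = "\<lambda>z. z powi n" and g = "\<lambda>z. z - c" and x = z and s = UNIV,
              OF powi_has_field_derivative[OF zc(2), of n] this]
          show "((\<lambda>z. (z - c) powi n) has_field_derivative of_int n * (z - c) powi n / (z - c)) (at z)" by simp
        qed
        then have "(v i has_field_derivative
          (of_int n * (z - c) powi n / (z - c) * u i z + (\<Sum>j\<in>I. B i j z * u j z) / (z - c) * (z - c) powi n)) (at z)"
          by (rule has_field_derivative_transform_within_open[OF _ op z]) (simp add: v(2)[OF i])
        then have "(z - c) * deriv (v i) z = of_int n * ((z - c) powi n * u i z) + (\<Sum>j\<in>I. B i j z * u j z) * (z - c) powi n"
          using zc(2) by (simp add: DERIV_imp_deriv distrib_left)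
        also have "(\<Sum>j\<in>I. B i j z * u j z) * (z - c) powi n = (\<Sum>j\<in>I. B i j z * v j z)"
          unfolding sum_distrib_right using v(2)[OF _ z] by (intro sum.cong) (auto simp: ac_simps)
        finally show ?thesis using v(2)[OF i z] by simp
      qed
      have 1: "((\<lambda>z. (z - c) * deriv (v i) z) \<longlongrightarrow> (c - c) * deriv (v i) c) (at c)"
        by (intro tendsto_intros lim holomorphic_deriv v(1) i open_ball)
      have 2: "((\<lambda>z. of_int n * v i z + (\<Sum>j\<in>I. B i j z * v j z)) \<longlongrightarrow> of_int n * v i c + (\<Sum>j\<in>I. B i j c * v j c)) (at c)"
        by (intro tendsto_intros lim B v(1) i)
      have "\<forall>\<^sub>F z in at c. (z - c) * deriv (v i) z = of_int n * v i z + (\<Sum>j\<in>I. B i j z * v j z)"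
        using ne by eventually_elim (rule dv)
      from tendsto_unique[OF trivial_limit_at 2 Lim_transform_eventually[OF 1 this]]
      have "of_int n * v i c + (\<Sum>j\<in>I. B i j c * v j c) = 0" by simp
      then show ?thesis by (simp only: add_eq_0_iff mult_minus_left)
    qed
    then have v0: "\<forall>i\<in>I. v i c = 0" by (intro eig[OF n]) auto
    show "P (n - 1)" unfolding P_def
    proof
      fix i assume i: "i \<in> I"
      show "\<exists>w. w holomorphic_on ball c d \<and> (\<forall>z\<in>ball c d - {c}. w z = (z - c) powi (n - 1) * u i z)"
      proof (subst holomorphic_on_extend_lim)
        have "u i holomorphic_on ball c d - {c}" unfolding holomorphic_on_open[OF op] using u[OF i] by blast
        then show "(\<lambda>z. (z - c) powi (n - 1) * u i z) holomorphic_on ball c d - {c}"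
          by (intro holomorphic_intros) auto
        show "c \<in> interior (ball c d)" using d by simp
        have "(v i \<longlongrightarrow> 0) (at c)" using lim[OF v(1)[OF i]] v0 i by simp
        then show "((\<lambda>z. (z - c) * ((z - c) powi (n - 1) * u i z)) \<longlongrightarrow> 0) (at c)"
          by (rule Lim_transform_eventually) (use ne in eventually_elim, simp add: v(2)[OF i] power_int_diff)
      qed
    qed
  qed
  \<comment> \<open>The exponent \<open>m\<close> from the growth estimate may lie below
    \<open>N\<close>; it is first raised to an exponent of the form \<open>N + k\<close> with a
    natural number \<open>k\<close>, from which the induction descends to \<open>N\<close>.\<close>
  have "P (int m)" unfolding P_def using m by simp
  then have "P (N + int k)" if "N + int k \<ge> int m" for k
    using up[of "int m" "nat (N + int k - int m)"] that by simp
  moreover have "int m \<le> N + int (m + nat (- N))" by (cases "N \<ge> 0") auto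
  ultimately have start: "P (N + int (m + nat (- N)))" by blast
  have "P (N + int k) \<Longrightarrow> P N" for k
  proof (induction k)
    case (Suc k)
    have "P (N + int (Suc k) - 1)" by (rule down[OF Suc.prems]) simp
    then show ?case using Suc.IH by simp
  qed simp
  from this[OF start] have "P N" .
  then show ?thesis using i by (auto simp: P_def)
qed

section \<open>Solutions on the covering surface\<close>

lemma has_coord_deriv_continuous:
  assumes f: "has_coord_deriv X u f D x"
    and u: "(u \<longlongrightarrow> u x) (at x within X)" "\<forall>\<^sub>F y in at x within X. u y \<noteq> u x"
  shows "(f \<longlongrightarrow> f x) (at x within X)"
proof -
  have "((\<lambda>y. (f y - f x) / (u y - u x) * (u y - u x) + f x) \<longlongrightarrow> D * (u x - u x) + f x) (at x within X)"
    by (intro tendsto_intros f[unfolded has_coord_deriv_def] u(1))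
  then have "((\<lambda>y. (f y - f x) / (u y - u x) * (u y - u x) + f x) \<longlongrightarrow> f x) (at x within X)" by simp
  then show ?thesis
    by (rule Lim_transform_eventually) (use u(2) in eventually_elim, simp)
qed

context
  fixes a :: "nat \<Rightarrow> complex" and g t and St :: "'b::real_normed_vector set" and rho x0 sg
  assumes mono: "monodromy_setup a g t St rho x0 sg"
begin

lemma ode_solution_continuous_at_infinity:
  assumes y: "ode_solution St rho q1 q2 y" and x: "x \<in> St" "rho x = rinf"
  shows "(y \<longlongrightarrow> y x) (at x within St)"
proof -
  obtain D where D: "has_coord_deriv St (\<lambda>x. if rho x = rinf then 0 else 1 / to_plane (rho x)) y D x"
    using y x unfolding ode_solution_def by blast
  have e: "(\<lambda>x. if rho x = rinf then 0 else 1 / to_plane (rho x)) = (\<lambda>x. pole_chart 0 (rho x))"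
    by (auto simp: pole_chart_def)
  have "pole_chart 0 (rho x) = 0" using x by (simp add: pole_chart_def)
  then show ?thesis
    using has_coord_deriv_continuous[OF D[unfolded e]] pole_chart_tendsto[OF mono x] pole_chart_nonzero[OF mono x] by simp
qed

text \<open>The identity theorem applies in each chart, and connectedness of the surface spreads the
  zeros. Over infinity the chart first gives a holomorphic function on the punctured disc only; an
  open set in the chart cannot consist of the centre alone, and the value at the centre follows by
  continuity.\<close>

lemma ode_solution_identity:
  assumes y: "ode_solution St rho q1 q2 y" and V: "openin (top_of_set St) V" "V \<noteq> {}" "\<And>x. x \<in> V \<Longrightarrow> y x = 0"
    and x: "x \<in> St"
  shows "y x = 0"
proof -
  obtain y' where y': "\<And>x. x \<in> finite_part St rho \<Longrightarrow>
      has_coord_deriv (finite_part St rho) (\<lambda>x. to_plane (rho x)) y (y' x) x"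
    using y unfolding ode_solution_def by blast
  define P where "P = (\<lambda>x. \<exists>V. openin (top_of_set St) V \<and> x \<in> V \<and> (\<forall>x\<in>V. y x = 0))"
  have local: "\<exists>N. openin (top_of_set St) N \<and> p \<in> N \<and> (\<forall>x\<in>N. \<forall>z\<in>N. P x \<longrightarrow> P z)" if p: "p \<in> St" for p
  proof -
    have "\<exists>N. openin (top_of_set St) N \<and> p \<in> N \<and> (\<forall>V x. openin (top_of_set St) V \<longrightarrow> x \<in> V \<longrightarrow> x \<in> N \<longrightarrow> (\<forall>x\<in>V. y x = 0) \<longrightarrow> (\<forall>x\<in>N. y x = 0))"
    proof (cases "rho p = rinf")
      case False
      let ?c = "to_plane (rho p)"
      obtain r N S where N: "openin (top_of_set St) N" "p \<in> N" and S: "continuous_on (ball ?c r) S"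
        "\<And>w. w \<in> ball ?c r \<Longrightarrow> S w \<in> N \<and> rho (S w) = of_plane w \<and> w \<notin> a ` {1..4}"
        "\<And>x'. x' \<in> N \<Longrightarrow> rho x' \<noteq> rinf \<and> to_plane (rho x') \<in> ball ?c r \<and> S (to_plane (rho x')) = x'"
        by (rule finite_chart[OF mono p False zero_less_one]) blast
      have NSt: "N \<subseteq> St" using N(1) by (rule openin_imp_subset)
      have SF: "S w \<in> finite_part St rho \<and> to_plane (rho (S w)) = w" if "w \<in> ball ?c r" for w
        using S(2)[OF that] NSt of_plane_neq_rinf by (auto simp: finite_part_def)
      have "((\<lambda>w. y (S w)) has_field_derivative y' (S w)) (at w)" if w: "w \<in> ball ?c r" for w
        by (rule has_coord_deriv_section[OF open_ball w S(1) SF]) (use y' SF[OF w] in auto)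
      then have hol: "(\<lambda>w. y (S w)) holomorphic_on ball ?c r"
        unfolding holomorphic_on_open[OF open_ball] by blast
      show ?thesis
      proof (intro exI conjI allI impI ballI)
        fix V x z
        assume V: "openin (top_of_set St) V" "x \<in> V" "x \<in> N" "\<forall>x\<in>V. y x = 0" and z: "z \<in> N"
        obtain O' where O: "open O'" "V = St \<inter> O'" using V(1) by (auto simp: openin_open)
        have op: "open (ball ?c r \<inter> S -` O')" by (rule continuous_open_preimage[OF S(1) open_ball O(1)])
        have xin: "to_plane (rho x) \<in> ball ?c r \<inter> S -` O'" using S(3)[OF V(3)] V(2) O(2) by auto
        have zero: "y (S w) = 0" if "w \<in> ball ?c r \<inter> S -` O'" for w
          using that V(4) O(2) S(2)[of w] NSt by auto
        have "y (S (to_plane (rho z))) = 0"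
          by (rule analytic_continuation_open[OF op open_ball _ connected_ball _ hol holomorphic_on_const zero])
            (use xin S(3)[OF z] in auto)
        then show "y z = 0" using S(3)[OF z] by simp
      qed (use N in auto)
    next
      case True
      obtain r N S where r: "r > 0" and N: "openin (top_of_set St) N" "p \<in> N" and S: "continuous_on (ball 0 r) S"
        "\<And>w. w \<in> ball 0 r \<Longrightarrow> S w \<in> N \<and> rho (S w) = inv_chart w"
        "\<And>x'. x' \<in> N \<Longrightarrow> pole_chart 0 (rho x') \<in> ball 0 r \<and> S (pole_chart 0 (rho x')) = x'"
        by (rule infinite_chart[OF mono p True zero_less_one]) blast
      have NSt: "N \<subseteq> St" using N(1) by (rule openin_imp_subset)
      have S0: "S 0 = p" using S(3)[OF N(2)] True by (simp add: pole_chart_def)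
      let ?U = "{z. cmod z > 1 / r}"
      have U: "z \<noteq> 0" "1 / z \<in> ball 0 r" if "z \<in> ?U" for z
      proof -
        have "0 < 1 / r" using r by simp
        then show "z \<noteq> 0" using that by auto
        then show "1 / z \<in> ball 0 r" using that r by (simp add: norm_divide field_simps)
      qed
      have SF: "S (1 / z) \<in> finite_part St rho \<and> to_plane (rho (S (1 / z))) = z" if z: "z \<in> ?U" for z
        using S(2)[OF U(2)[OF z]] U(1)[OF z] NSt of_plane_neq_rinf by (auto simp: finite_part_def inv_chart_def)
      have Sc: "continuous_on ?U (\<lambda>z. S (1 / z))"
        by (rule continuous_on_compose2[OF S(1)]) (use U in \<open>auto intro!: continuous_intros\<close>)
      have "((\<lambda>z. y (S (1 / z))) has_field_derivative y' (S (1 / z))) (at z)" if z: "z \<in> ?U" for z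
        by (rule has_coord_deriv_section[OF open_outside_disc z Sc SF]) (use y' SF[OF z] in auto)
      then have holU: "(\<lambda>z. y (S (1 / z))) holomorphic_on ?U"
        unfolding holomorphic_on_open[OF open_outside_disc] by blast
      have "(\<lambda>w. y (S (1 / (1 / w)))) holomorphic_on (ball 0 r - {0})"
        by (rule holomorphic_on_compose_gen[OF _ holU, of "\<lambda>w. 1 / w", unfolded o_def])
          (use r in \<open>auto intro!: holomorphic_intros simp: norm_divide field_simps\<close>)
      then have hol: "(\<lambda>w. y (S w)) holomorphic_on (ball 0 r - {0})" by simp
      have op0: "open (ball 0 r - {0::complex})" by (simp add: open_Diff)
      have con: "connected (ball 0 r - {0::complex})" by (rule connected_open_delete) auto
      show ?thesis
      proof (intro exI conjI allI impI ballI)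
        fix V x z
        assume V: "openin (top_of_set St) V" "x \<in> V" "x \<in> N" "\<forall>x\<in>V. y x = 0" and z: "z \<in> N"
        obtain O' where O: "open O'" "V = St \<inter> O'" using V(1) by (auto simp: openin_open)
        have op: "open (ball 0 r \<inter> S -` O')" by (rule continuous_open_preimage[OF S(1) open_ball O(1)])
        then have op': "open (ball 0 r \<inter> S -` O' - {0})" by (simp add: open_Diff)
        have xin: "pole_chart 0 (rho x) \<in> ball 0 r \<inter> S -` O'" using S(3)[OF V(3)] V(2) O(2) by auto
        have ne: "ball 0 r \<inter> S -` O' - {0} \<noteq> {}"
        proof
          assume "ball 0 r \<inter> S -` O' - {0} = {}"
          then have "ball 0 r \<inter> S -` O' = {0}" using xin by auto
          then show False using op by (metis not_open_singleton)
        qed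
        have zero: "y (S w) = 0" if "w \<in> ball 0 r \<inter> S -` O' - {0}" for w
          using that V(4) O(2) S(2)[of w] NSt by auto
        have z0: "y (S w) = 0" if w: "w \<in> ball 0 r - {0}" for w
          by (rule analytic_continuation_open[OF op' op0 ne con _ hol holomorphic_on_const zero w]) auto
        have "isCont S 0" using S(1) r by (simp add: continuous_on_eq_continuous_at)
        then have "(S \<longlongrightarrow> p) (at 0)" by (simp add: isCont_def S0)
        moreover have evb: "\<forall>\<^sub>F w in at 0. w \<in> ball 0 r \<and> w \<noteq> 0"
          using r by (intro eventually_conj eventually_at_in_open' eventually_neq_at_within) auto
        then have "\<forall>\<^sub>F w in at 0. S w \<in> St - {p}"
        proof eventually_elim
          case (elim w)
          then have "rho (S w) = inv_chart w" "S w \<in> St" using S(2)[of w] NSt by auto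
          moreover have "inv_chart w \<noteq> rinf" using elim of_plane_neq_rinf by (simp add: inv_chart_def)
          ultimately show ?case using True by auto
        qed
        ultimately have "filterlim S (at p within St) (at 0)" by (rule filterlim_at_withinI)
        from filterlim_compose[OF ode_solution_continuous_at_infinity[OF y p True] this]
        have 1: "((\<lambda>w. y (S w)) \<longlongrightarrow> y p) (at 0)" .
        have "\<forall>\<^sub>F w in at 0. y (S w) = 0" using evb by eventually_elim (use z0 in auto)
        then have "((\<lambda>w. y (S w)) \<longlongrightarrow> 0) (at 0)" by (rule tendsto_eventually)
        from tendsto_unique[OF trivial_limit_at 1 this] have yp: "y (S 0) = 0" by (simp add: S0)
        show "y z = 0"
        proof (cases "pole_chart 0 (rho z) = 0")
          case True
          then show ?thesis using S(3)[OF z] yp by auto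
        next
          case False
          then show ?thesis using S(3)[OF z] z0[of "pole_chart 0 (rho z)"] by auto
        qed
      qed (use N in auto)
    qed
    then obtain N where N: "openin (top_of_set St) N" "p \<in> N"
      "\<And>V x. openin (top_of_set St) V \<Longrightarrow> x \<in> V \<Longrightarrow> x \<in> N \<Longrightarrow> \<forall>x\<in>V. y x = 0 \<Longrightarrow> \<forall>x\<in>N. y x = 0"
      by blast
    show ?thesis
    proof (intro exI[of _ N] conjI ballI impI N(1,2))
      fix x z assume "x \<in> N" "z \<in> N" "P x"
      then obtain V where "openin (top_of_set St) V" "x \<in> V" "\<forall>x\<in>V. y x = 0" unfolding P_def by blast
      then have "\<forall>x\<in>N. y x = 0" using N(3) \<open>x \<in> N\<close> by blast
      then show "P z" unfolding P_def using N(1) \<open>z \<in> N\<close> by blast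
    qed
  qed
  obtain v where v: "v \<in> V" using V(2) by blast
  have "P v" unfolding P_def using V v by blast
  moreover have "v \<in> St" using v openin_imp_subset[OF V(1)] by blast
  ultimately have "P x"
    using connected_induction_simple[OF setup_connected[OF mono] _ x, of v P] local by blast
  then show ?thesis unfolding P_def by blast
qed

end

section \<open>Local exponents and the first kind system of a row vector\<close>

lemma row_matrix_zero:
  fixes k1 k2 :: complex
  assumes "k1 * m11 + k2 * m21 = 0" "k1 * m12 + k2 * m22 = 0" "m11 * m22 - m12 * m21 \<noteq> 0"
  shows "k1 = 0 \<and> k2 = 0"
proof -
  have "k1 * (m11 * m22 - m12 * m21) = 0" "k2 * (m11 * m22 - m12 * m21) = 0"
    using assms(1,2) by algebra+
  then show ?thesis using assms(3) by simp
qed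

text \<open>A row \<open>f (l + R - x')(l + R - y')\<close> can vanish only if \<open>l\<close> is a difference of an exponent \<open>x'\<close>, \<open>y'\<close> and an
  eigenvalue of \<open>R\<close>.\<close>

lemma exponent_row_zero:
  fixes R :: "complex^2^2" and l f1 f2 g1 g2 p q :: complex
  assumes R: "eigenvalue_pair R x y"
    and pq: "p = 1 - (x + y + 2 * s)" "q = (x + s) * (y + s)"
    and f: "l * f1 = g1 - (f1 * R$1$1 + f2 * R$2$1)" "l * f2 = g2 - (f1 * R$1$2 + f2 * R$2$2)"
    and g: "l * g1 = g1 - p * g1 - q * f1 - (g1 * R$1$1 + g2 * R$2$1)"
      "l * g2 = g2 - p * g2 - q * f2 - (g1 * R$1$2 + g2 * R$2$2)"
    and l: "l \<noteq> s" "l \<noteq> s + (x - y)" "l \<noteq> s - (x - y)"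
  shows "f1 = 0 \<and> f2 = 0 \<and> g1 = 0 \<and> g2 = 0"
proof -
  have R': "x + y = R$1$1 + R$2$2" "x * y = R$1$1 * R$2$2 - R$1$2 * R$2$1"
    using R by (auto simp: eigenvalue_pair_2)
  define c where "c = l - (x + s)"
  define d where "d = l - (y + s)"
  define k1 where "k1 = f1 * (R$1$1 + c) + f2 * R$2$1"
  define k2 where "k2 = f1 * R$1$2 + f2 * (R$2$2 + c)"
  \<comment> \<open>The first two equations read \<open>g = f (R + l)\<close>. Inserted into the
    others they leave \<open>f (R + c) (R + d) = 0\<close>, and each factor has a determinant which
    is a product of two non-zero numbers.\<close>
  have g': "g1 = f1 * (R$1$1 + l) + f2 * R$2$1" "g2 = f1 * R$1$2 + f2 * (R$2$2 + l)"
    using f by (simp_all add: algebra_simps)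
  have k: "k1 * (R$1$1 + d) + k2 * R$2$1 = 0" "k1 * R$1$2 + k2 * (R$2$2 + d) = 0"
    using g unfolding g' k1_def k2_def c_def d_def pq by algebra+
  have "(R$1$1 + d) * (R$2$2 + d) - R$1$2 * R$2$1 = (d + x) * (d + y)"
    using R' by algebra
  moreover have "d + x \<noteq> 0" "d + y \<noteq> 0" using l by (auto simp: d_def algebra_simps)
  ultimately have k0: "k1 = 0 \<and> k2 = 0" by (intro row_matrix_zero[OF k]) simp
  have "(R$1$1 + c) * (R$2$2 + c) - R$1$2 * R$2$1 = (c + x) * (c + y)"
    using R' by algebra
  moreover have "c + x \<noteq> 0" "c + y \<noteq> 0" using l by (auto simp: c_def algebra_simps)
  ultimately have "f1 = 0 \<and> f2 = 0"
    using k0 by (intro row_matrix_zero[of f1 "R$1$1 + c" f2 "R$2$1" "R$1$2" "R$2$2 + c"]) (simp_all add: k1_def k2_def)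
  then show ?thesis using g' by simp
qed

text \<open>\<open>f\<close> plays the role of \<open>y Y^(-1)\<close> and \<open>G\<close> that of
  \<open>y' Y^(-1)\<close>. Multiplying \<open>G\<close> by \<open>z - c\<close> reduces the double
  pole of \<open>q2\<close> to a simple one, so that \<open>f\<close> and \<open>(z - c) G\<close>
  together form a system of the first kind in four unknowns. Its residue at \<open>c\<close> has no
  eigenvalue \<open>- n\<close> with \<open>n > - s\<close>, which bounds the pole of
  \<open>f\<close>.\<close>

lemma fuchsian_row_extension:
  fixes A H :: "complex \<Rightarrow> complex^2^2" and f G :: "2 \<Rightarrow> complex \<Rightarrow> complex" and s :: int
  assumes d: "d > 0" and H: "matrix_holomorphic_on H (ball c d)"
      "\<And>z. z \<in> ball c d - {c} \<Longrightarrow> H z = mat (z - c) ** A z" "eigenvalue_pair (H c) x y"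
    and res: "x - y \<in> \<int> \<Longrightarrow> x = y"
    and q: "fuchsian_with_exponents q1 q2 c (x + of_int s) (y + of_int s)"
      "q1 holomorphic_on ball c d - {c}" "q2 holomorphic_on ball c d - {c}"
    and f: "\<And>j z. z \<in> ball c d - {c} \<Longrightarrow>
        (f j has_field_derivative G j z - (f 1 z * A z $ 1 $ j + f 2 z * A z $ 2 $ j)) (at z)"
    and G: "\<And>j z. z \<in> ball c d - {c} \<Longrightarrow>
        (G j has_field_derivative - q1 z * G j z - q2 z * f j z - (G 1 z * A z $ 1 $ j + G 2 z * A z $ 2 $ j)) (at z)"
  shows "((\<lambda>z. (z - c) * ((z - c) powi (- s) * f j z)) \<longlongrightarrow> 0) (at c)"
proof -
  obtain r1 r2 where r: "r1 analytic_on {c}" "r2 analytic_on {c}"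
    and ev: "\<forall>\<^sub>F z in at c. q1 z = r1 z / (z - c) \<and> q2 z = r2 z / (z - c)\<^sup>2"
    and ind: "\<And>X. X * (X - 1) + r1 c * X + r2 c = (X - (x + of_int s)) * (X - (y + of_int s))"
    using q(1) unfolding fuchsian_with_exponents_def by blast
  have rc: "r1 c = 1 - (x + y + 2 * of_int s)" "r2 c = (x + of_int s) * (y + of_int s)"
    using ind[of 0] ind[of 1] by (auto simp: algebra_simps)
  obtain e1 where e1: "e1 > 0" "r1 holomorphic_on ball c e1" using r(1) by (auto simp: analytic_on_def)
  obtain e2 where e2: "e2 > 0" "r2 holomorphic_on ball c e2" using r(2) by (auto simp: analytic_on_def)
  obtain e3 where e3: "e3 > 0" "\<And>z. z \<noteq> c \<Longrightarrow> dist z c < e3 \<Longrightarrow> q1 z = r1 z / (z - c) \<and> q2 z = r2 z / (z - c)\<^sup>2"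
    using ev unfolding eventually_at by auto
  define e where "e = min (min d e1) (min e2 e3)"
  have e: "e > 0" "ball c e \<subseteq> ball c d" "ball c e \<subseteq> ball c e1" "ball c e \<subseteq> ball c e2"
    using d e1 e2 e3 by (auto simp: e_def)
  have qr: "q1 z = r1 z / (z - c)" "q2 z = r2 z / (z - c)\<^sup>2" if "z \<in> ball c e - {c}" for z
    using e3(2)[of z] that by (auto simp: e_def dist_commute)
  have rh: "r1 holomorphic_on ball c e" "r2 holomorphic_on ball c e"
    using e1 e2 e by (auto intro: holomorphic_on_subset)
  have Hh: "(\<lambda>z. H z $ i $ j) holomorphic_on ball c e" for i j
    by (rule holomorphic_on_subset[OF matrix_holomorphic_onD[OF H(1)] e(2)])
  define u where "u = (\<lambda>i::nat. if i = 1 then f 1 else if i = 2 then f 2 else if i = 3 then (\<lambda>z. (z - c) * G 1 z) else (\<lambda>z. (z - c) * G 2 z))"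
  define B where "B = (\<lambda>(i::nat) (j::nat). if i = 1 then
        (if j = 1 then (\<lambda>z. - H z $ 1 $ 1) else if j = 2 then (\<lambda>z. - H z $ 2 $ 1) else if j = 3 then (\<lambda>z. 1) else (\<lambda>z. 0))
      else if i = 2 then
        (if j = 1 then (\<lambda>z. - H z $ 1 $ 2) else if j = 2 then (\<lambda>z. - H z $ 2 $ 2) else if j = 3 then (\<lambda>z. 0) else (\<lambda>z. 1))
      else if i = 3 then
        (if j = 1 then (\<lambda>z. - r2 z) else if j = 2 then (\<lambda>z. 0) else if j = 3 then (\<lambda>z. 1 - r1 z - H z $ 1 $ 1) else (\<lambda>z. - H z $ 2 $ 1))
      else
        (if j = 1 then (\<lambda>z. 0) else if j = 2 then (\<lambda>z. - r2 z) else if j = 3 then (\<lambda>z. - H z $ 1 $ 2) else (\<lambda>z. 1 - r1 z - H z $ 2 $ 2)))"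
  have S: "(\<Sum>j\<in>{1,2,3,4::nat}. F j) = F 1 + F 2 + F 3 + F 4" for F :: "nat \<Rightarrow> complex" by simp
  have Bh: "B i j holomorphic_on ball c e" for i j
    by (auto simp: B_def intro!: holomorphic_intros rh Hh)
  have du: "(u i has_field_derivative (\<Sum>j\<in>{1,2,3,4}. B i j z * u j z) / (z - c)) (at z)"
    if i: "i \<in> {1,2,3,4}" and z: "z \<in> ball c e - {c}" for i z
  proof -
    have zd: "z \<in> ball c d - {c}" and zc: "z - c \<noteq> 0" using z e(2) by auto
    have Az: "A z $ i $ j = H z $ i $ j / (z - c)" for i j
      using H(2)[OF zd] zc by (simp add: mat_mult_left)
    have fd: "(f j has_field_derivative ((z - c) * G j z - (f 1 z * H z $ 1 $ j + f 2 z * H z $ 2 $ j)) / (z - c)) (at z)" for j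
      by (rule DERIV_cong[OF f[OF zd]]) (use zc in \<open>simp add: Az diff_divide_distrib add_divide_distrib\<close>)
    have Gd: "((\<lambda>z. (z - c) * G j z) has_field_derivative
        ((z - c) * G j z - r1 z * ((z - c) * G j z) - r2 z * f j z
           - ((z - c) * G 1 z * H z $ 1 $ j + (z - c) * G 2 z * H z $ 2 $ j)) / (z - c)) (at z)" for j
    proof (rule DERIV_cong[OF DERIV_mult[OF _ G[OF zd]]])
      show "((\<lambda>z. z - c) has_field_derivative 1) (at z)" by (auto intro!: derivative_eq_intros)
      show "1 * G j z + (- q1 z * G j z - q2 z * f j z - (G 1 z * A z $ 1 $ j + G 2 z * A z $ 2 $ j)) * (z - c)
        = ((z - c) * G j z - r1 z * ((z - c) * G j z) - r2 z * f j z
           - ((z - c) * G 1 z * H z $ 1 $ j + (z - c) * G 2 z * H z $ 2 $ j)) / (z - c)"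
        unfolding qr[OF z] Az using zc by (simp add: divide_simps power2_eq_square) (simp add: algebra_simps)
    qed
    consider "i = 1" | "i = 2" | "i = 3" | "i = 4" using i by auto
    then show ?thesis
    proof cases
      case 1 then show ?thesis using fd[of 1] unfolding S by (simp add: u_def B_def algebra_simps)
    next
      case 2 then show ?thesis using fd[of 2] unfolding S by (simp add: u_def B_def algebra_simps)
    next
      case 3 then show ?thesis using Gd[of 1] unfolding S by (simp add: u_def B_def algebra_simps)
    next
      case 4 then show ?thesis using Gd[of 2] unfolding S by (simp add: u_def B_def algebra_simps)
    qed
  qed
  have eig: "\<forall>i\<in>{1,2,3,4}. X i = 0" if n: "n > - s"
    and X: "\<And>i. i \<in> {1,2,3,4} \<Longrightarrow> - of_int n * X i = (\<Sum>j\<in>{1,2,3,4}. B i j c * X j)" for n :: int and X :: "nat \<Rightarrow> complex"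
  proof -
    \<comment> \<open>An eigenvalue \<open>- n\<close> would have to be one of \<open>s\<close>,
      \<open>s + (x - y)\<close> and \<open>s - (x - y)\<close>. The condition
      \<open>n > - s\<close> excludes the first; the others would make \<open>x - y\<close> an
      integer, hence 0 by non-resonance, and so reduce to the first.\<close>
    have ne: "- of_int n \<noteq> (of_int s :: complex)"
    proof
      assume "- of_int n = (of_int s :: complex)"
      then have "of_int (- n) = (of_int s :: complex)" by simp
      then have "- n = s" by (simp only: of_int_eq_iff)
      then show False using n by simp
    qed
    have ne2: "- of_int n \<noteq> of_int s + (x - y)"
    proof
      assume "- of_int n = of_int s + (x - y)"
      then have "x - y = of_int (- n - s)" by (simp add: algebra_simps)
      then have "x = y" using res by (metis Ints_of_int)
      then show False using \<open>- of_int n = of_int s + (x - y)\<close> ne by simp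
    qed
    have ne3: "- of_int n \<noteq> of_int s - (x - y)"
    proof
      assume "- of_int n = of_int s - (x - y)"
      then have "x - y = of_int (n + s)" by (simp add: algebra_simps)
      then have "x = y" using res by (metis Ints_of_int)
      then show False using \<open>- of_int n = of_int s - (x - y)\<close> ne by simp
    qed
    have "X 1 = 0 \<and> X 2 = 0 \<and> X 3 = 0 \<and> X 4 = 0"
      by (rule exponent_row_zero[OF H(3) rc, of "- of_int n"])
        (use X[of 1] X[of 2] X[of 3] X[of 4] ne ne2 ne3 in \<open>simp_all add: S B_def algebra_simps\<close>)
    then show ?thesis by simp
  qed
  have fin: "finite {1,2,3,4::nat}" by simp
  have "\<exists>i\<in>{1,2,3,4::nat}. u i = f j"
    using exhaust_2[of j] by (auto simp: u_def)
  then obtain i where i: "i \<in> {1,2,3,4::nat}" "u i = f j" by blast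
  have "\<exists>v. v holomorphic_on ball c e \<and> (\<forall>z\<in>ball c e - {c}. v z = (z - c) powi (- s) * u i z)"
  proof (rule regular_singular_extension[where B = B, OF fin e(1)])
    show "B i j holomorphic_on ball c e" for i j by (rule Bh)
    show "(u i has_field_derivative (\<Sum>j\<in>{1,2,3,4}. B i j z * u j z) / (z - c)) (at z)"
      if "i \<in> {1,2,3,4}" "z \<in> ball c e - {c}" for i z by (rule du[OF that])
    show "\<forall>i\<in>{1,2,3,4}. X i = 0"
      if "n > - s" "\<And>i. i \<in> {1,2,3,4} \<Longrightarrow> - of_int n * X i = (\<Sum>j\<in>{1,2,3,4}. B i j c * X j)"
      for n :: int and X :: "nat \<Rightarrow> complex" by (rule eig[OF that])
    show "i \<in> {1,2,3,4}" by (rule i(1))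
  qed
  then obtain v where v: "v holomorphic_on ball c e" "\<And>z. z \<in> ball c e - {c} \<Longrightarrow> v z = (z - c) powi (- s) * f j z"
    unfolding i(2) by blast
  have cb: "c \<in> ball c e" using e by simp
  have "(v \<longlongrightarrow> v c) (at c)"
    using holomorphic_on_imp_continuous_on[OF v(1)] cb by (simp add: continuous_on_eq_continuous_at isCont_def)
  then have "((\<lambda>z. (z - c) * v z) \<longlongrightarrow> (c - c) * v c) (at c)" by (intro tendsto_intros)
  then have "((\<lambda>z. (z - c) * v z) \<longlongrightarrow> 0) (at c)" by simp
  then show ?thesis
  proof (rule Lim_transform_eventually)
    have "\<forall>\<^sub>F z in at c. z \<in> ball c e \<and> z \<noteq> c"
      using cb by (intro eventually_conj eventually_at_in_open' eventually_neq_at_within) auto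
    then show "\<forall>\<^sub>F z in at c. (z - c) * v z = (z - c) * ((z - c) powi (- s) * f j z)"
      by eventually_elim (simp add: v(2))
  qed
qed

section \<open>No equation for equal indices\<close>

text \<open>The row vector \<open>(p1, p2)\<close> times the inverse of \<open>M\<close>, by
  Cramer's rule; the explicit quotient can be differentiated entry by entry.\<close>

definition cramer_row :: "complex \<Rightarrow> complex \<Rightarrow> complex^2^2 \<Rightarrow> 2 \<Rightarrow> complex" where
  "cramer_row p1 p2 M j =
     (if j = 1 then p1 * M$2$2 - p2 * M$2$1 else p2 * M$1$1 - p1 * M$1$2) / (M$1$1 * M$2$2 - M$1$2 * M$2$1)"

lemma cramer_row_solves:
  assumes "M$1$1 * M$2$2 - M$1$2 * M$2$1 \<noteq> 0"
  shows "cramer_row p1 p2 M 1 * M$1$1 + cramer_row p1 p2 M 2 * M$2$1 = p1"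
    "cramer_row p1 p2 M 1 * M$1$2 + cramer_row p1 p2 M 2 * M$2$2 = p2"
proof -
  let ?D = "M$1$1 * M$2$2 - M$1$2 * M$2$1"
  have "(p1 * M$2$2 - p2 * M$2$1) * M$1$1 + (p2 * M$1$1 - p1 * M$1$2) * M$2$1 = p1 * ?D"
    "(p1 * M$2$2 - p2 * M$2$1) * M$1$2 + (p2 * M$1$1 - p1 * M$1$2) * M$2$2 = p2 * ?D"
    by (simp_all add: algebra_simps)
  moreover have "cramer_row p1 p2 M 1 * M$1$1 + cramer_row p1 p2 M 2 * M$2$1 =
      ((p1 * M$2$2 - p2 * M$2$1) * M$1$1 + (p2 * M$1$1 - p1 * M$1$2) * M$2$1) / ?D"
    "cramer_row p1 p2 M 1 * M$1$2 + cramer_row p1 p2 M 2 * M$2$2 =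
      ((p1 * M$2$2 - p2 * M$2$1) * M$1$2 + (p2 * M$1$1 - p1 * M$1$2) * M$2$2) / ?D"
    by (simp_all add: cramer_row_def add_divide_distrib)
  ultimately show "cramer_row p1 p2 M 1 * M$1$1 + cramer_row p1 p2 M 2 * M$2$1 = p1"
    "cramer_row p1 p2 M 1 * M$1$2 + cramer_row p1 p2 M 2 * M$2$2 = p2"
    using assms by simp_all
qed

text \<open>A common right factor cancels: \<open>(p X) (M X)^(-1) = p M^(-1)\<close>. This is what
  makes the quotient of two objects with the same monodromy single valued.\<close>

lemma cramer_row_mult:
  assumes "M$1$1 * M$2$2 - M$1$2 * M$2$1 \<noteq> 0" "(M ** X)$1$1 * (M ** X)$2$2 - (M ** X)$1$2 * (M ** X)$2$1 \<noteq> 0"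
  shows "cramer_row (p1 * X$1$1 + p2 * X$2$1) (p1 * X$1$2 + p2 * X$2$2) (M ** X) j = cramer_row p1 p2 M j"
proof -
  let ?q1 = "p1 * X$1$1 + p2 * X$2$1" and ?q2 = "p1 * X$1$2 + p2 * X$2$2"
  let ?d = "\<lambda>j. cramer_row ?q1 ?q2 (M ** X) j - cramer_row p1 p2 M j"
  note a = cramer_row_solves[OF assms(1), of p1 p2] and b = cramer_row_solves[OF assms(2), of ?q1 ?q2]
  have m: "(c1 - a1) * (M ** X)$1$j + (c2 - a2) * (M ** X)$2$j =
      (c1 * (M ** X)$1$j + c2 * (M ** X)$2$j) - ((a1 * M$1$1 + a2 * M$2$1) * X$1$j + (a1 * M$1$2 + a2 * M$2$2) * X$2$j)" for a1 a2 c1 c2 j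
    by (simp add: mult2_nth algebra_simps)
  have "?d 1 * (M ** X)$1$1 + ?d 2 * (M ** X)$2$1 = 0" "?d 1 * (M ** X)$1$2 + ?d 2 * (M ** X)$2$2 = 0"
    unfolding m a b by simp_all
  from row_matrix_zero[OF this assms(2)] show ?thesis using exhaust_2[of j] by auto
qed

text \<open>This is \<open>(p Y^(-1))' = p' Y^(-1) - p Y^(-1) A\<close>. Numerator and determinant
  both produce a trace term, and these cancel in the quotient rule.\<close>

lemma cramer_row_derivative:
  fixes A Y :: "complex \<Rightarrow> complex^2^2"
  assumes Y: "\<And>i j. ((\<lambda>z. Y z $ i $ j) has_field_derivative (A z ** Y z) $ i $ j) (at z)" "invertible (Y z)"
    and p: "(p1 has_field_derivative d1) (at z)" "(p2 has_field_derivative d2) (at z)"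
  shows "((\<lambda>z. cramer_row (p1 z) (p2 z) (Y z) j) has_field_derivative
    cramer_row d1 d2 (Y z) j - (cramer_row (p1 z) (p2 z) (Y z) 1 * A z $ 1 $ j + cramer_row (p1 z) (p2 z) (Y z) 2 * A z $ 2 $ j)) (at z)"
proof -
  let ?D = "\<lambda>z. Y z$1$1 * Y z$2$2 - Y z$1$2 * Y z$2$1"
  have D0: "?D z \<noteq> 0" using Y(2) by (simp add: det_nz_iff)
  have dD: "(?D has_field_derivative (A z$1$1 + A z$2$2) * ?D z) (at z)"
    by (rule DERIV_cong[OF DERIV_diff[OF DERIV_mult[OF Y(1) Y(1)] DERIV_mult[OF Y(1) Y(1)]]])
      (simp add: mult2_nth algebra_simps)
  define n where "n = (\<lambda>p1 p2 M (j::2). if j = 1 then p1 * M$2$2 - p2 * M$2$1 else p2 * M$1$1 - p1 * (M::complex^2^2)$1$2)"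
  have c: "cramer_row q1 q2 (Y w) j = n q1 q2 (Y w) j / ?D w" for q1 q2 w j
    by (simp add: cramer_row_def n_def)
  have dn: "((\<lambda>z. n (p1 z) (p2 z) (Y z) j) has_field_derivative
     n d1 d2 (Y z) j + (A z$1$1 + A z$2$2) * n (p1 z) (p2 z) (Y z) j
     - (n (p1 z) (p2 z) (Y z) 1 * A z $ 1 $ j + n (p1 z) (p2 z) (Y z) 2 * A z $ 2 $ j)) (at z)"
  proof (cases "j = 1")
    case True
    show ?thesis unfolding True n_def if_True
      by (simp, rule DERIV_cong[OF DERIV_diff[OF DERIV_mult[OF p(1) Y(1)] DERIV_mult[OF p(2) Y(1)]]])
        (simp add: mult2_nth algebra_simps)
  next
    case False
    then have j: "j = 2" using exhaust_2[of j] by auto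
    show ?thesis unfolding j n_def
      by (simp, rule DERIV_cong[OF DERIV_diff[OF DERIV_mult[OF p(2) Y(1)] DERIV_mult[OF p(1) Y(1)]]])
        (simp add: mult2_nth algebra_simps)
  qed
  have alg: "((a + t * b - e) * D - b * (t * D)) / (D * D) = a / D - e / D" if "D \<noteq> 0" for a t b e D :: complex
    using that by (simp add: divide_simps) (simp add: algebra_simps)
  show ?thesis unfolding c
    by (rule DERIV_cong[OF DERIV_divide[OF dn dD D0]], unfold alg[OF D0]) (simp add: add_divide_distrib)
qed

lemma cramer_row_linear:
  "cramer_row (a * p1 - b * r1) (a * p2 - b * r2) M j = a * cramer_row p1 p2 M j - b * cramer_row r1 r2 M j"
  by (simp add: cramer_row_def diff_divide_distrib[symmetric] algebra_simps)

lemma no_equation_for_equal_indices: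
  fixes M E :: "nat \<Rightarrow> complex^2^2" and St :: "'b::real_normed_vector set" and h :: int
  assumes inj: "inj_on a {1..4}" and mono: "monodromy_setup a g t St rho x0 sg"
    and adm: "admissible_data M E" and std: "standard_form a St rho sg M E h h A"
    and e: "\<And>k. k \<in> {1..4} \<Longrightarrow> eigenvalue_pair (E k) (e1 k) (e2 k)"
    and q: "q1 holomorphic_on (- (a ` {1..4}))" "q2 holomorphic_on (- (a ` {1..4}))"
    and fuchs: "\<And>k. k \<in> {1..4} \<Longrightarrow> fuchsian_with_exponents q1 q2 (a k)
        (e1 k + of_int (if k = 4 then 1 - h else 0)) (e2 k + of_int (if k = 4 then 1 - h else 0))"
    and om: "ode_monodromy St rho sg q1 q2 M"
  shows False
proof -
  note curve = setup_curve[OF mono]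
  let ?F = "finite_part St rho" and ?u = "\<lambda>x. to_plane (rho x)"
  have hol: "matrix_holomorphic_on A (- a ` {1..4})"
    and lf: "\<And>k. k \<in> {1..4} \<Longrightarrow> local_form_at a A k (E k)" and li: "local_form_at_infinity a A h h"
    using std by (auto simp: standard_form_def)
  obtain Y0 chi where Y0: "system_solution ?F ?u A Y0"
    "\<And>k x. k \<in> {1..4} \<Longrightarrow> x \<in> ?F \<Longrightarrow> Y0 x = Y0 (sg k x) ** chi k"
    and eq: "equivalent_tuples chi M"
    using std by (auto simp: standard_form_def system_monodromy_def)
  obtain y1 y2 chi' where ys: "ode_solution St rho q1 q2 y1" "ode_solution St rho q1 q2 y2"
    and indep: "\<And>c1 c2. \<forall>x\<in>St. c1 * y1 x + c2 * y2 x = 0 \<Longrightarrow> c1 = 0 \<and> c2 = 0"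
    and rel: "\<And>k x. k \<in> {1..4} \<Longrightarrow> x \<in> St \<Longrightarrow>
        (vector [y1 x, y2 x] :: complex^2) = vector [y1 (sg k x), y2 (sg k x)] v* chi' k"
    and eq': "equivalent_tuples chi' M"
    using om unfolding ode_monodromy_def by blast
  have "equivalent_tuples chi' chi"
    using equivalent_tuples_trans[OF eq' equivalent_tuples_sym[OF eq]] .
  then obtain P where P: "invertible P" "\<And>k. k \<in> {1..4} \<Longrightarrow> chi k = matrix_inv P ** chi' k ** P"
    by (auto simp: equivalent_tuples_def)
  have Pc: "P ** chi k = chi' k ** P" if "k \<in> {1..4}" for k
  proof -
    have "P ** chi k = (P ** matrix_inv P) ** chi' k ** P"
      unfolding P(2)[OF that] by (simp only: matrix_mul_assoc)
    then show ?thesis by (simp add: matrix_inv[OF P(1)])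
  qed
  have Pdet: "P$1$1 * P$2$2 - P$1$2 * P$2$1 \<noteq> 0" using P(1) by (simp add: det_nz_iff)
  obtain y1' where y1': "\<And>x. x \<in> ?F \<Longrightarrow> has_coord_deriv ?F ?u y1 (y1' x) x"
    "\<And>x. x \<in> ?F \<Longrightarrow> has_coord_deriv ?F ?u y1' (- q1 (?u x) * y1' x - q2 (?u x) * y1 x) x"
    using ys(1) unfolding ode_solution_def by blast
  obtain y2' where y2': "\<And>x. x \<in> ?F \<Longrightarrow> has_coord_deriv ?F ?u y2 (y2' x) x"
    "\<And>x. x \<in> ?F \<Longrightarrow> has_coord_deriv ?F ?u y2' (- q1 (?u x) * y2' x - q2 (?u x) * y2 x) x"
    using ys(2) unfolding ode_solution_def by blast
  \<comment> \<open>The basis \<open>(y1, y2) P\<close> of solutions has the very matrices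
    \<open>chi k\<close> of \<open>Y0\<close> as its monodromy, rather than equivalent ones.\<close>
  define w where "w = (\<lambda>(j::2) x. y1 x * P$1$j + y2 x * P$2$j)"
  define w' where "w' = (\<lambda>(j::2) x. y1' x * P$1$j + y2' x * P$2$j)"
  have wrel: "w j x = w 1 (sg k x) * chi k$1$j + w 2 (sg k x) * chi k$2$j" if k: "k \<in> {1..4}" and x: "x \<in> St" for k x j
  proof -
    have y: "y1 x = y1 (sg k x) * chi' k$1$1 + y2 (sg k x) * chi' k$2$1"
      "y2 x = y1 (sg k x) * chi' k$1$2 + y2 (sg k x) * chi' k$2$2"
      using rel[OF k x] by (simp_all add: vec2_eq_iff vector_matrix_mult_def sum_2 mult.commute)
    have c: "P$i$1 * chi k$1$j + P$i$2 * chi k$2$j = chi' k$i$1 * P$1$j + chi' k$i$2 * P$2$j" for i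
      using arg_cong[OF Pc[OF k], of "\<lambda>M. M$i$j"] by (simp add: mult2_nth)
    have "w j x = y1 (sg k x) * (chi' k$1$1 * P$1$j + chi' k$1$2 * P$2$j) + y2 (sg k x) * (chi' k$2$1 * P$1$j + chi' k$2$2 * P$2$j)"
      unfolding w_def y by (simp add: algebra_simps)
    also have "\<dots> = w 1 (sg k x) * chi k$1$j + w 2 (sg k x) * chi k$2$j"
      unfolding c[symmetric] w_def by (simp add: algebra_simps)
    finally show ?thesis .
  qed
  obtain T xi where T:
    "\<And>k. k \<in> {1..4} \<Longrightarrow> continuous_on (- co_arc g t k) (T k)"
    "\<And>k z. k \<in> {1..4} \<Longrightarrow> z \<notin> co_arc g t k \<Longrightarrow> T k z \<in> St \<and> rho (T k z) = of_plane z"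
    "\<And>j k z. j \<in> {1..4} \<Longrightarrow> k \<in> {1..4} \<Longrightarrow> z \<in> inside (path_image g) \<Longrightarrow> T j z = T k z"
    "\<And>k z. k \<in> {1..4} \<Longrightarrow> z \<in> outside (path_image g) \<Longrightarrow> T (prev_index k) z = sg k (T k z)"
    "\<And>k. k \<in> {1..4} \<Longrightarrow> xi k \<in> St \<and> rho (xi k) = rinf \<and> (T k \<longlongrightarrow> xi k) at_infinity"
    using monodromy_sheets[OF mono] by blast
  define Y where "Y = (\<lambda>k z. Y0 (T k z))"
  have Y: "sheet_solution g t A chi Y"
    unfolding Y_def by (rule sheet_solution_exists[OF mono Y0 T(1-4)])
  have Tf: "T k z \<in> ?F \<and> ?u (T k z) = z" if "k \<in> {1..4}" "z \<in> - co_arc g t k" for k z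
    using T(2)[of k z] that of_plane_neq_rinf by (auto simp: finite_part_def)
  have Ydet: "Y k z$1$1 * Y k z$2$2 - Y k z$1$2 * Y k z$2$1 \<noteq> 0" if "k \<in> {1..4}" "z \<notin> co_arc g t k" for k z
    using sheet_solutionD(1)[OF Y that] by (simp add: det_nz_iff)
  have dw: "((\<lambda>z. w j (T k z)) has_field_derivative w' j (T k z)) (at z)"
    "((\<lambda>z. w' j (T k z)) has_field_derivative (- q1 z * w' j (T k z) - q2 z * w j (T k z))) (at z)"
    if k: "k \<in> {1..4}" and z: "z \<notin> co_arc g t k" for j k z
  proof -
    have zc: "z \<in> - co_arc g t k" using z by simp
    have sec: "((\<lambda>z. phi (T k z)) has_field_derivative D) (at z)" if "has_coord_deriv ?F ?u phi D (T k z)" for phi D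
      by (rule has_coord_deriv_section[OF co_arc_open_connected(1)[OF curve k] zc T(1)[OF k] Tf[OF k] that])
    have F: "T k z \<in> ?F" "?u (T k z) = z" using Tf[OF k zc] by auto
    note s1 = sec[OF y1'(1)[OF F(1)]] and s2 = sec[OF y2'(1)[OF F(1)]]
      and s3 = sec[OF y1'(2)[OF F(1)]] and s4 = sec[OF y2'(2)[OF F(1)]]
    show "((\<lambda>z. w j (T k z)) has_field_derivative w' j (T k z)) (at z)"
      unfolding w_def w'_def by (intro DERIV_add DERIV_cmult_right) (rule s1 s2; simp)+
    have "((\<lambda>z. w' j (T k z)) has_field_derivative
        ((- q1 (?u (T k z)) * y1' (T k z) - q2 (?u (T k z)) * y1 (T k z)) * P$1$j
         + (- q1 (?u (T k z)) * y2' (T k z) - q2 (?u (T k z)) * y2 (T k z)) * P$2$j)) (at z)"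
      unfolding w'_def by (intro DERIV_add DERIV_cmult_right) (rule s3 s4; simp)+
    then show "((\<lambda>z. w' j (T k z)) has_field_derivative (- q1 z * w' j (T k z) - q2 z * w j (T k z))) (at z)"
      by (rule DERIV_cong) (simp add: F(2) w_def w'_def algebra_simps)
  qed
  define f where "f = (\<lambda>k j z. cramer_row (w 1 (T k z)) (w 2 (T k z)) (Y k z) j)"
  define G where "G = (\<lambda>k j z. cramer_row (w' 1 (T k z)) (w' 2 (T k z)) (Y k z) j)"
  have df: "((\<lambda>z. f k j z) has_field_derivative G k j z - (f k 1 z * A z$1$j + f k 2 z * A z$2$j)) (at z)"
    and dG: "((\<lambda>z. G k j z) has_field_derivative - q1 z * G k j z - q2 z * f k j z - (G k 1 z * A z$1$j + G k 2 z * A z$2$j)) (at z)"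
    if k: "k \<in> {1..4}" and z: "z \<notin> co_arc g t k" for k j z
  proof -
    note c = cramer_row_derivative[where Y = "Y k" and A = A and z = z and j = j,
        OF sheet_solutionD(2)[OF Y k z] sheet_solutionD(1)[OF Y k z]]
    show "((\<lambda>z. f k j z) has_field_derivative G k j z - (f k 1 z * A z$1$j + f k 2 z * A z$2$j)) (at z)"
      using c[where ?p1.0 = "\<lambda>z. w 1 (T k z)" and ?p2.0 = "\<lambda>z. w 2 (T k z)", OF dw(1)[OF k z] dw(1)[OF k z]]
      unfolding f_def G_def .
    show "((\<lambda>z. G k j z) has_field_derivative - q1 z * G k j z - q2 z * f k j z - (G k 1 z * A z$1$j + G k 2 z * A z$2$j)) (at z)"
      using c[where ?p1.0 = "\<lambda>z. w' 1 (T k z)" and ?p2.0 = "\<lambda>z. w' 2 (T k z)", OF dw(2)[OF k z] dw(2)[OF k z]]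
      unfolding cramer_row_linear f_def G_def .
  qed
  \<comment> \<open>Row and fundamental matrix acquire the same right factor \<open>chi k\<close>
    between consecutive sheets.\<close>
  have step: "f k j z = f (prev_index k) j z" if k: "k \<in> {1..4}" and z: "z \<in> outside (path_image g)" for k j z
  proof -
    let ?i = "prev_index k"
    have i: "?i \<in> {1..4}" by (rule prev_index_mem[OF k])
    note zk = outside_not_co_arc[OF curve k z] and zi = outside_not_co_arc[OF curve i z]
    have Yk: "Y k z = Y ?i z ** chi k" by (rule sheet_solutionD(4)[OF Y k z])
    have wk: "w j (T k z) = w 1 (T ?i z) * chi k$1$j + w 2 (T ?i z) * chi k$2$j" for j
      using wrel[OF k conjunct1[OF T(2)[OF k zk]], of j] T(4)[OF k z] by simp
    show ?thesis unfolding f_def Yk wk[of 1] wk[of 2]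
      by (rule cramer_row_mult[OF Ydet[OF i zi] Ydet[OF k zk, unfolded Yk]])
  qed
  have fagree: "f k j z = f l j z" if kl: "k \<in> {1..4}" "l \<in> {1..4}" and z: "z \<notin> co_arc g t k" "z \<notin> co_arc g t l" for k l j z
  proof (cases "k = l")
    case False
    from inside_or_outside[OF curve kl False z] show ?thesis
    proof
      assume zi: "z \<in> inside (path_image g)"
      show ?thesis unfolding f_def Y_def T(3)[OF kl zi] ..
    next
      assume zo: "z \<in> outside (path_image g)"
      have p: "prev_index 2 = 1" "prev_index 3 = 2" "prev_index 4 = 3" by (simp_all add: prev_index_def)
      have m: "2 \<in> {1..4::nat}" "3 \<in> {1..4::nat}" "4 \<in> {1..4::nat}" by simp_all
      note e = step[OF m(1) zo, of j, unfolded p] step[OF m(2) zo, of j, unfolded p] step[OF m(3) zo, of j, unfolded p]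
      have one: "f k j z = f 1 j z" if k: "k \<in> {1..4}" for k
      proof -
        consider "k = 1" | "k = 2" | "k = 3" | "k = 4" using k unfolding atLeastAtMost_1_4 by auto
        then show ?thesis by cases (simp_all only: e)
      qed
      show ?thesis unfolding one[OF kl(1)] one[OF kl(2)] ..
    qed
  qed simp
  \<comment> \<open>On the open overlap of two sheets the functions \<open>f k\<close> and
    \<open>f l\<close> coincide together with their derivatives, and the equation for
    \<open>f\<close> expresses \<open>G\<close> through these.\<close>
  have Gagree: "G k j z = G l j z" if kl: "k \<in> {1..4}" "l \<in> {1..4}" and z: "z \<notin> co_arc g t k" "z \<notin> co_arc g t l" for k l j z
  proof -
    let ?O = "- co_arc g t k \<inter> - co_arc g t l"
    have op: "open ?O" using co_arc_open_connected(1)[OF curve kl(1)] co_arc_open_connected(1)[OF curve kl(2)] by (rule open_Int)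
    have "((\<lambda>z. f l j z) has_field_derivative G k j z - (f k 1 z * A z$1$j + f k 2 z * A z$2$j)) (at z)"
      by (rule has_field_derivative_transform_within_open[OF df[OF kl(1) z(1)] op])
        (use z fagree[OF kl] in auto)
    from DERIV_unique[OF this df[OF kl(2) z(2)]] show ?thesis
      using fagree[OF kl z] by simp
  qed
  \<comment> \<open>Gluing: at each point some sheet is chosen, and the agreement on overlaps makes
    the choice immaterial.\<close>
  define kk where "kk = (\<lambda>z. SOME k. k \<in> {1..4} \<and> z \<notin> co_arc g t k)"
  have kk: "kk z \<in> {1..4} \<and> z \<notin> co_arc g t (kk z)" if za: "z \<notin> a ` {1..4}" for z
  proof -
    obtain k where "k \<in> {1..4}" "z \<notin> co_arc g t k" using co_arcs_cover[OF curve za] by (rule bexE)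
    then show ?thesis unfolding kk_def by (intro someI conjI)
  qed
  have notin: "z \<notin> a ` {1..4}" if "k \<in> {1..4}" "z \<notin> co_arc g t k" for k z
    using points_in_co_arc[OF curve that(1)] that(2) by blast
  define F where "F = (\<lambda>j z. f (kk z) j z)"
  define FG where "FG = (\<lambda>j z. G (kk z) j z)"
  have F: "F j z = f k j z" "FG j z = G k j z" if k: "k \<in> {1..4}" "z \<notin> co_arc g t k" for j k z
  proof -
    note kz = kk[OF notin[OF k]]
    show "F j z = f k j z" unfolding F_def by (rule fagree[OF conjunct1[OF kz] k(1) conjunct2[OF kz] k(2)])
    show "FG j z = G k j z" unfolding FG_def by (rule Gagree[OF conjunct1[OF kz] k(1) conjunct2[OF kz] k(2)])
  qed
  have dF: "(F j has_field_derivative FG j z - (F 1 z * A z$1$j + F 2 z * A z$2$j)) (at z)"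
    and dFG: "(FG j has_field_derivative - q1 z * FG j z - q2 z * F j z - (FG 1 z * A z$1$j + FG 2 z * A z$2$j)) (at z)"
    if z: "z \<notin> a ` {1..4}" for j z
  proof -
    obtain k where k: "k \<in> {1..4}" "z \<notin> co_arc g t k" using co_arcs_cover[OF curve z] by blast
    have zk: "z \<in> - co_arc g t k" using k by simp
    note op = co_arc_open_connected(1)[OF curve k(1)]
    show "(F j has_field_derivative FG j z - (F 1 z * A z$1$j + F 2 z * A z$2$j)) (at z)"
      unfolding F[OF k]
      by (rule has_field_derivative_transform_within_open[OF df[OF k] op zk]) (simp add: F[OF k(1)])
    show "(FG j has_field_derivative - q1 z * FG j z - q2 z * F j z - (FG 1 z * A z$1$j + FG 2 z * A z$2$j)) (at z)"
      unfolding F[OF k]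
      by (rule has_field_derivative_transform_within_open[OF dG[OF k] op zk]) (simp add: F[OF k(1)])
  qed
  have opa: "open (- a ` {1..4})" by (simp add: open_Compl finite_imp_closed)
  \<comment> \<open>The power removes the shift \<open>1 - h\<close> of the exponents at
    \<open>a 4\<close>, so that all four points become removable.\<close>
  define Phi where "Phi = (\<lambda>j z. (z - a 4) powi (h - 1) * F j z)"
  have "F j holomorphic_on (- a ` {1..4})" for j
    unfolding holomorphic_on_open[OF opa] using dF by blast
  then have Phih: "Phi j holomorphic_on (- a ` {1..4})" for j
    unfolding Phi_def by (intro holomorphic_intros) auto
  have limF: "((\<lambda>z. (z - a k) * ((z - a k) powi (- (if k = 4 then 1 - h else 0)) * F j z)) \<longlongrightarrow> 0) (at (a k))"
    if k: "k \<in> {1..4}" for k j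
  proof -
    obtain d H where d: "d > 0" and away: "\<And>j. j \<in> {1..4} \<Longrightarrow> j \<noteq> k \<Longrightarrow> a j \<notin> ball (a k) d"
      and H: "matrix_holomorphic_on H (ball (a k) d)"
        "\<And>z. z \<in> ball (a k) d - {a k} \<Longrightarrow> H z = mat (z - a k) ** A z"
        "\<And>x y. eigenvalue_pair (E k) x y \<Longrightarrow> eigenvalue_pair (H (a k)) x y"
      using local_form_residue[OF lf[OF k]] by metis
    have sub: "ball (a k) d - {a k} \<subseteq> - a ` {1..4}"
    proof
      fix z assume z: "z \<in> ball (a k) d - {a k}"
      have "z \<noteq> a j" if "j \<in> {1..4}" for j
        using away[OF that] z by (cases "j = k") auto
      then show "z \<in> - a ` {1..4}" by blast
    qed
    have res: "e1 k - e2 k \<in> \<int> \<Longrightarrow> e1 k = e2 k"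
      using nonresonant_pair[OF _ e[OF k]] adm k by (auto simp: admissible_data_def)
    show ?thesis
      by (rule fuchsian_row_extension[OF d H(1,2) H(3)[OF e[OF k]] res fuchs[OF k]
            holomorphic_on_subset[OF q(1) sub] holomorphic_on_subset[OF q(2) sub] dF dFG]) (use sub in auto)
  qed
  have Philim: "((\<lambda>z. (z - b) * Phi j z) \<longlongrightarrow> 0) (at b)" if b: "b \<in> a ` {1..4}" for b j
  proof -
    obtain k where k: "k \<in> {1..4}" "b = a k" using b by auto
    show ?thesis
    proof (cases "k = 4")
      case True
      then show ?thesis using limF[OF k(1), of j] by (simp add: Phi_def k(2))
    next
      case False
      have ne: "a k \<noteq> a 4" using False inj k(1) by (auto dest: inj_onD)
      have "((\<lambda>z. (z - a 4) powi (h - 1)) \<longlongrightarrow> (a k - a 4) powi (h - 1)) (at (a k))"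
        using DERIV_isCont[OF powi_shift_derivative[OF ne, of "h - 1"]] by (simp add: isCont_def)
      from tendsto_mult[OF this limF[OF k(1), of j]] show ?thesis
        using False by (simp add: Phi_def k(2) ac_simps)
    qed
  qed
  \<comment> \<open>The solutions \<open>y\<close> converge at infinity and both rows of
    \<open>Y\<close> carry the power \<open>z powi h\<close>, so \<open>F\<close> is of order
    \<open>z powi (- h)\<close> and a decay of order \<open>1 / z\<close> remains. For the indices
    \<open>h + 1\<close> and \<open>h - 1\<close> one entry would only be bounded: this is where the
    equality of the indices counts.\<close>
  have Phi0: "(Phi j \<longlongrightarrow> 0) at_infinity" for j
  proof -
    obtain d W B where d: "d > 0" "\<And>j. j \<in> {1..4} \<Longrightarrow> cmod (a j) \<le> 1 / d"
      and Winv: "\<And>w. w \<in> ball 0 d \<Longrightarrow> invertible (W w)"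
      and Wd: "\<And>w i j. w \<in> ball 0 d \<Longrightarrow> ((\<lambda>w. W w $ i $ j) has_field_derivative (B w ** W w) $ i $ j) (at w)"
      and Yi: "system_solution {z. cmod z > 1 / d} (\<lambda>z. z) A (\<lambda>z. diag_power h h z ** W (1 / z))"
      by (rule local_form_infinity[OF li]) (rule that)
    obtain R1 where R1: "\<And>z. z \<in> co_arc g t 1 \<Longrightarrow> cmod z \<le> R1"
      using co_arc_open_connected(3)[OF curve, of 1] by (auto simp: bounded_iff)
    define R where "R = max (1 / d) R1"
    let ?U = "{z. cmod z > R}"
    have one: "1 \<in> {1..4::nat}" by simp
    have U: "z \<notin> co_arc g t 1" "cmod z > 1 / d" "z \<noteq> 0" if "z \<in> ?U" for z
    proof -
      show "z \<notin> co_arc g t 1" using that R1[of z] by (auto simp: R_def)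
      show "cmod z > 1 / d" using that by (auto simp: R_def)
      moreover have "0 < 1 / d" using d by simp
      ultimately show "z \<noteq> 0" by auto
    qed
    have dYi: "((\<lambda>z. (diag_power h h z ** W (1 / z)) $ i $ j) has_field_derivative (A z ** (diag_power h h z ** W (1 / z))) $ i $ j) (at z)"
      "invertible (diag_power h h z ** W (1 / z))" if z: "z \<in> ?U" for z i j
      by (rule system_solution_plane[OF open_outside_disc Yi]; use U(2)[OF z] in simp)+
    have dY: "((\<lambda>z. Y 1 z $ i $ j) has_field_derivative (A z ** Y 1 z) $ i $ j) (at z)" if z: "z \<in> ?U" for z i j
      by (rule sheet_solutionD(2)[OF Y one U(1)[OF z]])
    obtain C where C: "\<And>z. z \<in> ?U \<Longrightarrow> Y 1 z = diag_power h h z ** W (1 / z) ** C"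
      by (rule fundamental_solution_unique[OF open_outside_disc[of R] connected_outside_disc[of R] dYi dY], assumption+, rule that)
    define X where "X = (\<lambda>w. W w ** C)"
    have YX: "Y 1 z $ i $ j = z powi h * X (1 / z) $ i $ j" if "z \<in> ?U" for z i j
      using exhaust_2[of i] unfolding C[OF that] X_def
      by (auto simp: mult2_nth algebra_simps)
    have evU: "\<forall>\<^sub>F z in at_infinity. z \<in> ?U"
      unfolding eventually_at_infinity by (intro exI[of _ "R + 1"]) auto
    then obtain z1 where z1: "z1 \<in> ?U" using eventually_happens'[OF trivial_limit_at_infinity] by blast
    have Cdet: "det C \<noteq> 0"
    proof -
      have "det (Y 1 z1) \<noteq> 0" using sheet_solutionD(1)[OF Y one U(1)[OF z1]] by (simp add: invertible_det_nz)
      then show ?thesis unfolding C[OF z1] det_mul by simp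
    qed
    define DX where "DX = (\<lambda>w. X w$1$1 * X w$2$2 - X w$1$2 * X w$2$1)"
    have DX: "DX w = det (W w) * det C" for w
      unfolding DX_def X_def using det_mul[of "W w" C] by (simp add: det_2)
    have z0: "0 \<in> ball 0 d" using d by simp
    have DX0: "DX 0 \<noteq> 0" using Winv[OF z0] Cdet by (simp add: DX invertible_det_nz)
    have inv: "((\<lambda>z::complex. 1 / z) \<longlongrightarrow> 0) at_infinity"
      using tendsto_inverse_0 by (simp add: divide_inverse)
    have Xlim: "((\<lambda>z. X (1 / z) $ i $ j) \<longlongrightarrow> X 0 $ i $ j) at_infinity" for i j
    proof (rule isCont_tendsto_compose[OF _ inv])
      show "isCont (\<lambda>w. X w $ i $ j) 0" unfolding X_def mult2_nth
        by (intro continuous_intros DERIV_isCont[OF Wd[OF z0]])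
    qed
    have wlim: "((\<lambda>z. w j (T 1 z)) \<longlongrightarrow> w j (xi 1)) at_infinity" for j
    proof -
      have xi: "xi 1 \<in> St" "rho (xi 1) = rinf" "(T 1 \<longlongrightarrow> xi 1) at_infinity" using T(5)[OF one] by auto
      have "filterlim (T 1) (at (xi 1) within St) at_infinity"
      proof (rule filterlim_at_withinI[OF xi(3)])
        show "\<forall>\<^sub>F z in at_infinity. T 1 z \<in> St - {xi 1}"
          using evU
        proof eventually_elim
          case (elim z)
          show ?case using T(2)[OF one U(1)[OF elim]] xi(2) of_plane_neq_rinf[of z] by auto
        qed
      qed
      then have "((\<lambda>z. y1 (T 1 z)) \<longlongrightarrow> y1 (xi 1)) at_infinity" "((\<lambda>z. y2 (T 1 z)) \<longlongrightarrow> y2 (xi 1)) at_infinity"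
        using ode_solution_continuous_at_infinity[OF mono ys(1) xi(1,2)]
          ode_solution_continuous_at_infinity[OF mono ys(2) xi(1,2)] by (blast intro: filterlim_compose)+
      then show ?thesis unfolding w_def by (intro tendsto_intros)
    qed
    define num where "num = (\<lambda>z. (if j = 1 then w 1 (T 1 z) * X (1 / z)$2$2 - w 2 (T 1 z) * X (1 / z)$2$1
        else w 2 (T 1 z) * X (1 / z)$1$1 - w 1 (T 1 z) * X (1 / z)$1$2) / DX (1 / z))"
    have DXlim: "((\<lambda>z. DX (1 / z)) \<longlongrightarrow> DX 0) at_infinity"
      unfolding DX_def by (intro tendsto_intros Xlim)
    have "\<exists>L. (num \<longlongrightarrow> L) at_infinity"
    proof (cases "j = 1")
      case True
      have "(num \<longlongrightarrow> (w 1 (xi 1) * X 0$2$2 - w 2 (xi 1) * X 0$2$1) / DX 0) at_infinity"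
        unfolding num_def if_P[OF True] by (intro tendsto_intros wlim Xlim DXlim DX0)
      then show ?thesis by blast
    next
      case False
      have "(num \<longlongrightarrow> (w 2 (xi 1) * X 0$1$1 - w 1 (xi 1) * X 0$1$2) / DX 0) at_infinity"
        unfolding num_def if_not_P[OF False] by (intro tendsto_intros wlim Xlim DXlim DX0)
      then show ?thesis by blast
    qed
    then obtain L where L: "(num \<longlongrightarrow> L) at_infinity" by blast
    have "isCont (\<lambda>w. (1 - a 4 * w) powi (h - 1)) 0"
      using holomorphic_on_imp_continuous_on[OF holomorphic_shifted_power[OF d(1) d(2)[of 4], of "h - 1"]] z0
      by (simp add: continuous_on_eq_continuous_at)
    from isCont_tendsto_compose[OF this inv]
    have "((\<lambda>z. (1 - a 4 * (1 / z)) powi (h - 1)) \<longlongrightarrow> 1) at_infinity" by simp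
    from tendsto_mult[OF tendsto_mult[OF this inv] L]
    have "((\<lambda>z. (1 - a 4 * (1 / z)) powi (h - 1) * (1 / z) * num z) \<longlongrightarrow> 0) at_infinity" by simp
    then show ?thesis
    proof (rule Lim_transform_eventually)
      show "\<forall>\<^sub>F z in at_infinity. (1 - a 4 * (1 / z)) powi (h - 1) * (1 / z) * num z = Phi j z"
        using evU
      proof eventually_elim
        case (elim z)
        have zh: "z powi h \<noteq> 0" using U(3)[OF elim] by simp
        have det: "Y 1 z$1$1 * Y 1 z$2$2 - Y 1 z$1$2 * Y 1 z$2$1 = z powi h * (z powi h * DX (1 / z))"
          unfolding YX[OF elim] DX_def by (simp add: algebra_simps)
        have gen: "(u * (p * x) - v * (p * y)) / (p * (p * D)) = (u * x - v * y) / D / p" if "p \<noteq> 0" for u v x y p D :: complex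
        proof -
          have "u * (p * x) - v * (p * y) = p * (u * x - v * y)" by (simp add: algebra_simps)
          then show ?thesis using that by simp
        qed
        have Fz: "F j z = num z / z powi h"
        proof (cases "j = 1")
          case True
          show ?thesis unfolding F(1)[OF one U(1)[OF elim]] f_def cramer_row_def num_def if_P[OF True]
            unfolding det unfolding YX[OF elim] by (rule gen[OF zh])
        next
          case False
          show ?thesis unfolding F(1)[OF one U(1)[OF elim]] f_def cramer_row_def num_def if_not_P[OF False]
            unfolding det unfolding YX[OF elim] by (rule gen[OF zh])
        qed
        have e2: "z powi (- (h - 1)) * (1 / z) = 1 / z powi h"
          using U(3)[OF elim] by (simp add: power_int_diff power_int_minus divide_inverse)
        have "(1 - a 4 * (1 / z)) powi (h - 1) * (1 / z) * num z
            = (z - a 4) powi (h - 1) * (z powi (- (h - 1)) * (1 / z)) * num z"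
          unfolding power_int_shift[OF U(3)[OF elim], symmetric] by (simp only: mult.assoc)
        also have "\<dots> = Phi j z" unfolding e2 Phi_def Fz by simp
        finally show ?case .
      qed
    qed
  qed
  have F0: "F j z = 0" if z: "z \<notin> a ` {1..4}" for j z
  proof -
    have "Phi j z = 0"
      by (rule punctured_plane_Liouville[OF _ Phih Philim Phi0 z]) simp
    moreover have "z \<noteq> a 4" using z by auto
    ultimately show ?thesis by (simp add: Phi_def)
  qed
  have one: "1 \<in> {1..4::nat}" by simp
  have y0: "y1 (T 1 z) = 0" if z: "z \<notin> co_arc g t 1" for z
  proof -
    have f0: "cramer_row (w 1 (T 1 z)) (w 2 (T 1 z)) (Y 1 z) j = 0" for j
      using F(1)[OF one z, of j] F0[OF notin[OF one z], of j] by (simp add: f_def)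
    have "w 1 (T 1 z) = 0" "w 2 (T 1 z) = 0"
      using cramer_row_solves[OF Ydet[OF one z], of "w 1 (T 1 z)" "w 2 (T 1 z)"] unfolding f0 by simp_all
    then show ?thesis
      using row_matrix_zero[of "y1 (T 1 z)" "P$1$1" "y2 (T 1 z)" "P$2$1" "P$1$2" "P$2$2"] Pdet by (simp add: w_def)
  qed
  \<comment> \<open>So far \<open>y1\<close> vanishes along the sheet \<open>T 1\<close> only. A
    chart of the surface around one of its points is contained in the sheet by uniqueness of lifts,
    which provides an open set of zeros on the surface.\<close>
  obtain z where z: "z \<in> inside (path_image g)" by (rule inside_point[OF curve])
  have "open (inside (path_image g))" using curve_Jordan[OF curve] by blast
  then obtain r0 where r0: "r0 > 0" "ball z r0 \<subseteq> inside (path_image g)" using z open_contains_ball by blast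
  have zc: "z \<notin> co_arc g t 1" by (rule inside_not_co_arc[OF curve one z])
  have Tz: "T 1 z \<in> St" "rho (T 1 z) \<noteq> rinf" "?u (T 1 z) = z"
    using T(2)[OF one zc] of_plane_neq_rinf by auto
  obtain r N S where r: "r > 0" "r \<le> r0" and N: "openin (top_of_set St) N" "T 1 z \<in> N"
    and S: "continuous_on (ball z r) S" "\<And>w. w \<in> ball z r \<Longrightarrow> S w \<in> N \<and> rho (S w) = of_plane w \<and> w \<notin> a ` {1..4}"
      "\<And>x'. x' \<in> N \<Longrightarrow> rho x' \<noteq> rinf \<and> ?u x' \<in> ball z r \<and> S (?u x') = x'"
    by (rule finite_chart[OF mono Tz(1,2) r0(1), unfolded Tz(3)]) blast
  have NSt: "N \<subseteq> St" using N(1) by (rule openin_imp_subset)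
  have ballc: "v \<notin> co_arc g t 1" if "v \<in> ball z r" for v
  proof -
    have "v \<in> ball z r0" using that r(2) by simp
    then show ?thesis using r0(2) inside_not_co_arc[OF curve one] by blast
  qed
  have ST: "S v = T 1 v" if v: "v \<in> ball z r" for v
  proof (rule lifts_agree[OF mono connected_ball, of z z r v S "T 1"])
    show "z \<in> ball z r" using r by simp
    show "continuous_on (ball z r) (T 1)"
      by (rule continuous_on_subset[OF T(1)[OF one]]) (use ballc in auto)
    show "S v \<in> St \<and> T 1 v \<in> St \<and> rho (S v) = rho (T 1 v)" if "v \<in> ball z r" for v
      using S(2)[OF that] T(2)[OF one ballc[OF that]] NSt by auto
    show "S z = T 1 z" using S(3)[OF N(2)] Tz(3) by simp
  qed (use v S in auto)
  have "y1 x = 0" if "x \<in> N" for x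
    using S(3)[OF that] ST[of "?u x"] y0[OF ballc, of "?u x"] by simp
  then have "y1 x = 0" if "x \<in> St" for x
    using ode_solution_identity[OF mono ys(1) N(1) _ _ that] N(2) by blast
  then have "\<forall>x\<in>St. 1 * y1 x + 0 * y2 x = 0" by simp
  from indep[OF this] show False by simp
qed

section \<open>The equation for unequal indices\<close>

lemma product_derivative:
  fixes a :: "'i \<Rightarrow> complex"
  assumes "finite I" "z \<notin> a ` I"
  shows "((\<lambda>z. \<Prod>k\<in>I. z - a k) has_field_derivative (\<Prod>k\<in>I. z - a k) * (\<Sum>k\<in>I. 1 / (z - a k))) (at z)"
  using assms
proof (induction I rule: finite_induct)
  case empty
  then show ?case by simp
next
  case (insert i I)
  have z: "z - a i \<noteq> 0" "z \<notin> a ` I" using insert.prems by auto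
  have "((\<lambda>z. z - a i) has_field_derivative 1) (at z)" by (auto intro!: derivative_eq_intros)
  from DERIV_mult[OF this insert.IH[OF z(2)]]
  have "((\<lambda>z. (z - a i) * (\<Prod>k\<in>I. z - a k)) has_field_derivative
    1 * (\<Prod>k\<in>I. z - a k) + (\<Prod>k\<in>I. z - a k) * (\<Sum>k\<in>I. 1 / (z - a k)) * (z - a i)) (at z)" .
  then show ?case unfolding prod.insert[OF insert.hyps] sum.insert[OF insert.hyps]
    by (rule DERIV_cong) (use z(1) in \<open>simp add: field_simps\<close>)
qed

lemma equation_for_unequal_indices:
  fixes M E :: "nat \<Rightarrow> complex^2^2" and St :: "'b::real_normed_vector set"
  assumes inj: "inj_on a {1..4}" and mono: "monodromy_setup a g t St rho x0 sg"
    and adm: "admissible_data M E" and std: "standard_form a St rho sg M E kap1 kap2 A" and k12: "kap1 - kap2 = 2"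
    and irr: "irreducible_tuple M \<or> reducible_with_n1_less_n2 M E"
    and e: "\<And>k. k \<in> {1..4} \<Longrightarrow> eigenvalue_pair (E k) (e1 k) (e2 k)"
  obtains q1 q2 where "q1 holomorphic_on (- (a ` {1..4}))" "q2 holomorphic_on (- (a ` {1..4}))"
    "\<not> ode_singular_at_infinity q1 q2"
    "\<And>k. k \<in> {1..4} \<Longrightarrow> fuchsian_with_exponents q1 q2 (a k)
        (e1 k + of_int (if k = 4 then - kap2 else 0)) (e2 k + of_int (if k = 4 then - kap2 else 0))"
    "ode_monodromy St rho sg q1 q2 M"
proof -
  let ?S = "- a ` {1..4}"
  \<comment> \<open>This power makes the second row finite at infinity, and it accounts for the
    shift of the exponents at \<open>a 4\<close>.\<close>
  define s where "s = - kap2"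
  have hol: "matrix_holomorphic_on A ?S"
    and lf: "\<And>k. k \<in> {1..4} \<Longrightarrow> local_form_at a A k (E k)" and li: "local_form_at_infinity a A kap1 kap2"
    using std by (auto simp: standard_form_def)
  obtain Y0 chi where Y0: "system_solution (finite_part St rho) (\<lambda>x. to_plane (rho x)) A Y0"
    "\<And>k x. k \<in> {1..4} \<Longrightarrow> x \<in> finite_part St rho \<Longrightarrow> Y0 x = Y0 (sg k x) ** chi k"
    and eq: "equivalent_tuples chi M"
    using std by (auto simp: standard_form_def system_monodromy_def)
  have fin: "finite {1..4::nat}" by simp
  have "\<forall>k\<in>{1..4}. \<exists>r. ((\<lambda>z. (z - a k) * A z $ 2 $ 1) \<longlongrightarrow> r) (at (a k))"
  proof
    fix k :: nat assume k: "k \<in> {1..4}"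
    show "\<exists>r. ((\<lambda>z. (z - a k) * A z $ 2 $ 1) \<longlongrightarrow> r) (at (a k))"
      by (rule residue_limits[OF lf[OF k]]) blast
  qed
  from bchoice[OF this] obtain r where r: "\<And>k. k \<in> {1..4} \<Longrightarrow> ((\<lambda>z. (z - a k) * A z $ 2 $ 1) \<longlongrightarrow> r k) (at (a k))" by blast
  obtain d W B where d: "d > 0" "\<And>j. j \<in> {1..4} \<Longrightarrow> cmod (a j) \<le> 1 / d"
    and Winv: "\<And>w. w \<in> ball 0 d \<Longrightarrow> invertible (W w)"
    and B: "matrix_holomorphic_on B (ball 0 d)"
    and Wd: "\<And>w i j. w \<in> ball 0 d \<Longrightarrow> ((\<lambda>w. W w $ i $ j) has_field_derivative (B w ** W w) $ i $ j) (at w)"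
    and Yi: "system_solution {z. cmod z > 1 / d} (\<lambda>z. z) A (\<lambda>z. diag_power kap1 kap2 z ** W (1 / z))"
    and Ainf: "\<And>z. cmod z > 1 / d \<Longrightarrow> A z $ 2 $ 1 = - (z powi (kap2 - kap1) * B (1 / z) $ 2 $ 1 / z\<^sup>2)"
    by (rule local_form_infinity[OF li]) (rule that)
  \<comment> \<open>For an index difference of 2 the lower left entry is
    \<open>- B (1 / z) $ 2 $ 1 / z ^ 4\<close>, which matches the reciprocal of a product of four
    linear factors.\<close>
  have c4: "((\<lambda>z. z ^ card {1..4::nat} * A z $ 2 $ 1) \<longlongrightarrow> - B 0 $ 2 $ 1) at_infinity"
  proof (rule Lim_transform_eventually)
    have "isCont (\<lambda>w. B w $ 2 $ 1) 0"
      using holomorphic_on_imp_continuous_on[OF matrix_holomorphic_onD[OF B, of 2 1]] d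
      by (simp add: continuous_on_eq_continuous_at)
    moreover have "((\<lambda>z::complex. 1 / z) \<longlongrightarrow> 0) at_infinity"
      using tendsto_inverse_0 by (simp add: divide_inverse)
    ultimately have "((\<lambda>z. B (1 / z) $ 2 $ 1) \<longlongrightarrow> B 0 $ 2 $ 1) at_infinity" by (rule isCont_tendsto_compose)
    then show "((\<lambda>z. - B (1 / z) $ 2 $ 1) \<longlongrightarrow> - B 0 $ 2 $ 1) at_infinity" by (rule tendsto_minus)
    have "\<forall>\<^sub>F z::complex in at_infinity. cmod z > 1 / d"
      unfolding eventually_at_infinity by (intro exI[of _ "1 / d + 1"]) auto
    then show "\<forall>\<^sub>F z in at_infinity. - B (1 / z) $ 2 $ 1 = z ^ card {1..4::nat} * A z $ 2 $ 1"
    proof eventually_elim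
      case (elim z)
      have "0 < 1 / d" using d by simp
      then have z: "z \<noteq> 0" using elim by auto
      have k21: "kap2 - kap1 = - 2" using k12 by simp
      have "z powi (kap2 - kap1) = 1 / z\<^sup>2"
        unfolding k21 by (simp add: power_int_minus divide_inverse)
      then have "z ^ 4 * (z powi (kap2 - kap1) / z\<^sup>2) = z ^ 4 * (1 / z\<^sup>2 / z\<^sup>2)" by (simp only:)
      also have "\<dots> = 1" using z by (simp add: field_simps flip: power_add)
      finally have "z ^ 4 * (z powi (kap2 - kap1) / z\<^sup>2) = 1" .
      then have "z ^ 4 * A z $ 2 $ 1 = - (1 * B (1 / z) $ 2 $ 1)"
        unfolding Ainf[OF elim] by (metis (no_types, lifting) minus_mult_right mult.assoc times_divide_eq_left)
      then show ?case by simp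
    qed
  qed
  define cc where "cc = - B 0 $ 2 $ 1"
  have A21: "A z $ 2 $ 1 = cc / (\<Prod>k=1..4. z - a k)" if "z \<notin> a ` {1..4}" for z
    unfolding cc_def by (rule simple_poles_product_form[OF fin inj matrix_holomorphic_onD[OF hol] r c4 that])
  have cc0: "cc \<noteq> 0" using lower_left_nonzero[OF inj mono adm std irr] A21 by auto
  have Ane: "A z $ 2 $ 1 \<noteq> 0" if "z \<notin> a ` {1..4}" for z
    unfolding A21[OF that] using cc0 that by (auto simp: prod_zero_iff)
  then have Ane': "\<forall>z\<in>?S. A z $ 2 $ 1 \<noteq> 0" by blast
  have opS: "open ?S" by (simp add: open_Compl finite_imp_closed)
  have b: "a 4 \<in> a ` {1..4}" "a 4 \<notin> ?S" by auto
  have ld: "logder A z = - (\<Sum>k=1..4. 1 / (z - a k))" if z: "z \<notin> a ` {1..4}" for z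
  proof -
    let ?p = "\<lambda>z. \<Prod>k=1..4. z - a k"
    have p0: "?p z \<noteq> 0" using z by (auto simp: prod_zero_iff)
    have "((\<lambda>z. cc / ?p z) has_field_derivative
        (0 * ?p z - cc * (?p z * (\<Sum>k=1..4. 1 / (z - a k)))) / (?p z * ?p z)) (at z)"
      by (rule DERIV_divide[OF DERIV_const product_derivative[OF fin z] p0])
    moreover have zS: "z \<in> ?S" using z by simp
    ultimately have "((\<lambda>z. A z $ 2 $ 1) has_field_derivative
        (0 * ?p z - cc * (?p z * (\<Sum>k=1..4. 1 / (z - a k)))) / (?p z * ?p z)) (at z)"
      by (rule has_field_derivative_transform_within_open[OF _ opS]) (simp add: A21)
    then show ?thesis unfolding logder_def A21[OF z] using cc0 p0
      by (simp add: DERIV_imp_deriv)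
  qed
  \<comment> \<open>One constant serves twice: as \<open>cc\<close> it keeps the lower left entry
    free of zeros, so no apparent singularity arises in the plane, and as the value of
    \<open>B\<close> at 0 it keeps the Wronskian at infinity from vanishing.\<close>
  have B21: "B 0 $ 2 $ 1 \<noteq> 0" using cc0 by (simp add: cc_def)
  have Yi': "system_solution {z. cmod z > 1 / d} (\<lambda>z. z) A (\<lambda>z. diag_power kap1 (- s) z ** W (1 / z))"
    using Yi by (simp add: s_def)
  show thesis
  proof (rule that[of "scalar_q1 A s (a 4)" "scalar_q2 A s (a 4)"])
    show "scalar_q1 A s (a 4) holomorphic_on ?S" "scalar_q2 A s (a 4) holomorphic_on ?S"
      using scalar_q_holomorphic[OF opS hol Ane' b(2)] by auto
    show "\<not> ode_singular_at_infinity (scalar_q1 A s (a 4)) (scalar_q2 A s (a 4))"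
      by (rule scalar_not_singular_at_infinity[OF hol Ane b(1) d Winv Wd Yi' B21])
    show "ode_monodromy St rho sg (scalar_q1 A s (a 4)) (scalar_q2 A s (a 4)) M"
      by (rule scalar_ode_monodromy[OF hol Ane b(1) d Winv Wd Yi' B21 mono Y0 eq])
    fix k :: nat assume k: "k \<in> {1..4}"
    obtain d' H where d': "d' > 0" and away: "\<And>j. j \<in> {1..4} \<Longrightarrow> j \<noteq> k \<Longrightarrow> a j \<notin> ball (a k) d'"
      and H: "matrix_holomorphic_on H (ball (a k) d')"
        "\<And>z. z \<in> ball (a k) d' - {a k} \<Longrightarrow> H z = mat (z - a k) ** A z"
        "\<And>x y. eigenvalue_pair (E k) x y \<Longrightarrow> eigenvalue_pair (H (a k)) x y"
      using local_form_residue[OF lf[OF k]] by metis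
    have zaj: "z \<noteq> a j" if z: "z \<in> ball (a k) d'" and "j \<in> {1..4}" "j \<noteq> k" for z j
      using away[OF that(2,3)] z by auto
    have sub: "ball (a k) d' - {a k} \<subseteq> ?S"
    proof
      fix z assume z: "z \<in> ball (a k) d' - {a k}"
      have "z \<noteq> a j" if "j \<in> {1..4}" for j
        using zaj[OF _ that] z by (cases "j = k") auto
      then show "z \<in> ?S" by blast
    qed
    have nr: "e1 k = e2 k" if "e1 k - e2 k \<in> \<int>"
      using nonresonant_pair[OF _ e[OF k] that] adm k by (auto simp: admissible_data_def)
    have ne: "e1 k - e2 k \<noteq> 1" "e2 k - e1 k \<noteq> 1"
    proof -
      show "e1 k - e2 k \<noteq> 1" using nr by auto
      show "e2 k - e1 k \<noteq> 1"
      proof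
        assume *: "e2 k - e1 k = 1"
        then have "e1 k - e2 k = - 1" by (simp add: algebra_simps)
        then have "e1 k - e2 k \<in> \<int>" by simp
        then show False using nr * by simp
      qed
    qed
    \<comment> \<open>The logarithmic derivative of the reciprocal product, multiplied by
      \<open>z - a k\<close>: the factor with index \<open>k\<close> gives \<open>- 1\<close>, the
      others vanish at \<open>a k\<close>.\<close>
    define nu where "nu = (\<lambda>z. - 1 - (\<Sum>j\<in>{1..4} - {k}. (z - a k) / (z - a j)))"
    have nuh: "nu holomorphic_on ball (a k) d'"
      unfolding nu_def by (intro holomorphic_intros) (use zaj in auto)
    have nuk: "nu (a k) = - 1" by (simp add: nu_def)
    have nul: "logder A z = nu z / (z - a k)" if z: "z \<in> ball (a k) d' - {a k}" for z
    proof -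
      have zk: "z - a k \<noteq> 0" using z by simp
      have zS: "z \<notin> a ` {1..4}" using z sub by auto
      have "nu z / (z - a k) = - 1 / (z - a k) - (\<Sum>j\<in>{1..4} - {k}. 1 / (z - a j))"
      proof -
        have "(\<Sum>j\<in>{1..4} - {k}. (z - a k) / (z - a j)) / (z - a k) = (\<Sum>j\<in>{1..4} - {k}. (z - a k) / (z - a j) / (z - a k))"
          by (rule sum_divide_distrib)
        also have "\<dots> = (\<Sum>j\<in>{1..4} - {k}. 1 / (z - a j))" using zk by (intro sum.cong refl) simp
        finally show ?thesis unfolding nu_def diff_divide_distrib by (simp only:)
      qed
      also have "\<dots> = logder A z" unfolding ld[OF zS] sum.remove[OF fin k] by simp
      finally show ?thesis ..
    qed
    \<comment> \<open>For \<open>k = 4\<close> the quotient \<open>(z - a k) / (z - a 4)\<close> is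
      1 except at \<open>a 4\<close> itself, where division by 0 gives 0; the case distinction
      restores a holomorphic function.\<close>
    define si where "si = (\<lambda>z. if k = 4 then of_int s else of_int s * ((z - a k) / (z - a 4)))"
    define ta where "ta = (\<lambda>z. if k = 4 then of_int s * (of_int s + 1) else of_int s * (of_int s + 1) * ((z - a k) / (z - a 4))\<^sup>2)"
    have z4: "z \<noteq> a 4" if "k \<noteq> 4" "z \<in> ball (a k) d'" for z
      using zaj[OF that(2), of 4] that(1) by auto
    have sih: "si holomorphic_on ball (a k) d'" "ta holomorphic_on ball (a k) d'"
      unfolding si_def ta_def by (cases "k = 4"; simp; intro holomorphic_intros; use z4 in auto)+
    have sil: "of_int s / (z - a 4) = si z / (z - a k)"
      "of_int s * (of_int s + 1) / (z - a 4)\<^sup>2 = ta z / (z - a k)\<^sup>2" if z: "z \<in> ball (a k) d' - {a k}" for z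
    proof -
      have zk: "z - a k \<noteq> 0" using z by simp
      show "of_int s / (z - a 4) = si z / (z - a k)" using zk by (simp add: si_def)
      show "of_int s * (of_int s + 1) / (z - a 4)\<^sup>2 = ta z / (z - a k)\<^sup>2"
        using zk by (simp add: ta_def power_divide)
    qed
    have sik: "si (a k) = of_int (if k = 4 then - kap2 else 0)" by (simp add: si_def s_def)
    have tak: "ta (a k) = si (a k) * (si (a k) + 1)" by (simp add: si_def ta_def)
    have "fuchsian_with_exponents (scalar_q1 A s (a 4)) (scalar_q2 A s (a 4)) (a k) (e1 k + si (a k)) (e2 k + si (a k))"
      by (rule scalar_fuchsian[OF opS hol Ane' b(2) d' sub H(1,2) nuh nuk nul sih(1) sil(1) sih(2) tak sil(2) H(3)[OF e[OF k]] ne])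
    then show "fuchsian_with_exponents (scalar_q1 A s (a 4)) (scalar_q2 A s (a 4)) (a k)
        (e1 k + of_int (if k = 4 then - kap2 else 0)) (e2 k + of_int (if k = 4 then - kap2 else 0))"
      unfolding sik .
  qed
qed

section \<open>The indices and the conclusion\<close>

lemma index_sum:
  assumes inj: "inj_on a {1..4}" and std: "standard_form a St rho sg M E kap1 kap2 A"
    and kap: "of_int kap = (\<Sum>k=1..4. trace (E k))"
    and e: "\<And>k. k \<in> {1..4} \<Longrightarrow> eigenvalue_pair (E k) (e1 k) (e2 k)"
  shows "kap1 + kap2 = kap"
proof -
  have hol: "matrix_holomorphic_on A (- a ` {1..4})"
    and lf: "\<And>k. k \<in> {1..4} \<Longrightarrow> local_form_at a A k (E k)" and li: "local_form_at_infinity a A kap1 kap2"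
    using std by (auto simp: standard_form_def)
  have tr: "((\<lambda>z. (z - a k) * (A z $ 1 $ 1 + A z $ 2 $ 2)) \<longlongrightarrow> trace (E k)) (at (a k))" if k: "k \<in> {1..4}" for k
  proof -
    obtain R where R: "\<And>i j. ((\<lambda>z. (z - a k) * A z $ i $ j) \<longlongrightarrow> R $ i $ j) (at (a k))"
      "\<And>x y. eigenvalue_pair (E k) x y \<Longrightarrow> eigenvalue_pair R x y"
      by (rule residue_limits[OF lf[OF k]]) (rule that)
    have "R $ 1 $ 1 + R $ 2 $ 2 = trace (E k)"
      using e[OF k] R(2)[OF e[OF k]] by (simp add: eigenvalue_pair_2 trace_def sum_2)
    with tendsto_add[OF R(1)[of 1 1] R(1)[of 2 2]] show ?thesis by (simp add: distrib_left)
  qed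
  have inf: "((\<lambda>z. z * (A z $ 1 $ 1 + A z $ 2 $ 2)) \<longlongrightarrow> of_int kap1 + of_int kap2) at_infinity"
    using tendsto_add[OF infinity_limits(1,2)[OF li]] by (simp add: distrib_left)
  have "(\<lambda>z. A z $ 1 $ 1 + A z $ 2 $ 2) holomorphic_on - a ` {1..4}"
    by (intro holomorphic_intros matrix_holomorphic_onD[OF hol])
  from simple_poles_partial_fractions(2)[OF _ inj this tr inf]
  have "of_int kap1 + of_int kap2 = (of_int kap :: complex)" unfolding kap by simp
  then have "of_int (kap1 + kap2) = (of_int kap :: complex)" by simp
  then show ?thesis by (simp only: of_int_eq_iff)
qed

lemma index_difference:
  fixes M E :: "nat \<Rightarrow> complex^2^2" and St :: "'b::real_normed_vector set"
  assumes inj: "inj_on a {1..4}" and mono: "monodromy_setup a g t St rho x0 sg"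
    and adm: "admissible_data M E" and std: "standard_form a St rho sg M E kap1 kap2 A"
    and irr: "irreducible_tuple M \<or> reducible_with_n1_less_n2 M E"
  shows "kap1 - kap2 \<le> 2"
proof (rule ccontr)
  assume "\<not> kap1 - kap2 \<le> 2"
  then have k12: "kap1 - kap2 > 2" by simp
  have hol: "matrix_holomorphic_on A (- a ` {1..4})"
    and lf: "\<And>k. k \<in> {1..4} \<Longrightarrow> local_form_at a A k (E k)" and li: "local_form_at_infinity a A kap1 kap2"
    using std by (auto simp: standard_form_def)
  have fin: "finite {1..4::nat}" by simp
  have "\<forall>k\<in>{1..4}. \<exists>r. ((\<lambda>z. (z - a k) * A z $ 2 $ 1) \<longlongrightarrow> r) (at (a k))"
  proof
    fix k :: nat assume k: "k \<in> {1..4}"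
    show "\<exists>r. ((\<lambda>z. (z - a k) * A z $ 2 $ 1) \<longlongrightarrow> r) (at (a k))"
      by (rule residue_limits[OF lf[OF k]]) blast
  qed
  from bchoice[OF this] obtain r where r: "\<And>k. k \<in> {1..4} \<Longrightarrow> ((\<lambda>z. (z - a k) * A z $ 2 $ 1) \<longlongrightarrow> r k) (at (a k))" by blast
  have lim: "((\<lambda>z. z ^ card {1..4::nat} * A z $ 2 $ 1) \<longlongrightarrow> 0) at_infinity"
    using infinity_limits(3)[OF li k12] by simp
  have "A z $ 2 $ 1 = 0" if "z \<notin> a ` {1..4}" for z
    using simple_poles_product_form[OF fin inj matrix_holomorphic_onD[OF hol] r lim that] by simp
  then show False using lower_left_nonzero[OF inj mono adm std irr] by blast
qed

theorem corollary6p5: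
  fixes a :: "nat \<Rightarrow> complex"
    and g :: "real \<Rightarrow> complex" and t :: "nat \<Rightarrow> real"
    and St :: "'b::real_normed_vector set" and rho :: "'b \<Rightarrow> complex \<times> real"
    and x0 :: 'b and sg :: "nat \<Rightarrow> 'b \<Rightarrow> 'b"
    and M E :: "nat \<Rightarrow> complex^2^2" and A :: "complex \<Rightarrow> complex^2^2"
    and kap kap1 kap2 :: int and e1 e2 :: "nat \<Rightarrow> complex"
  assumes "inj_on a {1..4}"
    and "monodromy_setup a g t St rho x0 sg"
    and "admissible_data M E"
    and "of_int kap = (\<Sum>k=1..4. trace (E k))"
    and "standard_form a St rho sg M E kap1 kap2 A"
    and "irreducible_tuple M \<or> reducible_with_n1_less_n2 M E"
    and "\<forall>k\<in>{1..4}. eigenvalue_pair (E k) (e1 k) (e2 k)"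
  shows "(odd kap \<longrightarrow> kap1 = (kap + 1) div 2 \<and> kap2 = (kap - 1) div 2) \<and>
    (even kap \<longrightarrow>
       (kap1 = kap div 2 \<and> kap2 = kap div 2) \<or>
       (kap1 = kap div 2 + 1 \<and> kap2 = kap div 2 - 1)) \<and>
    (even kap \<longrightarrow>
       (kap1 = kap div 2 + 1 \<and> kap2 = kap div 2 - 1 \<longleftrightarrow>
        (\<exists>q1 q2.
           q1 holomorphic_on (- (a ` {1..4})) \<and> q2 holomorphic_on (- (a ` {1..4})) \<and>
           \<not> ode_singular_at_infinity q1 q2 \<and>
           (\<forall>k\<in>{1..3}. fuchsian_with_exponents q1 q2 (a k) (e1 k) (e2 k)) \<and>
           fuchsian_with_exponents q1 q2 (a 4)
             (e1 4 + 1 - of_int (kap div 2)) (e2 4 + 1 - of_int (kap div 2)) \<and>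
           ode_monodromy St rho sg q1 q2 M)))"
proof -
  note inj = assms(1) and mono = assms(2) and adm = assms(3) and std = assms(5) and irr = assms(6)
  have e: "\<And>k. k \<in> {1..4} \<Longrightarrow> eigenvalue_pair (E k) (e1 k) (e2 k)" using assms(7) by blast
  have sum: "kap1 + kap2 = kap" by (rule index_sum[OF inj std assms(4) e])
  have diff: "kap1 - kap2 \<le> 2" by (rule index_difference[OF inj mono adm std irr])
  have ge: "kap2 \<le> kap1" using std by (simp add: standard_form_def)
  have A: "odd kap \<longrightarrow> kap1 = (kap + 1) div 2 \<and> kap2 = (kap - 1) div 2"
    using sum diff ge by presburger
  have B: "even kap \<longrightarrow> (kap1 = kap div 2 \<and> kap2 = kap div 2) \<or> (kap1 = kap div 2 + 1 \<and> kap2 = kap div 2 - 1)"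
    using sum diff ge by presburger
  define h where "h = kap div 2"
  \<comment> \<open>The shift in the statement is \<open>1 - h\<close>, which is
    \<open>- kap2\<close> for \<open>kap2 = h - 1\<close>; this matches the two forms of the
    exponents.\<close>
  have x4: "x + 1 - of_int h = x + of_int (1 - h)" for x :: complex by simp
  have C1: "\<exists>q1 q2. q1 holomorphic_on (- (a ` {1..4})) \<and> q2 holomorphic_on (- (a ` {1..4})) \<and>
           \<not> ode_singular_at_infinity q1 q2 \<and>
           (\<forall>k\<in>{1..3}. fuchsian_with_exponents q1 q2 (a k) (e1 k) (e2 k)) \<and>
           fuchsian_with_exponents q1 q2 (a 4) (e1 4 + 1 - of_int h) (e2 4 + 1 - of_int h) \<and>
           ode_monodromy St rho sg q1 q2 M" if kk: "kap1 = h + 1" "kap2 = h - 1"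
  proof -
    have k2: "kap1 - kap2 = 2" using kk by simp
    obtain q1 q2 where q: "q1 holomorphic_on (- (a ` {1..4}))" "q2 holomorphic_on (- (a ` {1..4}))"
      "\<not> ode_singular_at_infinity q1 q2"
      and f: "\<And>k. k \<in> {1..4} \<Longrightarrow> fuchsian_with_exponents q1 q2 (a k)
        (e1 k + of_int (if k = 4 then - kap2 else 0)) (e2 k + of_int (if k = 4 then - kap2 else 0))"
      and m: "ode_monodromy St rho sg q1 q2 M"
      by (rule equation_for_unequal_indices[OF inj mono adm std k2 irr e], assumption, rule that)
    have "fuchsian_with_exponents q1 q2 (a k) (e1 k) (e2 k)" if "k \<in> {1..3}" for k
      using f[of k] that by (simp split: if_splits)
    moreover have "fuchsian_with_exponents q1 q2 (a 4) (e1 4 + 1 - of_int h) (e2 4 + 1 - of_int h)"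
      unfolding x4 using f[of 4] kk by simp
    ultimately show ?thesis using q m by blast
  qed
  \<comment> \<open>By the dichotomy (b), the converse implication amounts to excluding such an
    equation when the indices are equal.\<close>
  have C2: False if kk: "kap1 = h" "kap2 = h"
    and q: "q1 holomorphic_on (- (a ` {1..4}))" "q2 holomorphic_on (- (a ` {1..4}))"
    and f: "\<forall>k\<in>{1..3}. fuchsian_with_exponents q1 q2 (a k) (e1 k) (e2 k)"
      "fuchsian_with_exponents q1 q2 (a 4) (e1 4 + 1 - of_int h) (e2 4 + 1 - of_int h)"
    and m: "ode_monodromy St rho sg q1 q2 M" for q1 q2
  proof (rule no_equation_for_equal_indices[OF inj mono adm std[unfolded kk] e q _ m])
    fix k :: nat assume k: "k \<in> {1..4}"
    show "fuchsian_with_exponents q1 q2 (a k) (e1 k + of_int (if k = 4 then 1 - h else 0)) (e2 k + of_int (if k = 4 then 1 - h else 0))"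
    proof (cases "k = 4")
      case True
      then show ?thesis using f(2) unfolding x4 by simp
    next
      case False
      then show ?thesis using f(1) k by simp
    qed
  qed
  have C: "even kap \<longrightarrow> (kap1 = h + 1 \<and> kap2 = h - 1 \<longleftrightarrow>
        (\<exists>q1 q2. q1 holomorphic_on (- (a ` {1..4})) \<and> q2 holomorphic_on (- (a ` {1..4})) \<and>
           \<not> ode_singular_at_infinity q1 q2 \<and>
           (\<forall>k\<in>{1..3}. fuchsian_with_exponents q1 q2 (a k) (e1 k) (e2 k)) \<and>
           fuchsian_with_exponents q1 q2 (a 4) (e1 4 + 1 - of_int h) (e2 4 + 1 - of_int h) \<and>
           ode_monodromy St rho sg q1 q2 M))"
    using C1 C2 B[folded h_def] by blast
  show ?thesis using A B C[unfolded h_def] by blast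
qed

end
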